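(* Let $q$ be a prime and $D\ge1$. For each $S\in\mathrm{Sym}_D$ (with $N=\dim\ker S$) fix a decomposition of $V_{L_N(q)}$ into irreducible $U_{\sqrt q}(sl_2)$-submodules $\mathcal{I}$; this gives the decomposition $V=\bigoplus_{S\in\mathrm{Sym}_D}\bigoplus_{\mathcal{I}}\phi_S^{-1}(\mathcal{I})$ into irreducible $\mathcal{T}$-submodules, and two such summands are isomorphic $\mathcal{T}$-modules exactly when they have the same dimension $\ell+1$ and come from matrices $S$ of the same rank and same type. For integers $\ell\ge0$, $0\le\text{rank}\le D$ and $\epsilon\in\{-1,0,1\}$, let $M_{\ell,\mathrm{rank},\epsilon}$ be the number of summands $\phi_S^{-1}(\mathcal{I})$ of dimension $\ell+1$ with $S$ of that rank and type $\epsilon$. Then $$M_{\ell,0,1}=\mathrm{mult}\Big(\tfrac{D-\ell}{2},D\Big),$$ $$M_{\ell,2n+1,0}=\mathrm{mult}\Big(\tfrac{D-2n-1-\ell}{2},D-2n-1\Big)\prod_{k=1}^n\frac{q^{2k}}{q^{2k}-1}\prod_{k=0}^{2n}(q^{D-k}-1),$$ $$M_{\ell,2n,\pm1}=\mathrm{mult}\Big(\tfrac{D-2n-\ell}{2},D-2n\Big)\frac{q^n\pm1}{2q^n}\prod_{k=1}^n\frac{q^{2k}}{q^{2k}-1}\prod_{k=0}^{2n-1}(q^{D-k}-1).$$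
   Context: Equip $\mathbb{F}_q^{2D}$ with the non-degenerate symplectic form $\mathfrak{B}$ for which $e_1,\dots,e_D,f_1,\dots,f_D$ is a symplectic basis: $\mathfrak{B}(e_i,e_j)=\mathfrak{B}(f_i,f_j)=0$, $\mathfrak{B}(e_i,f_j)=-\mathfrak{B}(f_j,e_i)=\delta_{ij}$. $X$ is the set of maximal isotropic subspaces (all of dimension $D$); the symplectic dual polar graph has vertex set $X$, $x\sim y$ iff $\dim(x\cap y)=D-1$. $V=\mathrm{span}_{\mathbb{C}}\{|x\rangle:x\in X\}$; $A$ is the adjacency matrix, with eigenvalues $\theta_j=\frac{1-q+q^{D+1-j}-q^j}{q-1}$ and $E_j$ the orthogonal projector onto the $\theta_j$-eigenspace; $x_0=\mathrm{span}\{e_1,\dots,e_D\}$; $A^*$ is diagonal with $(A^* )_{xx}=|X|(E_1)_{x_0x}$; $\mathcal{T}$ is the algebra generated by $A,A^*$. Put $x_i=\mathrm{span}\{e_1,\dots,e_{D-i}\}\oplus\mathrm{span}\{f_{D-i+1},\dots,f_D\}$. $\mathrm{Sym}_D$: symmetric $D\times D$ matrices over $\mathbb{F}_q$; $\mathrm{Sym}_{D,i}$: those with $\mathcal{F}_{mn}=0$ whenever $m\le D-i$ or $n\le D-i$. $(\mathcal{C},\mathcal{F})\in Sp(2D,q)$ ($\mathcal{C}\in GL(D,q)$, $\mathcal{F}\in\mathrm{Sym}_D$) has matrix $\begin{pmatrix}\mathcal{C}&0\\0&(\mathcal{C}^t)^{-1}\end{pmatrix}\begin{pmatrix}I&\mathcal{F}\\0&I\end{pmatrix}$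 in the basis $(e_1,\dots,f_D)$; $g$ acts on subspaces by $gx=\{gv:v\in x\}$, $\rho(g)|x\rangle=|gx\rangle$. For $S'\in\mathrm{Sym}_{D,i}$, $|[I],S'\rangle_i=q^{-i(i+1)/4}\sum_{\mathcal{F}\in\mathrm{Sym}_{D,i}}e^{2\pi\sqrt{-1}\mathrm{tr}(S'\mathcal{F})/q}|(I,\mathcal{F})x_i\rangle$ (exponent entries read in $\{0,\dots,q-1\}$); $|[\mathcal{C}],S\rangle_i=\rho((\mathcal{C},0))|[I],\mathcal{C}^tS\mathcal{C}\rangle_i$ when $\mathcal{C}^tS\mathcal{C}\in\mathrm{Sym}_{D,i}$; $W(S)=\bigoplus_i\mathrm{span}_{\mathbb{C}}\{|[\mathcal{C}],S\rangle_i\}$, and $V=\bigoplus_{S}W(S)$. $\phi_S(|[\mathcal{C}],S\rangle_i)=|(\mathcal{C},0)x_i\cap x_0\rangle$ is a linear isomorphism from $W(S)$ onto $V_{L_N(q)}=\mathrm{span}_{\mathbb{C}}\{|U\rangle:U\subseteq\mathbb{V}_0\}$, $\mathbb{V}_0\subseteq x_0$ of dimension $N$. On $V_{L_N(q)}$: $L|U'\rangle=\sum_{U\subset U',\dim U=\dim U'-1}|U\rangle$, $R|U'\rangle=\sum_{U\supset U',\dim U=\dim U'+1}|U\rangle$, $K|U\rangle=q^{N/2-\dim U}|U\rangle$; $U_{\sqrt q}(sl_2)$-submodules are subspaces invariant under $\hat L=q^{(1-N)/4}L$, $\hat R=q^{(1-N)/4}R$, $K^{\pm1}$. Type of $S$: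 $\epsilon=1$ if $S=0$; otherwise with $r=\mathrm{rank}S$ and $\Upsilon\in GL(D,q)$ such that $\Upsilon^tS\Upsilon=\begin{pmatrix}0&0\\0&Q\end{pmatrix}$, $Q$ non-singular $r\times r$: $\epsilon=1$ if $r$ is even and $(-1)^{r/2}\det Q$ is a square in $\mathbb{F}_q$, $\epsilon=-1$ if $r$ is even and it is a non-square, $\epsilon=0$ if $r$ odd. $\mathrm{mult}(\nu,N)=1$ if $\nu=0$, $\mathrm{mult}(\nu,N)=\binom{N}{\nu}_q-\binom{N}{\nu-1}_q$ if $\nu$ is an integer with $0<\nu\le N/2$, and $\mathrm{mult}(\nu,N)=0$ otherwise, where $\binom{N}{\nu}_q=\prod_{j=0}^{\nu-1}\frac{q^{N-j}-1}{q^{\nu-j}-1}$.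
   Formalization: The prime q is taken to be odd: for q = 2 and D ≥ 2 the claim fails, since every element of F_2 is a square, so no S has type −1 although the formula for M_{D-2,2,-1} is positive, and V is not the direct sum of the W(S). *)

theory Defs
  imports "HOL-Analysis.Analysis" "HOL-Computational_Algebra.Primes"
begin

text \<open>
  Conventions. The field \<open>F_q\<close> is a finite field type \<open>'a\<close> with \<open>q = CARD('a)\<close> (prime in the theorem),
  and \<open>D = CARD('d)\<close> for a finite linearly ordered index type \<open>'d\<close>. The symplectic space
  \<open>F_q^{2D}\<close> is \<open>'a ^ ('d + 'd)\<close>, the coordinates \<open>Inl m\<close> and \<open>Inr m\<close> belonging to
  \<open>e_m\<close> and \<open>f_m\<close>. Spans, subspaces and dimensions over \<open>F_q\<close> and over the complex numbers are
  \<open>vec.span\<close>, \<open>vec.subspace\<close>, \<open>vec.dim\<close>, whose scalar multiplication is \<open>*s\<close>; the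
  unqualified versions are about real vector spaces and are not used.
\<close>

type_synonym ('a, 'n) sqmat = "(('a, 'n) vec, 'n) vec"

text \<open>The position of an index in the order, in \<open>{1..D}\<close>.\<close>

definition pos :: "'d::{finite,linorder} \<Rightarrow> nat" where
  "pos m = card {..m}"

subsection \<open>The symplectic dual polar graph\<close>

definition sympl :: "('a::field)^('d::finite + 'd) \<Rightarrow> 'a^('d + 'd) \<Rightarrow> 'a" where
  "sympl u v = (\<Sum>m\<in>UNIV. u $ Inl m * v $ Inr m - u $ Inr m * v $ Inl m)"

definition isotropic :: "(('a::field)^('d::finite + 'd)) set \<Rightarrow> bool" where
  "isotropic x \<longleftrightarrow> vec.subspace x \<and> (\<forall>u\<in>x. \<forall>v\<in>x. sympl u v = 0)"

definition max_isotropic :: "(('a::field)^('d::finite + 'd)) set \<Rightarrow> bool" where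
  "max_isotropic x \<longleftrightarrow> isotropic x \<and> (\<forall>y. isotropic y \<longrightarrow> x \<subseteq> y \<longrightarrow> y = x)"

lemma ex_max_isotropic: "\<exists>x :: (('a::{field,finite})^('d::finite + 'd)) set. max_isotropic x"
proof -
  have "isotropic ({0} :: ('a^('d + 'd)) set)"
    by (simp add: isotropic_def sympl_def vec.subspace_def)
  then obtain x :: "('a^('d + 'd)) set"
    where "isotropic x" "\<And>y. isotropic y \<Longrightarrow> x \<subseteq> y \<Longrightarrow> x = y"
    using finite_has_maximal[of "Collect (isotropic :: ('a^('d + 'd)) set \<Rightarrow> bool)"]
    by (metis empty_iff finite mem_Collect_eq)
  then show ?thesis
    unfolding max_isotropic_def by metis
qed

typedef (overloaded) ('a, 'd) lagr = "{x :: (('a::{field,finite})^('d::finite + 'd)) set. max_isotropic x}"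
  using ex_max_isotropic by blast

instance lagr :: ("{field,finite}", finite) finite
proof
  have "inj (Rep_lagr :: ('a, 'b) lagr \<Rightarrow> _)"
    by (simp add: inj_def Rep_lagr_inject)
  then show "finite (UNIV :: ('a, 'b) lagr set)"
    by (rule finite_imageD[rotated]) simp
qed

text \<open>The space \<open>V\<close> is the whole type \<open>complex ^ ('a, 'd) lagr\<close>, with \<open>|x\<rangle>\<close> being \<open>axis x 1\<close>.\<close>

abbreviation ket :: "'n::finite \<Rightarrow> complex^'n" where
  "ket x \<equiv> axis x 1"

definition adj :: "('a::{field,finite}, 'd::finite) lagr \<Rightarrow> ('a, 'd) lagr \<Rightarrow> bool" where
  "adj x y \<longleftrightarrow> vec.dim (Rep_lagr x \<inter> Rep_lagr y) = CARD('d) - 1"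

definition A_mat :: "(complex, ('a::{field,finite}, 'd::finite) lagr) sqmat" where
  "A_mat = (\<chi> x y. if adj x y then 1 else 0)"

definition theta :: "nat \<Rightarrow> nat \<Rightarrow> nat \<Rightarrow> complex" where
  "theta q D j = (1 - of_nat q + of_nat q ^ (D + 1 - j) - of_nat q ^ j) / (of_nat q - 1)"

definition eigenspace :: "(complex, 'n) sqmat \<Rightarrow> complex \<Rightarrow> (complex^'n) set" where
  "eigenspace M c = {v. M *v v = c *s v}"

definition hinner :: "complex^'n \<Rightarrow> complex^'n \<Rightarrow> complex" where
  "hinner u v = (\<Sum>x\<in>UNIV. cnj (u $ x) * v $ x)"

definition orth_proj :: "(complex^'n) set \<Rightarrow> (complex, 'n) sqmat" where
  "orth_proj W = (THE P. \<forall>v. P *v v \<in> W \<and> (\<forall>w\<in>W. hinner w (v - P *v v) = 0))"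

definition E_mat :: "nat \<Rightarrow> (complex, ('a::{field,finite}, 'd::finite) lagr) sqmat" where
  "E_mat j = orth_proj (eigenspace A_mat (theta CARD('a) CARD('d) j))"

definition evec :: "'d::finite \<Rightarrow> ('a::field)^('d + 'd)" where
  "evec m = axis (Inl m) 1"

definition fvec :: "'d::finite \<Rightarrow> ('a::field)^('d + 'd)" where
  "fvec m = axis (Inr m) 1"

definition xl :: "nat \<Rightarrow> ('a::{field,finite}, 'd::{finite,linorder}) lagr" where
  "xl i = Abs_lagr (vec.span (evec ` {m. pos m \<le> CARD('d) - i} \<union> fvec ` {m. pos m > CARD('d) - i}))"

definition A_star :: "(complex, ('a::{field,finite}, 'd::{finite,linorder}) lagr) sqmat" where
  "A_star = (\<chi> x y. if x = y then of_nat CARD(('a, 'd) lagr) * E_mat 1 $ xl 0 $ x else 0)"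

subsection \<open>The algebra and its modules\<close>

inductive_set T_alg :: "((complex, ('a::{field,finite}, 'd::{finite,linorder}) lagr) sqmat) set" where
  A_in: "A_mat \<in> T_alg"
| A_star_in: "A_star \<in> T_alg"
| one_in: "mat 1 \<in> T_alg"
| add_in: "M \<in> T_alg \<Longrightarrow> M' \<in> T_alg \<Longrightarrow> M + M' \<in> T_alg"
| scale_in: "M \<in> T_alg \<Longrightarrow> (\<chi> x y. c * M $ x $ y) \<in> T_alg"
| mult_in: "M \<in> T_alg \<Longrightarrow> M' \<in> T_alg \<Longrightarrow> M ** M' \<in> T_alg"

definition T_submodule :: "(complex^('a::{field,finite}, 'd::{finite,linorder}) lagr) set \<Rightarrow> bool" where
  "T_submodule W \<longleftrightarrow> vec.subspace W \<and> (\<forall>M\<in>T_alg. \<forall>v\<in>W. M *v v \<in> W)"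

definition T_irreducible :: "(complex^('a::{field,finite}, 'd::{finite,linorder}) lagr) set \<Rightarrow> bool" where
  "T_irreducible W \<longleftrightarrow> T_submodule W \<and> W \<noteq> {0} \<and>
     (\<forall>W'. T_submodule W' \<longrightarrow> W' \<subseteq> W \<longrightarrow> W' = {0} \<or> W' = W)"

definition lin_on :: "(complex^'m) set \<Rightarrow> (complex^'m \<Rightarrow> complex^'n) \<Rightarrow> bool" where
  "lin_on W f \<longleftrightarrow> (\<forall>u\<in>W. \<forall>v\<in>W. f (u + v) = f u + f v) \<and> (\<forall>c. \<forall>v\<in>W. f (c *s v) = c *s f v)"

definition T_isomorphic ::
  "(complex^('a::{field,finite}, 'd::{finite,linorder}) lagr) set \<Rightarrow> (complex^('a, 'd) lagr) set \<Rightarrow> bool" where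
  "T_isomorphic W W' \<longleftrightarrow> (\<exists>f. lin_on W f \<and> bij_betw f W W' \<and> (\<forall>M\<in>T_alg. \<forall>v\<in>W. f (M *v v) = M *v f v))"

definition direct_sum :: "(complex^'n) set \<Rightarrow> 'i set \<Rightarrow> ('i \<Rightarrow> (complex^'n) set) \<Rightarrow> bool" where
  "direct_sum U J W \<longleftrightarrow> finite J \<and> (\<forall>j\<in>J. vec.subspace (W j)) \<and>
     U = {\<Sum>j\<in>J. w j | w. \<forall>j\<in>J. w j \<in> W j} \<and>
     (\<forall>w. (\<forall>j\<in>J. w j \<in> W j) \<longrightarrow> (\<Sum>j\<in>J. w j) = 0 \<longrightarrow> (\<forall>j\<in>J. w j = 0))"

subsection \<open>Symmetric matrices and the spaces \<open>W(S)\<close>\<close>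

definition Sym :: "(('a::field, 'd::finite) sqmat) set" where
  "Sym = {F. transpose F = F}"

definition Sym_sub :: "nat \<Rightarrow> (('a::field, 'd::{finite,linorder}) sqmat) set" where
  "Sym_sub i = {F \<in> Sym. \<forall>m n. pos m \<le> CARD('d) - i \<or> pos n \<le> CARD('d) - i \<longrightarrow> F $ m $ n = 0}"

definition block :: "('a::field, 'd::finite) sqmat \<Rightarrow> ('a, 'd) sqmat \<Rightarrow> ('a, 'd) sqmat \<Rightarrow> ('a, 'd) sqmat \<Rightarrow> ('a, 'd + 'd) sqmat" where
  "block P Q R S = (\<chi> i j. case i of
       Inl m \<Rightarrow> (case j of Inl n \<Rightarrow> P $ m $ n | Inr n \<Rightarrow> Q $ m $ n)
     | Inr m \<Rightarrow> (case j of Inl n \<Rightarrow> R $ m $ n | Inr n \<Rightarrow> S $ m $ n))"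

definition spm :: "('a::field, 'd::finite) sqmat \<Rightarrow> ('a, 'd) sqmat \<Rightarrow> ('a, 'd + 'd) sqmat" where
  "spm C F = block C 0 0 (matrix_inv (transpose C)) ** block (mat 1) F 0 (mat 1)"

definition act :: "('a::{field,finite}, 'd::finite + 'd) sqmat \<Rightarrow> ('a, 'd) lagr \<Rightarrow> ('a, 'd) lagr" where
  "act g x = Abs_lagr ((\<lambda>v. g *v v) ` Rep_lagr x)"

definition rho :: "('a::{field,finite}, 'd::finite + 'd) sqmat \<Rightarrow> (complex, ('a, 'd) lagr) sqmat" where
  "rho g = (\<chi> y x. if y = act g x then 1 else 0)"

text \<open>The representative in \<open>{0..q-1}\<close> of an element of the prime field \<open>F_q\<close>.\<close>

definition fq_rep :: "'a::{field,finite} \<Rightarrow> nat" where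
  "fq_rep a = (THE n. n < CARD('a) \<and> of_nat n = a)"

definition state_I :: "nat \<Rightarrow> ('a::{field,finite}, 'd::{finite,linorder}) sqmat \<Rightarrow> complex^('a, 'd) lagr" where
  "state_I i S' = of_real (real CARD('a) powr (- (real i * (real i + 1) / 4))) *s
     (\<Sum>F\<in>Sym_sub i. exp (2 * of_real pi * \<i> * of_nat (fq_rep (trace (S' ** F))) / of_nat CARD('a))
        *s ket (act (spm (mat 1) F) (xl i)))"

definition state :: "nat \<Rightarrow> ('a::{field,finite}, 'd::{finite,linorder}) sqmat \<Rightarrow> ('a, 'd) sqmat \<Rightarrow> complex^('a, 'd) lagr" where
  "state i C S = rho (spm C 0) *v state_I i (transpose C ** S ** C)"

definition admissible :: "nat \<Rightarrow> ('a::{field,finite}, 'd::{finite,linorder}) sqmat \<Rightarrow> ('a, 'd) sqmat \<Rightarrow> bool" where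
  "admissible i C S \<longleftrightarrow> i \<le> CARD('d) \<and> invertible C \<and> transpose C ** S ** C \<in> Sym_sub i"

text \<open>The span of all states is the sum, over \<open>i\<close>, of the spans of the states of index \<open>i\<close>; these
  have disjoint supports (the \<open>x\<close> with \<open>dim (x \<inter> x_0) = D - i\<close>), so that the sum is direct.\<close>

definition W_space :: "('a::{field,finite}, 'd::{finite,linorder}) sqmat \<Rightarrow> (complex^('a, 'd) lagr) set" where
  "W_space S = vec.span {state i C S | i C. admissible i C S}"

subsection \<open>Subspace lattices and the map to them\<close>

text \<open>The subspace \<open>V_0\<close> of \<open>x_0\<close>: the kernel of \<open>S\<close>, placed in the \<open>e\<close>-coordinates. This is the
  only choice for which the subspaces \<open>(C,0)x_i \<inter> x_0\<close> below are exactly the subspaces of \<open>V_0\<close>.\<close>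

definition V0 :: "('a::field, 'd::finite) sqmat \<Rightarrow> ('a^('d + 'd)) set" where
  "V0 S = {v. S *v (\<chi> m. v $ Inl m) = 0 \<and> (\<forall>m. v $ Inr m = 0)}"

definition subs :: "(('a::field)^('n::finite)) set \<Rightarrow> ('a^'n) set set" where
  "subs Y = {U. vec.subspace U \<and> U \<subseteq> Y}"

definition V_L :: "(('a::{field,finite})^('n::finite)) set \<Rightarrow> (complex^(('a^'n) set)) set" where
  "V_L Y = vec.span (ket ` subs Y)"

definition L_hat :: "(('a::{field,finite})^('n::finite)) set \<Rightarrow> (complex, ('a^'n) set) sqmat" where
  "L_hat Y = (\<chi> U U'. if U \<in> subs Y \<and> U' \<in> subs Y \<and> U \<subset> U' \<and> vec.dim U' = vec.dim U + 1
     then of_real (real CARD('a) powr ((1 - real (vec.dim Y)) / 4)) else 0)"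

definition R_hat :: "(('a::{field,finite})^('n::finite)) set \<Rightarrow> (complex, ('a^'n) set) sqmat" where
  "R_hat Y = (\<chi> U U'. if U \<in> subs Y \<and> U' \<in> subs Y \<and> U' \<subset> U \<and> vec.dim U = vec.dim U' + 1
     then of_real (real CARD('a) powr ((1 - real (vec.dim Y)) / 4)) else 0)"

definition K_mat :: "(('a::{field,finite})^('n::finite)) set \<Rightarrow> (complex, ('a^'n) set) sqmat" where
  "K_mat Y = (\<chi> U U'. if U = U' \<and> U \<in> subs Y
     then of_real (real CARD('a) powr (real (vec.dim Y) / 2 - real (vec.dim U))) else 0)"

text \<open>The inverse of \<open>K\<close> on \<open>V_L Y\<close>.\<close>

definition K_inv :: "(('a::{field,finite})^('n::finite)) set \<Rightarrow> (complex, ('a^'n) set) sqmat" where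
  "K_inv Y = (\<chi> U U'. if U = U' \<and> U \<in> subs Y
     then of_real (real CARD('a) powr (- (real (vec.dim Y) / 2 - real (vec.dim U)))) else 0)"

definition sl2_submodule :: "(('a::{field,finite})^('n::finite)) set \<Rightarrow> (complex^(('a^'n) set)) set \<Rightarrow> bool" where
  "sl2_submodule Y I \<longleftrightarrow> vec.subspace I \<and> I \<subseteq> V_L Y \<and>
     (\<forall>M\<in>{L_hat Y, R_hat Y, K_mat Y, K_inv Y}. \<forall>v\<in>I. M *v v \<in> I)"

definition sl2_irreducible :: "(('a::{field,finite})^('n::finite)) set \<Rightarrow> (complex^(('a^'n) set)) set \<Rightarrow> bool" where
  "sl2_irreducible Y I \<longleftrightarrow> sl2_submodule Y I \<and> I \<noteq> {0} \<and>
     (\<forall>I'. sl2_submodule Y I' \<longrightarrow> I' \<subseteq> I \<longrightarrow> I' = {0} \<or> I' = I)"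

definition sl2_decomposition :: "(('a::{field,finite})^('n::finite)) set \<Rightarrow> (complex^(('a^'n) set)) set set \<Rightarrow> bool" where
  "sl2_decomposition Y Is \<longleftrightarrow> (\<forall>I\<in>Is. sl2_irreducible Y I) \<and> direct_sum (V_L Y) Is (\<lambda>I. I)"

text \<open>The states span \<open>W_space S\<close>, so \<open>phi S\<close> is determined there; its values elsewhere are never used.\<close>

definition phi :: "('a::{field,finite}, 'd::{finite,linorder}) sqmat \<Rightarrow> complex^('a, 'd) lagr \<Rightarrow> complex^(('a^('d + 'd)) set)" where
  "phi S = (SOME f. lin_on (W_space S) f \<and>
     (\<forall>i C. admissible i C S \<longrightarrow>
        f (state i C S) = ket (Rep_lagr (act (spm C 0) (xl i)) \<inter> Rep_lagr (xl 0 :: ('a, 'd) lagr))))"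

definition summand :: "('a::{field,finite}, 'd::{finite,linorder}) sqmat \<Rightarrow> (complex^(('a^('d + 'd)) set)) set \<Rightarrow> (complex^('a, 'd) lagr) set" where
  "summand S I = {w \<in> W_space S. phi S w \<in> I}"

subsection \<open>Types and multiplicities\<close>

text \<open>The determinant of the principal submatrix with index set \<open>J\<close> (compare \<open>det_def\<close>, the case \<open>J = UNIV\<close>).\<close>

definition det_on :: "'d set \<Rightarrow> ('a::comm_ring_1, 'd::finite) sqmat \<Rightarrow> 'a" where
  "det_on J M = (\<Sum>p\<in>{p. p permutes J}. of_int (sign p) * (\<Prod>i\<in>J. M $ i $ p i))"

definition last_inds :: "nat \<Rightarrow> ('d::{finite,linorder}) set" where
  "last_inds r = {m. pos m > CARD('d) - r}"

text \<open>Membership in \<open>Sym_sub r\<close> says that only the lower right \<open>r \<times> r\<close> block, \<open>Q\<close>, is non-zero.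
  The square class of \<open>det Q\<close> does not depend on the matrix chosen.\<close>

definition normalizer :: "('a::{field,finite}, 'd::{finite,linorder}) sqmat \<Rightarrow> ('a, 'd) sqmat" where
  "normalizer S = (SOME C. invertible C \<and> transpose C ** S ** C \<in> Sym_sub (rank S) \<and>
     det_on (last_inds (rank S)) (transpose C ** S ** C) \<noteq> 0)"

definition mtype :: "('a::{field,finite}, 'd::{finite,linorder}) sqmat \<Rightarrow> int" where
  "mtype S = (if S = 0 then 1
     else if odd (rank S) then 0
     else if \<exists>y. y ^ 2 = (-1) ^ (rank S div 2) *
          det_on (last_inds (rank S)) (transpose (normalizer S) ** S ** normalizer S) then 1
     else -1)"

definition qbinom :: "nat \<Rightarrow> nat \<Rightarrow> nat \<Rightarrow> real" where
  "qbinom q N k = (\<Prod>j<k. (real q ^ (N - j) - 1) / (real q ^ (k - j) - 1))"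

definition qmult :: "nat \<Rightarrow> real \<Rightarrow> nat \<Rightarrow> real" where
  "qmult q \<nu> N = (if \<nu> = 0 then 1
     else if \<nu> \<in> \<int> \<and> 0 < \<nu> \<and> \<nu> \<le> real N / 2
       then qbinom q N (nat \<lfloor>\<nu>\<rfloor>) - qbinom q N (nat \<lfloor>\<nu>\<rfloor> - 1)
     else 0)"

definition M_count ::
  "(('a::{field,finite}, 'd::{finite,linorder}) sqmat \<Rightarrow> (complex^(('a^('d + 'd)) set)) set set) \<Rightarrow> nat \<Rightarrow> nat \<Rightarrow> int \<Rightarrow> nat" where
  "M_count Dec l r eps = card {(S, I). S \<in> Sym \<and> I \<in> Dec S \<and>
     vec.dim (summand S I) = l + 1 \<and> rank S = r \<and> mtype S = eps}"

end

theory Submission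
  imports Defs
begin

text \<open>
  A maximal isotropic subspace is determined by its intersection \<open>U\<close> with \<open>x_0\<close> and a symmetric matrix
  \<open>F\<close> modulo those mapping \<open>perp U\<close> into \<open>U\<close>. The translations \<open>(I, G)\<close> act by \<open>F \<mapsto> F + G\<close> and
  commute with \<open>A\<close> and \<open>A^*\<close>, so \<open>V\<close> splits into their character spaces, which are the \<open>W(S)\<close>.
  A function in \<open>W(S)\<close> is supported on the \<open>U\<close> inside \<open>ker S\<close> and is determined by its values at
  \<open>F = 0\<close>; in these coordinates \<open>A\<close> becomes a combination of \<open>L\<close>, \<open>R\<close> and a diagonal operator
  whose entries are quadratic Gauss sums, hence depend on rank and type of \<open>S\<close>. As \<open>A^*\<close> separates
  the dimensions of \<open>U\<close>, the \<open>T\<close>-submodules of \<open>W(S)\<close> are the graded subspaces closed under \<open>L\<close>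
  and \<open>R\<close>. Irreducible ones have a basis indexed by consecutive dimensions on which the coefficients of \<open>L\<close>, \<open>R\<close>
  depend only on its lowest dimension and \<open>N\<close>; this yields the isomorphism criterion, and comparing
  dimensions of weight spaces gives the multiplicities. The number of symmetric matrices of given
  rank and type follows by induction on the size: border a matrix by one row and column and read
  rank and type off the Gauss sum.
\<close>

subsection \<open>Additive characters of a prime field\<close>

text \<open>The algebra is never computed. What is used of it is that \<open>A_star\<close> takes
  distinct values on the layers of fixed dim (x \<inter> x_0), so the projections to the layers are
  polynomials in \<open>A_star\<close> and cut \<open>A\<close> into raising, flat and lowering
  parts. The obstacle is \<open>E_mat 1\<close>, given only as the projection to an eigenspace of
  unknown dimension. The layer sums of any eigenvector are fixed by its value at x_0, so a single
  explicit radial eigenvector already yields the row of \<open>E_mat 1\<close> at x_0. An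
  isomorphism commutes with the layer projections. It therefore preserves the interval {\<nu>..N -
  \<nu>} of occurring dimensions, which gives N and so the rank, and the diagonal coefficient of
  \<open>A\<close>, which then gives the type. For odd rank the Gauss sums of the non-zero multiples
  of a form cancel; this is why all such S share one type. In the count, the sign of a bordered
  matrix picks up \<open>chi (- 1)\<close> whenever the rank rises by 2. The factor (-1)^(r/2) in
  the definition of the type absorbs exactly this.\<close>

definition dot :: "('a::comm_ring_1)^'n \<Rightarrow> 'a^'n \<Rightarrow> 'a" where
  "dot u v = (\<Sum>i\<in>UNIV. u $ i * v $ i)"

definition perp :: "(('a::field)^'n) set \<Rightarrow> ('a^'n) set" where
  "perp U = {b. \<forall>u\<in>U. dot u b = 0}"

text \<open>The phase in \<open>state_I\<close>; an additive character by
  \<open>psi_add\<close>.\<close>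

definition psi :: "'a::{field,finite} \<Rightarrow> complex" where
  "psi a = exp (2 * of_real pi * \<i> * of_nat (fq_rep a) / of_nat CARD('a))"

lemma dot_simps [simp]:
  "dot 0 v = 0" "dot u 0 = 0"
  "dot (u + u') v = dot u v + dot u' v" "dot u (v + v') = dot u v + dot u v'"
  "dot (u - u') v = dot u v - dot u' v" "dot u (v - v') = dot u v - dot u v'"
  "dot (- u) v = - dot u v" "dot u (- v) = - dot u v"
  "dot (c *s u) v = c * dot u v" "dot u (c *s v) = c * dot u v"
  by (simp_all add: dot_def sum.distrib sum_subtractf sum_negf algebra_simps sum_distrib_left)

lemma dot_commute: "dot u v = dot v u"
  by (simp add: dot_def mult.commute)

lemma dot_axis [simp]: "dot u (axis i c) = u $ i * c" "dot (axis i c) u = c * u $ i"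
proof -
  have "dot u (axis i c) = (\<Sum>j\<in>UNIV. if j = i then u $ i * c else 0)" for u
    unfolding dot_def axis_def by (intro sum.cong) auto
  then show "dot u (axis i c) = u $ i * c" by simp
  then show "dot (axis i c) u = c * u $ i" by (simp add: dot_commute mult.commute)
qed

lemma dot_eq_0_imp: "(\<And>v. dot u v = 0) \<Longrightarrow> u = 0"
  by (metis dot_axis(1) mult_1_right vec_eq_iff zero_index)

lemma dot_matrix_vector: "dot u (M *v v) = dot (transpose M *v u) v"
proof -
  have "dot u (M *v v) = (\<Sum>i\<in>UNIV. \<Sum>j\<in>UNIV. u $ i * (M $ i $ j * v $ j))"
    by (simp add: dot_def matrix_vector_mult_def sum_distrib_left)
  also have "\<dots> = (\<Sum>j\<in>UNIV. \<Sum>i\<in>UNIV. u $ i * (M $ i $ j * v $ j))"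
    by (rule sum.swap)
  also have "\<dots> = dot (transpose M *v u) v"
    by (simp add: dot_def matrix_vector_mult_def transpose_def sum_distrib_right sum_distrib_left algebra_simps)
  finally show ?thesis .
qed

lemma dot_sym: "M \<in> Sym \<Longrightarrow> dot u (M *v v) = dot v (M *v u)"
  by (metis (mono_tags, lifting) Sym_def dot_commute dot_matrix_vector mem_Collect_eq)

lemma subspace_perp: "vec.subspace (perp U)"
  by (auto simp: vec.subspace_def perp_def)

lemma perp_antimono: "U \<subseteq> V \<Longrightarrow> perp V \<subseteq> perp U"
  by (auto simp: perp_def)

lemma perp_perp_sup: "U \<subseteq> perp (perp U)"
  by (auto simp: perp_def dot_commute)

lemma perp_0 [simp]: "perp {0} = UNIV"
  by (auto simp: perp_def)

lemma perp_sum: "vec.subspace U \<Longrightarrow> vec.subspace U' \<Longrightarrow>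
  perp {u + u' | u u'. u \<in> U \<and> u' \<in> U'} = perp U \<inter> perp U'"
  by (fastforce simp: perp_def dest: vec.subspace_0)

text \<open>Adding 1 permutes the ring, so the sum of all elements equals itself plus
  \<open>CARD('a)\<close> copies of 1.\<close>

lemma of_nat_card_eq_0: "of_nat CARD('a::{ring_1,finite}) = (0::'a)"
proof -
  have "(\<Sum>x\<in>UNIV. x + (1::'a)) = (\<Sum>x\<in>UNIV. x)"
    by (rule sum.reindex_bij_witness[of _ "\<lambda>x. x - 1" "\<lambda>x. x + 1"]) auto
  then show ?thesis by (simp add: sum.distrib)
qed

lemma card_span_insert:
  fixes a :: "('a::{field,finite})^'n"
  assumes "a \<notin> vec.span B"
  shows "card (vec.span (insert a B)) = CARD('a) * card (vec.span B)"
proof -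
  let ?f = "\<lambda>(c, v). c *s a + v"
  have "inj_on ?f (UNIV \<times> vec.span B)"
  proof (rule inj_onI, clarsimp)
    fix c v c' v' assume v: "v \<in> vec.span B" "v' \<in> vec.span B" and e: "c *s a + v = c' *s a + v'"
    have "(c - c') *s a = v' - v" using e by (simp add: vec.scale_left_diff_distrib algebra_simps)
    then have m: "(c - c') *s a \<in> vec.span B" using v by (simp add: vec.span_diff)
    have "c = c'"
    proof (rule ccontr)
      assume "c \<noteq> c'"
      then have "inverse (c - c') *s ((c - c') *s a) = a"
        by (metis eq_iff_diff_eq_0 left_inverse vec.scale_one vec.scale_scale)
      then show False using m assms vec.span_scale by metis
    qed
    then show "c = c' \<and> v = v'" using e by simp
  qed
  moreover have "?f ` (UNIV \<times> vec.span B) = vec.span (insert a B)"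
  proof (rule set_eqI)
    fix x
    have "x \<in> ?f ` (UNIV \<times> vec.span B) \<longleftrightarrow> (\<exists>k. x - k *s a \<in> vec.span B)"
    proof
      assume "\<exists>k. x - k *s a \<in> vec.span B"
      then obtain k where "x - k *s a \<in> vec.span B" by blast
      then have "(k, x - k *s a) \<in> UNIV \<times> vec.span B" "x = ?f (k, x - k *s a)" by auto
      then show "x \<in> ?f ` (UNIV \<times> vec.span B)" by blast
    next
      assume "x \<in> ?f ` (UNIV \<times> vec.span B)"
      then obtain c v where "v \<in> vec.span B" "x = c *s a + v" by auto
      then have "x - c *s a \<in> vec.span B" by simp
      then show "\<exists>k. x - k *s a \<in> vec.span B" by blast
    qed
    then show "x \<in> ?f ` (UNIV \<times> vec.span B) \<longleftrightarrow> x \<in> vec.span (insert a B)"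
      by (simp add: vec.span_breakdown_eq)
  qed
  ultimately show ?thesis
    by (metis card_image card_cartesian_product)
qed

text \<open>Lets dimensions be compared by counting: many dimension identities below come from
  equating powers of q.\<close>

lemma card_subspace:
  fixes U :: "(('a::{field,finite})^'n) set"
  assumes "vec.subspace U"
  shows "card U = CARD('a) ^ vec.dim U"
proof -
  have *: "vec.independent B \<longrightarrow> card (vec.span B) = CARD('a) ^ card B" for B :: "('a^'n) set"
  proof (induction B rule: finite_induct[OF finite])
    case (2 a B)
    then show ?case
      by (auto simp: vec.independent_insert card_span_insert)
  qed (simp add: vec.span_empty)
  obtain B where "B \<subseteq> U" "vec.independent B" "U \<subseteq> vec.span B" "card B = vec.dim U"
    using vec.basis_exists by blast
  then show ?thesis
    using * by (metis assms vec.span_eq_iff vec.span_mono subset_antisym)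
qed

text \<open>Primality makes \<open>of_nat\<close> reach every element, so that \<open>psi\<close> is
  a character. Oddness makes 2 invertible, as completing squares and diagonalising quadratic forms
  require.\<close>

locale odd_prime_field =
  fixes ty :: "'a::{field,finite} itself"
  assumes prime_card: "prime CARD('a)" and odd_card: "odd CARD('a)"
begin

lemma q_gt_2: "CARD('a) > 2"
  using prime_card odd_card prime_ge_2_nat[OF prime_card] by (cases "CARD('a) = 2") auto

text \<open>The characteristic divides the prime q and is not 1, so it equals q.\<close>

lemma of_nat_eq_0_iff_card_dvd: "of_nat n = (0::'a) \<longleftrightarrow> CARD('a) dvd n"
proof -
  have "CHAR('a) dvd CARD('a)" using of_nat_card_eq_0[where 'a='a] of_nat_eq_0_iff_char_dvd by blast
  then have "CHAR('a) = CARD('a)" using prime_card CHAR_not_1'[where 'a='a] by (auto simp: prime_nat_iff)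
  then show ?thesis by (simp add: of_nat_eq_0_iff_char_dvd)
qed

lemma two_neq_0: "(2::'a) \<noteq> 0"
  using of_nat_eq_0_iff_card_dvd[of 2] q_gt_2 by (auto dest: dvd_imp_le)

lemma of_nat_eq_iff_mod: "of_nat m = (of_nat n::'a) \<longleftrightarrow> m mod CARD('a) = n mod CARD('a)"
proof -
  have *: "of_nat m = (of_nat n::'a) \<longleftrightarrow> m mod CARD('a) = n mod CARD('a)" if "n \<le> m" for m n
  proof -
    have "of_nat m = (of_nat n::'a) \<longleftrightarrow> of_nat (m - n) = (0::'a)"
      using that by (simp add: of_nat_diff)
    then show ?thesis using that by (metis mod_eq_dvd_iff_nat of_nat_eq_0_iff_card_dvd)
  qed
  show ?thesis using *[of m n] *[of n m] by (cases "n \<le> m") auto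
qed

lemma bij_of_nat: "bij_betw (of_nat :: nat \<Rightarrow> 'a) {..<CARD('a)} UNIV"
proof -
  have i: "inj_on (of_nat :: nat \<Rightarrow> 'a) {..<CARD('a)}"
    by (auto simp: inj_on_def of_nat_eq_iff_mod)
  then show ?thesis
    unfolding bij_betw_def by (metis card_image card_lessThan card_eq_UNIV_imp_eq_UNIV finite)
qed

lemma fq_rep: "fq_rep (a::'a) < CARD('a)" "of_nat (fq_rep a) = a"
proof -
  have "a \<in> of_nat ` {..<CARD('a)}"
    using bij_of_nat by (simp add: bij_betw_def)
  then obtain n where n: "n < CARD('a)" "of_nat n = a" by auto
  have "m = n" if "m < CARD('a)" "of_nat m = a" for m
    using that n of_nat_eq_iff_mod[of m n] by auto
  then have "\<exists>!n. n < CARD('a) \<and> of_nat n = a"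
    using n by blast
  then have "fq_rep a < CARD('a) \<and> of_nat (fq_rep a) = a"
    unfolding fq_rep_def by (rule theI')
  then show "fq_rep a < CARD('a)" "of_nat (fq_rep a) = a" by auto
qed

lemma exp_eq_iff_of_nat:
  "exp (2 * of_real pi * \<i> * of_nat m / of_nat CARD('a)) = exp (2 * of_real pi * \<i> * of_nat n / of_nat CARD('a))
    \<longleftrightarrow> of_nat m = (of_nat n :: 'a)"
  using complex_root_unity_eq[of "CARD('a)" m n] q_gt_2 by (simp add: of_nat_eq_iff_mod cong_def)

lemma psi_of_nat: "psi (of_nat n :: 'a) = exp (2 * of_real pi * \<i> * of_nat n / of_nat CARD('a))"
  unfolding psi_def by (simp add: exp_eq_iff_of_nat fq_rep)

lemma psi_add: "psi (a + b :: 'a) = psi a * psi b"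
proof -
  have "a + b = of_nat (fq_rep a + fq_rep b)" by (simp add: fq_rep)
  then have "psi (a + b) = exp (2 * of_real pi * \<i> * of_nat (fq_rep a + fq_rep b) / of_nat CARD('a))"
    by (metis psi_of_nat)
  also have "\<dots> = psi a * psi b"
    unfolding psi_def exp_add[symmetric] by (simp add: distrib_left add_divide_distrib)
  finally show ?thesis .
qed

lemma psi_0 [simp]: "psi (0::'a) = 1"
  using psi_of_nat[of 0] by simp

lemma psi_eq_1_iff: "psi (a::'a) = 1 \<longleftrightarrow> a = 0"
  using exp_eq_iff_of_nat[of "fq_rep a" 0] by (simp add: psi_def fq_rep)

lemma psi_neq_0 [simp]: "psi (a::'a) \<noteq> 0"
  by (simp add: psi_def)

lemma psi_minus: "psi (- a :: 'a) = inverse (psi a)"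
  by (metis psi_add psi_0 add.left_inverse inverse_unique mult.commute)

text \<open>Orthogonality of characters. Translation by some h with \<open>f h\<close> non-zero is
  injective on the finite set H, hence permutes it, and multiplies the sum by
  \<open>psi (f h)\<close>, which is not 1.\<close>

lemma sum_psi_hom:
  fixes f :: "'b::ab_group_add \<Rightarrow> 'a"
  assumes "finite H" and cl: "\<And>x y. x \<in> H \<Longrightarrow> y \<in> H \<Longrightarrow> x + y \<in> H"
    and f: "\<And>x y. x \<in> H \<Longrightarrow> y \<in> H \<Longrightarrow> f (x + y) = f x + f y"
  shows "(\<Sum>x\<in>H. psi (f x)) = (if \<forall>x\<in>H. f x = 0 then of_nat (card H) else 0)"
proof (cases "\<forall>x\<in>H. f x = 0")
  case False
  then obtain h where h: "h \<in> H" "f h \<noteq> 0" by blast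
  have "inj_on (\<lambda>x. x + h) H" by simp
  moreover have "(\<lambda>x. x + h) ` H \<subseteq> H" using cl h by blast
  ultimately have "bij_betw (\<lambda>x. x + h) H H"
    using endo_inj_surj[OF assms(1)] by (simp add: bij_betw_def)
  then have "(\<Sum>x\<in>H. psi (f x)) = (\<Sum>x\<in>H. psi (f (x + h)))"
    by (rule sum.reindex_bij_betw[symmetric])
  also have "\<dots> = psi (f h) * (\<Sum>x\<in>H. psi (f x))"
    using h by (simp add: sum_distrib_left f psi_add mult.commute)
  finally show ?thesis using h psi_eq_1_iff False by auto
qed auto

lemma sum_psi_mult: "(\<Sum>c\<in>UNIV. psi (c * (a::'a))) = (if a = 0 then of_nat CARD('a) else 0)"
  using sum_psi_hom[of UNIV "\<lambda>c. c * a"] by (auto simp: algebra_simps)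

lemma sum_psi_dot: "(\<Sum>v\<in>UNIV. psi (dot u (v::'a^'n))) = (if u = 0 then of_nat (CARD('a) ^ CARD('n)) else 0)"
  using sum_psi_hom[of UNIV "dot u"] dot_eq_0_imp[of u] by auto

text \<open>The sum of \<open>psi (dot u b)\<close> over U and the whole space, evaluated in both
  orders: summing over b first leaves only u = 0, summing over u first leaves only b in
  \<open>perp U\<close>.\<close>

lemma card_perp:
  fixes U :: "('a^'n) set"
  assumes U: "vec.subspace U"
  shows "card U * card (perp U) = CARD('a) ^ CARD('n)"
proof -
  have "(\<Sum>u\<in>U. \<Sum>b\<in>UNIV. psi (dot u b)) = (\<Sum>u\<in>U. if u = 0 then of_nat (CARD('a) ^ CARD('n)) else 0)"
    by (simp add: sum_psi_dot)
  then have 1: "(\<Sum>u\<in>U. \<Sum>b\<in>UNIV. psi (dot u b)) = of_nat (CARD('a) ^ CARD('n))"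
    using vec.subspace_0[OF U] by simp
  have "(\<Sum>u\<in>U. \<Sum>b\<in>UNIV. psi (dot u b)) = (\<Sum>b\<in>UNIV. \<Sum>u\<in>U. psi (dot u b))"
    by (rule sum.swap)
  also have "\<dots> = (\<Sum>b\<in>UNIV. if b \<in> perp U then of_nat (card U) else 0)"
    using vec.subspace_add[OF U] by (intro sum.cong refl, subst sum_psi_hom) (auto simp: perp_def)
  also have "\<dots> = of_nat (card U * card (perp U))"
    by (simp add: sum.If_cases mult.commute)
  finally show ?thesis using 1 by (metis of_nat_eq_iff)
qed

lemma dim_perp:
  fixes U :: "('a^'n) set"
  assumes U: "vec.subspace U"
  shows "vec.dim U + vec.dim (perp U) = CARD('n)"
  using card_perp[OF U] q_gt_2
  by (simp add: card_subspace U subspace_perp flip: power_add)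

lemma perp_perp:
  fixes U :: "('a^'n) set"
  assumes U: "vec.subspace U"
  shows "perp (perp U) = U"
proof -
  have "vec.dim (perp (perp U)) = vec.dim U"
    using dim_perp[OF U] dim_perp[OF subspace_perp, of U] by simp
  then have "card (perp (perp U)) = card U"
    by (simp add: card_subspace U subspace_perp)
  then show ?thesis
    by (metis card_subset_eq finite perp_perp_sup)
qed

end

subsection \<open>Counting subspaces\<close>

text \<open>The covering relation of the subspace lattice. The dimension condition makes the
  inclusion strict, so this is the relation used in \<open>L_hat\<close> and
  \<open>R_hat\<close>.\<close>

definition cov :: "(('a::field)^'n) set \<Rightarrow> ('a^'n) set \<Rightarrow> bool" where
  "cov U U' \<longleftrightarrow> U \<subseteq> U' \<and> vec.dim U' = vec.dim U + 1"

definition ssum :: "(('a::field)^'n) set \<Rightarrow> ('a^'n) set \<Rightarrow> ('a^'n) set" where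
  "ssum U U' = {u + u' | u u'. u \<in> U \<and> u' \<in> U'}"

text \<open>The q-integer [m], the number of lines in an m-dimensional space over F_q.\<close>

definition qnum :: "nat \<Rightarrow> nat \<Rightarrow> real" where
  "qnum q m = (real q ^ m - 1) / (real q - 1)"

lemma qnum_0 [simp]: "qnum q 0 = 0"
  by (simp add: qnum_def)

lemma subspace_ssum: "vec.subspace U \<Longrightarrow> vec.subspace U' \<Longrightarrow> vec.subspace (ssum U U')"
  unfolding ssum_def by (rule vec.subspace_sums)

lemma ssum_upper: "vec.subspace U \<Longrightarrow> vec.subspace U' \<Longrightarrow> U \<subseteq> ssum U U' \<and> U' \<subseteq> ssum U U'"
proof -
  assume "vec.subspace U" "vec.subspace U'"
  then have "u + 0 \<in> ssum U U'" "0 + u' \<in> ssum U U'" if "u \<in> U" "u' \<in> U'" for u u'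
    using that vec.subspace_0 unfolding ssum_def by blast+
  moreover have "0 \<in> U" "0 \<in> U'" by (simp_all add: vec.subspace_0 \<open>vec.subspace U\<close> \<open>vec.subspace U'\<close>)
  ultimately show ?thesis by (metis add_0 add_0_right subsetI)
qed

lemma ssum_least: "vec.subspace W \<Longrightarrow> U \<subseteq> W \<Longrightarrow> U' \<subseteq> W \<Longrightarrow> ssum U U' \<subseteq> W"
  unfolding ssum_def using vec.subspace_add by blast

lemma dim_ssum: "vec.subspace U \<Longrightarrow> vec.subspace U' \<Longrightarrow>
    vec.dim (ssum U U') + vec.dim (U \<inter> U') = vec.dim U + vec.dim U'"
  unfolding ssum_def by (rule vec.dim_sums_Int)

lemma perp_ssum: "vec.subspace U \<Longrightarrow> vec.subspace U' \<Longrightarrow> perp (ssum U U') = perp U \<inter> perp U'"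
  unfolding ssum_def by (rule perp_sum)

lemma cov_eq_span_insert:
  assumes "vec.subspace U" "vec.subspace U'" "cov U U'" "a \<in> U'" "a \<notin> U"
  shows "U' = vec.span (insert a U)"
proof -
  have "vec.span (insert a U) \<subseteq> U'"
    using assms by (intro vec.span_minimal) (auto simp: cov_def)
  moreover have "vec.dim (vec.span (insert a U)) = vec.dim U'"
    using assms by (simp add: vec.dim_insert cov_def vec.span_eq_iff[THEN iffD2])
  ultimately show ?thesis
    using vec.subspace_dim_equal assms(2) vec.subspace_span by (metis order_refl)
qed

lemma cov_span_insert:
  assumes "vec.subspace U" "a \<notin> U"
  shows "cov U (vec.span (insert a U))"
  using assms by (auto simp: cov_def vec.dim_insert vec.span_eq_iff[THEN iffD2] intro: vec.span_base)

text \<open>Together with \<open>cov_common_below\<close>: distinct subspaces have a common upper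
  neighbour exactly when they have a common lower one, and at most one of each. This cancels the
  off-diagonal entries of the commutator of L and R.\<close>

lemma cov_common:
  assumes U: "vec.subspace U" and V: "vec.subspace V" and "U \<noteq> V"
  shows "vec.subspace W \<and> cov U W \<and> cov V W \<longleftrightarrow> W = ssum U V \<and> vec.dim V = vec.dim U \<and> vec.dim (U \<inter> V) + 1 = vec.dim U"
    (is "?l \<longleftrightarrow> ?r")
proof
  assume l: ?l
  then have d: "vec.dim V = vec.dim U" by (simp add: cov_def)
  have s: "ssum U V \<subseteq> W" using l by (intro ssum_least) (auto simp: cov_def)
  have "vec.dim (ssum U V) > vec.dim U"
  proof (rule ccontr)
    assume "\<not> ?thesis"
    then have "U = ssum U V" "V = ssum U V"
      using vec.subspace_dim_equal[OF U subspace_ssum[OF U V]] vec.subspace_dim_equal[OF V subspace_ssum[OF U V]]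
        ssum_upper[OF U V] d by auto
    then show False using assms(3) by simp
  qed
  then have "vec.dim (ssum U V) \<ge> vec.dim W" using l by (simp add: cov_def)
  then have "W = ssum U V"
    using vec.subspace_dim_equal[OF subspace_ssum[OF U V] _ s] l by auto
  then show ?r using dim_ssum[OF U V] l d by (auto simp: cov_def)
next
  assume r: ?r
  then show ?l using dim_ssum[OF U V] ssum_upper[OF U V] subspace_ssum[OF U V] by (auto simp: cov_def)
qed

lemma cov_common_below:
  assumes U: "vec.subspace U" and V: "vec.subspace V" and "U \<noteq> V"
  shows "vec.subspace W \<and> cov W U \<and> cov W V \<longleftrightarrow> W = U \<inter> V \<and> vec.dim V = vec.dim U \<and> vec.dim (U \<inter> V) + 1 = vec.dim U"
    (is "?l \<longleftrightarrow> ?r")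
proof
  assume l: ?l
  then have d: "vec.dim V = vec.dim U" by (simp add: cov_def)
  have s: "W \<subseteq> U \<inter> V" using l by (auto simp: cov_def)
  have "vec.dim (U \<inter> V) < vec.dim U"
  proof (rule ccontr)
    assume "\<not> ?thesis"
    then have "U \<inter> V = U" "U \<inter> V = V"
      using vec.subspace_dim_equal[OF vec.subspace_inter[OF U V]] U V d by auto
    then show False using assms(3) by simp
  qed
  then have "vec.dim (U \<inter> V) \<le> vec.dim W" using l by (simp add: cov_def)
  then have "W = U \<inter> V"
    using vec.subspace_dim_equal[OF _ vec.subspace_inter[OF U V] s] l by auto
  then show ?r using l d by (auto simp: cov_def)
next
  assume r: ?r
  then show ?l using vec.subspace_inter[OF U V] by (auto simp: cov_def)
qed

context odd_prime_field
begin

text \<open>The differences U' - U over all covers U' inside Y partition Y - U, because a vector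
  outside U spans a single cover with U; all parts have the same size.\<close>

lemma card_up:
  fixes U Y :: "('a^'n) set"
  assumes U: "vec.subspace U" and Y: "vec.subspace Y" and "U \<subseteq> Y"
  shows "real (card {U'. vec.subspace U' \<and> U' \<subseteq> Y \<and> cov U U'}) = qnum CARD('a) (vec.dim Y - vec.dim U)"
proof -
  let ?S = "{U'. vec.subspace U' \<and> U' \<subseteq> Y \<and> cov U U'}"
  let ?q = "CARD('a)"
  have "Y - U = (\<Union>U'\<in>?S. U' - U)"
  proof
    show "Y - U \<subseteq> (\<Union>U'\<in>?S. U' - U)"
    proof
      fix a assume a: "a \<in> Y - U"
      then have "vec.span (insert a U) \<in> ?S"
        using cov_span_insert[OF U, of a] assms vec.span_minimal[of "insert a U" Y] by simp
      moreover have "a \<in> vec.span (insert a U)" by (simp add: vec.span_base)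
      ultimately show "a \<in> (\<Union>U'\<in>?S. U' - U)" using a by blast
    qed
  qed auto
  moreover have "\<forall>i\<in>?S. \<forall>j\<in>?S. i \<noteq> j \<longrightarrow> (i - U) \<inter> (j - U) = {}"
    using cov_eq_span_insert[OF U] by blast
  ultimately have "card (Y - U) = (\<Sum>U'\<in>?S. card (U' - U))"
    by (simp only:) (rule card_UN_disjoint; simp)
  also have "\<dots> = (\<Sum>U'\<in>?S. ?q ^ (vec.dim U + 1) - ?q ^ vec.dim U)"
    by (intro sum.cong refl, subst card_Diff_subset) (auto simp: card_subspace U cov_def)
  finally have e: "?q ^ vec.dim Y - ?q ^ vec.dim U = card ?S * (?q ^ (vec.dim U + 1) - ?q ^ vec.dim U)"
    using assms by (simp add: card_Diff_subset card_subspace)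
  have d: "vec.dim U \<le> vec.dim Y" using assms(3) by (rule vec.dim_subset)
  then have le: "?q ^ vec.dim U \<le> ?q ^ vec.dim Y" "?q ^ vec.dim U \<le> ?q ^ (vec.dim U + 1)"
    using q_gt_2 by (auto intro!: power_increasing)
  have "real (?q ^ vec.dim Y) - real (?q ^ vec.dim U)
      = real (card ?S) * (real (?q ^ (vec.dim U + 1)) - real (?q ^ vec.dim U))"
    unfolding of_nat_diff[OF le(1), symmetric] of_nat_diff[OF le(2), symmetric] e of_nat_mult ..
  moreover have "real (?q ^ vec.dim Y) = real ?q ^ (vec.dim Y - vec.dim U) * real ?q ^ vec.dim U"
    using d by (simp flip: power_add)
  ultimately have "(real ?q ^ (vec.dim Y - vec.dim U) - 1) * real ?q ^ vec.dim U
      = (real (card ?S) * (real ?q - 1)) * real ?q ^ vec.dim U"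
    by (simp add: algebra_simps)
  moreover have "real ?q ^ vec.dim U \<noteq> 0" using q_gt_2 by simp
  ultimately have "real ?q ^ (vec.dim Y - vec.dim U) - 1 = real (card ?S) * (real ?q - 1)"
    by (rule mult_right_cancel[THEN iffD1, rotated])
  moreover have "real ?q - 1 \<noteq> 0" using q_gt_2 by simp
  ultimately show ?thesis by (simp add: qnum_def)
qed

text \<open>\<open>perp\<close> reverses the order and turns subspaces covered by U into covers of
  \<open>perp U\<close>.\<close>

lemma card_down:
  fixes U :: "('a^'n) set"
  assumes U: "vec.subspace U"
  shows "real (card {U'. vec.subspace U' \<and> cov U' U}) = qnum CARD('a) (vec.dim U)"
proof -
  have *: "cov (perp V) (perp W)" if "cov W V" "vec.subspace V" "vec.subspace W" for V W :: "('a^'n) set"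
    using that perp_antimono dim_perp[of V] dim_perp[of W] by (auto simp: cov_def)
  have "bij_betw perp {U'. vec.subspace U' \<and> cov U' U} {U'. vec.subspace U' \<and> U' \<subseteq> UNIV \<and> cov (perp U) U'}"
  proof (rule bij_betw_byWitness[where f' = perp], goal_cases)
    case 4
    have "cov (perp W) U" if "vec.subspace W" "cov (perp U) W" for W
      using *[OF that(2,1) subspace_perp] perp_perp[OF U] by simp
    then show ?case by (auto simp: subspace_perp)
  qed (auto simp: perp_perp subspace_perp U intro!: *)
  then have "card {U'. vec.subspace U' \<and> cov U' U} = card {U'. vec.subspace U' \<and> U' \<subseteq> UNIV \<and> cov (perp U) U'}"
    by (rule bij_betw_same_card)
  moreover have "CARD('n) - vec.dim (perp U) = vec.dim U" using dim_perp[OF U] by simp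
  ultimately show ?thesis
    using card_up[OF subspace_perp vec.subspace_UNIV, of U] by (simp add: card_cart_basis)
qed

definition nsub :: "('a^'n) set \<Rightarrow> nat \<Rightarrow> nat" where
  "nsub Y k = card {U \<in> subs Y. vec.dim U = k}"

text \<open>Counting covering pairs between dimensions k and k + 1 from both ends gives a recursion
  in k.\<close>

lemma nsub_eq_qbinom:
  fixes Y :: "('a^'n) set"
  assumes Y: "vec.subspace Y" and "k \<le> vec.dim Y"
  shows "real (nsub Y k) = qbinom CARD('a) (vec.dim Y) k"
  using assms(2)
proof (induction k)
  case 0
  have "{U \<in> subs Y. vec.dim U = 0} = {{0}}"
    using vec.subspace_0 Y by (auto simp: subs_def)
  then show ?case by (simp add: nsub_def qbinom_def)
next
  case (Suc k)
  let ?q = "CARD('a)" and ?N = "vec.dim Y"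
  let ?A = "{U \<in> subs Y. vec.dim U = k}" and ?B = "{U \<in> subs Y. vec.dim U = Suc k}"
  have "(\<Sum>U\<in>?A. card {U'\<in>?B. cov U U'}) = (\<Sum>U'\<in>?B. card {U\<in>?A. cov U U'})"
    by (rule sum_multicount_gen[symmetric]) auto
  then have "(\<Sum>U\<in>?A. real (card {U'\<in>?B. cov U U'})) = (\<Sum>U'\<in>?B. real (card {U\<in>?A. cov U U'}))"
    by (metis (no_types, lifting) of_nat_sum sum.cong)
  moreover have "real (card {U'\<in>?B. cov U U'}) = qnum ?q (?N - k)" if "U \<in> ?A" for U
  proof -
    have "{U'\<in>?B. cov U U'} = {U'. vec.subspace U' \<and> U' \<subseteq> Y \<and> cov U U'}"
      using that by (auto simp: subs_def cov_def)
    then show ?thesis using card_up[OF _ Y, of U] that by (auto simp: subs_def)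
  qed
  moreover have "real (card {U\<in>?A. cov U U'}) = qnum ?q (Suc k)" if "U' \<in> ?B" for U'
  proof -
    have "{U\<in>?A. cov U U'} = {U. vec.subspace U \<and> cov U U'}"
      using that by (auto simp: subs_def cov_def)
    then show ?thesis using card_down[of U'] that by (auto simp: subs_def)
  qed
  ultimately have "real (nsub Y k) * qnum ?q (?N - k) = real (nsub Y (Suc k)) * qnum ?q (Suc k)"
    by (simp add: nsub_def)
  moreover have "real ?q ^ Suc k \<noteq> 1"
    using one_less_power[of "real ?q" "Suc k"] q_gt_2 by simp
  moreover have "qbinom ?q ?N (Suc k) * (real ?q ^ Suc k - 1) = qbinom ?q ?N k * (real ?q ^ (?N - k) - 1)"
  proof -
    \<comment> \<open>Reversing the denominator lets passing from k to k + 1 append one factor above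
      and one below.\<close>
    have d: "(\<Prod>j<k. real ?q ^ (k - j) - 1) = (\<Prod>j<k. real ?q ^ Suc j - 1)" for k
      by (rule prod.reindex_bij_witness[of _ "\<lambda>j. k - 1 - j" "\<lambda>j. k - 1 - j"]) (auto simp: Suc_diff_Suc)
    have "qbinom ?q ?N k = (\<Prod>j<k. real ?q ^ (?N - j) - 1) / (\<Prod>j<k. real ?q ^ Suc j - 1)" for k
      unfolding qbinom_def prod_dividef d ..
    then have "qbinom ?q ?N (Suc k) = qbinom ?q ?N k * ((real ?q ^ (?N - k) - 1) / (real ?q ^ Suc k - 1))"
      by (simp del: power_Suc)
    then show ?thesis using \<open>real ?q ^ Suc k \<noteq> 1\<close> by (simp del: power_Suc)
  qed
  moreover have "real (nsub Y k) = qbinom ?q ?N k" using Suc by simp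
  moreover have "real ?q - 1 \<noteq> 0" using q_gt_2 by simp
  ultimately have "real (nsub Y (Suc k)) * (real ?q ^ Suc k - 1) = qbinom ?q ?N (Suc k) * (real ?q ^ Suc k - 1)"
    by (simp add: qnum_def field_simps del: power_Suc)
  then show ?case using \<open>real ?q ^ Suc k \<noteq> 1\<close> by simp
qed

end

subsection \<open>Modules on the subspace lattice\<close>

text \<open>Phrased for an indexed family, so that it also gives injectivity; dimensions can then be
  read as sizes of index sets.\<close>

lemma indep_family:
  fixes w :: "'k \<Rightarrow> ('a::field)^'n"
  assumes K: "finite K" and z: "\<And>a k. (\<Sum>k\<in>K. a k *s w k) = 0 \<Longrightarrow> k \<in> K \<Longrightarrow> a k = 0"
  shows "inj_on w K" and "vec.independent (w ` K)"
proof -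
  show i: "inj_on w K"
  proof (rule inj_onI, rule ccontr)
    fix j k assume jk: "j \<in> K" "k \<in> K" "w j = w k" "j \<noteq> k"
    \<comment> \<open>Equal vectors at two indices satisfy the relation with coefficients 1 and
      -1.\<close>
    let ?a = "\<lambda>i. if i = j then 1 else if i = k then - 1 else (0::'a)"
    have "(\<Sum>i\<in>K. ?a i *s w i) = (\<Sum>i\<in>K. (if i = j then w j else 0) + (if i = k then - w k else 0))"
      using jk by (intro sum.cong) auto
    also have "\<dots> = 0" using jk K by (simp add: sum.distrib)
    finally show False using z[of ?a j] jk by simp
  qed
  show "vec.independent (w ` K)"
  proof
    assume "vec.dependent (w ` K)"
    then obtain u v where u: "(\<Sum>v\<in>w ` K. u v *s v) = 0" "v \<in> w ` K" "u v \<noteq> 0"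
      by (auto simp: vec.dependent_finite[OF finite_imageI[OF K]])
    then obtain k where "k \<in> K" "v = w k" by blast
    then show False using z[of "\<lambda>k. u (w k)" k] u by (simp add: sum.reindex[OF i])
  qed
qed

lemma span_image_finite:
  fixes w :: "'k \<Rightarrow> ('a::field)^'n"
  assumes K: "finite K" and "v \<in> vec.span (w ` K)"
  shows "\<exists>a. v = (\<Sum>k\<in>K. a k *s w k)"
  using assms(2)
proof (induction rule: vec.span_induct_alt)
  case base
  show ?case by (rule exI[of _ "\<lambda>_. 0"]) simp
next
  case (step c x y)
  then obtain a k where a: "y = (\<Sum>k\<in>K. a k *s w k)" and k: "k \<in> K" "x = w k" by blast
  have "(\<Sum>j\<in>K. (a j + (if j = k then c else 0)) *s w j) = (\<Sum>j\<in>K. a j *s w j + (if j = k then c *s w k else 0))"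
    by (intro sum.cong) (auto simp: vec.scale_left_distrib)
  also have "\<dots> = c *s x + y" using K k a by (simp add: sum.distrib)
  finally show ?case by metis
qed

text \<open>Each vector has a witness coordinate at which all the others vanish, so the coefficients
  of a combination can be read off there.\<close>

lemma disjoint_support:
  fixes w :: "'k \<Rightarrow> ('a::field)^'n"
  assumes K: "finite K" and nz: "\<And>k. k \<in> K \<Longrightarrow> w k $ x k \<noteq> 0"
    and z: "\<And>j k. j \<in> K \<Longrightarrow> k \<in> K \<Longrightarrow> j \<noteq> k \<Longrightarrow> w j $ x k = 0"
  shows "inj_on w K" and "vec.independent (w ` K)"
    and "v \<in> vec.span (w ` K) \<Longrightarrow> v = (\<Sum>k\<in>K. (v $ x k / w k $ x k) *s w k)"
proof -
  have c: "(\<Sum>j\<in>K. a j *s w j) $ x k = a k * w k $ x k" if "k \<in> K" for a k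
  proof -
    have "(\<Sum>j\<in>K. a j *s w j) $ x k = (\<Sum>j\<in>K. if j = k then a k * w k $ x k else 0)"
      unfolding sum_component using that z by (intro sum.cong) auto
    then show ?thesis using that K by simp
  qed
  have z': "a k = 0" if "(\<Sum>k\<in>K. a k *s w k) = 0" "k \<in> K" for a k
    using c[OF that(2), of a] that nz by simp
  show "inj_on w K"
    by (rule indep_family(1)[OF K]) (rule z')
  show "vec.independent (w ` K)"
    by (rule indep_family(2)[OF K]) (rule z')
  assume "v \<in> vec.span (w ` K)"
  then obtain a where a: "v = (\<Sum>k\<in>K. a k *s w k)" using span_image_finite[OF K] by blast
  have "v $ x k / w k $ x k = a k" if "k \<in> K" for k
    using c[OF that, of a] a nz[OF that] by simp
  then have "(\<Sum>k\<in>K. (v $ x k / w k $ x k) *s w k) = (\<Sum>k\<in>K. a k *s w k)"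
    by (intro sum.cong) auto
  then show "v = (\<Sum>k\<in>K. (v $ x k / w k $ x k) *s w k)" using a by simp
qed

lemma span_ket: "v \<in> vec.span (ket ` A) \<longleftrightarrow> (\<forall>x. x \<notin> A \<longrightarrow> v $ x = 0)"
proof
  assume "v \<in> vec.span (ket ` A)"
  then show "\<forall>x. x \<notin> A \<longrightarrow> v $ x = 0"
    by (induction rule: vec.span_induct_alt) (auto simp: axis_def split: if_splits)
next
  assume z: "\<forall>x. x \<notin> A \<longrightarrow> v $ x = 0"
  have "v = (\<Sum>x\<in>A. v $ x *s ket x)"
  proof (rule vec_eq_iff[THEN iffD2], rule allI)
    fix y
    have "(\<Sum>x\<in>A. v $ x *s ket x) $ y = (\<Sum>x\<in>A. if x = y then v $ y else 0)"
      unfolding sum_component by (intro sum.cong) (auto simp: axis_def)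
    then show "v $ y = (\<Sum>x\<in>A. v $ x *s ket x) $ y" using z by simp
  qed
  also have "\<dots> \<in> vec.span (ket ` A)"
    by (intro vec.span_sum vec.span_scale vec.span_base) auto
  finally show "v \<in> vec.span (ket ` A)" .
qed

text \<open>Lagrange interpolation in the values of \<open>d\<close>.\<close>

lemma level_indicator_closed:
  fixes d :: "'n::finite \<Rightarrow> complex"
  assumes one: "Q (\<lambda>_. 1)" and add: "\<And>f g. Q f \<Longrightarrow> Q g \<Longrightarrow> Q (\<lambda>x. f x + g x)"
    and scale: "\<And>c f. Q f \<Longrightarrow> Q (\<lambda>x. c * f x)" and mult: "\<And>f g. Q f \<Longrightarrow> Q g \<Longrightarrow> Q (\<lambda>x. f x * g x)"
    and d: "Q d"
  shows "Q (\<lambda>x. if d x = c then 1 else 0)"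
proof (cases "c \<in> range d")
  case False
  then have "(\<lambda>x. if d x = c then 1 else 0) = (\<lambda>x. 0 * d x)" by (auto simp: fun_eq_iff)
  then show ?thesis using scale[OF d, of 0] by simp
next
  case True
  have p: "Q (\<lambda>x. \<Prod>b\<in>B. (d x - b) / (c - b))" if "finite B" for B
    using that
  proof (induction B)
    case (insert b B)
    have "Q (\<lambda>x. (1 / (c - b)) * (d x + (- b) * 1))"
      by (intro scale add d one)
    then have "Q (\<lambda>x. (d x - b) / (c - b))" by simp
    from mult[OF this insert.IH] show ?case by (simp only: prod.insert[OF insert.hyps])
  qed (simp add: one)
  have "(\<Prod>b\<in>range d - {c}. (d x - b) / (c - b)) = (if d x = c then 1 else 0)" for x
    by (auto intro!: prod.neutral prod_zero bexI[of _ "d x"])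
  then show ?thesis using p[of "range d - {c}"] by simp
qed

text \<open>\<open>L_hat\<close> divided by its non-zero scalar q^((1-N)/4): the same subspaces are
  invariant, and the entries become 0 and 1, so that products count subspaces.\<close>

definition Lm :: "(('a::{field,finite})^'n) set \<Rightarrow> (complex, ('a^'n) set) sqmat" where
  "Lm Y = (\<chi> U U'. if U \<in> subs Y \<and> U' \<in> subs Y \<and> cov U U' then 1 else 0)"

definition Rm :: "(('a::{field,finite})^'n) set \<Rightarrow> (complex, ('a^'n) set) sqmat" where
  "Rm Y = (\<chi> U U'. if U \<in> subs Y \<and> U' \<in> subs Y \<and> cov U' U then 1 else 0)"

definition gproj :: "(('a::{field,finite})^'n) set \<Rightarrow> nat \<Rightarrow> complex^(('a^'n) set) \<Rightarrow> complex^(('a^'n) set)" where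
  "gproj Y k v = (\<chi> U. if U \<in> subs Y \<and> vec.dim U = k then v $ U else 0)"

text \<open>Invariance under K and its inverse, rephrased as invariance under the projections to a
  fixed dimension; see \<open>sl2_submodule_iff\<close>.\<close>

definition graded_submodule :: "(('a::{field,finite})^'n) set \<Rightarrow> (complex^(('a^'n) set)) set \<Rightarrow> bool" where
  "graded_submodule Y I \<longleftrightarrow> vec.subspace I \<and> I \<subseteq> V_L Y \<and>
     (\<forall>v\<in>I. Lm Y *v v \<in> I \<and> Rm Y *v v \<in> I \<and> (\<forall>k. gproj Y k v \<in> I))"

lemma mem_V_L: "v \<in> V_L Y \<longleftrightarrow> (\<forall>U. U \<notin> subs Y \<longrightarrow> v $ U = 0)"
  unfolding V_L_def by (rule span_ket)

lemma subspace_V_L: "vec.subspace (V_L Y)"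
  unfolding V_L_def by (rule vec.subspace_span)

lemma gproj_lin:
  "gproj Y k (u + v) = gproj Y k u + gproj Y k v" "gproj Y k (c *s v) = c *s gproj Y k v" "gproj Y k 0 = 0"
  by (auto simp: gproj_def vec_eq_iff)

lemma gproj_sum: "gproj Y k (\<Sum>i\<in>A. f i) = (\<Sum>i\<in>A. gproj Y k (f i))"
  by (induction A rule: infinite_finite_induct) (auto simp: gproj_lin)

lemma gproj_gproj: "gproj Y j (gproj Y k v) = (if j = k then gproj Y k v else 0)"
  by (auto simp: gproj_def vec_eq_iff)

lemma dim_subs_le: "U \<in> subs Y \<Longrightarrow> vec.dim U \<le> vec.dim Y"
  by (auto simp: subs_def intro: vec.dim_subset)

lemma gproj_above: "k > vec.dim Y \<Longrightarrow> gproj Y k v = 0"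
  by (auto simp: gproj_def vec_eq_iff dest: dim_subs_le)

lemma gproj_in_V_L: "gproj Y k v \<in> V_L Y"
  by (auto simp: gproj_def mem_V_L)

lemma gproj_Rm: "gproj Y (Suc k) (Rm Y *v v) = Rm Y *v gproj Y k v"
  by (auto simp: vec_eq_iff gproj_def matrix_vector_mult_def Rm_def cov_def intro!: sum.cong sum.neutral)

lemma gproj_Lm: "gproj Y k (Lm Y *v v) = Lm Y *v gproj Y (Suc k) v"
  by (auto simp: vec_eq_iff gproj_def matrix_vector_mult_def Lm_def cov_def intro!: sum.cong sum.neutral)

lemma Lm_gproj_0: "Lm Y *v gproj Y 0 v = 0"
  by (auto simp: vec_eq_iff gproj_def matrix_vector_mult_def Lm_def cov_def intro!: sum.neutral simp del: vec.dim_eq_0)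

lemma L_hat_mult: "L_hat Y *v v = of_real (real CARD('a) powr ((1 - real (vec.dim Y)) / 4)) *s (Lm Y *v v)"
  for Y :: "(('a::{field,finite})^'n) set"
  by (auto simp: vec_eq_iff matrix_vector_mult_def L_hat_def Lm_def cov_def sum_distrib_left psubset_eq intro!: sum.cong)

lemma R_hat_mult: "R_hat Y *v v = of_real (real CARD('a) powr ((1 - real (vec.dim Y)) / 4)) *s (Rm Y *v v)"
  for Y :: "(('a::{field,finite})^'n) set"
  by (auto simp: vec_eq_iff matrix_vector_mult_def R_hat_def Rm_def cov_def sum_distrib_left psubset_eq intro!: sum.cong)

lemma diag_mult: "(\<chi> x y. if x = y then f x else 0) *v v = (\<chi> x. f x * v $ x)"
  for v :: "('a::semiring_1)^'n"
  by (auto simp: vec_eq_iff matrix_vector_mult_def if_distrib[of "\<lambda>a. a * b" for b] cong: if_cong)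

lemma K_mat_mult: "K_mat Y *v v = (\<chi> U. (if U \<in> subs Y
     then of_real (real CARD('a) powr (real (vec.dim Y) / 2 - real (vec.dim U))) else 0) * v $ U)"
  for Y :: "(('a::{field,finite})^'n) set"
  unfolding K_mat_def diag_mult[symmetric] by (rule arg_cong[of _ _ "\<lambda>M. M *v v"]) (auto simp: vec_eq_iff)

lemma K_inv_mult: "K_inv Y *v v = (\<chi> U. (if U \<in> subs Y
     then of_real (real CARD('a) powr (- (real (vec.dim Y) / 2 - real (vec.dim U)))) else 0) * v $ U)"
  for Y :: "(('a::{field,finite})^'n) set"
  unfolding K_inv_def diag_mult[symmetric] by (rule arg_cong[of _ _ "\<lambda>M. M *v v"]) (auto simp: vec_eq_iff)

lemma diag_gproj:
  assumes "v \<in> V_L Y"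
  shows "(\<chi> U. (if U \<in> subs Y then f (vec.dim U) else 0) * v $ U) = (\<Sum>k\<le>vec.dim Y. f k *s gproj Y k v)"
proof -
  have "(\<Sum>k\<le>vec.dim Y. f k *s gproj Y k v) $ U = (if U \<in> subs Y then f (vec.dim U) else 0) * v $ U" for U
    using dim_subs_le[of U Y] by (auto simp: gproj_def if_distrib[of "\<lambda>a. b * a" for b] cong: if_cong)
  then show ?thesis by (simp add: vec_eq_iff)
qed

lemma sum_gproj: "v \<in> V_L Y \<Longrightarrow> (\<Sum>k\<le>vec.dim Y. gproj Y k v) = v"
proof -
  assume v: "v \<in> V_L Y"
  then have "(\<chi> U. (if U \<in> subs Y then 1 else 0) * v $ U) = v" by (auto simp: mem_V_L vec_eq_iff)
  then show ?thesis using diag_gproj[OF v, of "\<lambda>_. 1"] by simp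
qed

context odd_prime_field
begin

text \<open>K is diagonal with a different eigenvalue for each dimension, so the projections
  \<open>gproj\<close> are polynomials in K; conversely K and its inverse are combinations of these
  projections.\<close>

lemma sl2_submodule_iff:
  fixes Y :: "('a^'n) set"
  shows "sl2_submodule Y I \<longleftrightarrow> graded_submodule Y I"
proof
  let ?\<kappa> = "of_real (real CARD('a) powr ((1 - real (vec.dim Y)) / 4)) :: complex"
  have \<kappa>: "?\<kappa> \<noteq> 0" using q_gt_2 by simp
  {
    assume m: "sl2_submodule Y I"
    then have I: "vec.subspace I" "I \<subseteq> V_L Y" by (auto simp: sl2_submodule_def)
    have "Lm Y *v v \<in> I" "Rm Y *v v \<in> I" if "v \<in> I" for v
    proof -
      have "inverse ?\<kappa> *s (L_hat Y *v v) \<in> I" "inverse ?\<kappa> *s (R_hat Y *v v) \<in> I"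
        using m that by (auto simp: sl2_submodule_def intro!: vec.subspace_scale)
      then show "Lm Y *v v \<in> I" "Rm Y *v v \<in> I" using \<kappa> by (simp_all add: L_hat_mult R_hat_mult)
    qed
    moreover have "gproj Y k v \<in> I" if "v \<in> I" for v k
    proof -
      let ?g = "\<lambda>k. of_real (real CARD('a) powr (real (vec.dim Y) / 2 - real k)) :: complex"
      let ?d = "\<lambda>U. if U \<in> subs Y then ?g (vec.dim U) else 0"
      \<comment> \<open>Closure of the invariant diagonal operators under sums, multiples and
        products feeds the interpolation.\<close>
      have 1: "\<forall>v\<in>I. (\<chi> U. (if ?d U = ?g k then 1 else 0) * v $ U) \<in> I"
      proof (rule level_indicator_closed[where Q = "\<lambda>f. \<forall>v\<in>I. (\<chi> U. f U * v $ U) \<in> I"], goal_cases)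
        case (2 f g)
        show ?case
        proof
          fix v assume "v \<in> I"
          then have "(\<chi> U. f U * v $ U) + (\<chi> U. g U * v $ U) \<in> I" using 2 I vec.subspace_add by blast
          then show "(\<chi> U. (f U + g U) * v $ U) \<in> I" by (simp add: plus_vec_def distrib_right)
        qed
      next
        case (3 c f)
        show ?case
        proof
          fix v assume "v \<in> I"
          then have "c *s (\<chi> U. f U * v $ U) \<in> I" using 3 I vec.subspace_scale by blast
          then show "(\<chi> U. c * f U * v $ U) \<in> I" by (simp add: vector_scalar_mult_def mult.assoc)
        qed
      next
        case (4 f g)
        show ?case
        proof
          fix v assume "v \<in> I"
          then have "(\<chi> U. f U * (\<chi> U. g U * v $ U) $ U) \<in> I" using 4 by blast
          then show "(\<chi> U. f U * g U * v $ U) \<in> I" by (simp add: mult.assoc)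
        qed
      next
        case 5
        show ?case using m by (auto simp: sl2_submodule_def simp flip: K_mat_mult)
      qed simp
      have 2: "(\<chi> U. (if ?d U = ?g k then 1 else 0) * v $ U) = gproj Y k v"
      proof -
        \<comment> \<open>The eigenvalues are positive and injective in the dimension, so the value
          0 given outside \<open>subs Y\<close> differs from all of them.\<close>
        have "?d U = ?g k \<longleftrightarrow> U \<in> subs Y \<and> vec.dim U = k" for U
          using q_gt_2 by (auto simp: powr_inj)
        then show ?thesis by (auto simp: gproj_def vec_eq_iff)
      qed
      show ?thesis using bspec[OF 1 that] unfolding 2 .
    qed
    ultimately show "graded_submodule Y I" using I by (auto simp: graded_submodule_def)
  next
    assume m: "graded_submodule Y I"
    then have I: "vec.subspace I" "I \<subseteq> V_L Y" by (auto simp: graded_submodule_def)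
    have g: "(\<Sum>k\<le>vec.dim Y. f k *s gproj Y k v) \<in> I" if "v \<in> I" for f v
      using m that I by (auto simp: graded_submodule_def intro!: vec.subspace_sum vec.subspace_scale)
    have "K_mat Y *v v \<in> I" "K_inv Y *v v \<in> I" if "v \<in> I" for v
      using g[OF that] diag_gproj[OF subsetD[OF I(2) that], of "\<lambda>k. of_real (real CARD('a) powr (real (vec.dim Y) / 2 - real k))"]
        diag_gproj[OF subsetD[OF I(2) that], of "\<lambda>k. of_real (real CARD('a) powr (- (real (vec.dim Y) / 2 - real k)))"]
      unfolding K_mat_mult K_inv_mult by simp_all
    then show "sl2_submodule Y I" using m I
      by (auto simp: sl2_submodule_def graded_submodule_def L_hat_mult R_hat_mult intro!: vec.subspace_scale)
  }
qed

text \<open>Both products count common neighbours, above and below respectively. For distinct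
  subspaces the two counts agree; on the diagonal they are [N - k] and [k].\<close>

lemma Lm_Rm_commutator:
  fixes Y :: "('a^'n) set"
  assumes Y: "vec.subspace Y"
  shows "Lm Y *v (Rm Y *v v) - Rm Y *v (Lm Y *v v) =
    (\<chi> U. (if U \<in> subs Y then of_real (qnum CARD('a) (vec.dim Y - vec.dim U) - qnum CARD('a) (vec.dim U)) else 0) * v $ U)"
proof -
  let ?h = "\<lambda>U. if U \<in> subs Y then of_real (qnum CARD('a) (vec.dim Y - vec.dim U) - qnum CARD('a) (vec.dim U)) else (0::complex)"
  have LR: "(Lm Y ** Rm Y) $ U $ W = (if U \<in> subs Y \<and> W \<in> subs Y then of_nat (card {X. X \<in> subs Y \<and> cov U X \<and> cov W X}) else 0)" for U W
  proof -
    have "(Lm Y ** Rm Y) $ U $ W = (\<Sum>X\<in>UNIV. if U \<in> subs Y \<and> W \<in> subs Y \<and> X \<in> subs Y \<and> cov U X \<and> cov W X then 1 else 0)"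
      unfolding matrix_matrix_mult_def Lm_def Rm_def by (simp, intro sum.cong) auto
    then show ?thesis by (auto simp: sum.If_cases)
  qed
  have RL: "(Rm Y ** Lm Y) $ U $ W = (if U \<in> subs Y \<and> W \<in> subs Y then of_nat (card {X. X \<in> subs Y \<and> cov X U \<and> cov X W}) else 0)" for U W
  proof -
    have "(Rm Y ** Lm Y) $ U $ W = (\<Sum>X\<in>UNIV. if U \<in> subs Y \<and> W \<in> subs Y \<and> X \<in> subs Y \<and> cov X U \<and> cov X W then 1 else 0)"
      unfolding matrix_matrix_mult_def Lm_def Rm_def by (simp, intro sum.cong) auto
    then show ?thesis by (auto simp: sum.If_cases)
  qed
  have "(Lm Y ** Rm Y - Rm Y ** Lm Y) $ U $ W = (if U = W then ?h U else 0)" for U W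
  proof (cases "U \<in> subs Y \<and> W \<in> subs Y")
    case True
    then have s: "vec.subspace U" "vec.subspace W" "U \<subseteq> Y" "W \<subseteq> Y" by (auto simp: subs_def)
    show ?thesis
    proof (cases "U = W")
      case True
      have "{X. X \<in> subs Y \<and> cov U X \<and> cov U X} = {X. vec.subspace X \<and> X \<subseteq> Y \<and> cov U X}"
        "{X. X \<in> subs Y \<and> cov X U \<and> cov X U} = {X. vec.subspace X \<and> cov X U}"
        using s by (auto simp: subs_def cov_def)
      then have "real (card {X. X \<in> subs Y \<and> cov U X \<and> cov U X}) = qnum CARD('a) (vec.dim Y - vec.dim U)"
        "real (card {X. X \<in> subs Y \<and> cov X U \<and> cov X U}) = qnum CARD('a) (vec.dim U)"
        using card_up[OF s(1) Y s(3)] card_down[OF s(1)] by (simp_all only:)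
      from this[symmetric] show ?thesis using \<open>U \<in> subs Y \<and> W \<in> subs Y\<close>
        unfolding True[symmetric] vector_minus_component LR RL of_real_diff of_real_of_nat_eq
        by (simp only: of_real_of_nat_eq of_real_diff if_True simp_thms)
    next
      case False
      let ?P = "vec.dim W = vec.dim U \<and> vec.dim (U \<inter> W) + 1 = vec.dim U"
      have "{X. X \<in> subs Y \<and> cov U X \<and> cov W X} = (if ?P then {ssum U W} else {})"
        using cov_common[OF s(1,2) False] ssum_least[OF Y s(3,4)] by (auto simp: subs_def)
      moreover have "{X. X \<in> subs Y \<and> cov X U \<and> cov X W} = (if ?P then {U \<inter> W} else {})"
        using cov_common_below[OF s(1,2) False] s by (auto simp: subs_def)
      ultimately show ?thesis using False by (simp add: LR RL)
    qed
  qed (auto simp: LR RL)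
  then have "Lm Y ** Rm Y - Rm Y ** Lm Y = (\<chi> U W. if U = W then ?h U else 0)"
    by (simp add: vec_eq_iff)
  then have "(Lm Y ** Rm Y - Rm Y ** Lm Y) *v v = (\<chi> U. ?h U * v $ U)"
    by (simp only: diag_mult)
  then show ?thesis
    by (simp only: matrix_vector_mult_diff_rdistrib matrix_vector_mul_assoc)
qed

end

text \<open>\<open>[L, R]\<close> is scalar in each dimension; summing these scalars along a string that starts in dimension \<open>\<nu>\<close> gives the coefficient of \<open>L\<close>.\<close>

definition lower_coeff :: "nat \<Rightarrow> nat \<Rightarrow> nat \<Rightarrow> nat \<Rightarrow> real" where
  "lower_coeff q N \<nu> j = qnum q (Suc j) * (real q ^ (N - \<nu> - j) - real q ^ \<nu>) / (real q - 1)"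

text \<open>The shape of an irreducible module: one vector for each dimension from \<nu> to N -
  \<nu>, symmetric about N/2. All coefficients of R are normalised to 1, so those of L carry the
  structure and depend on \<nu> and N only.\<close>

definition string_basis :: "(('a::{field,finite})^'n) set \<Rightarrow> (complex^(('a^'n) set)) set \<Rightarrow> nat \<Rightarrow> (nat \<Rightarrow> complex^(('a^'n) set)) \<Rightarrow> bool" where
  "string_basis Y I \<nu> w \<longleftrightarrow> 2 * \<nu> \<le> vec.dim Y \<and> I = vec.span (w ` {\<nu>..vec.dim Y - \<nu>}) \<and>
     (\<forall>k\<in>{\<nu>..vec.dim Y - \<nu>}. w k \<noteq> 0 \<and> gproj Y k (w k) = w k \<and>
        Rm Y *v w k = (if k < vec.dim Y - \<nu> then w (Suc k) else 0) \<and>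
        Lm Y *v w k = (if k > \<nu> then of_real (lower_coeff CARD('a) (vec.dim Y) \<nu> (k - \<nu> - 1)) *s w (k - 1) else 0))"

lemma gproj_in_span_shift:
  "gproj Y k x = x \<Longrightarrow> gproj Y j x = (if j = k then x else 0)"
  by (metis gproj_gproj)

lemma matrix_vector_mult_sum: "M *v (\<Sum>i\<in>A. f i) = (\<Sum>i\<in>A. M *v f i)"
  for M :: "('a::semiring_1)^'n^'m"
  by (induction A rule: infinite_finite_induct) (auto simp: matrix_vector_right_distrib)

lemma gproj_mult_diag:
  "(\<chi> U. (if U \<in> subs Y then f (vec.dim U) else 0) * gproj Y k v $ U) = f k *s gproj Y k v"
  by (auto simp: vec_eq_iff gproj_def)

lemma span_closed:
  assumes "v \<in> vec.span B" "\<And>b. b \<in> B \<Longrightarrow> f b \<in> vec.span B"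
    and add: "\<And>u v. f (u + v) = f u + f v" and sc: "\<And>c u. f (c *s u) = c *s f u" and "f 0 = 0"
  shows "f v \<in> vec.span (B :: (('a::field)^'n) set)"
  using assms(1)
proof (induction rule: vec.span_induct_alt)
  case base
  show ?case using assms(5) by (simp add: vec.span_zero)
next
  case (step c x y)
  then show ?case by (simp add: add sc vec.span_add vec.span_scale assms(2))
qed

section \<open>Structure and multiplicities of the irreducible modules\<close>

context odd_prime_field
begin

lemma lower_coeff_alt:
  "lower_coeff CARD('a) N \<nu> j = ((real CARD('a) ^ Suc j - 1) * (real CARD('a) ^ (N - \<nu> - j) - real CARD('a) ^ \<nu>))
    / ((real CARD('a) - 1) * (real CARD('a) - 1))"
  by (simp add: lower_coeff_def qnum_def)

lemma qnum_diff:
  "qnum CARD('a) m - qnum CARD('a) n = ((real CARD('a) ^ m - real CARD('a) ^ n) * (real CARD('a) - 1))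
    / ((real CARD('a) - 1) * (real CARD('a) - 1))"
  using q_gt_2 by (simp add: qnum_def diff_divide_distrib[symmetric])

text \<open>The increment is the eigenvalue of [L, R] in dimension \<nu> + Suc j, so the closed form
  obeys the recursion forced by the commutator.\<close>

lemma lower_coeff_step:
  assumes "\<nu> + Suc j \<le> N"
  shows "lower_coeff CARD('a) N \<nu> (Suc j) = lower_coeff CARD('a) N \<nu> j + (qnum CARD('a) (N - (\<nu> + Suc j)) - qnum CARD('a) (\<nu> + Suc j))"
proof -
  have "N - \<nu> - j = Suc (N - \<nu> - Suc j)" "N - (\<nu> + Suc j) = N - \<nu> - Suc j" using assms by simp_all
  then show ?thesis
    unfolding lower_coeff_alt qnum_diff add_divide_distrib[symmetric]
    by (intro arg_cong2[of _ _ _ _ "(/)"] refl) (simp add: algebra_simps power_add)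
qed

lemma lower_coeff_0:
  assumes "\<nu> \<le> N"
  shows "lower_coeff CARD('a) N \<nu> 0 = qnum CARD('a) (N - \<nu>) - qnum CARD('a) \<nu>"
  unfolding lower_coeff_alt qnum_diff by simp

text \<open>The factor q^(m+1) - 1 is non-zero, so the other one vanishes and N - \<nu> - m = \<nu>:
  a string can stop only at the dimension opposite to its start.\<close>

lemma lower_coeff_eq_0:
  assumes "\<nu> + m \<le> N" "lower_coeff CARD('a) N \<nu> m = 0"
  shows "2 * \<nu> + m = N"
proof -
  have q: "real CARD('a) > 1" using q_gt_2 by simp
  then have "(real CARD('a) ^ Suc m - 1) * (real CARD('a) ^ (N - \<nu> - m) - real CARD('a) ^ \<nu>) = 0"
    using assms(2) by (simp only: lower_coeff_alt divide_eq_0_iff mult_eq_0_iff) auto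
  moreover have "real CARD('a) ^ Suc m > 1" using q by (intro one_less_power) auto
  ultimately have "real CARD('a) ^ (N - \<nu> - m) = real CARD('a) ^ \<nu>"
    by (metis eq_iff_diff_eq_0 less_irrefl mult_eq_0_iff)
  then have "N - \<nu> - m = \<nu>" using q by (simp add: power_inject_exp)
  then show ?thesis using assms(1) by simp
qed

text \<open>A vector of lowest dimension is killed by L. By the commutator, L maps each R-power of
  it to a multiple of the preceding one, so these powers span a submodule, which must be all of
  I.\<close>

theorem irreducible_string_basis:
  fixes Y :: "('a^'n) set"
  assumes Y: "vec.subspace Y" and irr: "sl2_irreducible Y I"
  obtains \<nu> w where "string_basis Y I \<nu> w"
proof -
  let ?N = "vec.dim Y" and ?c = "lower_coeff CARD('a) (vec.dim Y)"
  let ?h = "\<lambda>k. qnum CARD('a) (vec.dim Y - k) - qnum CARD('a) k"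
  have I: "graded_submodule Y I" "I \<noteq> {0}" and min: "\<And>I'. graded_submodule Y I' \<Longrightarrow> I' \<subseteq> I \<Longrightarrow> I' \<noteq> {0} \<Longrightarrow> I' = I"
    using irr by (auto simp: sl2_irreducible_def sl2_submodule_iff)
  then have sI: "vec.subspace I" "I \<subseteq> V_L Y" by (auto simp: graded_submodule_def)
  define P where "P k \<longleftrightarrow> (\<exists>v\<in>I. gproj Y k v \<noteq> 0)" for k
  have "\<exists>k. P k"
  proof -
    obtain v where v: "v \<in> I" "v \<noteq> 0" using I(2) vec.subspace_0[OF sI(1)] by blast
    then have "(\<Sum>k\<le>?N. gproj Y k v) \<noteq> 0" using sum_gproj[OF subsetD[OF sI(2) v(1)]] v(2) by simp
    then show ?thesis using v(1) unfolding P_def by (meson sum.neutral)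
  qed
  \<comment> \<open>The lowest dimension that occurs in I.\<close>
  define \<nu> where "\<nu> = (LEAST k. P k)"
  have "P \<nu>" unfolding \<nu>_def using \<open>\<exists>k. P k\<close> by (rule LeastI_ex)
  then obtain v0 where v0: "v0 \<in> I" "gproj Y \<nu> v0 \<noteq> 0" by (auto simp: P_def)
  define v where "v = gproj Y \<nu> v0"
  have v: "v \<in> I" "v \<noteq> 0" "gproj Y \<nu> v = v"
    using v0 I(1) by (auto simp: v_def graded_submodule_def gproj_gproj)
  have Lv: "Lm Y *v v = 0"
  proof (cases \<nu>)
    case 0
    then show ?thesis using v(3) Lm_gproj_0 by metis
  next
    case (Suc k)
    have "\<not> P k" using not_less_Least[of k P] Suc by (simp add: \<nu>_def)
    then have "gproj Y k (Lm Y *v v) = 0" using v(1) I(1) by (auto simp: P_def graded_submodule_def)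
    then show ?thesis using gproj_Lm[of Y k v] v(3) Suc by simp
  qed
  define u where "u j = ((*v) (Rm Y) ^^ j) v" for j
  have u0: "u 0 = v" and uS: "u (Suc j) = Rm Y *v u j" for j by (simp_all add: u_def)
  have uI: "u j \<in> I" for j
    by (induction j) (use v I(1) in \<open>auto simp: u0 uS graded_submodule_def\<close>)
  have ug: "gproj Y (\<nu> + j) (u j) = u j" for j
    by (induction j) (auto simp: u0 uS v gproj_Rm)
  have uz: "u j = 0" if "\<nu> + j > ?N" for j
    using ug[of j] gproj_above[OF that] by simp
  have comm: "Lm Y *v (Rm Y *v u j) = Rm Y *v (Lm Y *v u j) + of_real (?h (\<nu> + j)) *s u j" for j
  proof -
    have "(\<chi> U. (if U \<in> subs Y then of_real (?h (vec.dim U)) else 0) * u j $ U) = of_real (?h (\<nu> + j)) *s u j"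
      using gproj_mult_diag[of Y "\<lambda>k. of_real (?h k)" "\<nu> + j" "u j"] by (simp only: ug)
    then show ?thesis using Lm_Rm_commutator[OF Y, of "u j"] by (simp only: diff_eq_eq add.commute)
  qed
  have \<nu>N: "\<nu> \<le> ?N" using uz[of 0] v u0 by (metis add_0_right not_le)
  have Lu: "Lm Y *v u (Suc j) = of_real (?c \<nu> j) *s u j" if "\<nu> + j \<le> ?N" for j
    using that
  proof (induction j)
    case 0
    have "Lm Y *v u (Suc 0) = of_real (?h \<nu>) *s u 0"
      using comm[of 0] Lv by (simp add: uS u0)
    then show ?case using lower_coeff_0[OF \<nu>N] by simp
  next
    case (Suc j)
    then have IH: "Lm Y *v u (Suc j) = of_real (?c \<nu> j) *s u j" by simp
    have "Lm Y *v u (Suc (Suc j)) = of_real (?c \<nu> j) *s u (Suc j) + of_real (?h (\<nu> + Suc j)) *s u (Suc j)"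
      using comm[of "Suc j"] by (simp only: uS[of "Suc j"] IH vec.scale uS[of j, symmetric])
    then show ?case unfolding lower_coeff_step[OF Suc.prems]
      by (simp only: of_real_add vec.scale_left_distrib)
  qed
  \<comment> \<open>The index of the last non-zero vector of the string; it exists because
    dimensions above N are empty.\<close>
  define m where "m = (LEAST j. u (Suc j) = 0)"
  have um: "u (Suc m) = 0" unfolding m_def by (rule LeastI[of _ ?N]) (simp add: uz)
  have unz: "u j \<noteq> 0" if "j \<le> m" for j
  proof (cases j)
    case (Suc i)
    then have "i < m" using that by simp
    then show ?thesis using not_less_Least[of i "\<lambda>j. u (Suc j) = 0"] Suc by (simp add: m_def)
  qed (simp add: u0 v)
  have mN: "\<nu> + m \<le> ?N" using uz[of m] unz[of m] by (metis le_refl not_le)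
  \<comment> \<open>L applied to R \<open>u m\<close> = 0 must give the coefficient times
    \<open>u m\<close>, which is non-zero; this fixes the length of the string.\<close>
  have "of_real (?c \<nu> m) *s u m = 0" using Lu[OF mN] um by simp
  then have "?c \<nu> m = 0" using unz[of m] by simp
  then have m: "2 * \<nu> + m = ?N" using lower_coeff_eq_0[OF mN] by simp
  define w where "w k = u (k - \<nu>)" for k
  have wimg: "w ` {\<nu>..?N - \<nu>} = u ` {..m}"
  proof -
    have "{..m} = (\<lambda>k. k - \<nu>) ` {\<nu>..?N - \<nu>}"
    proof (rule set_eqI, rule iffI)
      fix j assume "j \<in> {..m}"
      then show "j \<in> (\<lambda>k. k - \<nu>) ` {\<nu>..?N - \<nu>}" using m by (intro image_eqI[of _ _ "j + \<nu>"]) auto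
    qed (use m in auto)
    then show ?thesis by (simp add: w_def image_image)
  qed
  let ?I = "vec.span (w ` {\<nu>..?N - \<nu>})"
  have R: "Rm Y *v w k = (if k < ?N - \<nu> then w (Suc k) else 0)" if "k \<in> {\<nu>..?N - \<nu>}" for k
  proof (cases "k < ?N - \<nu>")
    case True
    then show ?thesis using that by (simp add: w_def uS[symmetric] Suc_diff_le)
  next
    case False
    then have "k - \<nu> = m" using that m by auto
    then show ?thesis using False um by (simp add: w_def uS[symmetric])
  qed
  have L: "Lm Y *v w k = (if k > \<nu> then of_real (?c \<nu> (k - \<nu> - 1)) *s w (k - 1) else 0)" if "k \<in> {\<nu>..?N - \<nu>}" for k
  proof (cases "k > \<nu>")
    case True
    then have "k - \<nu> = Suc (k - \<nu> - 1)" "k - 1 - \<nu> = k - \<nu> - 1" by auto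
    then show ?thesis using Lu[of "k - \<nu> - 1"] that True unfolding w_def by simp
  next
    case False
    then show ?thesis using that Lv u0 by (simp add: w_def)
  qed
  have g: "gproj Y k (w k) = w k" if "k \<in> {\<nu>..?N - \<nu>}" for k
    using ug[of "k - \<nu>"] that by (simp add: w_def)
  have nz: "w k \<noteq> 0" if "k \<in> {\<nu>..?N - \<nu>}" for k
  proof -
    have "k - \<nu> \<le> m" using that m by auto
    then show ?thesis using unz by (simp add: w_def)
  qed
  have wS: "w k \<in> ?I" if "k \<in> {\<nu>..?N - \<nu>}" for k
    using that by (intro vec.span_base imageI)
  have wS': "w (k - Suc 0) \<in> ?I" if "\<nu> < k" "k \<le> ?N - \<nu>" for k
    using that by (intro wS) auto
  have "graded_submodule Y ?I"
    unfolding graded_submodule_def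
  proof (intro conjI ballI allI)
    show "?I \<subseteq> V_L Y"
      by (rule vec.span_minimal) (use sI uI in \<open>auto simp: w_def subspace_V_L\<close>)
    fix x assume x: "x \<in> ?I"
    show "Lm Y *v x \<in> ?I"
      by (rule span_closed[OF x]) (auto simp: L vec.span_zero matrix_vector_right_distrib vec.scale intro!: vec.span_scale wS')
    show "Rm Y *v x \<in> ?I"
      by (rule span_closed[OF x]) (auto simp: R vec.span_zero matrix_vector_right_distrib vec.scale intro!: wS)
    show "gproj Y k x \<in> ?I" for k
      by (rule span_closed[OF x]) (auto simp: gproj_in_span_shift[OF g] gproj_lin vec.span_zero intro!: wS)
  qed (simp add: vec.subspace_span)
  moreover have "?I \<subseteq> I"
    by (rule vec.span_minimal) (use sI uI in \<open>auto simp: w_def\<close>)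
  moreover have "?I \<noteq> {0}"
  proof -
    have "\<nu> \<in> {\<nu>..?N - \<nu>}" using m by auto
    then have "w \<nu> \<in> ?I" by (intro vec.span_base imageI)
    then show ?thesis using nz \<open>\<nu> \<in> {\<nu>..?N - \<nu>}\<close> by auto
  qed
  ultimately have "?I = I" by (rule min)
  then have "string_basis Y I \<nu> w"
    using m R L g nz unfolding string_basis_def by auto
  then show ?thesis by (rule that)
qed

lemma gproj_string:
  assumes sb: "string_basis Y I \<nu> w" and "v \<in> I"
  shows "gproj Y k v \<in> (if k \<in> {\<nu>..vec.dim Y - \<nu>} then vec.span {w k} else {0})"
proof -
  obtain a where "v = (\<Sum>j\<in>{\<nu>..vec.dim Y - \<nu>}. a j *s w j)"
    using sb assms(2) span_image_finite[of "{\<nu>..vec.dim Y - \<nu>}" v w] by (auto simp: string_basis_def)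
  then have "gproj Y k v = (\<Sum>j\<in>{\<nu>..vec.dim Y - \<nu>}. a j *s gproj Y k (w j))"
    by (simp add: gproj_sum gproj_lin)
  also have "\<dots> = (\<Sum>j\<in>{\<nu>..vec.dim Y - \<nu>}. if j = k then a k *s w k else 0)"
  proof (intro sum.cong refl)
    fix j assume "j \<in> {\<nu>..vec.dim Y - \<nu>}"
    then have "gproj Y j (w j) = w j" using sb by (simp add: string_basis_def)
    from gproj_in_span_shift[OF this, of k] show "a j *s gproj Y k (w j) = (if j = k then a k *s w k else 0)" by auto
  qed
  also have "\<dots> = (if k \<in> {\<nu>..vec.dim Y - \<nu>} then a k *s w k else 0)"
    by simp
  finally show ?thesis by (auto intro: vec.span_scale vec.span_base)
qed

lemma string_support:
  assumes sb: "string_basis Y I \<nu> w"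
  shows "\<exists>x. \<forall>k\<in>{\<nu>..vec.dim Y - \<nu>}. w k $ x k \<noteq> 0 \<and> x k \<in> subs Y \<and> vec.dim (x k) = k \<and>
    (\<forall>j\<in>{\<nu>..vec.dim Y - \<nu>}. j \<noteq> k \<longrightarrow> w j $ x k = 0)"
proof -
  have "\<exists>U. w k $ U \<noteq> 0" if "k \<in> {\<nu>..vec.dim Y - \<nu>}" for k
    using sb that by (auto simp: string_basis_def vec_eq_iff)
  then have "\<forall>k\<in>{\<nu>..vec.dim Y - \<nu>}. \<exists>U. w k $ U \<noteq> 0" by blast
  from bchoice[OF this] obtain x where x: "\<forall>k\<in>{\<nu>..vec.dim Y - \<nu>}. w k $ x k \<noteq> 0" by blast
  have g: "w k $ U \<noteq> 0 \<Longrightarrow> U \<in> subs Y \<and> vec.dim U = k" if "k \<in> {\<nu>..vec.dim Y - \<nu>}" for k U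
  proof -
    have "w k $ U = gproj Y k (w k) $ U" using sb that by (simp add: string_basis_def)
    then show "w k $ U \<noteq> 0 \<Longrightarrow> U \<in> subs Y \<and> vec.dim U = k" by (auto simp: gproj_def split: if_splits)
  qed
  show ?thesis by (rule exI[of _ x]) (use x g in blast)
qed

lemma dim_string:
  assumes sb: "string_basis Y I \<nu> w"
  shows "vec.dim I = vec.dim Y - 2 * \<nu> + 1"
proof -
  obtain x where x: "\<forall>k\<in>{\<nu>..vec.dim Y - \<nu>}. w k $ x k \<noteq> 0 \<and> x k \<in> subs Y \<and> vec.dim (x k) = k \<and>
    (\<forall>j\<in>{\<nu>..vec.dim Y - \<nu>}. j \<noteq> k \<longrightarrow> w j $ x k = 0)"
    using string_support[OF sb] by blast
  have d: "inj_on w {\<nu>..vec.dim Y - \<nu>}" "vec.independent (w ` {\<nu>..vec.dim Y - \<nu>})"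
    using disjoint_support(1,2)[of "{\<nu>..vec.dim Y - \<nu>}" w x] x by auto
  have "vec.dim I = card (w ` {\<nu>..vec.dim Y - \<nu>})"
    using sb d(2) by (simp add: string_basis_def vec.dim_eq_card_independent)
  moreover have "2 * \<nu> \<le> vec.dim Y" using sb by (simp add: string_basis_def)
  ultimately show ?thesis unfolding card_image[OF d(1)] by simp
qed

text \<open>Each string meets dimension k in a line or not at all, so the vectors
  \<open>w I k\<close> of the strings passing through k form a basis of the span of the kets of
  dimension k.\<close>

lemma weight_count:
  fixes Y :: "('a^'n) set"
  assumes Y: "vec.subspace Y" and ds: "direct_sum (V_L Y) Is (\<lambda>I. I)"
    and sb: "\<And>I. I \<in> Is \<Longrightarrow> string_basis Y I (\<nu> I) (w I)"
  shows "card {I \<in> Is. \<nu> I \<le> k \<and> k \<le> vec.dim Y - \<nu> I} = nsub Y k"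
proof -
  let ?J = "{I \<in> Is. \<nu> I \<le> k \<and> k \<le> vec.dim Y - \<nu> I}"
  let ?V = "{v :: complex^(('a^'n) set). \<forall>U. U \<notin> {U \<in> subs Y. vec.dim U = k} \<longrightarrow> v $ U = 0}"
  have fin: "finite Is" and sub: "\<And>I. I \<in> Is \<Longrightarrow> vec.subspace I"
    and dsum: "V_L Y = {\<Sum>I\<in>Is. u I | u. \<forall>I\<in>Is. u I \<in> I}"
    and dind: "\<And>u I. \<forall>I\<in>Is. u I \<in> I \<Longrightarrow> (\<Sum>I\<in>Is. u I) = 0 \<Longrightarrow> I \<in> Is \<Longrightarrow> u I = 0"
    using ds by (auto simp: direct_sum_def)
  have w: "w I k \<in> I" "w I k \<noteq> 0" "gproj Y k (w I k) = w I k" if "I \<in> ?J" for I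
  proof -
    have k: "k \<in> {\<nu> I..vec.dim Y - \<nu> I}" using that by auto
    have s: "string_basis Y I (\<nu> I) (w I)" using sb that by auto
    have "w I k \<in> vec.span (w I ` {\<nu> I..vec.dim Y - \<nu> I})" using k by (intro vec.span_base imageI)
    then show "w I k \<in> I" using s by (simp add: string_basis_def)
    show "w I k \<noteq> 0" "gproj Y k (w I k) = w I k" using s k by (auto simp: string_basis_def)
  qed
  have ind: "a I = 0" if a: "(\<Sum>I\<in>?J. a I *s w I k) = 0" and I: "I \<in> ?J" for a I
  proof -
    \<comment> \<open>A relation among the strings through k, extended by zero to all summands, so
      that directness of the whole sum applies.\<close>
    define u where "u I = (if I \<in> ?J then a I *s w I k else 0)" for I
    have "\<forall>I\<in>Is. u I \<in> I" using w sub by (auto simp: u_def vec.subspace_0 vec.subspace_scale)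
    moreover have "(\<Sum>I\<in>Is. u I) = 0"
      using a fin by (simp add: u_def sum.inter_filter[symmetric] if_distrib cong: if_cong)
    ultimately have "u I = 0" using dind I by blast
    then show ?thesis using w[OF I] I by (simp add: u_def)
  qed
  have fJ: "finite ?J" using fin by simp
  have inj: "inj_on (\<lambda>I. w I k) ?J"
    by (rule indep_family(1)[OF fJ]) (rule ind)
  have indep: "vec.independent ((\<lambda>I. w I k) ` ?J)"
    by (rule indep_family(2)[OF fJ]) (rule ind)
  have gV: "gproj Y k v \<in> ?V" for v by (auto simp: gproj_def)
  have "vec.dim ?V = card ((\<lambda>I. w I k) ` ?J)"
  proof (rule vec.dim_unique[OF _ _ indep refl])
    show "(\<lambda>I. w I k) ` ?J \<subseteq> ?V" using w(3) gV by (metis (no_types, lifting) image_subsetI)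
    show "?V \<subseteq> vec.span ((\<lambda>I. w I k) ` ?J)"
    proof
      fix v assume v: "v \<in> ?V"
      then have "v \<in> V_L Y" by (auto simp: mem_V_L)
      then obtain u where u: "v = (\<Sum>I\<in>Is. u I)" "\<And>I. I \<in> Is \<Longrightarrow> u I \<in> I" using dsum by blast
      have "v = gproj Y k v" using v by (auto simp: gproj_def vec_eq_iff)
      also have "\<dots> = (\<Sum>I\<in>Is. gproj Y k (u I))" by (simp add: u(1) gproj_sum)
      also have "\<dots> \<in> vec.span ((\<lambda>I. w I k) ` ?J)"
      proof (rule vec.span_sum)
        fix I assume I: "I \<in> Is"
        have *: "gproj Y k (u I) \<in> (if k \<in> {\<nu> I..vec.dim Y - \<nu> I} then vec.span {w I k} else {0})"
          by (rule gproj_string[OF sb[OF I] u(2)[OF I]])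
        show "gproj Y k (u I) \<in> vec.span ((\<lambda>I. w I k) ` ?J)"
        proof (cases "k \<in> {\<nu> I..vec.dim Y - \<nu> I}")
          case True
          then have "vec.span {w I k} \<subseteq> vec.span ((\<lambda>I. w I k) ` ?J)" using I by (intro vec.span_mono) auto
          then show ?thesis using * True by auto
        qed (use * vec.span_zero in auto)
      qed
      finally show "v \<in> vec.span ((\<lambda>I. w I k) ` ?J)" .
    qed
  qed
  then show ?thesis
    using dim_substandard_cart[of "{U \<in> subs Y. vec.dim U = k}", where 'a = complex] card_image[OF inj]
    by (simp add: nsub_def)
qed

text \<open>Strings that start exactly at k are counted by the difference of two consecutive values
  of \<open>weight_count\<close>; a string of dimension l + 1 starts at (N - l)/2.\<close>

theorem multiplicity_count:
  fixes Y :: "('a^'n) set"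
  assumes Y: "vec.subspace Y" and dec: "sl2_decomposition Y Is"
  shows "real (card {I \<in> Is. vec.dim I = l + 1}) = qmult CARD('a) ((real (vec.dim Y) - real l) / 2) (vec.dim Y)"
proof -
  let ?N = "vec.dim Y"
  have ds: "direct_sum (V_L Y) Is (\<lambda>I. I)" and irr: "\<And>I. I \<in> Is \<Longrightarrow> sl2_irreducible Y I"
    using dec by (auto simp: sl2_decomposition_def)
  have fin: "finite Is" using ds by (simp add: direct_sum_def)
  have "\<forall>I\<in>Is. \<exists>p. string_basis Y I (fst p) (snd p)"
  proof
    fix I assume "I \<in> Is"
    then obtain \<nu> w where "string_basis Y I \<nu> w" using irreducible_string_basis[OF Y irr] by blast
    then show "\<exists>p. string_basis Y I (fst p) (snd p)" by (intro exI[of _ "(\<nu>, w)"]) simp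
  qed
  from bchoice[OF this] obtain p where p: "\<forall>I\<in>Is. string_basis Y I (fst (p I)) (snd (p I))" by blast
  define \<nu> w where "\<nu> I = fst (p I)" and "w I = snd (p I)" for I
  have sb: "string_basis Y I (\<nu> I) (w I)" if "I \<in> Is" for I using p that by (simp add: \<nu>_def w_def)
  have \<nu>: "2 * \<nu> I \<le> ?N" "vec.dim I = ?N - 2 * \<nu> I + 1" if "I \<in> Is" for I
    using sb[OF that] dim_string[OF sb[OF that]] by (simp_all add: string_basis_def)
  \<comment> \<open>In the lower half, \<nu> \<le> k already implies k \<le> N - \<nu>.\<close>
  have wc: "card {I \<in> Is. \<nu> I \<le> k} = nsub Y k" if "2 * k \<le> ?N" for k
  proof -
    have "k \<le> ?N - \<nu> I" if "I \<in> Is" "\<nu> I \<le> k" for I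
      using \<nu>(1)[OF that(1)] that(2) \<open>2 * k \<le> ?N\<close> by linarith
    then have "{I \<in> Is. \<nu> I \<le> k} = {I \<in> Is. \<nu> I \<le> k \<and> k \<le> ?N - \<nu> I}" by blast
    then show ?thesis using weight_count[OF Y ds sb] by simp
  qed
  have c: "real (card {I \<in> Is. \<nu> I = k}) = qmult CARD('a) (real k) ?N" if "2 * k \<le> ?N" for k
  proof (cases k)
    case 0
    have "nsub Y 0 = 1" using nsub_eq_qbinom[OF Y, of 0] by (simp add: qbinom_def)
    then show ?thesis using wc[of 0] 0 by (simp add: qmult_def)
  next
    case (Suc j)
    have "{I \<in> Is. \<nu> I \<le> k} = {I \<in> Is. \<nu> I = k} \<union> {I \<in> Is. \<nu> I \<le> j}" using Suc by auto
    moreover have "{I \<in> Is. \<nu> I = k} \<inter> {I \<in> Is. \<nu> I \<le> j} = {}" using Suc by auto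
    ultimately have "nsub Y k = card {I \<in> Is. \<nu> I = k} + nsub Y j"
      using wc[of k] wc[of j] that Suc fin by (simp add: card_Un_disjoint)
    then have "real (card {I \<in> Is. \<nu> I = k}) = qbinom CARD('a) ?N k - qbinom CARD('a) ?N j"
      using nsub_eq_qbinom[OF Y, of k] nsub_eq_qbinom[OF Y, of j] that Suc by simp
    then show ?thesis using Suc that by (simp add: qmult_def nat_add_distrib)
  qed
  show ?thesis
  proof (cases "\<exists>k. l + 2 * k = ?N")
    case True
    then obtain k where k: "l + 2 * k = ?N" by blast
    have "vec.dim I = l + 1 \<longleftrightarrow> \<nu> I = k" if "I \<in> Is" for I
      using \<nu>[OF that] k by linarith
    then have "{I \<in> Is. vec.dim I = l + 1} = {I \<in> Is. \<nu> I = k}" by blast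
    moreover have "(real ?N - real l) / 2 = real k" unfolding k[symmetric] by simp
    moreover have "2 * k \<le> ?N" using k by simp
    ultimately show ?thesis using c[of k] by (simp only:)
  next
    case False
    have "vec.dim I \<noteq> l + 1" if "I \<in> Is" for I
    proof
      assume "vec.dim I = l + 1"
      then have "l + 2 * \<nu> I = ?N" using \<nu>[OF that] by linarith
      then show False using False by blast
    qed
    then have "{I \<in> Is. vec.dim I = l + 1} = {}" by blast
    \<comment> \<open>A non-zero value would make (N - l)/2 a natural number, which this case
      excludes.\<close>
    moreover have "qmult CARD('a) ((real ?N - real l) / 2) ?N = 0"
    proof (rule ccontr)
      assume "qmult CARD('a) ((real ?N - real l) / 2) ?N \<noteq> 0"
      then have "(real ?N - real l) / 2 \<in> \<int>" "(real ?N - real l) / 2 \<ge> 0"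
        by (auto simp: qmult_def split: if_splits)
      then obtain i where i: "(real ?N - real l) / 2 = of_int i" "i \<ge> 0" by (auto elim!: Ints_cases)
      then have "real ?N = real (l + 2 * nat i)" by simp
      then show False using False by (simp only: of_nat_eq_iff) blast
    qed
    ultimately show ?thesis by (simp only: card.empty of_nat_0)
  qed
qed

end

subsection \<open>Quadratic Gauss sums\<close>

definition qform :: "(('a::comm_ring_1), 'n::finite) sqmat \<Rightarrow> 'a^'n \<Rightarrow> 'a" where
  "qform S v = dot v (S *v v)"

definition gauss :: "(('a::{field,finite}), 'n::finite) sqmat \<Rightarrow> complex" where
  "gauss S = (\<Sum>v\<in>UNIV. psi (qform S v))"

text \<open>The Legendre symbol, extended by 0.\<close>

definition chi :: "'a::field \<Rightarrow> int" where
  "chi a = (if a = 0 then 0 else if \<exists>y. y ^ 2 = a then 1 else - 1)"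

definition diag_mat :: "('n \<Rightarrow> 'a::zero) \<Rightarrow> ('a, 'n::finite) sqmat" where
  "diag_mat d = (\<chi> i j. if i = j then d i else 0)"

text \<open>The map \<open>v\<close> to \<open>v + dot \<kappa> v *s axis a 1\<close>, which changes
  only coordinate a: the elementary step of symmetric elimination.\<close>

definition shear :: "'n \<Rightarrow> ('a::field)^'n \<Rightarrow> ('a, 'n::finite) sqmat" where
  "shear a \<kappa> = (\<chi> i n. (if i = n then 1 else 0) + (if i = a then \<kappa> $ n else 0))"

lemma shear_mult: "shear a \<kappa> *v v = v + dot \<kappa> v *s axis a 1"
proof (rule vec_eq_iff[THEN iffD2], rule allI)
  fix i
  have "(shear a \<kappa> *v v) $ i = (\<Sum>n\<in>UNIV. (if n = i then v $ n else 0) + (if i = a then \<kappa> $ n * v $ n else 0))"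
    unfolding matrix_vector_mult_def shear_def by (simp, intro sum.cong) (auto simp: distrib_right)
  then show "(shear a \<kappa> *v v) $ i = (v + dot \<kappa> v *s axis a 1) $ i"
    by (auto simp: sum.distrib dot_def axis_def)
qed

lemma invertible_if_inj: "inj ((*v) A) \<Longrightarrow> invertible A" for A :: "('a::field)^'n^'n"
  using matrix_left_invertible_injective[of A] invertible_left_inverse[of A] by blast

lemma invertible_imp_inj: "invertible A \<Longrightarrow> inj ((*v) A)" for A :: "('a::field)^'n^'n"
  using matrix_left_invertible_injective[of A] invertible_left_inverse[of A] by blast

lemma bij_invertible: "invertible A \<Longrightarrow> bij ((*v) A)" for A :: "('a::{field,finite})^'n^'n"
  using finite_UNIV_inj_surj[OF _ invertible_imp_inj] invertible_imp_inj by (auto simp: bij_def)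

lemma invertible_shear:
  assumes "\<kappa> $ a = 0"
  shows "invertible (shear a \<kappa> :: ('a::field, 'n::finite) sqmat)"
proof (rule invertible_if_inj, rule injI)
  fix u v assume e: "shear a \<kappa> *v u = shear a \<kappa> *v v"
  have "shear a (- \<kappa>) *v (shear a \<kappa> *v x) = x" for x
    using assms by (simp add: shear_mult)
  then show "u = v" using e by metis
qed

lemma mv_axis [simp]: "(M *v axis j 1) $ i = M $ i $ j" for M :: "('a::comm_ring_1)^'n^'m"
proof -
  have "(M *v axis j 1) $ i = dot (M $ i) (axis j 1)" by (simp only: matrix_vector_mult_def dot_def vec_lambda_beta)
  then show ?thesis by simp
qed

lemma congruent_entry:
  "(transpose P ** S ** P) $ m $ n = dot (P *v axis m 1) (S *v (P *v axis n 1))" for P S :: "('a::field, 'n::finite) sqmat"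
proof -
  have "(transpose P ** S ** P) $ m $ n = dot (axis m 1) ((transpose P ** S ** P) *v axis n 1)"
    by simp
  also have "\<dots> = dot (axis m 1) (transpose P *v (S *v (P *v axis n 1)))"
    by (simp only: matrix_vector_mul_assoc matrix_mul_assoc)
  also have "\<dots> = dot (P *v axis m 1) (S *v (P *v axis n 1))"
    by (simp only: dot_matrix_vector[of _ "transpose P"] transpose_transpose)
  finally show ?thesis .
qed

lemma dot_axis_mult: "dot (axis i 1) (S *v axis j 1) = S $ i $ j" for S :: "('a::field, 'n::finite) sqmat"
  by simp

lemma Sym_entry: "S \<in> Sym \<Longrightarrow> S $ i $ j = S $ j $ i"
  by (metis (mono_tags, lifting) Sym_def mem_Collect_eq transpose_def vec_lambda_beta)

lemma Sym_iff: "S \<in> Sym \<longleftrightarrow> (\<forall>i j. S $ i $ j = S $ j $ i)"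
  by (auto simp: Sym_def transpose_def vec_eq_iff)

lemma Sym_congruent: "S \<in> Sym \<Longrightarrow> transpose P ** S ** P \<in> Sym" for S :: "('a::field, 'n::finite) sqmat"
  by (simp add: Sym_def matrix_transpose_mul matrix_mul_assoc)

lemma shear_congruent:
  fixes S :: "('a::field, 'n::finite) sqmat"
  assumes "S \<in> Sym"
  shows "(transpose (shear a \<kappa>) ** S ** shear a \<kappa>) $ m $ n =
    S $ m $ n + \<kappa> $ n * S $ m $ a + \<kappa> $ m * S $ a $ n + \<kappa> $ m * \<kappa> $ n * S $ a $ a"
  by (simp add: congruent_entry shear_mult matrix_vector_right_distrib vec.scale algebra_simps)

lemma qform_congruent: "qform (transpose P ** S ** P) v = qform S (P *v v)" for S :: "('a::field, 'n::finite) sqmat"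
proof -
  have "qform (transpose P ** S ** P) v = dot v (transpose P *v (S *v (P *v v)))"
    by (simp only: qform_def matrix_vector_mul_assoc matrix_mul_assoc)
  then show ?thesis by (simp only: dot_matrix_vector[of _ "transpose P"] transpose_transpose qform_def)
qed

lemma gauss_congruent:
  fixes S P :: "('a::{field,finite}, 'n::finite) sqmat"
  assumes "invertible P"
  shows "gauss (transpose P ** S ** P) = gauss S"
  unfolding gauss_def qform_congruent
  using sum.reindex_bij_betw[OF bij_invertible[OF assms], of "\<lambda>v. psi (qform S v)"] by simp

text \<open>Distributivity over all coordinates; it factors the Gauss sum of a diagonal
  form.\<close>

lemma sum_prod_vec:
  fixes f :: "'n::finite \<Rightarrow> 'a::finite \<Rightarrow> 'b::comm_semiring_1"
  shows "(\<Sum>v\<in>UNIV. \<Prod>i\<in>UNIV. f i ((v::'a^'n) $ i)) = (\<Prod>i\<in>UNIV. \<Sum>t\<in>UNIV. f i t)"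
proof -
  have "(\<Prod>i\<in>UNIV. \<Sum>t\<in>UNIV. f i t) = (\<Sum>g\<in>PiE UNIV (\<lambda>_. UNIV). \<Prod>i\<in>UNIV. f i (g i))"
    by (rule prod_sum_PiE) auto
  also have "PiE UNIV (\<lambda>_. UNIV) = (UNIV :: ('n \<Rightarrow> 'a) set)" by (auto simp: PiE_def extensional_def)
  also have "(\<Sum>g\<in>UNIV. \<Prod>i\<in>UNIV. f i (g i)) = (\<Sum>v\<in>UNIV. \<Prod>i\<in>UNIV. f i ((v::'a^'n) $ i))"
    by (rule sum.reindex_bij_witness[of _ vec_nth vec_lambda]) (simp_all add: fun_eq_iff)
  finally show ?thesis ..
qed

context odd_prime_field
begin

text \<open>Simultaneous row and column elimination, by induction on the set J of indices that may
  still have off-diagonal entries. A non-zero diagonal entry is a pivot; if there is none, a shear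
  produces one, using that 2 is invertible.\<close>

lemma diagonalize:
  fixes S :: "('a, 'n::finite) sqmat"
  assumes "S \<in> Sym"
  obtains P :: "('a, 'n) sqmat" and d where "invertible P" "transpose P ** S ** P = diag_mat d"
proof -
  have "\<exists>(P :: ('a, 'n) sqmat) d. invertible P \<and> transpose P ** S ** P = diag_mat d"
    if "S \<in> Sym" "\<And>i j. i \<noteq> j \<Longrightarrow> i \<notin> J \<or> j \<notin> J \<Longrightarrow> S $ i $ j = 0" for J and S :: "('a, 'n) sqmat"
    using finite[of J] that
  proof (induction J arbitrary: S rule: finite_psubset_induct)
    case (psubset J)
    note sy = Sym_entry[OF psubset.prems(1)]
    have comb: "\<exists>(P :: ('a, 'n) sqmat) d. invertible P \<and> transpose P ** S ** P = diag_mat d"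
      if "invertible R" "\<exists>(P :: ('a, 'n) sqmat) d. invertible P \<and> transpose P ** (transpose R ** S ** R) ** P = diag_mat d" for R :: "('a, 'n) sqmat"
    proof -
      from that(2) obtain P :: "('a, 'n) sqmat" and d where P: "invertible P" "transpose P ** (transpose R ** S ** R) ** P = diag_mat d" by blast
      have "transpose (R ** P) ** S ** (R ** P) = diag_mat d"
        using P(2) by (simp add: matrix_transpose_mul matrix_mul_assoc)
      then show ?thesis using invertible_mult[OF that(1) P(1)] by blast
    qed
    have elim: "\<exists>(P :: ('a, 'n) sqmat) d. invertible P \<and> transpose P ** S ** P = diag_mat d"
      if S: "S \<in> Sym" "\<And>i j. i \<noteq> j \<Longrightarrow> i \<notin> J \<or> j \<notin> J \<Longrightarrow> S $ i $ j = 0" and j: "j \<in> J" "S $ j $ j \<noteq> 0"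
      for S :: "('a, 'n) sqmat" and j
    proof -
      \<comment> \<open>Adding these multiples of column j clears the rest of row and column
        j.\<close>
      define \<kappa> where "\<kappa> = (\<chi> n. if n = j then 0 else - S $ j $ n / S $ j $ j)"
      let ?R = "shear j \<kappa>"
      have R: "invertible ?R" by (rule invertible_shear) (simp add: \<kappa>_def)
      have off: "(transpose ?R ** S ** ?R) $ m $ n = 0" if "m \<noteq> n" "m \<notin> J - {j} \<or> n \<notin> J - {j}" for m n
      proof -
        from that consider "m = j" "n \<noteq> j" | "n = j" "m \<noteq> j" | "m \<noteq> j" "n \<noteq> j" "m \<notin> J \<or> n \<notin> J" by blast
        then show ?thesis
        proof cases
          case 1 then show ?thesis unfolding shear_congruent[OF S(1)] using j(2) by (simp add: \<kappa>_def)
        next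
          case 2 then show ?thesis unfolding shear_congruent[OF S(1)] using j(2) Sym_entry[OF S(1), of m j] by (simp add: \<kappa>_def)
        next
          case 3
          then have "S $ m $ n = 0" "\<kappa> $ m = 0 \<or> \<kappa> $ n = 0" "\<kappa> $ n * S $ m $ j = 0" "\<kappa> $ m * S $ j $ n = 0"
            using S(2)[of m n] S(2)[of j m] S(2)[of j n] S(2)[of m j] that(1) by (auto simp: \<kappa>_def)
          then show ?thesis unfolding shear_congruent[OF S(1)] by auto
        qed
      qed
      have "\<exists>(P :: ('a, 'n) sqmat) d. invertible P \<and> transpose P ** (transpose ?R ** S ** ?R) ** P = diag_mat d"
        by (rule psubset.IH[of "J - {j}"]) (use j(1) off Sym_congruent[OF S(1)] in auto)
      then obtain P :: "('a, 'n) sqmat" and d where P: "invertible P" "transpose P ** (transpose ?R ** S ** ?R) ** P = diag_mat d" by blast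
      have "transpose (?R ** P) ** S ** (?R ** P) = diag_mat d"
        using P(2) by (simp add: matrix_transpose_mul matrix_mul_assoc)
      then show ?thesis using invertible_mult[OF R P(1)] by blast
    qed
    consider "\<forall>i j. i \<noteq> j \<longrightarrow> S $ i $ j = 0" | j where "j \<in> J" "S $ j $ j \<noteq> 0"
      | j k where "j \<noteq> k" "S $ j $ k \<noteq> 0" "\<forall>i\<in>J. S $ i $ i = 0" by blast
    then show ?case
    proof cases
      case 1
      then have "transpose (mat 1) ** S ** mat 1 = diag_mat (\<lambda>i. S $ i $ i)"
        by (simp add: transpose_mat diag_mat_def vec_eq_iff)
      moreover have "invertible (mat 1 :: ('a, 'n) sqmat)"
        unfolding invertible_def by (rule exI[of _ "mat 1"]) simp
      ultimately show ?thesis by blast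
    next
      case 2
      then show ?thesis using elim[OF psubset.prems] by blast
    next
      case 3
      then have jk: "j \<in> J" "k \<in> J" using psubset.prems(2) by blast+
      \<comment> \<open>Replaces e_j by e_j + e_k; both diagonal entries being 0, the new one is
        \<open>2 * S $ j $ k\<close>.\<close>
      let ?R = "shear k (axis j 1)"
      let ?S = "transpose ?R ** S ** ?R"
      have R: "invertible ?R" by (rule invertible_shear) (use 3 in \<open>simp add: axis_def\<close>)
      have "?S $ j $ j = 2 * S $ j $ k"
        unfolding shear_congruent[OF psubset.prems(1)] using 3 jk sy[of k j] by simp
      then have nz: "?S $ j $ j \<noteq> 0" using 3 two_neq_0 by simp
      have off: "?S $ m $ n = 0" if "m \<noteq> n" "m \<notin> J \<or> n \<notin> J" for m n
        unfolding shear_congruent[OF psubset.prems(1)]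
        using that jk psubset.prems(2)[of m n] psubset.prems(2)[of m k] psubset.prems(2)[of k n] by (auto simp: axis_def)
      have "\<exists>(P :: ('a, 'n) sqmat) d. invertible P \<and> transpose P ** ?S ** P = diag_mat d"
        by (rule elim[OF Sym_congruent[OF psubset.prems(1)] off jk(1)]) (use nz in auto)
      then show ?thesis by (rule comb[OF R])
    qed
  qed
  from this[of S UNIV] assms show ?thesis using that by blast
qed

end

definition gauss1 :: "'a::{field,finite} \<Rightarrow> complex" where
  "gauss1 c = (\<Sum>t\<in>UNIV. psi (c * t ^ 2))"

definition nullspace :: "('a::field)^'n^'m \<Rightarrow> ('a^'n) set" where
  "nullspace S = {v. S *v v = 0}"

definition corner :: "'n \<Rightarrow> 'a::zero \<Rightarrow> ('a, 'n::finite) sqmat" where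
  "corner j c = (\<chi> m n. if m = j \<and> n = j then c else 0)"

lemma corner_mult: "corner j c *v v = axis j (c * v $ j)" for v :: "('a::semiring_1)^'n::finite"
proof (rule vec_eq_iff[THEN iffD2], rule allI)
  fix i
  have "(corner j c *v v) $ i = (\<Sum>n\<in>UNIV. if n = j then (if i = j then c * v $ j else 0) else 0)"
    unfolding corner_def matrix_vector_mult_def vec_lambda_beta by (intro sum.cong) auto
  then show "(corner j c *v v) $ i = axis j (c * v $ j) $ i" by (simp add: axis_def)
qed

lemma qform_add: "qform (S + T) v = qform S v + qform T v" for S T :: "('a::field, 'n::finite) sqmat"
  by (simp add: qform_def matrix_vector_mult_add_rdistrib)

lemma qform_corner: "qform (corner j c) v = c * (v $ j) ^ 2" for v :: "('a::field)^'n::finite"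
  by (simp add: qform_def corner_mult power2_eq_square)

lemma qform_add_vec:
  "S \<in> Sym \<Longrightarrow> qform S (u + v) = qform S u + 2 * dot u (S *v v) + qform S v" for u v :: "('a::field)^'n::finite"
  using dot_sym[of S u v] by (simp add: qform_def matrix_vector_right_distrib)

lemma qform_scale: "qform S (c *s v) = c ^ 2 * qform S v" for v :: "('a::field)^'n::finite"
  by (simp add: qform_def vec.scale power2_eq_square)

lemma subspace_nullspace: "vec.subspace (nullspace S)"
  by (auto simp: nullspace_def vec.subspace_def matrix_vector_right_distrib vec.scale)

lemma mv_component: "(S *v v) $ i = dot (S $ i) v"
  by (simp add: matrix_vector_mult_def dot_def)

text \<open>Connects \<open>rank\<close>, a row rank, with the duality of \<open>perp\<close>, and
  so yields rank-nullity and the image of a symmetric matrix.\<close>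

lemma nullspace_eq_perp: "nullspace S = perp (vec.span (rows S))"
proof
  show "perp (vec.span (rows S)) \<subseteq> nullspace S"
  proof
    fix v assume v: "v \<in> perp (vec.span (rows S))"
    have "S $ i \<in> vec.span (rows S)" for i by (rule vec.span_base) (auto simp: rows_def row_def vec_nth_inverse)
    then show "v \<in> nullspace S" using v by (auto simp: perp_def nullspace_def vec_eq_iff mv_component)
  qed
  show "nullspace S \<subseteq> perp (vec.span (rows S))"
  proof
    fix v assume v: "v \<in> nullspace S"
    have "dot u v = 0" if "u \<in> vec.span (rows S)" for u
      using that
    proof (induction rule: vec.span_induct_alt)
      case (step c x y)
      then obtain i where "x = row i S" by (auto simp: rows_def)
      then have "x = S $ i" by (simp add: row_def vec_eq_iff)
      moreover have "dot (S $ i) v = 0" using v by (simp add: nullspace_def vec_eq_iff mv_component)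
      ultimately have "dot x v = 0" by simp
      then show ?case using step by simp
    qed simp
    then show "v \<in> perp (vec.span (rows S))" by (simp add: perp_def)
  qed
qed

text \<open>With identity rows put outside J, only permutations fixing every index outside J survive
  in the Leibniz formula.\<close>

lemma det_on_eq_det:
  fixes M :: "('a::comm_ring_1, 'd::finite) sqmat"
  assumes "\<And>i j. i \<notin> J \<Longrightarrow> M $ i $ j = 0"
  shows "det (M + (\<chi> i j. if i = j \<and> i \<notin> J then 1 else 0)) = det_on J M"
proof -
  let ?A = "M + (\<chi> i j. if i = j \<and> i \<notin> J then 1 else 0)"
  have A: "?A $ i $ j = (if i \<in> J then M $ i $ j else if i = j then 1 else 0)" for i j
    using assms by auto
  have "det ?A = (\<Sum>p\<in>{p. p permutes J}. of_int (sign p) * (\<Prod>i\<in>UNIV. ?A $ i $ p i))"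
    unfolding det_def
  proof (rule sum.mono_neutral_right)
    show "{p. p permutes J} \<subseteq> {p. p permutes UNIV}" by (auto intro: permutes_subset)
    show "\<forall>p\<in>{p. p permutes UNIV} - {p. p permutes J}. of_int (sign p) * (\<Prod>i\<in>UNIV. ?A $ i $ p i) = 0"
    proof
      fix p assume p: "p \<in> {p. p permutes UNIV} - {p. p permutes J}"
      then obtain i where "i \<notin> J" "p i \<noteq> i" by (auto simp: permutes_def)
      then have "?A $ i $ p i = 0" unfolding A by auto
      then have "(\<Prod>i\<in>UNIV. ?A $ i $ p i) = 0" by (rule prod_zero[OF finite bexI]) simp
      then show "of_int (sign p) * (\<Prod>i\<in>UNIV. ?A $ i $ p i) = 0" by simp
    qed
  qed (simp add: finite_permutations)
  also have "\<dots> = det_on J M"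
    unfolding det_on_def
  proof (intro sum.cong refl arg_cong2[of _ _ _ _ "(*)"])
    fix p assume "p \<in> {p. p permutes J}"
    then have "p i = i" if "i \<notin> J" for i using that by (simp add: permutes_def)
    then have "(\<Prod>i\<in>UNIV. ?A $ i $ p i) = (\<Prod>i\<in>J. ?A $ i $ p i)"
      unfolding A by (intro prod.mono_neutral_right) auto
    also have "\<dots> = (\<Prod>i\<in>J. M $ i $ p i)" using A by (intro prod.cong) auto
    finally show "(\<Prod>i\<in>UNIV. ?A $ i $ p i) = (\<Prod>i\<in>J. M $ i $ p i)" .
  qed
  finally show ?thesis .
qed

lemma chi_values: "a \<noteq> 0 \<Longrightarrow> chi a = 1 \<or> chi a = - 1"
  by (simp add: chi_def)

lemma chi_0 [simp]: "chi 0 = 0"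
  by (simp add: chi_def)

lemma chi_eq_0_iff [simp]: "chi a = 0 \<longleftrightarrow> a = 0"
  by (simp add: chi_def)

context odd_prime_field
begin

lemma dim_nullspace: "vec.dim (nullspace (S :: ('a, 'n::finite) sqmat)) + rank S = CARD('n)"
  using dim_perp[OF vec.subspace_span[of "rows S"]] by (simp add: nullspace_eq_perp row_rank_def_gen)

lemma neg_neq: "(t::'a) \<noteq> 0 \<Longrightarrow> t \<noteq> - t"
proof
  assume "t \<noteq> 0" "t = - t"
  then have "2 * t = 0" by (metis add.right_inverse mult_2)
  then show False using two_neq_0 \<open>t \<noteq> 0\<close> by simp
qed

lemma card_square_roots: "t \<noteq> 0 \<Longrightarrow> card {s. s ^ 2 = (t::'a) ^ 2} = 2"
proof -
  assume "t \<noteq> 0"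
  have "{s. s ^ 2 = t ^ 2} = {t, - t}" by (auto simp: power2_eq_iff)
  then show ?thesis using neg_neq[OF \<open>t \<noteq> 0\<close>] by simp
qed

definition squares :: "'a set" where
  "squares = (\<lambda>t. t ^ 2) ` (UNIV - {0})"

lemma card_squares: "2 * card squares = CARD('a) - 1"
proof -
  have "(\<Sum>t\<in>UNIV - {0::'a}. 1::nat) = (\<Sum>a\<in>squares. \<Sum>t\<in>{t \<in> UNIV - {0}. t ^ 2 = a}. 1)"
    unfolding squares_def by (rule sum.image_gen) simp
  also have "\<dots> = (\<Sum>a\<in>squares. 2)"
  proof (rule sum.cong[OF refl])
    fix a assume "a \<in> squares"
    then obtain t where t: "t \<noteq> 0" "a = t ^ 2" by (auto simp: squares_def)
    then have "{t \<in> UNIV - {0}. t ^ 2 = a} = {s. s ^ 2 = t ^ 2}" by auto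
    then show "(\<Sum>t\<in>{t \<in> UNIV - {0}. t ^ 2 = a}. 1) = (2::nat)" using card_square_roots[OF t(1)] by simp
  qed
  finally show ?thesis by (simp add: card_Diff_singleton)
qed

lemma mem_squares: "a \<in> squares \<longleftrightarrow> a \<noteq> 0 \<and> chi a = 1"
proof
  show "a \<noteq> 0 \<and> chi a = 1 \<Longrightarrow> a \<in> squares"
    by (force simp: squares_def chi_def split: if_splits)
qed (auto simp: squares_def chi_def)

text \<open>The non-zero squares are half of the non-zero elements, so the squares and one disjoint
  multiple of them exhaust everything.\<close>

lemma nonsquare_coset:
  assumes c: "(c::'a) \<noteq> 0" "c \<notin> squares"
  shows "squares \<inter> (*) c ` squares = {}" "squares \<union> (*) c ` squares = UNIV - {0}"
proof -
  show 1: "squares \<inter> (*) c ` squares = {}"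
  proof (rule ccontr)
    assume "squares \<inter> (*) c ` squares \<noteq> {}"
    then obtain s t where st: "s \<noteq> 0" "t \<noteq> 0" "s ^ 2 = c * t ^ 2" by (auto simp: squares_def)
    then have "c = (s / t) ^ 2" by (simp add: power_divide)
    then show False using c st by (auto simp: squares_def)
  qed
  have "card ((*) c ` squares) = card squares" using c(1) by (intro card_image) (auto simp: inj_on_def)
  then have "card (squares \<union> (*) c ` squares) = CARD('a) - 1" using 1 card_squares by (simp add: card_Un_disjoint)
  moreover have "card (UNIV - {0::'a}) = CARD('a) - 1" by (simp add: card_Diff_singleton)
  ultimately show "squares \<union> (*) c ` squares = UNIV - {0}"
    using c(1) by (intro card_subset_eq) (auto simp: squares_def)
qed

lemma chi_mult: "chi (a * b :: 'a) = chi a * chi b"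
proof (cases "a = 0 \<or> b = 0")
  case False
  show ?thesis
  proof (cases "a \<in> squares")
    case True
    then obtain y where y: "y \<noteq> 0" "a = y ^ 2" by (auto simp: squares_def)
    have "(\<exists>t. t ^ 2 = y ^ 2 * b) \<longleftrightarrow> (\<exists>t. t ^ 2 = b)"
    proof
      assume "\<exists>t. t ^ 2 = y ^ 2 * b"
      then obtain t where "t ^ 2 = y ^ 2 * b" by blast
      then have "(t / y) ^ 2 = b" using y by (simp add: power_divide)
      then show "\<exists>t. t ^ 2 = b" by blast
    qed (auto simp flip: power_mult_distrib)
    then show ?thesis using False y True mem_squares[of a] by (auto simp: chi_def)
  next
    case nsq: False
    have "a * b \<in> (*) a ` squares \<longleftrightarrow> b \<in> squares" using False by auto
    moreover have "a * b \<in> squares \<longleftrightarrow> a * b \<notin> (*) a ` squares"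
      using nonsquare_coset[of a] False nsq by (metis Diff_iff Int_iff UNIV_I Un_iff empty_iff mult_eq_0_iff singletonD)
    ultimately have "chi (a * b) = 1 \<longleftrightarrow> chi b \<noteq> 1" using False by (simp add: mem_squares)
    moreover have "chi a = - 1" using nsq False chi_values[of a] by (auto simp: mem_squares)
    ultimately show ?thesis using chi_values[of "a * b"] chi_values[of b] False by auto
  qed
qed auto

lemma chi_1 [simp]: "chi (1::'a) = 1"
  by (auto simp: chi_def intro: exI[of _ 1])

lemma chi_power: "chi ((a::'a) ^ n) = chi a ^ n"
  by (induction n) (simp_all add: chi_mult)

lemma chi_sq: "(a::'a) \<noteq> 0 \<Longrightarrow> chi a * chi a = 1"
  using chi_values[of a] by auto

lemma chi_square [simp]: "(a::'a) \<noteq> 0 \<Longrightarrow> chi (a ^ 2) = 1"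
  by (auto simp: chi_def)

lemma gauss1_0 [simp]: "gauss1 (0::'a) = of_nat CARD('a)"
  by (simp add: gauss1_def)

text \<open>Every non-zero square has exactly two roots.\<close>

lemma gauss1_eq:
  assumes c: "(c::'a) \<noteq> 0"
  shows "gauss1 c = 1 + 2 * (\<Sum>a\<in>squares. psi (c * a))"
proof -
  have "gauss1 c = psi (c * 0 ^ 2) + (\<Sum>t\<in>UNIV - {0}. psi (c * t ^ 2))"
    unfolding gauss1_def by (rule sum.remove) auto
  also have "(\<Sum>t\<in>UNIV - {0}. psi (c * t ^ 2)) = (\<Sum>a\<in>squares. \<Sum>t\<in>{t \<in> UNIV - {0}. t ^ 2 = a}. psi (c * t ^ 2))"
    unfolding squares_def by (rule sum.image_gen) simp
  also have "\<dots> = (\<Sum>a\<in>squares. 2 * psi (c * a))"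
  proof (rule sum.cong[OF refl])
    fix a assume "a \<in> squares"
    then obtain t where t: "t \<noteq> 0" "a = t ^ 2" by (auto simp: squares_def)
    then have "{t \<in> UNIV - {0}. t ^ 2 = a} = {s. s ^ 2 = t ^ 2}" by auto
    then show "(\<Sum>t\<in>{t \<in> UNIV - {0}. t ^ 2 = a}. psi (c * t ^ 2)) = 2 * psi (c * a)"
      using card_square_roots[OF t(1)] t(2) by simp
  qed
  finally show ?thesis by (simp add: sum_distrib_left)
qed

text \<open>A square factor is absorbed by substitution. For a non-square c the sums over the two
  cosets of squares add up to the sum over all non-zero elements, which is -1; hence
  \<open>gauss1 1 + gauss1 c = 0\<close>.\<close>

lemma gauss1_chi:
  assumes c: "(c::'a) \<noteq> 0"
  shows "gauss1 c = of_int (chi c) * gauss1 (1::'a)"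
proof (cases "c \<in> squares")
  case True
  then obtain y where y: "y \<noteq> 0" "c = y ^ 2" by (auto simp: squares_def)
  have "gauss1 c = (\<Sum>t\<in>UNIV. psi (1 * (y * t) ^ 2))" by (simp add: gauss1_def y(2) power_mult_distrib)
  also have "\<dots> = gauss1 (1::'a)"
    unfolding gauss1_def
    by (rule sum.reindex_bij_witness[of _ "\<lambda>t. t / y" "\<lambda>t. y * t"]) (use y(1) in auto)
  finally show ?thesis using True by (simp add: mem_squares)
next
  case False
  have i: "inj_on ((*) c) squares" using c by (auto simp: inj_on_def)
  have "(\<Sum>a\<in>squares. psi (1 * a)) + (\<Sum>a\<in>squares. psi (c * a)) = (\<Sum>a\<in>squares. psi a) + (\<Sum>a\<in>(*) c ` squares. psi a)"
    by (simp add: sum.reindex[OF i])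
  also have "\<dots> = (\<Sum>a\<in>UNIV - {0}. psi (a::'a))"
    using nonsquare_coset[OF c False] by (simp flip: sum.union_disjoint)
  also have "\<dots> = - 1"
    using sum_psi_mult[of 1] sum.remove[of UNIV "0::'a" psi] by (simp add: add_eq_0_iff)
  finally have "(\<Sum>a\<in>squares. psi (1 * a)) + (\<Sum>a\<in>squares. psi (c * a)) = - 1" .
  moreover have "gauss1 (1::'a) + gauss1 c = 2 + 2 * ((\<Sum>a\<in>squares. psi (1 * a)) + (\<Sum>a\<in>squares. psi (c * a)))"
    unfolding gauss1_eq[OF c] gauss1_eq[of "1::'a", OF one_neq_zero] distrib_left by simp
  ultimately have "gauss1 (1::'a) + gauss1 c = 0" by simp
  moreover have "chi c = - 1" using False c chi_values[of c] by (auto simp: mem_squares)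
  ultimately show ?thesis by (simp add: add_eq_0_iff)
qed

text \<open>Substituting s = t + a makes the exponent linear in t, and the sum over t then kills
  every a except 0.\<close>

lemma gauss1_norm: "gauss1 (1::'a) * gauss1 (- 1 :: 'a) = of_nat CARD('a)"
proof -
  have "gauss1 (1::'a) * gauss1 (- 1 :: 'a) = (\<Sum>t\<in>UNIV. \<Sum>s\<in>UNIV. psi ((s::'a) ^ 2 - t ^ 2))"
    unfolding gauss1_def sum_product by (subst sum.swap) (simp flip: psi_add)
  also have "\<dots> = (\<Sum>t\<in>UNIV. \<Sum>a\<in>UNIV. psi ((t + a :: 'a) ^ 2 - t ^ 2))"
  proof (rule sum.cong[OF refl])
    fix t :: 'a
    show "(\<Sum>s\<in>UNIV. psi (s ^ 2 - t ^ 2)) = (\<Sum>a\<in>UNIV. psi ((t + a) ^ 2 - t ^ 2))"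
      by (rule sum.reindex_bij_witness[of _ "\<lambda>a. t + a" "\<lambda>s. s - t"]) auto
  qed
  also have "\<dots> = (\<Sum>t\<in>UNIV. \<Sum>a\<in>UNIV. psi (a ^ 2) * psi (t * (2 * a :: 'a)))"
    by (simp add: power2_eq_square algebra_simps flip: psi_add)
  also have "\<dots> = (\<Sum>a\<in>UNIV. psi (a ^ 2) * (\<Sum>t\<in>UNIV. psi (t * (2 * a :: 'a))))"
    by (subst sum.swap) (simp add: sum_distrib_left)
  also have "\<dots> = (\<Sum>a\<in>UNIV. if a = (0::'a) then of_nat CARD('a) else 0)"
    using two_neq_0 by (intro sum.cong) (auto simp: sum_psi_mult)
  finally show ?thesis by simp
qed

lemma gauss1_sq: "gauss1 (1::'a) ^ 2 = of_int (chi (- 1 :: 'a)) * of_nat CARD('a)"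
proof -
  have "of_int (chi (- 1 :: 'a)) * gauss1 (1::'a) ^ 2 = of_nat CARD('a)"
    using gauss1_norm gauss1_chi[of "- 1"] by (simp add: power2_eq_square algebra_simps)
  moreover have "of_int (chi (- 1 :: 'a)) * of_int (chi (- 1 :: 'a)) = (1::complex)"
    using chi_sq[of "- 1"] by (metis neg_equal_0_iff_equal of_int_1 of_int_mult zero_neq_one)
  ultimately show ?thesis by (metis mult.assoc mult_1)
qed

lemma gauss1_nonzero: "gauss1 (1::'a) \<noteq> 0"
  using gauss1_norm by auto

lemma cmod_gauss1: "cmod (gauss1 (1::'a)) ^ 2 = real CARD('a)"
proof -
  have "cmod (gauss1 (1::'a) ^ 2) = real CARD('a)"
    unfolding gauss1_sq norm_mult using chi_values[of "- 1 :: 'a"] by auto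
  then show ?thesis by (simp add: norm_power)
qed

lemma gauss_diag: "gauss (diag_mat d :: ('a, 'n::finite) sqmat) = (\<Prod>i\<in>UNIV. gauss1 (d i))"
proof -
  have "psi (qform (diag_mat d) v) = (\<Prod>i\<in>UNIV. psi (d i * (v $ i) ^ 2))" for v :: "'a^'n"
  proof -
    have "qform (diag_mat d) v = (\<Sum>i\<in>UNIV. d i * (v $ i) ^ 2)"
      by (simp add: qform_def diag_mat_def diag_mult dot_def power2_eq_square algebra_simps)
    moreover have "psi (\<Sum>i\<in>A. f i) = (\<Prod>i\<in>A. psi (f i))" for A and f :: "'n \<Rightarrow> 'a"
      by (induction A rule: infinite_finite_induct) (auto simp: psi_add)
    ultimately show ?thesis by simp
  qed
  then show ?thesis
    unfolding gauss_def gauss1_def using sum_prod_vec[of "\<lambda>i t. psi (d i * t ^ 2)"] by simp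
qed

lemma nullspace_congruent:
  fixes S P :: "('a, 'n::finite) sqmat"
  assumes P: "invertible P"
  shows "card (nullspace (transpose P ** S ** P)) = card (nullspace S)"
proof -
  have i: "inj ((*v) P)" "inj ((*v) (transpose P))" using P by (auto intro!: invertible_imp_inj simp: invertible_det_nz)
  have "(transpose P ** S ** P) *v v = 0 \<longleftrightarrow> S *v (P *v v) = 0" for v
  proof -
    have "(transpose P ** S ** P) *v v = transpose P *v (S *v (P *v v))"
      by (simp only: matrix_vector_mul_assoc matrix_mul_assoc)
    then show ?thesis using injD[OF i(2), of "S *v (P *v v)" 0] by auto
  qed
  then have "nullspace S = (*v) P ` nullspace (transpose P ** S ** P)"
    using bij_is_surj[OF bij_invertible[OF P]] by (auto simp: nullspace_def image_iff)
  then show ?thesis using i(1) by (metis card_image inj_on_subset subset_UNIV)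
qed

lemma rank_diag: "rank (diag_mat d :: ('a, 'n::finite) sqmat) = card {i. d i \<noteq> 0}"
proof -
  have "nullspace (diag_mat d :: ('a, 'n) sqmat) = {v. \<forall>i. i \<notin> {i. d i = 0} \<longrightarrow> v $ i = 0}"
    by (auto simp: nullspace_def diag_mat_def diag_mult vec_eq_iff)
  then have "vec.dim (nullspace (diag_mat d :: ('a, 'n) sqmat)) = card {i. d i = 0}"
    using dim_substandard_cart[of "{i. d i = 0}", where 'a = 'a] by simp
  moreover have "card {i. d i = 0} + card {i. d i \<noteq> 0} = CARD('n)"
    by (subst card_Un_disjoint[symmetric]) (auto intro: arg_cong[of _ _ card])
  ultimately show ?thesis using dim_nullspace[of "diag_mat d :: ('a, 'n) sqmat"] by simp
qed

lemma rank_congruent: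
  fixes S P :: "('a, 'n::finite) sqmat"
  assumes P: "invertible P"
  shows "rank (transpose P ** S ** P) = rank S"
  using nullspace_congruent[OF P, of S] dim_nullspace[of S] dim_nullspace[of "transpose P ** S ** P"] q_gt_2
  by (simp add: card_subspace subspace_nullspace)

text \<open>S does not see translations along e_j. Averaging over them separates the variable j; the
  factor q on the left is the number of translations.\<close>

lemma gauss_add_corner:
  fixes S :: "('a, 'n::finite) sqmat"
  assumes S: "S \<in> Sym" "\<And>i. S $ i $ j = 0"
  shows "of_nat CARD('a) * gauss (S + corner j c) = gauss S * gauss1 c"
proof -
  let ?f = "\<lambda>v. psi (qform (S + corner j c) v)"
  have z: "S *v axis j t = 0" for t
    using S(2) by (simp add: vec_eq_iff mv_component)
  have sh: "qform (S + corner j c) (v + axis j t) = qform S v + c * (v $ j + t) ^ 2" for v t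
    by (simp add: qform_add qform_corner qform_add_vec[OF S(1)] z) (simp add: qform_def z)
  have "of_nat CARD('a) * gauss (S + corner j c) = (\<Sum>t\<in>(UNIV::'a set). \<Sum>v\<in>UNIV. ?f v)"
    by (simp add: gauss_def)
  also have "\<dots> = (\<Sum>t\<in>UNIV. \<Sum>v\<in>UNIV. ?f (v + axis j t))"
  proof (rule sum.cong[OF refl])
    fix t :: 'a
    show "(\<Sum>v\<in>UNIV. ?f v) = (\<Sum>v\<in>UNIV. ?f (v + axis j t))"
      by (rule sum.reindex_bij_witness[of _ "\<lambda>v. v + axis j t" "\<lambda>v. v - axis j t"]) auto
  qed
  also have "\<dots> = (\<Sum>v\<in>UNIV. psi (qform S v) * (\<Sum>t\<in>UNIV. psi (c * (v $ j + t) ^ 2)))"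
    by (subst sum.swap) (simp add: sh psi_add sum_distrib_left)
  also have "(\<lambda>v. \<Sum>t\<in>UNIV. psi (c * (v $ j + t) ^ 2)) = (\<lambda>v::'a^'n. gauss1 c)"
    unfolding gauss1_def
    by (rule ext, rule sum.reindex_bij_witness[of _ "\<lambda>t. t - v $ j" "\<lambda>t. v $ j + t" for v]) auto
  finally show ?thesis by (simp add: gauss_def sum_distrib_right)
qed

end

section \<open>Normal forms, types and Gauss sums\<close>

definition coord_space :: "nat \<Rightarrow> (('a::field)^'d::{finite,linorder}) set" where
  "coord_space k = {v. \<forall>m. pos m > k \<longrightarrow> v $ m = 0}"

lemma pos_bij: "bij_betw pos (UNIV :: 'd::{finite,linorder} set) {1..CARD('d)}"
proof -
  have lt: "pos m < pos n" if "m < n" for m n :: 'd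
    unfolding pos_def using that by (intro psubset_card_mono) auto
  have inj: "inj (pos :: 'd \<Rightarrow> nat)"
  proof (rule injI, rule ccontr)
    fix m n :: 'd assume "pos m = pos n" "m \<noteq> n"
    then show False using lt[of m n] lt[of n m] by (cases m n rule: linorder_cases) auto
  qed
  have "pos m \<in> {1..CARD('d)}" for m :: 'd
  proof -
    have "card {m} \<le> pos m" unfolding pos_def by (rule card_mono) auto
    moreover have "pos m \<le> CARD('d)" unfolding pos_def by (rule card_mono) auto
    ultimately show ?thesis by simp
  qed
  then have "range (pos :: 'd \<Rightarrow> nat) \<subseteq> {1..CARD('d)}" by blast
  then have "range (pos :: 'd \<Rightarrow> nat) = {1..CARD('d)}"
    by (rule card_subset_eq[rotated]) (simp_all add: card_image[OF inj])
  then show ?thesis using inj by (simp add: bij_betw_def)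
qed

lemma pos_pos: "pos m \<ge> 1" "pos m \<le> CARD('d)" for m :: "'d::{finite,linorder}"
  using pos_bij[where 'd = 'd] by (auto simp: bij_betw_def)

lemma card_pos_le: "k \<le> CARD('d) \<Longrightarrow> card {m :: 'd::{finite,linorder}. pos m \<le> k} = k"
proof -
  assume k: "k \<le> CARD('d)"
  have "x \<in> pos ` {m :: 'd. pos m \<le> k}" if "x \<in> {1..k}" for x
  proof -
    have "x \<in> pos ` (UNIV :: 'd set)" using that k bij_betw_imp_surj_on[OF pos_bij[where 'd = 'd]] by auto
    then show ?thesis using that by auto
  qed
  then have "pos ` {m :: 'd. pos m \<le> k} = {1..k}" using pos_pos(1) by force
  then have "bij_betw pos {m :: 'd. pos m \<le> k} {1..k}"
    by (intro bij_betw_subset[OF pos_bij]) auto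
  then show ?thesis by (simp add: bij_betw_same_card)
qed

lemma card_pos_gt: "k \<le> CARD('d) \<Longrightarrow> card {m :: 'd::{finite,linorder}. pos m > k} = CARD('d) - k"
proof -
  assume k: "k \<le> CARD('d)"
  have "{m :: 'd. pos m > k} = UNIV - {m. pos m \<le> k}" by auto
  then have "card {m :: 'd. pos m > k} = CARD('d) - card {m :: 'd. pos m \<le> k}" by (simp add: card_Diff_subset)
  then show ?thesis by (simp add: card_pos_le[OF k])
qed

lemma subspace_coord_space: "vec.subspace (coord_space k)"
  by (auto simp: coord_space_def vec.subspace_def)

lemma dim_coord_space: "k \<le> CARD('d) \<Longrightarrow> vec.dim (coord_space k :: (('a::field)^'d::{finite,linorder}) set) = k"
  using dim_substandard_cart[of "{m :: 'd. pos m \<le> k}", where 'a = 'a] by (simp add: coord_space_def card_pos_le not_le)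

lemma subspace_image_mv: "vec.subspace V \<Longrightarrow> vec.subspace ((*v) M ` V)" for M :: "('a::field)^'n^'m"
proof -
  assume V: "vec.subspace V"
  show ?thesis
    unfolding vec.subspace_def
  proof (intro conjI ballI allI)
    show "0 \<in> (*v) M ` V" using vec.subspace_0[OF V] by (intro image_eqI[of _ _ 0]) auto
    fix x assume "x \<in> (*v) M ` V"
    then obtain u where u: "u \<in> V" "x = M *v u" by blast
    show "c *s x \<in> (*v) M ` V" for c
      using u vec.subspace_scale[OF V] by (intro image_eqI[of _ _ "c *s u"]) (auto simp: vec.scale)
    fix y assume "y \<in> (*v) M ` V"
    then obtain v where v: "v \<in> V" "y = M *v v" by blast
    show "x + y \<in> (*v) M ` V"
      using u v vec.subspace_add[OF V] by (intro image_eqI[of _ _ "u + v"]) (auto simp: matrix_vector_right_distrib)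
  qed
qed

lemma mv_expand: "M *v v = (\<Sum>m\<in>UNIV. v $ m *s (M *v axis m 1))" for M :: "('a::field)^'n^'m"
proof -
  have "M *v v = M *v (\<Sum>m\<in>UNIV. v $ m *s axis m 1)" by (simp add: basis_expansion)
  then show ?thesis by (simp only: matrix_vector_mult_sum vec.scale)
qed

lemma inj_if_nullspace_0:
  fixes A :: "('a::field)^'n^'m"
  assumes "\<And>v. A *v v = 0 \<Longrightarrow> v = 0"
  shows "inj ((*v) A)"
proof (rule injI)
  fix u v assume "A *v u = A *v v"
  then have "A *v (u - v) = 0" by (simp add: matrix_vector_mult_diff_distrib)
  from assms[OF this] show "u = v" by simp
qed

text \<open>The columns of C are a basis of the whole space that lists a basis of U first. In this
  way every subspace is the image of a member of the standard flag, as the definition of the states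
  requires.\<close>

lemma adapted_basis:
  fixes U :: "(('a::{field,finite})^'d::{finite,linorder}) set"
  assumes U: "vec.subspace U"
  obtains C :: "('a, 'd) sqmat" where "invertible C" "U = (*v) C ` coord_space (vec.dim U)"
proof -
  let ?k = "vec.dim U"
  obtain B where B: "B \<subseteq> U" "vec.independent B" "U \<subseteq> vec.span B" "card B = ?k"
    using vec.basis_exists by blast
  let ?B = "vec.extend_basis B"
  have B': "B \<subseteq> ?B" "vec.independent ?B" "vec.span ?B = UNIV"
    using B(2) by (simp_all add: vec.extend_basis_superset vec.independent_extend_basis vec.span_extend_basis)
  have cB: "card ?B = CARD('d)"
    using vec.dim_eq_card_independent[OF B'(2)] vec.dim_span[of ?B] B'(3) by (simp add: card_cart_basis)
  have k: "?k \<le> CARD('d)" using dim_subset_UNIV_cart_gen by blast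
  have "card {m :: 'd. pos m \<le> ?k} = card B" using card_pos_le[OF k] B(4) by simp
  then obtain f where f: "bij_betw f {m :: 'd. pos m \<le> ?k} B"
    using finite_same_card_bij[of "{m :: 'd. pos m \<le> ?k}" B] by auto
  have "card {m :: 'd. pos m > ?k} = card (?B - B)"
    using card_pos_gt[OF k] B(4) B'(1) cB by (simp add: card_Diff_subset)
  then obtain g where g: "bij_betw g {m :: 'd. pos m > ?k} (?B - B)"
    using finite_same_card_bij[of "{m :: 'd. pos m > ?k}" "?B - B"] by auto
  define h where "h m = (if pos m \<le> ?k then f m else g m)" for m :: 'd
  define C :: "('a, 'd) sqmat" where "C = (\<chi> i m. h m $ i)"
  have Ca: "C *v axis m 1 = h m" for m by (simp add: vec_eq_iff C_def)
  have hB: "h m \<in> B" if "pos m \<le> ?k" for m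
    using that f by (auto simp: h_def bij_betw_def)
  have im: "B \<subseteq> h ` {m. pos m \<le> ?k}"
    using f by (auto simp: h_def bij_betw_def)
  have ax: "axis m 1 \<in> (coord_space ?k :: ('a, 'd) vec set)" if "pos m \<le> ?k" for m
    using that by (auto simp: coord_space_def axis_def)
  have "B \<subseteq> (*v) C ` coord_space ?k"
  proof
    fix x assume "x \<in> B"
    then obtain m where "pos m \<le> ?k" "x = h m" using im by auto
    then have "axis m 1 \<in> (coord_space ?k :: ('a, 'd) vec set)" "x = C *v axis m 1" using ax Ca by simp_all
    then show "x \<in> (*v) C ` coord_space ?k" by blast
  qed
  then have "U \<subseteq> (*v) C ` coord_space ?k"
    using B(3) vec.span_minimal[OF _ subspace_image_mv[OF subspace_coord_space]] by blast
  moreover have "(*v) C ` coord_space ?k \<subseteq> U"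
  proof (rule image_subsetI)
    fix v :: "('a, 'd) vec" assume v: "v \<in> coord_space ?k"
    have "v $ m *s h m \<in> U" for m
    proof (cases "pos m \<le> ?k")
      case True
      then show ?thesis using hB B(1) vec.subspace_scale[OF U] by blast
    next
      case False
      then show ?thesis using v vec.subspace_0[OF U] by (simp add: coord_space_def)
    qed
    then show "C *v v \<in> U" unfolding mv_expand[of C v] Ca by (rule vec.subspace_sum[OF U])
  qed
  moreover have "invertible C"
  proof (rule invertible_if_inj)
    have "?B \<subseteq> range h"
    proof
      fix x assume "x \<in> ?B"
      then consider "x \<in> f ` {m. pos m \<le> ?k}" | "x \<in> g ` {m. pos m > ?k}"
        using bij_betw_imp_surj_on[OF f] bij_betw_imp_surj_on[OF g] by blast
      then show "x \<in> range h" by cases (auto simp: h_def)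
    qed
    moreover have "range h \<subseteq> range ((*v) C)"
    proof (rule image_subsetI)
      fix m show "h m \<in> range ((*v) C)" by (rule range_eqI[of _ _ "axis m 1"]) (simp add: Ca)
    qed
    ultimately have "?B \<subseteq> range ((*v) C)" by blast
    then have "vec.span ?B \<subseteq> range ((*v) C)"
      by (rule vec.span_minimal[OF _ subspace_image_mv[OF vec.subspace_UNIV]])
    then have "surj ((*v) C)" using B'(3) by blast
    then show "inj ((*v) C)" by (simp add: finite_UNIV_surj_inj)
  qed
  ultimately show ?thesis using that by blast
qed

context odd_prime_field
begin

lemma chi_prod: "chi (\<Prod>i\<in>A. f i :: 'a) = (\<Prod>i\<in>A. chi (f i))"
  by (induction A rule: infinite_finite_induct) (auto simp: chi_mult)

text \<open>After diagonalisation the symbols of the diagonal entries multiply to the symbol of det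
  M times a square.\<close>

lemma gauss_nonsingular:
  fixes M :: "('a, 'n::finite) sqmat"
  assumes M: "M \<in> Sym" "det M \<noteq> 0"
  shows "gauss M = of_int (chi (det M)) * gauss1 (1::'a) ^ CARD('n)"
proof -
  obtain P :: "('a, 'n) sqmat" and d where P: "invertible P" "transpose P ** M ** P = diag_mat d"
    using diagonalize[OF M(1)] by blast
  have dP: "det P \<noteq> 0" using P(1) by (simp add: invertible_det_nz)
  have "det (diag_mat d) = (\<Prod>i\<in>UNIV. d i)" by (subst det_diagonal) (auto simp: diag_mat_def)
  then have prod: "(\<Prod>i\<in>UNIV. d i) = det P ^ 2 * det M"
    using arg_cong[OF P(2), of det] by (simp add: det_mul power2_eq_square mult_ac)
  have nz: "d i \<noteq> 0" for i 
  proof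
    assume "d i = 0"
    then have "(\<Prod>i\<in>UNIV. d i) = 0" by (intro prod_zero) auto
    then show False using prod dP M(2) by simp
  qed
  have "gauss M = (\<Prod>i\<in>UNIV. gauss1 (d i))"
    using gauss_congruent[OF P(1), of M] P(2) gauss_diag[of d] by simp
  also have "\<dots> = (\<Prod>i\<in>UNIV. of_int (chi (d i)) * gauss1 (1::'a))"
    by (intro prod.cong refl gauss1_chi nz)
  also have "\<dots> = of_int (chi (\<Prod>i\<in>UNIV. d i)) * gauss1 (1::'a) ^ CARD('n)"
    by (simp add: prod.distrib chi_prod)
  also have "chi (\<Prod>i\<in>UNIV. d i) = chi (det M)"
    using dP by (simp add: prod chi_mult)
  finally show ?thesis .
qed

text \<open>Fills zero rows with diagonal ones, one \<open>gauss_add_corner\<close> at a time, to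
  reduce a block to a non-singular matrix.\<close>

lemma gauss_fill:
  fixes M :: "('a, 'n::finite) sqmat"
  assumes M: "M \<in> Sym" "\<And>i j. i \<in> K \<Longrightarrow> M $ i $ j = 0"
  shows "of_nat CARD('a) ^ card K * gauss (M + (\<chi> i j. if i = j \<and> i \<in> K then 1 else 0)) = gauss M * gauss1 (1::'a) ^ card K"
  using finite[of K] M(2)
proof (induction K rule: finite_induct)
  case empty
  have "M + (\<chi> i j. if i = j \<and> i \<in> {} then 1 else 0) = M" by (simp add: vec_eq_iff)
  then show ?case by simp
next
  case (insert k K)
  let ?A = "M + (\<chi> i j. if i = j \<and> i \<in> K then 1 else 0)"
  have "M $ i $ k = 0" for i
    using insert.prems[of k i] Sym_entry[OF M(1), of i k] by simp
  then have A: "?A \<in> Sym" "?A $ i $ k = 0" for i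
    using M(1) insert.hyps(2) by (auto simp: Sym_iff)
  have e: "M + (\<chi> i j. if i = j \<and> i \<in> insert k K then 1 else 0) = ?A + corner k 1"
    using insert.hyps(2) by (auto simp: vec_eq_iff corner_def)
  have "of_nat CARD('a) ^ card (insert k K) * gauss (?A + corner k 1)
      = of_nat CARD('a) ^ card K * (of_nat CARD('a) * gauss (?A + corner k 1))"
    using insert.hyps by simp
  also have "\<dots> = (of_nat CARD('a) ^ card K * gauss ?A) * gauss1 (1::'a)"
    unfolding gauss_add_corner[OF A] by simp
  also have "\<dots> = gauss M * gauss1 (1::'a) ^ card (insert k K)"
    using insert by simp
  finally show ?case unfolding e .
qed

text \<open>In a basis that lists the kernel first, only the lower right block of size rank S
  survives, and it is non-singular. This also makes the choice in \<open>normalizer\<close> a proper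
  one.\<close>

lemma normal_form_exists:
  fixes S :: "('a, 'd::{finite,linorder}) sqmat"
  assumes S: "S \<in> Sym"
  shows "\<exists>C :: ('a, 'd) sqmat. invertible C \<and> transpose C ** S ** C \<in> Sym_sub (rank S) \<and>
    det_on (last_inds (rank S)) (transpose C ** S ** C) \<noteq> 0"
proof -
  have dk: "vec.dim (nullspace S) = CARD('d) - rank S" "rank S \<le> CARD('d)" using dim_nullspace[of S] by simp_all
  obtain C :: "('a, 'd) sqmat" where C: "invertible C" "nullspace S = (*v) C ` coord_space (CARD('d) - rank S)"
    using adapted_basis[OF subspace_nullspace[of S]] dk by metis
  let ?M = "transpose C ** S ** C" and ?J = "last_inds (rank S) :: 'd set"
  have sM: "?M \<in> Sym" by (rule Sym_congruent[OF S])
  have z: "?M $ m $ n = 0" if "pos n \<le> CARD('d) - rank S" for m n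
  proof -
    have "axis n 1 \<in> (coord_space (CARD('d) - rank S) :: ('a, 'd) vec set)" using that by (auto simp: coord_space_def axis_def)
    then have "C *v axis n 1 \<in> nullspace S" using C(2) by blast
    then show ?thesis by (simp add: congruent_entry nullspace_def)
  qed
  have z': "?M $ m $ n = 0" if "pos m \<le> CARD('d) - rank S" for m n
    using z[OF that, of n] Sym_entry[OF sM, of m n] by simp
  have sub: "?M \<in> Sym_sub (rank S)" using sM z z' by (auto simp: Sym_sub_def)
  let ?A = "?M + (\<chi> i j. if i = j \<and> i \<notin> ?J then 1 else 0)"
  have "inj ((*v) ?A)"
  proof -
    have "v = 0" if v: "?A *v v = 0" for v
    proof -
      have e: "?A *v v = ?M *v v + (\<chi> i. (if i \<notin> ?J then 1 else 0) * v $ i)"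
      proof -
        have "(\<chi> i j. if i = j \<and> i \<notin> ?J then 1 else 0) = (\<chi> i j. if i = j then (if i \<notin> ?J then 1 else 0) else (0::'a))"
          by (auto simp: vec_eq_iff)
        then show ?thesis by (simp only: matrix_vector_mult_add_rdistrib diag_mult)
      qed
      \<comment> \<open>Outside J the rows of the congruent matrix vanish, so the added identity
        gives v_i = 0 there. The remaining equation puts C v into the kernel of S, whose coordinates
        live outside J, so v = 0.\<close>
      have vJ: "v $ i = 0" if "i \<notin> ?J" for i
      proof -
        have "(?M *v v) $ i = 0" using that z' by (auto simp: mv_component dot_def last_inds_def not_less intro!: sum.neutral)
        then show ?thesis using v arg_cong[OF e, of "\<lambda>v. v $ i"] that by simp
      qed
      then have "(\<chi> i. (if i \<notin> ?J then 1 else 0) * v $ i) = 0" by (auto simp: vec_eq_iff)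
      then have "?M *v v = 0" using v e by simp
      then have "transpose C *v (S *v (C *v v)) = 0" by (simp only: matrix_vector_mul_assoc matrix_mul_assoc)
      moreover have "inj ((*v) (transpose C))" using C(1) by (intro invertible_imp_inj) (simp add: invertible_det_nz)
      ultimately have "S *v (C *v v) = 0" by (metis injD matrix_vector_mult_0_right)
      then have "C *v v \<in> nullspace S" by (simp add: nullspace_def)
      then have "C *v v \<in> (*v) C ` coord_space (CARD('d) - rank S)" using C(2) by simp
      then have "v \<in> coord_space (CARD('d) - rank S)" using invertible_imp_inj[OF C(1)] by (simp add: inj_image_mem_iff)
      then show "v = 0" using vJ by (auto simp: vec_eq_iff coord_space_def last_inds_def)
    qed
    then show ?thesis by (rule inj_if_nullspace_0)
  qed
  then have "det ?A \<noteq> 0" using invertible_if_inj invertible_det_nz by blast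
  moreover have "det ?A = det_on ?J ?M"
    by (rule det_on_eq_det) (use z' in \<open>auto simp: last_inds_def not_less\<close>)
  ultimately show ?thesis using C(1) sub by auto
qed

lemma gauss_normal_form:
  fixes S C :: "('a, 'd::{finite,linorder}) sqmat"
  assumes S: "S \<in> Sym" and C: "invertible C" "transpose C ** S ** C \<in> Sym_sub (rank S)"
    and det: "det_on (last_inds (rank S)) (transpose C ** S ** C) \<noteq> 0"
  shows "gauss S = of_int (chi (det_on (last_inds (rank S)) (transpose C ** S ** C)))
    * of_nat CARD('a) ^ (CARD('d) - rank S) * gauss1 (1::'a) ^ rank S"
proof -
  let ?M = "transpose C ** S ** C" and ?J = "last_inds (rank S) :: 'd set"
  let ?r = "rank S" and ?D = "CARD('d)" and ?q = "of_nat CARD('a) :: complex" and ?g = "gauss1 (1::'a)"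
  have r: "?r \<le> ?D" using dim_nullspace[of S] by simp
  have M: "?M \<in> Sym" "\<And>i j. i \<notin> ?J \<Longrightarrow> ?M $ i $ j = 0"
    using C(2) by (auto simp: Sym_sub_def last_inds_def not_less)
  have cK: "card (- ?J) = ?D - ?r"
  proof -
    have "- ?J = {m. pos m \<le> ?D - ?r}" by (auto simp: last_inds_def not_less)
    then show ?thesis by (simp add: card_pos_le)
  qed
  let ?A = "?M + (\<chi> i j. if i = j \<and> i \<notin> ?J then 1 else 0)"
  have dA: "det ?A = det_on ?J ?M" by (rule det_on_eq_det[OF M(2)])
  have "?A \<in> Sym" using M(1) by (auto simp: Sym_iff)
  then have 1: "gauss ?A = of_int (chi (det_on ?J ?M)) * ?g ^ ?D"
    using gauss_nonsingular[OF _ det[folded dA]] unfolding dA by simp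
  have 2: "?q ^ (?D - ?r) * gauss ?A = gauss ?M * ?g ^ (?D - ?r)"
    using gauss_fill[OF M(1), of "- ?J"] M(2) cK by simp
  have 3: "gauss ?M = gauss S" by (rule gauss_congruent[OF C(1)])
  have 4: "?g ^ ?D = ?g ^ ?r * ?g ^ (?D - ?r)" using r by (simp flip: power_add)
  have "gauss S * ?g ^ (?D - ?r) = ?q ^ (?D - ?r) * gauss ?A" using 2 3 by simp
  also have "\<dots> = (of_int (chi (det_on ?J ?M)) * ?q ^ (?D - ?r) * ?g ^ ?r) * ?g ^ (?D - ?r)"
    unfolding 1 4 by (simp only: mult_ac)
  finally have "gauss S * ?g ^ (?D - ?r) = (of_int (chi (det_on ?J ?M)) * ?q ^ (?D - ?r) * ?g ^ ?r) * ?g ^ (?D - ?r)" .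
  moreover have "?g ^ (?D - ?r) \<noteq> 0" using gauss1_nonzero by simp
  ultimately show ?thesis by (rule mult_right_cancel[THEN iffD1, rotated])
qed

lemma gauss_rank:
  fixes S :: "('a, 'd::{finite,linorder}) sqmat"
  assumes S: "S \<in> Sym"
  obtains \<delta> :: int where "\<delta> = 1 \<or> \<delta> = - 1"
    "gauss S = of_int \<delta> * of_nat CARD('a) ^ (CARD('d) - rank S) * gauss1 (1::'a) ^ rank S"
proof -
  obtain C :: "('a, 'd) sqmat" where C: "invertible C" "transpose C ** S ** C \<in> Sym_sub (rank S)"
    "det_on (last_inds (rank S)) (transpose C ** S ** C) \<noteq> 0" using normal_form_exists[OF S] by blast
  show ?thesis by (rule that[OF chi_values[OF C(3)] gauss_normal_form[OF S C]])
qed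

lemma rank_zero: "rank (0 :: ('a, 'd::finite) sqmat) = 0"
  using dim_nullspace[of "0 :: ('a, 'd) sqmat"] by (simp add: nullspace_def card_cart_basis)

lemma mtype_odd: "odd (rank S) \<Longrightarrow> mtype (S :: ('a, 'd::{finite,linorder}) sqmat) = 0"
  by (auto simp: mtype_def rank_zero)

text \<open>gauss1(1)^(2n) contributes chi(-1)^n q^n, and chi(-1)^n is the sign built into
  \<open>mtype\<close>. Hence the type is the sign of the Gauss sum and does not depend on the
  chosen normal form.\<close>

lemma mtype_gauss:
  fixes S :: "('a, 'd::{finite,linorder}) sqmat"
  assumes S: "S \<in> Sym" and r: "rank S = 2 * n"
  shows "gauss S = of_int (mtype S) * of_nat CARD('a) ^ (CARD('d) - n)" and "mtype S = 1 \<or> mtype S = - 1"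
proof -
  let ?\<Delta> = "det_on (last_inds (rank S)) (transpose (normalizer S) ** S ** normalizer S)"
  let ?q = "of_nat CARD('a) :: complex"
  have N: "invertible (normalizer S)" "transpose (normalizer S) ** S ** normalizer S \<in> Sym_sub (rank S)" "?\<Delta> \<noteq> 0"
    using someI_ex[OF normal_form_exists[OF S]] unfolding normalizer_def by auto
  show "mtype S = 1 \<or> mtype S = - 1" using r by (simp add: mtype_def)
  show "gauss S = of_int (mtype S) * of_nat CARD('a) ^ (CARD('d) - n)"
  proof (cases "S = 0")
    case True
    then have "n = 0" using r by (simp add: rank_zero)
    then show ?thesis using True by (simp add: mtype_def gauss_def qform_def)
  next
    case False
    have x: "(- 1) ^ (rank S div 2) * ?\<Delta> \<noteq> 0" using N(3) by simp
    have "mtype S = chi ((- 1) ^ n * ?\<Delta>)"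
      using False r x by (simp add: mtype_def chi_def)
    also have "\<dots> = chi (- 1 :: 'a) ^ n * chi ?\<Delta>" by (simp add: chi_mult chi_power)
    finally have m: "mtype S = chi (- 1 :: 'a) ^ n * chi ?\<Delta>" .
    have "gauss S = of_int (chi ?\<Delta>) * ?q ^ (CARD('d) - 2 * n) * (gauss1 (1::'a) ^ 2) ^ n"
      using gauss_normal_form[OF S N] r by (simp add: power_mult)
    also have "\<dots> = of_int (mtype S) * (?q ^ (CARD('d) - 2 * n) * ?q ^ n)"
      by (simp add: gauss1_sq m power_mult_distrib)
    also have "?q ^ (CARD('d) - 2 * n) * ?q ^ n = ?q ^ (CARD('d) - n)"
      using dim_nullspace[of S] r by (simp flip: power_add)
    finally show ?thesis .
  qed
qed

lemma sum_chi: "(\<Sum>c\<in>UNIV - {0::'a}. chi c) = 0"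
proof -
  have s: "squares \<subseteq> UNIV - {0::'a}" by (auto simp: squares_def)
  have "(\<Sum>c\<in>UNIV - {0::'a}. chi c) = (\<Sum>c\<in>UNIV - {0} - squares. chi c) + (\<Sum>c\<in>squares. chi c)"
    by (rule sum.subset_diff[OF s]) simp
  also have "(\<Sum>c\<in>UNIV - {0} - squares. chi c) = (\<Sum>c\<in>UNIV - {0} - squares. - 1)"
    using chi_values by (intro sum.cong) (auto simp: mem_squares)
  also have "(\<Sum>c\<in>squares. chi c) = (\<Sum>c\<in>squares. 1)" by (intro sum.cong) (auto simp: mem_squares)
  also have "card (UNIV - {0} - squares) = card squares"
    using card_squares by (simp add: card_Diff_subset[OF _ s] card_Diff_singleton)
  then have "(\<Sum>c\<in>UNIV - {0} - squares. - 1 :: int) + (\<Sum>c\<in>squares. 1) = 0" by simp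
  finally show ?thesis .
qed

text \<open>In diagonal form, each of the rank S non-zero entries contributes one factor
  \<open>chi c\<close>.\<close>

lemma gauss_scale:
  fixes S :: "('a, 'n::finite) sqmat"
  assumes S: "S \<in> Sym" and c: "c \<noteq> 0"
  shows "(\<Sum>v\<in>UNIV. psi (c * qform S v)) = of_int (chi c ^ rank S) * gauss S"
proof -
  obtain P :: "('a, 'n) sqmat" and d where P: "invertible P" "transpose P ** S ** P = diag_mat d"
    using diagonalize[OF S] by blast
  have "(\<Sum>v\<in>UNIV. psi (c * qform S v)) = (\<Sum>v\<in>UNIV. psi (c * qform S (P *v v)))"
    using sum.reindex_bij_betw[OF bij_invertible[OF P(1)], of "\<lambda>v. psi (c * qform S v)"] by simp
  also have "\<dots> = gauss (diag_mat (\<lambda>i. c * d i))"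
  proof -
    have "c * qform S (P *v v) = qform (diag_mat (\<lambda>i. c * d i)) v" for v
      unfolding qform_congruent[symmetric] P(2)
      by (simp add: qform_def diag_mat_def diag_mult dot_def sum_distrib_left algebra_simps)
    then show ?thesis by (simp add: gauss_def)
  qed
  also have "\<dots> = (\<Prod>i\<in>UNIV. (if d i \<noteq> 0 then of_int (chi c) else 1) * gauss1 (d i))"
    unfolding gauss_diag using c gauss1_chi[of "c * d i" for i] gauss1_chi[of "d i" for i]
    by (intro prod.cong) (auto simp: chi_mult)
  also have "\<dots> = of_int (chi c) ^ card {i. d i \<noteq> 0} * gauss (diag_mat d)"
    by (simp add: prod.distrib gauss_diag prod.If_cases)
  also have "card {i. d i \<noteq> 0} = rank S"
    using rank_diag[of d] rank_congruent[OF P(1), of S] P(2) by simp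
  also have "gauss (diag_mat d) = gauss S" using gauss_congruent[OF P(1), of S] P(2) by simp
  finally show ?thesis by simp
qed

text \<open>For even rank all c contribute equally; for odd rank the factors \<open>chi c\<close>
  sum to 0, in agreement with type 0. This sum becomes the diagonal part of
  \<open>A\<close>.\<close>

lemma gauss_total:
  fixes S :: "('a, 'd::{finite,linorder}) sqmat"
  assumes S: "S \<in> Sym"
  shows "(\<Sum>c\<in>UNIV - {0}. \<Sum>v\<in>UNIV. psi (c * qform S v)) =
    of_int (mtype S) * of_nat (CARD('a) - 1) * of_nat CARD('a) ^ (CARD('d) - rank S div 2)"
proof -
  have e: "(\<Sum>c\<in>UNIV - {0}. \<Sum>v\<in>UNIV. psi (c * qform S v)) = of_int (\<Sum>c\<in>UNIV - {0::'a}. chi c ^ rank S) * gauss S"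
    by (simp add: gauss_scale[OF S] sum_distrib_right)
  show ?thesis
  proof (cases "even (rank S)")
    case True
    then obtain n where n: "rank S = 2 * n" by blast
    have "(\<Sum>c\<in>UNIV - {0::'a}. chi c ^ rank S) = (\<Sum>c\<in>UNIV - {0::'a}. 1)"
      using chi_sq by (intro sum.cong) (auto simp: n power_mult power2_eq_square)
    then show ?thesis unfolding e mtype_gauss(1)[OF S n] using n by (simp add: card_Diff_singleton)
  next
    case False
    then obtain n where n: "rank S = 2 * n + 1" by (elim oddE)
    have "(\<Sum>c\<in>UNIV - {0::'a}. chi c ^ rank S) = (\<Sum>c\<in>UNIV - {0::'a}. chi c)"
      using chi_sq by (intro sum.cong) (auto simp: n power_mult power2_eq_square power_add)
    then show ?thesis unfolding e using sum_chi mtype_odd[OF False] by simp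
  qed
qed

end

subsection \<open>Counting symmetric matrices by rank and type\<close>

text \<open>Symmetric matrices of size |J|, padded with zeros, so that an induction on the size can
  run inside one index type.\<close>

definition Sym_on :: "'n set \<Rightarrow> ('a::field, 'n::finite) sqmat set" where
  "Sym_on J = {S \<in> Sym. \<forall>i j. i \<notin> J \<longrightarrow> S $ i $ j = 0}"

definition supp_in :: "'n set \<Rightarrow> (('a::field)^'n::finite) set" where
  "supp_in J = {b. \<forall>i. i \<notin> J \<longrightarrow> b $ i = 0}"

text \<open>Rank and Gauss sum determine the congruence class. This sign is defined for odd ranks too, which makes the bordering recursion below close up.\<close>

definition gsign :: "('a::{field,finite}, 'd::{finite,linorder}) sqmat \<Rightarrow> int" where
  "gsign S = (if gauss S = of_nat CARD('a) ^ (CARD('d) - rank S) * gauss1 (1::'a) ^ rank S then 1 else - 1)"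

definition border :: "'n \<Rightarrow> ('a::field)^'n::finite \<Rightarrow> ('a, 'n) sqmat" where
  "border j b = (\<chi> m n. (if m = j then b $ n else 0) + (if n = j then b $ m else 0))"

definition extend :: "'n \<Rightarrow> ('a::field, 'n::finite) sqmat \<Rightarrow> 'a^'n \<Rightarrow> 'a \<Rightarrow> ('a, 'n) sqmat" where
  "extend j S b c = S + border j b + corner j c"

lemma border_mult: "border j b *v v = dot b v *s axis j 1 + v $ j *s b"
proof (rule vec_eq_iff[THEN iffD2], rule allI)
  fix i
  have "(border j b *v v) $ i = (\<Sum>n\<in>UNIV. (if i = j then b $ n * v $ n else 0) + (if n = j then v $ j * b $ i else 0))"
    unfolding border_def matrix_vector_mult_def vec_lambda_beta by (intro sum.cong) (auto simp: distrib_right)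
  then show "(border j b *v v) $ i = (dot b v *s axis j 1 + v $ j *s b) $ i"
    by (auto simp: sum.distrib dot_def axis_def)
qed

lemma qform_extend: "qform (extend j S b c) v = qform S v + 2 * v $ j * dot b v + c * (v $ j) ^ 2"
  by (simp add: extend_def qform_add qform_corner) (simp add: qform_def border_mult dot_commute[of v b] algebra_simps)

lemma extend_Sym_on:
  assumes "S \<in> Sym_on J" "b \<in> supp_in J"
  shows "extend j S b c \<in> Sym_on (insert j J)"
  using assms Sym_entry[of S] by (auto simp: Sym_on_def supp_in_def extend_def border_def corner_def Sym_iff)

lemma bij_extend:
  fixes j :: "'n::finite"
  assumes j: "j \<notin> J"
  shows "bij_betw (\<lambda>(S, b, c). extend j S b c) (Sym_on J \<times> supp_in J \<times> UNIV) (Sym_on (insert j J) :: ('a::field, 'n) sqmat set)"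
proof (rule bij_betw_byWitness[where f' = "\<lambda>S. (\<chi> m n. if m = j \<or> n = j then 0 else S $ m $ n, \<chi> m. if m = j then 0 else S $ j $ m, S $ j $ j)"], goal_cases)
  case 1
  have "S $ i $ j = 0" "b $ j = 0" "S $ j $ i = 0" if "S \<in> Sym_on J" "b \<in> supp_in J" for i and S :: "('a, 'n) sqmat" and b :: "('a, 'n) vec"
    using that j Sym_entry[of S i j] by (auto simp: Sym_on_def supp_in_def)
  then show ?case by (auto simp: extend_def border_def corner_def vec_eq_iff)
next
  case 2
  have "extend j (\<chi> m n. if m = j \<or> n = j then 0 else S $ m $ n) (\<chi> m. if m = j then 0 else S $ j $ m) (S $ j $ j) = S"
    if "S \<in> Sym_on (insert j J)" for S :: "('a, 'n) sqmat"
  proof -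
    have sy: "S $ m $ j = S $ j $ m" for m using that Sym_entry[of S m j] by (auto simp: Sym_on_def)
    have "extend j (\<chi> m n. if m = j \<or> n = j then 0 else S $ m $ n) (\<chi> m. if m = j then 0 else S $ j $ m) (S $ j $ j) $ m $ n = S $ m $ n" for m n
      using sy[of m] by (cases "m = j"; cases "n = j") (simp_all add: extend_def border_def corner_def)
    then show ?thesis by (simp add: vec_eq_iff)
  qed
  then show ?case by simp
next
  case 3
  show ?case using extend_Sym_on by auto
next
  case 4
  have "(\<chi> m n. if m = j \<or> n = j then 0 else S $ m $ n) \<in> Sym_on J \<and> (\<chi> m. if m = j then 0 else S $ j $ m) \<in> supp_in J"
    if S: "S \<in> Sym_on (insert j J)" for S :: "('a, 'n) sqmat"
  proof -
    have sy: "S $ m $ n = S $ n $ m" for m n using S Sym_entry[of S m n] by (auto simp: Sym_on_def)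
    have z: "S $ m $ n = 0" if "m \<noteq> j" "m \<notin> J" for m n using S that by (auto simp: Sym_on_def)
    have "S $ j $ m = 0" if "m \<noteq> j" "m \<notin> J" for m using z[OF that, of j] sy[of j m] by simp
    then show ?thesis using z by (auto simp: Sym_on_def supp_in_def Sym_iff intro: sy)
  qed
  then show ?case by auto
qed

lemma card_supp_in: "card (supp_in J :: (('a::{field,finite})^'n::finite) set) = CARD('a) ^ card J"
proof -
  have "vec.subspace (supp_in J :: ('a^'n) set)" by (auto simp: supp_in_def vec.subspace_def)
  then show ?thesis using dim_substandard_cart[of J, where 'a = 'a] card_subspace[of "supp_in J :: ('a^'n) set"]
    by (simp add: supp_in_def)
qed

context odd_prime_field
begin

text \<open>A symmetric matrix has equal row and column spaces; the size of its image counts the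
  border vectors of special kind.\<close>

lemma range_Sym:
  fixes S :: "('a, 'n::finite) sqmat"
  assumes S: "S \<in> Sym"
  shows "range ((*v) S) = perp (nullspace S)" "card (range ((*v) S)) = CARD('a) ^ rank S"
proof -
  have sr: "vec.subspace (range ((*v) S))" by (rule subspace_image_mv) (rule vec.subspace_UNIV)
  have "perp (nullspace S) = vec.span (rows S)" unfolding nullspace_eq_perp by (rule perp_perp) (rule vec.subspace_span)
  moreover have "vec.span (rows S) \<subseteq> range ((*v) S)"
  proof (rule vec.span_minimal[OF _ sr], rule subsetI)
    fix x assume "x \<in> rows S"
    then obtain i where "x = row i S" by (auto simp: rows_def)
    then have "x = S *v axis i 1" using Sym_entry[OF S] by (simp add: vec_eq_iff row_def)
    then show "x \<in> range ((*v) S)" by blast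
  qed
  moreover have "range ((*v) S) \<subseteq> perp (nullspace S)"
    using dot_sym[OF S] by (auto simp: perp_def nullspace_def)
  ultimately show e: "range ((*v) S) = perp (nullspace S)" by blast
  have "vec.dim (perp (nullspace S)) = rank S" using dim_nullspace[of S] dim_perp[OF subspace_nullspace, of S] by simp
  then show "card (range ((*v) S)) = CARD('a) ^ rank S" unfolding e by (simp add: card_subspace subspace_perp)
qed

text \<open>q^rank is moved to the left to avoid the difference D - rank;
  \<open>rank_gsign_unique\<close> recognises rank and sign from an equation of this shape.\<close>

lemma gsign_gauss:
  fixes S :: "('a, 'd::{finite,linorder}) sqmat"
  assumes S: "S \<in> Sym"
  shows "gauss S * of_nat CARD('a) ^ rank S = of_int (gsign S) * of_nat CARD('a) ^ CARD('d) * gauss1 (1::'a) ^ rank S"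
    and "gsign S = 1 \<or> gsign S = - 1"
proof -
  obtain \<delta> :: int where d: "\<delta> = 1 \<or> \<delta> = - 1"
    "gauss S = of_int \<delta> * of_nat CARD('a) ^ (CARD('d) - rank S) * gauss1 (1::'a) ^ rank S"
    using gauss_rank[OF S] by blast
  have nz: "of_nat CARD('a) ^ (CARD('d) - rank S) * gauss1 (1::'a) ^ rank S \<noteq> (0::complex)"
    using gauss1_nonzero by simp
  have "gsign S = \<delta>"
    using d(1)
  proof
    assume "\<delta> = - 1"
    then have "gauss S \<noteq> of_nat CARD('a) ^ (CARD('d) - rank S) * gauss1 (1::'a) ^ rank S"
      unfolding d(2) using nz by (simp add: neg_eq_iff_add_eq_0 flip: mult_2)
    then show ?thesis using \<open>\<delta> = - 1\<close> by (simp add: gsign_def)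
  qed (use d(2) in \<open>simp add: gsign_def\<close>)
  then show "gsign S = 1 \<or> gsign S = - 1" using d(1) by simp
  have "of_nat CARD('a) ^ (CARD('d) - rank S) * of_nat CARD('a) ^ rank S = (of_nat CARD('a) ^ CARD('d) :: complex)"
    using dim_nullspace[of S] by (simp flip: power_add)
  then have e: "of_nat CARD('a) ^ CARD('d) = (of_nat CARD('a) ^ (CARD('d) - rank S) * of_nat CARD('a) ^ rank S :: complex)" ..
  show "gauss S * of_nat CARD('a) ^ rank S = of_int (gsign S) * of_nat CARD('a) ^ CARD('d) * gauss1 (1::'a) ^ rank S"
    unfolding \<open>gsign S = \<delta>\<close> d(2) e by (simp only: mult_ac)
qed

text \<open>Absolute values determine r, because |gauss1(1)|^2 = q; then the sign is determined
  too.\<close>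

lemma rank_gsign_unique:
  fixes S :: "('a, 'd::{finite,linorder}) sqmat"
  assumes S: "S \<in> Sym" and d: "\<delta> = 1 \<or> \<delta> = - 1"
    and e: "gauss S * of_nat CARD('a) ^ r = of_int \<delta> * of_nat CARD('a) ^ CARD('d) * gauss1 (1::'a) ^ r"
  shows "rank S = r \<and> gsign S = \<delta>"
proof -
  let ?q = "real CARD('a)" and ?g = "cmod (gauss1 (1::'a))"
  have *: "cmod (gauss S) ^ 2 * ?q ^ k = ?q ^ (2 * CARD('d))"
    if d: "\<delta> = 1 \<or> \<delta> = - 1" and e: "gauss S * of_nat CARD('a) ^ k = of_int \<delta> * of_nat CARD('a) ^ CARD('d) * gauss1 (1::'a) ^ k"
    for \<delta> :: int and k
  proof -
    have "cmod (gauss S) * ?q ^ k = ?q ^ CARD('d) * ?g ^ k"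
      using arg_cong[OF e, of cmod] d by (auto simp: norm_mult norm_power)
    then have "(cmod (gauss S) * ?q ^ k) ^ 2 = (?q ^ CARD('d) * ?g ^ k) ^ 2" by simp
    then have "(cmod (gauss S) ^ 2 * ?q ^ k) * ?q ^ k = ?q ^ (2 * CARD('d)) * (?g ^ 2) ^ k"
      by (simp add: power_mult_distrib power2_eq_square power_mult mult_ac)
    then show ?thesis unfolding cmod_gauss1 by simp
  qed
  have "cmod (gauss S) ^ 2 * ?q ^ r = cmod (gauss S) ^ 2 * ?q ^ rank S"
    using *[OF d e] *[OF gsign_gauss(2,1)[OF S]] by simp
  moreover have "cmod (gauss S) ^ 2 \<noteq> 0" using *[OF d e] by auto
  ultimately have "?q ^ r = ?q ^ rank S" by simp
  then have r: "rank S = r" using q_gt_2 by (simp add: power_inject_exp)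
  have "of_int (gsign S) * (of_nat CARD('a) ^ CARD('d) * gauss1 (1::'a) ^ r) = of_int \<delta> * (of_nat CARD('a) ^ CARD('d) * gauss1 (1::'a) ^ r)"
    using e gsign_gauss(1)[OF S] unfolding r by (simp add: mult.assoc)
  then show ?thesis using r gauss1_nonzero by simp
qed

text \<open>Some w in the kernel of S pairs non-trivially with b. Averaging over translations along
  w forces v_j = 0, so the Gauss sum only loses a factor q. A hyperbolic plane has been split off,
  whence rank + 2 and the sign \<open>chi (- 1)\<close>.\<close>

lemma extend_generic:
  fixes S :: "('a, 'd::{finite,linorder}) sqmat"
  assumes S: "S \<in> Sym_on J" and b: "b \<in> supp_in J" and j: "j \<notin> J" and nb: "b \<notin> range ((*v) S)"
  shows "rank (extend j S b c) = rank S + 2 \<and> gsign (extend j S b c) = gsign S * chi (- 1 :: 'a)"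
proof -
  let ?E = "extend j S b c" and ?q = "of_nat CARD('a) :: complex" and ?g = "gauss1 (1::'a)"
  have sS: "S \<in> Sym" and z: "S *v axis j t = 0" for t
    using S j Sym_entry[of S _ j] by (auto simp: Sym_on_def vec_eq_iff mv_component)
  have bj: "b $ j = 0" using b j by (auto simp: supp_in_def)
  obtain w0 where w0: "w0 \<in> nullspace S" "dot w0 b \<noteq> 0" using nb unfolding range_Sym(1)[OF sS] by (auto simp: perp_def)
  \<comment> \<open>Removing the j-coordinate changes neither S w nor \<open>dot b w\<close>, since
    S e_j = 0 and b_j = 0.\<close>
  define w where "w = w0 - axis j (w0 $ j)"
  have w: "S *v w = 0" "w $ j = 0" "dot b w \<noteq> 0"
    using w0 z bj by (auto simp: w_def nullspace_def matrix_vector_mult_diff_distrib dot_commute[of b])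
  have sh: "qform ?E (v + s *s w) = qform ?E v + s * (2 * v $ j * dot b w)" for v s
    using w by (simp add: qform_extend qform_add_vec[OF sS] vec.scale) (simp add: qform_def vec.scale algebra_simps)
  have "?q * gauss ?E = (\<Sum>s\<in>(UNIV::'a set). \<Sum>v\<in>UNIV. psi (qform ?E v))" by (simp add: gauss_def)
  also have "\<dots> = (\<Sum>s\<in>UNIV. \<Sum>v\<in>UNIV. psi (qform ?E (v + s *s w)))"
  proof (rule sum.cong[OF refl])
    fix s :: 'a
    show "(\<Sum>v\<in>UNIV. psi (qform ?E v)) = (\<Sum>v\<in>UNIV. psi (qform ?E (v + s *s w)))"
      by (rule sum.reindex_bij_witness[of _ "\<lambda>v. v + s *s w" "\<lambda>v. v - s *s w"]) auto
  qed
  also have "\<dots> = (\<Sum>v\<in>UNIV. psi (qform ?E v) * (\<Sum>s\<in>UNIV. psi (s * (2 * v $ j * dot b w))))"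
    by (subst sum.swap) (simp add: sh psi_add sum_distrib_left)
  also have "\<dots> = (\<Sum>v\<in>UNIV. psi (qform S v) * (if v $ j = 0 then ?q else 0))"
    using two_neq_0 w(3) by (intro sum.cong) (auto simp: sum_psi_mult qform_extend)
  \<comment> \<open>The factor q becomes a sum over translations along e_j, which S does not see;
    they turn the constraint v_j = 0 into a constraint on t and free v.\<close>
  also have "\<dots> = (\<Sum>v\<in>UNIV. \<Sum>t\<in>(UNIV::'a set). psi (qform S v) * (if v $ j = 0 then 1 else 0))"
    by (simp add: if_distrib[of "\<lambda>x. y * x" for y] mult.commute cong: if_cong)
  also have "\<dots> = (\<Sum>t\<in>(UNIV::'a set). \<Sum>v\<in>UNIV. psi (qform S v) * (if v $ j = 0 then 1 else 0))"
    by (rule sum.swap)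
  also have "\<dots> = (\<Sum>t\<in>UNIV. \<Sum>v\<in>UNIV. psi (qform S (v + axis j t)) * (if v $ j + t = 0 then 1 else 0))"
  proof (rule sum.cong[OF refl])
    fix t :: 'a
    show "(\<Sum>v\<in>UNIV. psi (qform S v) * (if v $ j = 0 then 1 else 0)) = (\<Sum>v\<in>UNIV. psi (qform S (v + axis j t)) * (if v $ j + t = 0 then 1 else 0))"
      by (rule sum.reindex_bij_witness[of _ "\<lambda>v. v + axis j t" "\<lambda>v. v - axis j t"]) auto
  qed
  also have "\<dots> = (\<Sum>v\<in>UNIV. \<Sum>t\<in>UNIV. psi (qform S v) * (if t = - v $ j then 1 else 0))"
    by (subst sum.swap) (simp add: qform_add_vec[OF sS] z, simp add: qform_def z eq_neg_iff_add_eq_0 add.commute)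
  also have "\<dots> = gauss S" by (simp add: gauss_def flip: sum_distrib_left)
  finally have e: "gauss S = ?q * gauss ?E" ..
  have E: "?E \<in> Sym" using extend_Sym_on[OF S b] by (auto simp: Sym_on_def)
  have "?q * (gauss ?E * ?q ^ (rank S + 2)) = (gauss S * ?q ^ rank S) * ?q ^ 2"
    unfolding e by (simp add: power_add power2_eq_square mult_ac)
  also have "\<dots> = of_int (gsign S) * ?q ^ CARD('d) * ?g ^ rank S * ?q ^ 2" unfolding gsign_gauss(1)[OF sS] ..
  \<comment> \<open>One factor q is traded for chi(-1) gauss1(1)^2, which supplies the two missing
    powers of the Gauss sum.\<close>
  also have "?q ^ 2 = ?q * (of_int (chi (- 1 :: 'a)) * ?g ^ 2)"
    unfolding gauss1_sq using chi_sq[of "- 1 :: 'a"] by (simp add: power2_eq_square mult_ac flip: of_int_mult)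
  also have "of_int (gsign S) * ?q ^ CARD('d) * ?g ^ rank S * (?q * (of_int (chi (- 1 :: 'a)) * ?g ^ 2))
      = ?q * (of_int (gsign S * chi (- 1 :: 'a)) * ?q ^ CARD('d) * ?g ^ (rank S + 2))"
    by (simp add: power_add power2_eq_square mult_ac)
  finally have "gauss ?E * ?q ^ (rank S + 2) = of_int (gsign S * chi (- 1 :: 'a)) * ?q ^ CARD('d) * ?g ^ (rank S + 2)"
    by simp
  moreover have "gsign S * chi (- 1 :: 'a) = 1 \<or> gsign S * chi (- 1 :: 'a) = - 1"
    using gsign_gauss(2)[OF sS] chi_values[of "- 1 :: 'a"] by auto
  ultimately show ?thesis by (intro rank_gsign_unique[OF E])
qed

text \<open>Completing the square: the substitution v + v_j w turns the bordered form into S plus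
  the one-variable form c' = c - Q(w).\<close>

lemma extend_special:
  fixes S :: "('a, 'd::{finite,linorder}) sqmat" and w :: "('a, 'd) vec" and c :: 'a
  assumes S: "S \<in> Sym_on J" and w: "S *v w \<in> supp_in J" "w $ j = 0" and j: "j \<notin> J"
  defines "c' \<equiv> c - qform S w"
  shows "c' = 0 \<Longrightarrow> rank (extend j S (S *v w) c) = rank S \<and> gsign (extend j S (S *v w) c) = gsign S"
    and "c' \<noteq> 0 \<Longrightarrow> rank (extend j S (S *v w) c) = rank S + 1 \<and> gsign (extend j S (S *v w) c) = gsign S * chi c'"
proof -
  let ?E = "extend j S (S *v w) c" and ?q = "of_nat CARD('a) :: complex" and ?g = "gauss1 (1::'a)"
  have sS: "S \<in> Sym" and z: "S $ i $ j = 0" for i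
    using S j Sym_entry[of S i j] by (auto simp: Sym_on_def)
  have E: "?E \<in> Sym" using extend_Sym_on[OF S w(1)] by (auto simp: Sym_on_def)
  have "qform ?E v = qform (S + corner j c') (v + v $ j *s w)" for v
    using w(2) dot_commute[of v "S *v w"]
    by (simp add: qform_add qform_corner qform_extend qform_add_vec[OF sS] qform_scale vec.scale c'_def algebra_simps)
  then have "gauss ?E = (\<Sum>v\<in>UNIV. psi (qform (S + corner j c') (v + v $ j *s w)))" by (simp add: gauss_def)
  also have "\<dots> = gauss (S + corner j c')"
    unfolding gauss_def using w(2)
    by (intro sum.reindex_bij_witness[of _ "\<lambda>v. v - v $ j *s w" "\<lambda>v. v + v $ j *s w"]) auto
  finally have "?q * gauss ?E = gauss S * gauss1 c'" using gauss_add_corner[OF sS z, of c'] by simp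
  note e = this gsign_gauss(1)[OF sS]
  show "rank ?E = rank S \<and> gsign ?E = gsign S" if "c' = 0"
    using rank_gsign_unique[OF E gsign_gauss(2)[OF sS]] e that by simp
  show "rank ?E = rank S + 1 \<and> gsign ?E = gsign S * chi c'" if "c' \<noteq> 0"
  proof -
    have "gauss ?E * ?q ^ (rank S + 1) = (?q * gauss ?E) * ?q ^ rank S" by simp
    also have "\<dots> = (gauss S * ?q ^ rank S) * (of_int (chi c') * ?g)"
      unfolding e(1) gauss1_chi[OF that] by (simp only: mult_ac)
    also have "\<dots> = of_int (gsign S * chi c') * ?q ^ CARD('d) * ?g ^ (rank S + 1)"
      unfolding e(2) by (simp add: mult_ac)
    finally have 1: "gauss ?E * ?q ^ (rank S + 1) = of_int (gsign S * chi c') * ?q ^ CARD('d) * ?g ^ (rank S + 1)" .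
    have 2: "gsign S * chi c' = 1 \<or> gsign S * chi c' = - 1"
      using gsign_gauss(2)[OF sS] chi_values[OF that] by auto
    show ?thesis by (rule rank_gsign_unique[OF E 2 1])
  qed
qed

definition cls :: "'d set \<Rightarrow> nat \<Rightarrow> int \<Rightarrow> ('a, 'd::{finite,linorder}) sqmat set" where
  "cls J r \<delta> = {S \<in> Sym_on J. rank S = r \<and> gsign S = \<delta>}"

lemma card_chi: "\<epsilon> = 1 \<or> \<epsilon> = - 1 \<Longrightarrow> card {c::'a. c \<noteq> 0 \<and> chi c = \<epsilon>} = card squares"
proof -
  assume "\<epsilon> = 1 \<or> \<epsilon> = - 1"
  then show ?thesis
  proof
    assume "\<epsilon> = 1"
    then show ?thesis using mem_squares by (intro arg_cong[of _ _ card]) auto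
  next
    assume "\<epsilon> = - 1"
    then have "{c::'a. c \<noteq> 0 \<and> chi c = \<epsilon>} = UNIV - {0} - squares" using mem_squares chi_values by auto
    moreover have "squares \<subseteq> UNIV - {0::'a}" by (auto simp: squares_def)
    ultimately show ?thesis using card_squares by (simp add: card_Diff_subset card_Diff_singleton)
  qed
qed

text \<open>Of the q^|J| border vectors, q^rank lie in the image of S. For each of these one corner
  entry keeps the rank and (q - 1)/2 raise it by 1 with a prescribed sign. Every other border raises
  it by 2, whatever the corner entry.\<close>

lemma card_extensions:
  fixes S :: "('a, 'd::{finite,linorder}) sqmat" and r :: nat
  assumes S: "S \<in> Sym_on J" and j: "j \<notin> J" and d: "\<delta> = 1 \<or> \<delta> = - 1"
  defines "ok \<equiv> \<lambda>b c. rank (extend j S b c) = r \<and> gsign (extend j S b c) = \<delta>"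
  shows "card {(b, c). b \<in> supp_in J \<and> ok b c} =
    CARD('a) ^ rank S * ((if rank S = r \<and> gsign S = \<delta> then 1 else 0) + (if rank S + 1 = r then card squares else 0))
    + (CARD('a) ^ card J - CARD('a) ^ rank S) * (if rank S + 2 = r \<and> gsign S * chi (- 1 :: 'a) = \<delta> then CARD('a) else 0)"
proof -
  have sS: "S \<in> Sym" using S by (auto simp: Sym_on_def)
  have gs: "gsign S = 1 \<or> gsign S = - 1" by (rule gsign_gauss(2)[OF sS])
  let ?R = "range ((*v) S)"
  let ?sp = "(if rank S = r \<and> gsign S = \<delta> then 1 else 0) + (if rank S + 1 = r then card squares else 0)"
  let ?ge = "if rank S + 2 = r \<and> gsign S * chi (- 1 :: 'a) = \<delta> then CARD('a) else 0"
  have R: "?R \<subseteq> supp_in J" using S by (auto simp: Sym_on_def supp_in_def mv_component dot_def)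
  have 1: "card {c. ok b c} = ?sp" if b: "b \<in> ?R" for b
  proof -
    obtain u where u: "b = S *v u" using b by blast
    define w where "w = u - axis j (u $ j)"
    have "S *v axis j t = 0" for t
      using S j Sym_entry[OF sS, of _ j] by (auto simp: Sym_on_def vec_eq_iff mv_component)
    then have w: "b = S *v w" "w $ j = 0" by (simp_all add: w_def u matrix_vector_mult_diff_distrib)
    then have wJ: "S *v w \<in> supp_in J" using R by blast
    have "ok b c \<longleftrightarrow> (c - qform S w = 0 \<and> rank S = r \<and> gsign S = \<delta>) \<or>
        (c - qform S w \<noteq> 0 \<and> rank S + 1 = r \<and> chi (c - qform S w) = gsign S * \<delta>)" for c
    proof (cases "c - qform S w = 0")
      case True
      then show ?thesis using extend_special(1)[OF S wJ w(2) j True] unfolding ok_def w(1) by auto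
    next
      case False
      have "gsign S * chi (c - qform S w) = \<delta> \<longleftrightarrow> chi (c - qform S w) = gsign S * \<delta>"
        using gs by auto
      then show ?thesis using extend_special(2)[OF S wJ w(2) j False] False unfolding ok_def w(1) by auto
    qed
    moreover have im: "(\<lambda>x. x + a) ` T = {c. c - a \<in> T}" for T and a :: 'a
    proof (intro set_eqI iffI)
      fix c assume "c \<in> {c. c - a \<in> T}"
      then show "c \<in> (\<lambda>x. x + a) ` T" by (intro image_eqI[of _ _ "c - a"]) auto
    qed auto
    ultimately have "{c. ok b c} = (\<lambda>x. x + qform S w) ` ({x. x = 0 \<and> rank S = r \<and> gsign S = \<delta>} \<union>
        {x. x \<noteq> 0 \<and> rank S + 1 = r \<and> chi x = gsign S * \<delta>})" (is "_ = _ ` (?A \<union> ?B)")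
      by simp
    then have "card {c. ok b c} = card (?A \<union> ?B)" by (simp add: card_image)
    also have "\<dots> = card ?A + card ?B" by (rule card_Un_disjoint) auto
    also have "card ?A = (if rank S = r \<and> gsign S = \<delta> then 1 else 0)" by (simp add: conj_commute)
    also have "card ?B = (if rank S + 1 = r then card squares else 0)"
      using card_chi[of "gsign S * \<delta>"] gs d by auto
    finally show ?thesis .
  qed
  have 2: "card {c. ok b c} = ?ge" if b: "b \<in> supp_in J - ?R" for b
    using extend_generic[OF S _ j] b by (auto simp: ok_def)
  have "{(b, c). b \<in> supp_in J \<and> ok b c} = Sigma (supp_in J) (\<lambda>b. {c. ok b c})" by auto
  then have "card {(b, c). b \<in> supp_in J \<and> ok b c} = (\<Sum>b\<in>supp_in J. card {c. ok b c})" by (simp add: card_SigmaI)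
  also have "\<dots> = (\<Sum>b\<in>supp_in J - ?R. card {c. ok b c}) + (\<Sum>b\<in>?R. card {c. ok b c})"
    by (rule sum.subset_diff[OF R]) simp
  also have "\<dots> = card (supp_in J - ?R) * ?ge + card ?R * ?sp" using 1 2 by simp
  also have "card (supp_in J - ?R) = CARD('a) ^ card J - CARD('a) ^ rank S"
    using R by (simp add: card_Diff_subset card_supp_in range_Sym(2)[OF sS])
  finally show ?thesis unfolding range_Sym(2)[OF sS] by simp
qed

end

section \<open>Solving the bordering recursion\<close>

definition pfac :: "real \<Rightarrow> nat \<Rightarrow> real" where
  "pfac q n = (\<Prod>k = 1..n. q ^ (2 * k) / (q ^ (2 * k) - 1))"

definition qfac :: "real \<Rightarrow> nat \<Rightarrow> nat \<Rightarrow> real" where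
  "qfac q m r = (\<Prod>k<r. q ^ (m - k) - 1)"

lemma qfac_0 [simp]: "qfac q m 0 = 1"
  by (simp add: qfac_def)

text \<open>Truncated subtraction gives the factor q^0 - 1 at k = m. The counting formula thereby
  holds for every rank, including ranks above the size.\<close>

lemma qfac_eq_0: "m < r \<Longrightarrow> qfac q m r = 0"
  unfolding qfac_def by (rule prod_zero[OF finite_lessThan bexI[of _ m]]) auto

text \<open>Written with a quotient, since q^(m - r) is truncated for r > m; there both sides are
  0.\<close>

lemma qfac_Suc:
  assumes "q > 1"
  shows "qfac q m (Suc r) = qfac q m r * (q ^ m / q ^ r - 1)"
proof (cases "m < r")
  case True
  then show ?thesis by (simp add: qfac_eq_0)
next
  case False
  then have "q ^ (m - r) = q ^ m / q ^ r" using assms by (simp add: power_diff)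
  then show ?thesis by (simp add: qfac_def)
qed

lemma qfac_Suc_Suc: "qfac q (Suc m) (Suc r) = (q ^ Suc m - 1) * qfac q m r"
  unfolding qfac_def prod.lessThan_Suc_shift by simp

lemma pfac_Suc: "pfac q (Suc n) = pfac q n * (q ^ (2 * Suc n) / (q ^ (2 * Suc n) - 1))"
  by (simp add: pfac_def)

text \<open>The algebra of the even step, with A = q^|J|. The three terms on the right come from old
  matrices of rank 2n + 2, 2n + 1 and 2n.\<close>

lemma even_step:
  fixes q A Y \<epsilon> :: real and n :: nat
  assumes q: "q > 1" and e: "\<epsilon> = 1 \<or> \<epsilon> = - 1"
  defines "w \<equiv> q ^ Suc n"
  shows "w ^ 2 / (w ^ 2 - 1) * (q * A - 1) * Y * ((w + \<epsilon>) / (2 * w)) =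
    w ^ 2 * (w ^ 2 / (w ^ 2 - 1) * Y * (A / (w ^ 2 / q) - 1) * ((w + \<epsilon>) / (2 * w)))
    + (w ^ 2 / q) * ((q - 1) / 2) * Y + (w ^ 2 / q) * Y * ((w / q + \<epsilon>) / (2 * (w / q)))"
proof -
  have w: "w > 1" unfolding w_def using q by (rule one_less_power) simp
  then have w2: "w ^ 2 - 1 = (w - \<epsilon>) * (w + \<epsilon>)" "w - \<epsilon> \<noteq> 0" "w + \<epsilon> \<noteq> 0" "w \<noteq> 0" "q \<noteq> 0"
    using e q by (auto simp: power2_eq_square algebra_simps)
  have a: "w ^ 2 / (w ^ 2 - 1) * ((w + \<epsilon>) / (2 * w)) = w / (2 * (w - \<epsilon>))"
    unfolding w2(1) using w2 by (simp add: power2_eq_square)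
  have b: "(w ^ 2 / q) * ((q - 1) / 2) * Y + (w ^ 2 / q) * Y * ((w / q + \<epsilon>) / (2 * (w / q))) = w * (w + \<epsilon>) / 2 * Y"
    using w2 by (simp add: field_simps power2_eq_square)
  have c: "w * (w + \<epsilon>) / 2 = w / (2 * (w - \<epsilon>)) * (w ^ 2 - 1)"
  proof -
    have "a * b / 2 = a / (2 * c) * (c * b)" if "c \<noteq> 0" for a b c :: real using that by (simp add: field_simps)
    from this[OF w2(2)] show ?thesis unfolding w2(1) .
  qed
  have d: "w ^ 2 * (A / (w ^ 2 / q) - 1) = q * A - w ^ 2"
    using w2 by (simp add: field_simps)
  have "w ^ 2 / (w ^ 2 - 1) * (q * A - 1) * Y * ((w + \<epsilon>) / (2 * w)) = (w / (2 * (w - \<epsilon>))) * (q * A - 1) * Y"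
    unfolding a[symmetric] by simp
  \<comment> \<open>Splits q A - 1 as (q A - w^2) + (w^2 - 1): the first part is the contribution of
    unchanged rank, the second that of the two smaller ranks.\<close>
  also have "\<dots> = (w / (2 * (w - \<epsilon>))) * (q * A - w ^ 2) * Y + (w / (2 * (w - \<epsilon>))) * (w ^ 2 - 1) * Y"
    by (simp only: flip: distrib_left distrib_right) simp
  also have "\<dots> = w ^ 2 * (w ^ 2 / (w ^ 2 - 1) * Y * (A / (w ^ 2 / q) - 1) * ((w + \<epsilon>) / (2 * w)))
    + ((w ^ 2 / q) * ((q - 1) / 2) * Y + (w ^ 2 / q) * Y * ((w / q + \<epsilon>) / (2 * (w / q))))"
    unfolding b c d[symmetric] a[symmetric] by (simp only: mult_ac)
  finally show ?thesis by simp
qed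

text \<open>The algebra of the odd step, with v = q^(2n) and A = q^|J|; the terms come from old
  ranks 2n + 1, 2n and 2n - 1.\<close>

lemma odd_step:
  fixes q A Z :: real
  assumes q: "q > 1" and v: "v > 0"
  shows "(q * A - 1) * Z = q * v * (Z * (A / v - 1)) + v * (q - 1) * Z + (v - 1) * Z"
  using assms by (simp add: field_simps)

context odd_prime_field
begin

definition ncls :: "'d::{finite,linorder} set \<Rightarrow> nat \<Rightarrow> int \<Rightarrow> real" where
  "ncls J r \<delta> = real (card (cls J r \<delta> :: ('a, 'd) sqmat set))"

text \<open>From rank r - 1 only the two signs together enter, because the corner entries that raise
  the rank by 1 are evenly split between squares and non-squares.\<close>

lemma ncls_insert:
  fixes j :: "'d::{finite,linorder}"
  assumes j: "j \<notin> J" and d: "\<delta> = 1 \<or> \<delta> = - 1"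
  defines "q \<equiv> real CARD('a)"
  shows "ncls (insert j J) r \<delta> = q ^ r * ncls J r \<delta>
    + (if r \<ge> 1 then q ^ (r - 1) * ((q - 1) / 2) * (ncls J (r - 1) 1 + ncls J (r - 1) (- 1)) else 0)
    + (if r \<ge> 2 then q * (q ^ card J - q ^ (r - 2)) * ncls J (r - 2) (\<delta> * chi (- 1 :: 'a)) else 0)"
proof -
  let ?ok = "\<lambda>S :: ('a, 'd) sqmat. rank S = r \<and> gsign S = \<delta>"
  let ?f = "\<lambda>(S :: ('a, 'd) sqmat, b, c). extend j S b c"
  let ?A = "Sym_on J \<times> supp_in J \<times> (UNIV :: 'a set)"
  let ?\<xi> = "chi (- 1 :: 'a)"
  have \<xi>: "?\<xi> = 1 \<or> ?\<xi> = - 1" by (rule chi_values) simp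
  have bij: "bij_betw ?f ?A (Sym_on (insert j J))" by (rule bij_extend[OF j])
  have im: "f ` {x \<in> A. P (f x)} = {y \<in> f ` A. P y}" for f :: "('a, 'd) sqmat \<times> ('a, 'd) vec \<times> 'a \<Rightarrow> ('a, 'd) sqmat" and A P
    by auto
  have "cls (insert j J) r \<delta> = ?f ` {x \<in> ?A. ?ok (?f x)}"
    using im[of ?f ?A "\<lambda>S. rank S = r \<and> gsign S = \<delta>"] bij_betw_imp_surj_on[OF bij] by (simp only: cls_def)
  moreover have "inj_on ?f {x \<in> ?A. ?ok (?f x)}"
    using bij_betw_imp_inj_on[OF bij] by (rule inj_on_subset) auto
  ultimately have "card (cls (insert j J) r \<delta> :: ('a, 'd) sqmat set) = card {x \<in> ?A. ?ok (?f x)}"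
    by (simp add: card_image)
  also have "{x \<in> ?A. ?ok (?f x)} = Sigma (Sym_on J) (\<lambda>S. {(b, c). b \<in> supp_in J \<and> ?ok (extend j S b c)})" by auto
  also have "card \<dots> = (\<Sum>S\<in>Sym_on J. card {(b, c). b \<in> supp_in J \<and> ?ok (extend j S b c)})" by (rule card_SigmaI) auto
  finally have "ncls (insert j J) r \<delta> = (\<Sum>S\<in>Sym_on J. real (card {(b, c). b \<in> supp_in J \<and> ?ok (extend j S b c)}))"
    by (simp add: ncls_def)
  also have "\<dots> = (\<Sum>S\<in>(Sym_on J :: ('a, 'd) sqmat set). (if rank S = r \<and> gsign S = \<delta> then q ^ r else 0)
      + (if rank S + 1 = r then q ^ (r - 1) * ((q - 1) / 2) else 0)
      + (if rank S + 2 = r \<and> gsign S = \<delta> * ?\<xi> then q * (q ^ card J - q ^ (r - 2)) else 0))"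
  proof (rule sum.cong[OF refl])
    fix S :: "('a, 'd) sqmat" assume S: "S \<in> Sym_on J"
    have sS: "S \<in> Sym" using S by (auto simp: Sym_on_def)
    have "range ((*v) S) \<subseteq> supp_in J" using S by (auto simp: Sym_on_def supp_in_def mv_component dot_def)
    then have "card (range ((*v) S)) \<le> card (supp_in J :: ('a, 'd) vec set)" by (intro card_mono) auto
    then have le: "CARD('a) ^ rank S \<le> CARD('a) ^ card J" unfolding range_Sym(2)[OF sS] card_supp_in .
    have s: "real (card squares) = (q - 1) / 2" using card_squares q_gt_2 by (simp add: q_def of_nat_diff field_simps)
    have g: "gsign S * ?\<xi> = \<delta> \<longleftrightarrow> gsign S = \<delta> * ?\<xi>" using \<xi> d by auto
    show "real (card {(b, c). b \<in> supp_in J \<and> ?ok (extend j S b c)}) = (if rank S = r \<and> gsign S = \<delta> then q ^ r else 0)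
      + (if rank S + 1 = r then q ^ (r - 1) * ((q - 1) / 2) else 0)
      + (if rank S + 2 = r \<and> gsign S = \<delta> * ?\<xi> then q * (q ^ card J - q ^ (r - 2)) else 0)"
      unfolding card_extensions[OF S j d] g of_nat_add of_nat_mult of_nat_diff[OF le] using s by (auto simp: q_def)
  qed
  also have "\<dots> = q ^ r * ncls J r \<delta> + (\<Sum>S\<in>(Sym_on J :: ('a, 'd) sqmat set). if rank S + 1 = r then q ^ (r - 1) * ((q - 1) / 2) else 0)
      + (\<Sum>S\<in>(Sym_on J :: ('a, 'd) sqmat set). if rank S + 2 = r \<and> gsign S = \<delta> * ?\<xi> then q * (q ^ card J - q ^ (r - 2)) else 0)"
    by (simp add: sum.distrib sum.If_cases ncls_def cls_def Int_def mult.commute)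
  also have "(\<Sum>S\<in>(Sym_on J :: ('a, 'd) sqmat set). if rank S + 1 = r then q ^ (r - 1) * ((q - 1) / 2) else 0)
      = (if r \<ge> 1 then q ^ (r - 1) * ((q - 1) / 2) * (ncls J (r - 1) 1 + ncls J (r - 1) (- 1)) else 0)"
  proof (cases r)
    case (Suc k)
    have "{S \<in> (Sym_on J :: ('a, 'd) sqmat set). rank S = k} = cls J k 1 \<union> cls J k (- 1)"
      using gsign_gauss(2) by (auto simp: cls_def Sym_on_def)
    moreover have "cls J k 1 \<inter> cls J k (- 1) = ({} :: ('a, 'd) sqmat set)" by (auto simp: cls_def)
    ultimately have "real (card {S \<in> (Sym_on J :: ('a, 'd) sqmat set). rank S = k}) = ncls J k 1 + ncls J k (- 1)"
      by (simp add: ncls_def card_Un_disjoint)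
    then show ?thesis using Suc by (simp add: sum.If_cases Int_def mult.commute)
  qed simp
  also have "(\<Sum>S\<in>(Sym_on J :: ('a, 'd) sqmat set). if rank S + 2 = r \<and> gsign S = \<delta> * ?\<xi> then q * (q ^ card J - q ^ (r - 2)) else 0)
      = (if r \<ge> 2 then q * (q ^ card J - q ^ (r - 2)) * ncls J (r - 2) (\<delta> * ?\<xi>) else 0)"
  proof (cases "r \<ge> 2")
    case True
    then have "{S \<in> (Sym_on J :: ('a, 'd) sqmat set). rank S + 2 = r \<and> gsign S = \<delta> * ?\<xi>} = cls J (r - 2) (\<delta> * ?\<xi>)"
      by (auto simp: cls_def)
    then show ?thesis using True by (simp add: sum.If_cases Int_def mult.commute ncls_def)
  qed auto
  finally show ?thesis .
qed

lemma ncls_empty: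
  "ncls ({} :: 'd::{finite,linorder} set) r \<delta> = (if r = 0 \<and> \<delta> = 1 then 1 else 0)"
proof -
  have "Sym_on {} = {0 :: ('a, 'd) sqmat}" by (auto simp: Sym_on_def Sym_iff vec_eq_iff)
  moreover have "gsign (0 :: ('a, 'd) sqmat) = 1" by (simp add: gsign_def rank_zero gauss_def qform_def)
  moreover have "{S \<in> {0 :: ('a, 'd) sqmat}. P S} = (if P 0 then {0} else {})" for P by auto
  ultimately have "cls ({} :: 'd set) r \<delta> = (if r = 0 \<and> \<delta> = 1 then {0 :: ('a, 'd) sqmat} else {})"
    unfolding cls_def by (simp only: rank_zero) metis
  then show ?thesis by (simp add: ncls_def)
qed

text \<open>The twist by \<xi>^n turns \<open>gsign\<close> into the type and makes the sign change
  in the r - 2 term of the recursion disappear. For odd rank only the sum over both signs is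
  claimed, which is all that the even case uses.\<close>

theorem ncls_formula:
  fixes J :: "'d::{finite,linorder} set"
  defines "q \<equiv> real CARD('a)" and "\<xi> \<equiv> chi (- 1 :: 'a)"
  shows "(\<forall>\<epsilon>\<in>{1, - 1}. ncls J (2 * n) (\<epsilon> * \<xi> ^ n) = pfac q n * qfac q (card J) (2 * n) * ((q ^ n + of_int \<epsilon>) / (2 * q ^ n)))
    \<and> ncls J (2 * n + 1) 1 + ncls J (2 * n + 1) (- 1) = pfac q n * qfac q (card J) (2 * n + 1)"
  using finite[of J]
proof (induction J arbitrary: n rule: finite_induct)
  case empty
  show ?case
  proof (cases n)
    case 0
    then show ?thesis by (simp add: ncls_empty pfac_def qfac_eq_0)
  qed (simp add: ncls_empty qfac_eq_0)
next
  case (insert j J)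
  have q: "q > 1" using q_gt_2 by (simp add: q_def)
  have \<xi>: "\<xi> = 1 \<or> \<xi> = - 1" unfolding \<xi>_def by (rule chi_values) simp
  have \<xi>\<xi>: "\<xi> * \<xi> = 1" using \<xi> by auto
  have \<xi>n: "\<xi> ^ n = 1 \<or> \<xi> ^ n = - 1" for n using \<xi> by (induction n) auto
  have cJ: "card (insert j J) = Suc (card J)" using insert.hyps by simp
  note rec = ncls_insert[OF insert.hyps(2), folded q_def \<xi>_def]
  let ?A = "q ^ card J"
  have ev: "ncls J (2 * n) (\<epsilon> * \<xi> ^ n) = pfac q n * qfac q (card J) (2 * n) * ((q ^ n + of_int \<epsilon>) / (2 * q ^ n))"
    if "\<epsilon> = 1 \<or> \<epsilon> = - 1" for \<epsilon> n using insert.IH[of n] that by auto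
  have od: "ncls J (2 * n + 1) 1 + ncls J (2 * n + 1) (- 1) = pfac q n * qfac q (card J) (2 * n + 1)" for n
    using insert.IH[of n] by blast
  \<comment> \<open>Over both signs, the terms with \<epsilon> cancel.\<close>
  have ev2: "ncls J (2 * n) 1 + ncls J (2 * n) (- 1) = pfac q n * qfac q (card J) (2 * n)" for n
  proof -
    have "ncls J (2 * n) 1 + ncls J (2 * n) (- 1) = ncls J (2 * n) (1 * \<xi> ^ n) + ncls J (2 * n) ((- 1) * \<xi> ^ n)"
      using \<xi>n[of n] by auto
    also have "\<dots> = pfac q n * qfac q (card J) (2 * n)"
      using q by (simp only: ev simp_thms) (simp add: field_simps)
    finally show ?thesis .
  qed
  show ?case
  proof (intro conjI ballI)
    fix \<epsilon> :: int assume e: "\<epsilon> \<in> {1, - 1}"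
    then have d: "\<epsilon> * \<xi> ^ n = 1 \<or> \<epsilon> * \<xi> ^ n = - 1" using \<xi>n[of n] by auto
    show "ncls (insert j J) (2 * n) (\<epsilon> * \<xi> ^ n) = pfac q n * qfac q (card (insert j J)) (2 * n) * ((q ^ n + of_int \<epsilon>) / (2 * q ^ n))"
    proof (cases n)
      case 0
      then show ?thesis using rec[of \<epsilon> 0] ev[of \<epsilon> 0] e by auto
    next
      case (Suc k)
      let ?Y = "pfac q k * qfac q (card J) (2 * k + 1)" and ?w = "q ^ Suc k" and ?e = "real_of_int \<epsilon>"
      have w2: "?w ^ 2 = q ^ (2 * Suc k)" "?w ^ 2 / q = q ^ (2 * k + 1)" "?w / q = q ^ k"
        using q by (simp_all add: power2_eq_square power_mult power_add flip: power_mult_distrib) 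
      have r: "\<epsilon> * \<xi> ^ n * \<xi> = \<epsilon> * \<xi> ^ k" using \<xi>\<xi> Suc by (simp add: mult_ac)
      have Q1: "qfac q (card J) (2 * Suc k) = qfac q (card J) (2 * k + 1) * (?A / q ^ (2 * k + 1) - 1)"
        using qfac_Suc[OF q, of "card J" "2 * k + 1"] by simp
      have Q0: "q * (?A - q ^ (2 * k)) * qfac q (card J) (2 * k) = q ^ (2 * k + 1) * qfac q (card J) (2 * k + 1)"
      proof -
        have "(?A - q ^ (2 * k)) * qfac q (card J) (2 * k) = q ^ (2 * k) * qfac q (card J) (2 * k + 1)"
          using qfac_Suc[OF q, of "card J" "2 * k"] q by (simp add: field_simps)
        then show ?thesis by (simp only: mult.assoc power_add power_one_right) (simp only: mult_ac)
      qed
      have Q2: "qfac q (Suc (card J)) (2 * Suc k) = (q * ?A - 1) * qfac q (card J) (2 * k + 1)"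
        using qfac_Suc_Suc[of q "card J" "2 * k + 1"] by simp
      have "ncls (insert j J) (2 * n) (\<epsilon> * \<xi> ^ n) = q ^ (2 * Suc k) * ncls J (2 * Suc k) (\<epsilon> * \<xi> ^ n)
        + q ^ (2 * k + 1) * ((q - 1) / 2) * (ncls J (2 * k + 1) 1 + ncls J (2 * k + 1) (- 1))
        + q * (?A - q ^ (2 * k)) * ncls J (2 * k) (\<epsilon> * \<xi> ^ k)"
        using rec[OF d, of "2 * n"] unfolding r by (simp add: Suc)
      also have "\<dots> = q ^ (2 * Suc k) * (pfac q (Suc k) * qfac q (card J) (2 * Suc k) * ((?w + ?e) / (2 * ?w)))
        + q ^ (2 * k + 1) * ((q - 1) / 2) * ?Y
        + (q * (?A - q ^ (2 * k)) * qfac q (card J) (2 * k)) * pfac q k * ((q ^ k + ?e) / (2 * q ^ k))"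
        unfolding od using ev[of \<epsilon> n] ev[of \<epsilon> k] e Suc by auto
      also have "\<dots> = ?w ^ 2 * (?w ^ 2 / (?w ^ 2 - 1) * ?Y * (?A / (?w ^ 2 / q) - 1) * ((?w + ?e) / (2 * ?w)))
        + (?w ^ 2 / q) * ((q - 1) / 2) * ?Y + (?w ^ 2 / q) * ?Y * ((?w / q + ?e) / (2 * (?w / q)))"
        unfolding w2(2,3) unfolding Q0 Q1 w2(1) pfac_Suc by (simp only: mult_ac)
      also have "\<dots> = ?w ^ 2 / (?w ^ 2 - 1) * (q * ?A - 1) * ?Y * ((?w + ?e) / (2 * ?w))"
        using even_step[OF q, of ?e k ?A ?Y] e by auto
      also have "\<dots> = pfac q n * qfac q (card (insert j J)) (2 * n) * ((q ^ n + ?e) / (2 * q ^ n))"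
        unfolding cJ Suc Q2 pfac_Suc w2(1) by (simp only: mult_ac)
      finally show ?thesis .
    qed
  next
    have s: "ncls (insert j J) (2 * n + 1) 1 + ncls (insert j J) (2 * n + 1) (- 1) =
      q * q ^ (2 * n) * (pfac q n * qfac q (card J) (2 * n + 1)) + q ^ (2 * n) * (q - 1) * (pfac q n * qfac q (card J) (2 * n))
      + (if n = 0 then 0 else q * (?A - q ^ (2 * n - 1)) * (ncls J (2 * n - 1) 1 + ncls J (2 * n - 1) (- 1)))"
    proof -
      show ?thesis
        unfolding ev2[symmetric] od[symmetric]
        using \<xi> rec[of 1 "2 * n + 1"] rec[of "- 1" "2 * n + 1"]
        by (elim disjE) (auto simp: algebra_simps)
    qed
    have t: "(if n = 0 then 0 else q * (?A - q ^ (2 * n - 1)) * (ncls J (2 * n - 1) 1 + ncls J (2 * n - 1) (- 1)))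
      = (q ^ (2 * n) - 1) * (pfac q n * qfac q (card J) (2 * n))"
    proof (cases n)
      case (Suc k)
      have Q0: "q * (?A - q ^ (2 * k + 1)) * qfac q (card J) (2 * k + 1) = q ^ (2 * Suc k) * qfac q (card J) (2 * Suc k)"
      proof -
        have "(?A - q ^ (2 * k + 1)) * qfac q (card J) (2 * k + 1) = q ^ (2 * k + 1) * qfac q (card J) (2 * Suc k)"
          using qfac_Suc[OF q, of "card J" "2 * k + 1"] q by (simp add: field_simps)
        moreover have "q ^ (2 * Suc k) = q * q ^ (2 * k + 1)" by simp
        ultimately show ?thesis by (simp only: mult.assoc)
      qed
      have "q ^ (2 * Suc k) > 1" using q by (intro one_less_power) auto
      then have "pfac q k * q ^ (2 * Suc k) = (q ^ (2 * Suc k) - 1) * pfac q (Suc k)"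
        unfolding pfac_Suc by (simp add: field_simps del: power_Suc)
      moreover have "q * (?A - q ^ (2 * n - 1)) * (ncls J (2 * n - 1) 1 + ncls J (2 * n - 1) (- 1))
        = (q * (?A - q ^ (2 * k + 1)) * qfac q (card J) (2 * k + 1)) * pfac q k"
        using od[of k] Suc by simp
      ultimately show ?thesis using Suc unfolding Q0 by (simp del: power_Suc add: mult_ac)
    qed simp
    have Q2: "qfac q (Suc (card J)) (2 * n + 1) = (q * ?A - 1) * qfac q (card J) (2 * n)"
      using qfac_Suc_Suc[of q "card J" "2 * n"] by simp
    have Q1: "qfac q (card J) (2 * n + 1) = qfac q (card J) (2 * n) * (?A / q ^ (2 * n) - 1)"
      using qfac_Suc[OF q, of "card J" "2 * n"] by simp
    show "ncls (insert j J) (2 * n + 1) 1 + ncls (insert j J) (2 * n + 1) (- 1) = pfac q n * qfac q (card (insert j J)) (2 * n + 1)"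
      unfolding s t cJ Q1 Q2
      using odd_step[OF q, of "q ^ (2 * n)" ?A "pfac q n * qfac q (card J) (2 * n)"] q by (simp add: mult_ac)
  qed
qed

theorem card_Sym_rank_type:
  fixes n :: nat and \<epsilon> :: int
  defines "q \<equiv> real CARD('a)"
  shows "\<epsilon> = 1 \<or> \<epsilon> = - 1 \<Longrightarrow> real (card {S :: ('a, 'd::{finite,linorder}) sqmat. S \<in> Sym \<and> rank S = 2 * n \<and> mtype S = \<epsilon>})
      = pfac q n * qfac q CARD('d) (2 * n) * ((q ^ n + of_int \<epsilon>) / (2 * q ^ n))"
    and "real (card {S :: ('a, 'd::{finite,linorder}) sqmat. S \<in> Sym \<and> rank S = 2 * n + 1 \<and> mtype S = 0})
      = pfac q n * qfac q CARD('d) (2 * n + 1)"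
proof -
  let ?\<xi> = "chi (- 1 :: 'a)"
  have \<xi>: "?\<xi> = 1 \<or> ?\<xi> = - 1" by (rule chi_values) simp
  have \<xi>n: "?\<xi> ^ n * ?\<xi> ^ n = 1" using \<xi> by (auto simp flip: power_mult_distrib)
  have U: "Sym_on UNIV = (Sym :: ('a, 'd) sqmat set)" by (auto simp: Sym_on_def)
  { assume e: "\<epsilon> = 1 \<or> \<epsilon> = - 1"
    \<comment> \<open>Comparison of the two expressions for the Gauss sum, one with q and one with
      powers of \<open>gauss1 1\<close>.\<close>
    have m: "mtype S = gsign S * ?\<xi> ^ n" if S: "S \<in> Sym" "rank S = 2 * n" for S :: "('a, 'd) sqmat"
    proof -
      let ?Q = "of_nat CARD('a) :: complex"
      have "2 * n \<le> CARD('d)" using dim_nullspace[of S] S(2) by simp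
      then have Q: "?Q ^ (CARD('d) - n) * ?Q ^ (2 * n) = ?Q ^ CARD('d) * ?Q ^ n" by (simp add: add.commute flip: power_add)
      have "of_int (mtype S) * (?Q ^ CARD('d) * ?Q ^ n) = gauss S * ?Q ^ rank S"
        unfolding mtype_gauss(1)[OF S] S(2) Q[symmetric] by simp
      also have "\<dots> = of_int (gsign S) * ?Q ^ CARD('d) * gauss1 (1::'a) ^ rank S" by (rule gsign_gauss(1)[OF S(1)])
      also have "gauss1 (1::'a) ^ rank S = (gauss1 (1::'a) ^ 2) ^ n" unfolding S(2) power_mult ..
      also have "of_int (gsign S) * ?Q ^ CARD('d) * (gauss1 (1::'a) ^ 2) ^ n = of_int (gsign S * ?\<xi> ^ n) * (?Q ^ CARD('d) * ?Q ^ n)"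
        unfolding gauss1_sq by (simp add: power_mult_distrib)
      finally show ?thesis by (simp del: of_int_mult of_int_power)
    qed
    have "mtype S = \<epsilon> \<longleftrightarrow> gsign S = \<epsilon> * ?\<xi> ^ n" if "S \<in> Sym" "rank S = 2 * n" for S :: "('a, 'd) sqmat"
    proof -
      have "?\<xi> ^ n = 1 \<or> ?\<xi> ^ n = - 1" using \<xi> by (cases "even n") auto
      then show ?thesis using m[OF that] by auto
    qed
    then have "{S :: ('a, 'd) sqmat. S \<in> Sym \<and> rank S = 2 * n \<and> mtype S = \<epsilon>} = cls UNIV (2 * n) (\<epsilon> * ?\<xi> ^ n)"
      by (auto simp: cls_def U)
    then show "real (card {S :: ('a, 'd::{finite,linorder}) sqmat. S \<in> Sym \<and> rank S = 2 * n \<and> mtype S = \<epsilon>})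
      = pfac q n * qfac q CARD('d) (2 * n) * ((q ^ n + of_int \<epsilon>) / (2 * q ^ n))"
      using ncls_formula[of "UNIV :: 'd set" n] e unfolding ncls_def q_def by auto }
  have mt: "mtype S = 0" if "rank S = Suc (2 * n)" for S :: "('a, 'd) sqmat" using mtype_odd[of S] that by simp
  have "{S :: ('a, 'd) sqmat. S \<in> Sym \<and> rank S = 2 * n + 1 \<and> mtype S = 0} = cls UNIV (2 * n + 1) 1 \<union> cls UNIV (2 * n + 1) (- 1)"
    using gsign_gauss(2) mt by (auto simp: cls_def U)
  moreover have "cls UNIV (2 * n + 1) 1 \<inter> cls UNIV (2 * n + 1) (- 1) = ({} :: ('a, 'd) sqmat set)" by (auto simp: cls_def)
  ultimately have "real (card {S :: ('a, 'd) sqmat. S \<in> Sym \<and> rank S = 2 * n + 1 \<and> mtype S = 0})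
      = ncls (UNIV :: 'd set) (2 * n + 1) 1 + ncls (UNIV :: 'd set) (2 * n + 1) (- 1)"
    by (simp add: ncls_def card_Un_disjoint)
  then show "real (card {S :: ('a, 'd) sqmat. S \<in> Sym \<and> rank S = 2 * n + 1 \<and> mtype S = 0})
      = pfac q n * qfac q CARD('d) (2 * n + 1)"
    using ncls_formula[of "UNIV :: 'd set" n] unfolding q_def by simp
qed

end

subsection \<open>Maximal isotropic subspaces\<close>

definition join :: "('a::field)^'d::finite \<Rightarrow> 'a^'d \<Rightarrow> 'a^('d + 'd)" where
  "join a b = (\<chi> i. case i of Inl m \<Rightarrow> a $ m | Inr m \<Rightarrow> b $ m)"

definition pL :: "('a::field)^('d::finite + 'd) \<Rightarrow> 'a^'d" where
  "pL v = (\<chi> m. v $ Inl m)"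

definition pR :: "('a::field)^('d::finite + 'd) \<Rightarrow> 'a^'d" where
  "pR v = (\<chi> m. v $ Inr m)"

definition Lset :: "(('a::field)^'d::finite) set \<Rightarrow> ('a, 'd) sqmat \<Rightarrow> ('a^('d + 'd)) set" where
  "Lset U F = {join (u + F *v b) b | u b. u \<in> U \<and> b \<in> perp U}"

text \<open>\<open>Lset U F\<close> is \<open>U \<oplus> perp U\<close>, the first summand in the \<open>e\<close>- and the second in the \<open>f\<close>-coordinates, translated by \<open>(I, F)\<close>.\<close>

definition Lg :: "(('a::{field,finite})^'d::finite) set \<Rightarrow> ('a, 'd) sqmat \<Rightarrow> ('a, 'd) lagr" where
  "Lg U F = Abs_lagr (Lset U F)"

text \<open>The intersection of x with x_0, read in the e-coordinates.\<close>

definition base :: "('a::{field,finite}, 'd::finite) lagr \<Rightarrow> ('a^'d) set" where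
  "base x = {a. join a 0 \<in> Rep_lagr x}"

lemma pL_join [simp]: "pL (join a b) = a" and pR_join [simp]: "pR (join a b) = b"
  by (simp_all add: pL_def pR_def join_def vec_eq_iff)

lemma join_pL_pR [simp]: "join (pL v) (pR v) = v"
  by (auto simp: pL_def pR_def join_def vec_eq_iff split: sum.split)

lemma join_eq_iff [simp]: "join a b = join a' b' \<longleftrightarrow> a = a' \<and> b = b'"
  by (metis pL_join pR_join)

lemma join_arith:
  "join a b + join a' b' = join (a + a') (b + b')" "c *s join a b = join (c *s a) (c *s b)"
  "join a b - join a' b' = join (a - a') (b - b')" "join 0 0 = 0"
  by (auto simp: join_def vec_eq_iff split: sum.split)

lemma pL_pR_arith:
  "pL (u + v) = pL u + pL v" "pR (u + v) = pR u + pR v" "pL (c *s v) = c *s pL v" "pR (c *s v) = c *s pR v"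
  by (simp_all add: pL_def pR_def vec_eq_iff)

lemma sum_UNIV_Plus: "(\<Sum>i\<in>(UNIV::('d::finite + 'd) set). f i) = (\<Sum>m\<in>UNIV. f (Inl m)) + (\<Sum>m\<in>UNIV. f (Inr m))"
  unfolding UNIV_Plus_UNIV[symmetric] by (subst sum.Plus) auto

lemma sympl_eq: "sympl u v = dot (pL u) (pR v) - dot (pR u) (pL v)"
  by (simp add: sympl_def dot_def pL_def pR_def sum_subtractf)

lemma sympl_join [simp]: "sympl (join a b) (join a' b') = dot a b' - dot b a'"
  by (simp add: sympl_eq)

lemma mem_Lset: "v \<in> Lset U F \<longleftrightarrow> pR v \<in> perp U \<and> pL v - F *v pR v \<in> U"
proof
  assume "pR v \<in> perp U \<and> pL v - F *v pR v \<in> U"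
  moreover have "v = join ((pL v - F *v pR v) + F *v pR v) (pR v)" by simp
  ultimately show "v \<in> Lset U F" unfolding Lset_def by blast
qed (auto simp: Lset_def)

lemma subspace_Lset: "vec.subspace U \<Longrightarrow> vec.subspace (Lset U F)"
proof -
  assume U: "vec.subspace U"
  have "0 \<in> Lset U F" using vec.subspace_0[OF U] by (simp add: mem_Lset perp_def flip: join_arith(4))
  moreover have "u + v \<in> Lset U F" if "u \<in> Lset U F" "v \<in> Lset U F" for u v
  proof -
    have "(pL u - F *v pR u) + (pL v - F *v pR v) \<in> U" using that vec.subspace_add[OF U] by (simp add: mem_Lset)
    moreover have "pR u + pR v \<in> perp U"
      by (rule vec.subspace_add[OF subspace_perp]) (use that in \<open>simp_all add: mem_Lset\<close>)
    ultimately show ?thesis by (simp add: mem_Lset pL_pR_arith matrix_vector_right_distrib algebra_simps)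
  qed
  moreover have "c *s u \<in> Lset U F" if "u \<in> Lset U F" for c u
  proof -
    have "c *s (pL u - F *v pR u) \<in> U"
      by (rule vec.subspace_scale[OF U]) (use that in \<open>simp add: mem_Lset\<close>)
    moreover have "c *s pR u \<in> perp U"
      by (rule vec.subspace_scale[OF subspace_perp]) (use that in \<open>simp_all add: mem_Lset\<close>)
    ultimately show ?thesis by (simp add: mem_Lset pL_pR_arith vec.scale vec.scale_right_diff_distrib)
  qed
  ultimately show ?thesis by (simp add: vec.subspace_def)
qed

context odd_prime_field
begin

text \<open>Isotropy is the symmetry of F. For maximality, a vector orthogonal to U has its f-part
  in \<open>perp U\<close>, and orthogonality to the graph of F puts the rest of it into the double
  \<open>perp\<close> of U.\<close>

lemma max_isotropic_Lset:
  fixes F :: "('a, 'd::finite) sqmat"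
  assumes U: "vec.subspace U" and F: "F \<in> Sym"
  shows "max_isotropic (Lset U F)"
  unfolding max_isotropic_def
proof (intro conjI allI impI)
  show "isotropic (Lset U F)"
    unfolding isotropic_def
  proof (intro conjI ballI)
    show "vec.subspace (Lset U F)" by (rule subspace_Lset[OF U])
    fix v w assume "v \<in> Lset U F" "w \<in> Lset U F"
    then obtain u b u' b' where v: "v = join (u + F *v b) b" "u \<in> U" "b \<in> perp U"
      and w: "w = join (u' + F *v b') b'" "u' \<in> U" "b' \<in> perp U" by (auto simp: Lset_def)
    have "dot u b' = 0" "dot b u' = 0" using v w by (auto simp: perp_def dot_commute)
    moreover have "dot (F *v b) b' = dot b (F *v b')" using dot_sym[OF F, of b b'] by (simp add: dot_commute)
    ultimately show "sympl v w = 0" by (simp add: v w)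
  qed
  fix y assume y: "isotropic y" "Lset U F \<subseteq> y"
  have "v \<in> Lset U F" if v: "v \<in> y" for v
  proof -
    have s: "sympl w v = 0" if "w \<in> Lset U F" for w using y v that by (auto simp: isotropic_def)
    have z: "0 \<in> perp U" "0 \<in> U" using vec.subspace_0 U by (auto simp: perp_def)
    have 1: "pR v \<in> perp U"
      using s[of "join u 0" for u] z by (auto simp: perp_def sympl_eq mem_Lset)
    have "dot (pL v - F *v pR v) b' = 0" if "b' \<in> perp U" for b'
      using s[of "join (F *v b') b'"] that z dot_sym[OF F, of "pR v" b'] by (simp add: sympl_eq mem_Lset dot_commute)
    then have "pL v - F *v pR v \<in> perp (perp U)" by (simp add: perp_def dot_commute)
    then show ?thesis using 1 perp_perp[OF U] by (simp add: mem_Lset)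
  qed
  then show "y = Lset U F" using y by blast
qed

lemma Rep_Lg:
  fixes F :: "('a, 'd::finite) sqmat"
  assumes "vec.subspace U" "F \<in> Sym"
  shows "Rep_lagr (Lg U F) = Lset U F"
  unfolding Lg_def by (rule Abs_lagr_inverse) (simp add: max_isotropic_Lset[OF assms])

lemma base_Lg:
  fixes F :: "('a, 'd::finite) sqmat"
  assumes "vec.subspace U" "F \<in> Sym"
  shows "base (Lg U F) = U"
  by (auto simp: base_def Rep_Lg[OF assms] mem_Lset perp_def)

lemma Lg_eq_iff:
  fixes F F' :: "('a, 'd::finite) sqmat"
  assumes "vec.subspace U" "F \<in> Sym" "vec.subspace U'" "F' \<in> Sym"
  shows "Lg U F = Lg U' F' \<longleftrightarrow> U = U' \<and> (\<forall>b\<in>perp U. (F - F') *v b \<in> U)"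
proof
  assume e: "Lg U F = Lg U' F'"
  then have U: "U = U'" using base_Lg assms by metis
  have "(F - F') *v b \<in> U" if b: "b \<in> perp U" for b
  proof -
    have "join (F *v b) b \<in> Lset U F" using b vec.subspace_0[OF assms(1)] by (simp add: mem_Lset)
    then have "join (F *v b) b \<in> Lset U' F'" using e Rep_Lg assms by metis
    then show ?thesis by (simp add: mem_Lset U matrix_vector_mult_diff_rdistrib)
  qed
  then show "U = U' \<and> (\<forall>b\<in>perp U. (F - F') *v b \<in> U)" using U by blast
next
  assume e: "U = U' \<and> (\<forall>b\<in>perp U. (F - F') *v b \<in> U)"
  have "v \<in> Lset U F \<longleftrightarrow> v \<in> Lset U F'" for v
  proof (cases "pR v \<in> perp U")
    case True
    then have "(F - F') *v pR v \<in> U" using e by blast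
    moreover have "pL v - F' *v pR v = (pL v - F *v pR v) + (F - F') *v pR v"
      "pL v - F *v pR v = (pL v - F' *v pR v) - (F - F') *v pR v"
      by (simp_all add: matrix_vector_mult_diff_rdistrib)
    ultimately show ?thesis using vec.subspace_add[OF assms(1)] vec.subspace_diff[OF assms(1)] True unfolding mem_Lset by metis
  qed (simp add: mem_Lset)
  then have "Lset U F = Lset U F'" by blast
  then show "Lg U F = Lg U' F'" using e by (simp add: Lg_def)
qed

text \<open>A maximal isotropic x is its own orthogonal space; hence its f-parts fill exactly
  \<open>perp\<close> of U = \<open>base x\<close>. A linear section over \<open>perp U\<close>
  gives a symmetric form there, which is then extended to a symmetric matrix.\<close>

lemma lagr_cases:
  fixes x :: "('a, 'd::finite) lagr"
  obtains U F where "vec.subspace U" "F \<in> Sym" "x = Lg U F"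
proof -
  let ?x = "Rep_lagr x"
  have mi: "max_isotropic ?x" using Rep_lagr[of x] by simp
  then have sx: "vec.subspace ?x" and iso: "\<And>u v. u \<in> ?x \<Longrightarrow> v \<in> ?x \<Longrightarrow> sympl u v = 0"
    and mx: "\<And>y. isotropic y \<Longrightarrow> ?x \<subseteq> y \<Longrightarrow> y = ?x" by (auto simp: max_isotropic_def isotropic_def)
  \<comment> \<open>Adjoining an orthogonal vector keeps x isotropic, so by maximality it was in x
    already.\<close>
  have self: "v \<in> ?x" if v: "\<And>w. w \<in> ?x \<Longrightarrow> sympl v w = 0" for v
  proof -
    let ?y = "vec.span (insert v ?x)"
    have y: "w \<in> ?y \<longleftrightarrow> (\<exists>k. w - k *s v \<in> ?x)" for w
      using sx by (simp add: vec.span_breakdown_eq vec.span_eq_iff[THEN iffD2])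
    have sym: "sympl w v = - sympl v w" for w by (simp add: sympl_eq dot_commute)
    have lin: "sympl (a + k *s v) (b + l *s v) = sympl a b + l * sympl a v + k * sympl v b + k * l * sympl v v" for a b k l
      by (simp add: sympl_eq pL_pR_arith algebra_simps)
    have "sympl a b = 0" if "a \<in> ?y" "b \<in> ?y" for a b
    proof -
      from that y obtain k l where k: "a - k *s v \<in> ?x" and l: "b - l *s v \<in> ?x" by blast
      have "sympl ((a - k *s v) + k *s v) ((b - l *s v) + l *s v) = 0"
        unfolding lin using iso[OF k l] v[OF k] v[OF l] sym[of "a - k *s v"] by (simp add: sympl_eq dot_commute)
      then show ?thesis by simp
    qed
    then have "isotropic ?y" by (simp add: isotropic_def vec.subspace_span)
    moreover have "?x \<subseteq> ?y" by (auto intro: vec.span_base)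
    ultimately have "?y = ?x" by (rule mx)
    moreover have "v \<in> ?y" by (simp add: vec.span_base)
    ultimately show ?thesis by simp
  qed
  define U where "U = base x"
  have memU: "a \<in> U \<longleftrightarrow> join a 0 \<in> ?x" for a by (simp add: U_def base_def)
  have U: "vec.subspace U"
    unfolding vec.subspace_def memU
  proof (intro conjI ballI allI)
    show "join 0 0 \<in> ?x" using vec.subspace_0[OF sx] by (simp add: join_arith)
    fix a assume a: "a \<in> U"
    show "join (c *s a) 0 \<in> ?x" for c
      using vec.subspace_scale[OF sx, of "join a 0" c] a by (simp add: memU join_arith)
    fix b assume b: "b \<in> U"
    show "join (a + b) 0 \<in> ?x"
      using vec.subspace_add[OF sx, of "join a 0" "join b 0"] a b by (simp add: memU join_arith)
  qed
  have sP: "vec.subspace (pR ` ?x)"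
  proof -
    have "0 \<in> pR ` ?x" using vec.subspace_0[OF sx] by (intro image_eqI[of _ _ 0]) (auto simp: pR_def vec_eq_iff)
    moreover have "a + b \<in> pR ` ?x" if "a \<in> pR ` ?x" "b \<in> pR ` ?x" for a b
      using that vec.subspace_add[OF sx] by (auto simp flip: pL_pR_arith)
    moreover have "c *s a \<in> pR ` ?x" if "a \<in> pR ` ?x" for a c
      using that vec.subspace_scale[OF sx] by (auto simp flip: pL_pR_arith)
    ultimately show ?thesis by (simp add: vec.subspace_def)
  qed
  have "perp (pR ` ?x) \<subseteq> U"
  proof
    fix a assume "a \<in> perp (pR ` ?x)"
    then have "sympl (join a 0) w = 0" if "w \<in> ?x" for w using that by (auto simp: perp_def sympl_eq dot_commute)
    then show "a \<in> U" unfolding memU by (rule self)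
  qed
  then have pU: "perp U \<subseteq> pR ` ?x" using perp_antimono perp_perp[OF sP] by metis
  have Up: "pR v \<in> perp U" if "v \<in> ?x" for v
    using iso[of "join u 0" v for u] that by (auto simp: perp_def memU sympl_eq)
  have linR: "Vector_Spaces.linear (*s) (*s) (pR :: 'a^('d + 'd) \<Rightarrow> 'a^'d)"
    by unfold_locales (simp_all add: pL_pR_arith)
  obtain g where g: "range g \<subseteq> ?x" "Vector_Spaces.linear (*s) (*s) g" "\<forall>b\<in>pR ` ?x. pR (g b) = b"
    using vec.linear_exists_right_inverse_on[OF linR sx] by blast
  obtain P where P: "range P \<subseteq> perp U" "Vector_Spaces.linear (*s) (*s) P" "\<forall>b\<in>perp U. P b = b"
    using vec.linear_exists_right_inverse_on[OF vec.linear_id subspace_perp, of U] by auto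
  define h where "h = pL \<circ> g"
  have linh: "Vector_Spaces.linear (*s) (*s) h"
    using g(2) unfolding h_def Vector_Spaces.linear_iff by (simp add: pL_pR_arith)
  have gx: "join (h b) b \<in> ?x" if "b \<in> perp U" for b
    using g that pU join_pL_pR[of "g b"] unfolding h_def comp_def by (metis range_subsetD subsetD)
  \<comment> \<open>The section h is symmetric only as a form on \<open>perp U\<close>; composing
    with the projection P on both sides extends that form. F b and h b then agree modulo U, which
    suffices.\<close>
  define F where "F = transpose (matrix P) ** matrix h ** matrix P"
  have MP: "matrix P *v v = P v" "matrix h *v v = h v" for v
    using matrix_works[OF P(2)] matrix_works[OF linh] by auto
  have Fd: "dot b' (F *v b) = dot (P b') (h (P b))" for b b'
  proof -
    have "F *v b = transpose (matrix P) *v (matrix h *v (matrix P *v b))"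
      by (simp only: F_def matrix_vector_mul_assoc matrix_mul_assoc)
    then show ?thesis by (simp only: dot_matrix_vector[of b'] transpose_transpose MP)
  qed
  have hs: "dot b' (h b) = dot b (h b')" if "b \<in> perp U" "b' \<in> perp U" for b b'
    using iso[OF gx[OF that(1)] gx[OF that(2)]] by (simp add: dot_commute)
  have F: "F \<in> Sym"
    unfolding Sym_iff
  proof (intro allI)
    fix i j
    have "P (axis i 1) \<in> perp U" "P (axis j 1) \<in> perp U" using P(1) by auto
    from hs[OF this] have "dot (axis i 1) (F *v axis j 1) = dot (axis j 1) (F *v axis i 1)"
      unfolding Fd by simp
    then show "F $ i $ j = F $ j $ i" by (simp only: dot_axis_mult)
  qed
  have "?x \<subseteq> Lset U F"
  proof
    fix v assume v: "v \<in> ?x"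
    let ?b = "pR v"
    have b: "?b \<in> perp U" by (rule Up[OF v])
    have "v - join (h ?b) ?b \<in> ?x" using v gx[OF b] vec.subspace_diff[OF sx] by blast
    moreover have "v - join (h ?b) ?b = join (pL v - h ?b) 0"
      by (subst join_pL_pR[of v, symmetric]) (simp only: join_arith diff_self)
    ultimately have 1: "pL v - h ?b \<in> U" by (simp add: memU)
    have "dot b' (h ?b - F *v ?b) = 0" if "b' \<in> perp U" for b'
      using that b P(3) Fd[of b' ?b] by simp
    then have "h ?b - F *v ?b \<in> perp (perp U)" by (simp add: perp_def)
    then have "h ?b - F *v ?b \<in> U" using perp_perp[OF U] by simp
    from vec.subspace_add[OF U 1 this] have "pL v - F *v ?b \<in> U" by simp
    then show "v \<in> Lset U F" using b by (simp add: mem_Lset)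
  qed
  moreover have "isotropic (Lset U F)" using max_isotropic_Lset[OF U F] by (simp add: max_isotropic_def)
  ultimately have "Lset U F = ?x" by (intro mx)
  then have "x = Lg U F" unfolding Lg_def by (simp add: Rep_lagr_inverse)
  then show ?thesis using that U F by blast
qed

end

section \<open>The group action and the adjacency relation\<close>

definition rad :: "(('a::field)^'d::finite) set \<Rightarrow> ('a, 'd) sqmat \<Rightarrow> ('a^'d) set" where
  "rad T G = {b \<in> perp T. G *v b \<in> T}"

lemma matrix_inv_works:
  assumes "invertible (A :: ('a::field, 'n::finite) sqmat)"
  shows "A ** matrix_inv A = mat 1" "matrix_inv A ** A = mat 1"
proof -
  have "\<exists>B. A ** B = mat 1 \<and> B ** A = mat 1" using assms by (simp add: invertible_def)
  then have "A ** matrix_inv A = mat 1 \<and> matrix_inv A ** A = mat 1" unfolding matrix_inv_def by (rule someI_ex)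
  then show "A ** matrix_inv A = mat 1" "matrix_inv A ** A = mat 1" by auto
qed

lemma block_mult: "block P Q R S *v join a b = join (P *v a + Q *v b) (R *v a + S *v b)"
proof (rule vec_eq_iff[THEN iffD2], rule allI)
  fix i
  have "(block P Q R S *v join a b) $ i = (\<Sum>m\<in>UNIV. block P Q R S $ i $ Inl m * a $ m) + (\<Sum>m\<in>UNIV. block P Q R S $ i $ Inr m * b $ m)"
    unfolding matrix_vector_mult_def vec_lambda_beta sum_UNIV_Plus by (simp add: join_def)
  then show "(block P Q R S *v join a b) $ i = join (P *v a + Q *v b) (R *v a + S *v b) $ i"
    by (cases i) (simp_all add: block_def join_def matrix_vector_mult_def)
qed

lemma spm_mult: "spm C F *v join a b = join (C *v (a + F *v b)) (matrix_inv (transpose C) *v b)"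
  unfolding spm_def matrix_vector_mul_assoc[symmetric] block_mult by simp

lemma subspace_rad: "vec.subspace T \<Longrightarrow> vec.subspace (rad T G)"
  using subspace_perp[of T]
  by (auto simp: rad_def vec.subspace_def matrix_vector_right_distrib vec.scale)

context odd_prime_field
begin

text \<open>The inverse transpose of C carries \<open>perp U\<close> onto \<open>perp\<close> of C
  U, and F is transported as a bilinear form.\<close>

lemma image_spm:
  fixes C F F' :: "('a, 'd::finite) sqmat"
  assumes C: "invertible C"
  shows "(*v) (spm C F') ` Lset U F = Lset ((*v) C ` U) (C ** (F + F') ** transpose C)"
proof -
  let ?B = "matrix_inv (transpose C)"
  have iC: "invertible (transpose C)" using C by (simp add: invertible_det_nz)
  have BC: "?B *v (transpose C *v v) = v" "transpose C *v (?B *v v) = v" for v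
    by (simp_all only: matrix_vector_mul_assoc matrix_inv_works[OF iC] matrix_vector_mul_lid)
  have perp: "b \<in> perp U \<longleftrightarrow> ?B *v b \<in> perp ((*v) C ` U)" for b
  proof -
    have "dot (C *v u) (?B *v b) = dot u b" for u
      by (subst dot_commute, subst dot_matrix_vector, subst BC, rule dot_commute)
    then show ?thesis by (simp add: perp_def)
  qed
  have F2: "(C ** (F + F') ** transpose C) *v (?B *v b) = C *v (F *v b) + C *v (F' *v b)" for b
    by (simp only: matrix_vector_mul_assoc[symmetric] BC matrix_vector_mult_add_rdistrib matrix_vector_right_distrib)
  show ?thesis
  proof (rule set_eqI, rule iffI)
    fix v assume "v \<in> (*v) (spm C F') ` Lset U F"
    then obtain u b where u: "u \<in> U" "b \<in> perp U" "v = spm C F' *v join (u + F *v b) b" by (auto simp: Lset_def)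
    then have "v = join (C *v u + (C ** (F + F') ** transpose C) *v (?B *v b)) (?B *v b)"
      by (simp add: spm_mult F2 matrix_vector_right_distrib)
    then show "v \<in> Lset ((*v) C ` U) (C ** (F + F') ** transpose C)"
      using u perp unfolding Lset_def by blast
  next
    fix v assume "v \<in> Lset ((*v) C ` U) (C ** (F + F') ** transpose C)"
    then obtain u b where u: "u \<in> U" "b \<in> perp ((*v) C ` U)"
      "v = join (C *v u + (C ** (F + F') ** transpose C) *v b) b" by (auto simp: Lset_def)
    let ?b = "transpose C *v b"
    have "v = spm C F' *v join (u + F *v ?b) ?b"
      using F2[of ?b] unfolding u(3) by (simp add: spm_mult BC matrix_vector_right_distrib del: transpose_matrix_vector)
    moreover have "?b \<in> perp U" using u(2) perp[of ?b] by (simp only: BC)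
    ultimately show "v \<in> (*v) (spm C F') ` Lset U F" using u(1) unfolding Lset_def by blast
  qed
qed

lemma act_spm:
  fixes C F F' :: "('a, 'd::finite) sqmat"
  assumes C: "invertible C" and F: "F \<in> Sym" and U: "vec.subspace U"
  shows "act (spm C F') (Lg U F) = Lg ((*v) C ` U) (C ** (F + F') ** transpose C)"
  unfolding act_def Rep_Lg[OF U F] unfolding Lg_def image_spm[OF C] ..

lemma invertible_1: "invertible (mat 1 :: ('a, 'n::finite) sqmat)"
  unfolding invertible_def by (rule exI[of _ "mat 1"]) simp

lemma translate:
  fixes F G :: "('a, 'd::finite) sqmat"
  assumes "F \<in> Sym" "vec.subspace U"
  shows "act (spm (mat 1) G) (Lg U F) = Lg U (F + G)"
  using act_spm[OF invertible_1 assms] by (simp add: transpose_mat)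

lemma Sym_closed:
  fixes F G :: "('a, 'd::finite) sqmat"
  shows "F \<in> Sym \<Longrightarrow> G \<in> Sym \<Longrightarrow> F + G \<in> Sym" "F \<in> Sym \<Longrightarrow> G \<in> Sym \<Longrightarrow> F - G \<in> Sym" "0 \<in> Sym" "F \<in> Sym \<Longrightarrow> - F \<in> Sym"
  by (auto simp: Sym_iff)

lemma adj_translate:
  fixes F F' G :: "('a, 'd::finite) sqmat"
  assumes "F \<in> Sym" "F' \<in> Sym" "G \<in> Sym" "vec.subspace U" "vec.subspace U'"
  shows "adj (Lg U (F + G)) (Lg U' (F' + G)) \<longleftrightarrow> adj (Lg U F) (Lg U' F')"
proof -
  let ?g = "(*v) (spm (mat 1) G)"
  have R: "Lset U (F + G) = ?g ` Lset U F" for U and F :: "('a, 'd) sqmat"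
    by (simp add: image_spm[OF invertible_1] transpose_mat)
  have inj: "inj ?g"
  proof (rule injI)
    fix v w assume e: "?g v = ?g w"
    have J: "?g (join a b) = join (a + G *v b) b" for a b
    proof -
      have "matrix_inv (mat 1 :: ('a, 'd) sqmat) = mat 1" using matrix_inv_works(1)[OF invertible_1] by simp
      then show ?thesis by (simp add: spm_mult transpose_mat)
    qed
    have "?g (join (pL v) (pR v)) = ?g (join (pL w) (pR w))" using e by simp
    then have "pL v + G *v pR v = pL w + G *v pR w" "pR v = pR w" unfolding J join_eq_iff by auto
    then have "pL v = pL w" by simp
    then have "join (pL v) (pR v) = join (pL w) (pR w)" using \<open>pR v = pR w\<close> by (simp only:)
    then show "v = w" by (simp only: join_pL_pR)
  qed
  have s: "vec.subspace (Lset U F \<inter> Lset U' F')" "vec.subspace (Lset U (F + G) \<inter> Lset U' (F' + G))"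
    by (intro vec.subspace_inter subspace_Lset assms)+
  have "card (Lset U (F + G) \<inter> Lset U' (F' + G)) = card (Lset U F \<inter> Lset U' F')"
    unfolding R image_Int[OF inj, symmetric] by (rule card_image) (rule inj_on_subset[OF inj], simp)
  then have "vec.dim (Lset U (F + G) \<inter> Lset U' (F' + G)) = vec.dim (Lset U F \<inter> Lset U' F')"
    unfolding card_subspace[OF s(1)] card_subspace[OF s(2)] using q_gt_2 by simp
  then show ?thesis using assms by (simp add: adj_def Rep_Lg Sym_closed)
qed

text \<open>The f-parts of common vectors are the b in \<open>perp (U + U')\<close> with G b in U +
  U'. Above each such b the e-parts form a coset of U \<inter> U'.\<close>

lemma dim_Lset_Int:
  fixes G :: "('a, 'd::finite) sqmat"
  assumes U: "vec.subspace U" and U': "vec.subspace U'"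
  shows "vec.dim (Lset U 0 \<inter> Lset U' G) = vec.dim (U \<inter> U') + vec.dim (rad (ssum U U') G)"
proof -
  let ?Y = "rad (ssum U U') G"
  have sY: "vec.subspace ?Y" by (rule subspace_rad[OF subspace_ssum[OF U U']])
  have "\<exists>a\<in>U. a - G *v b \<in> U'" if b: "b \<in> ?Y" for b
  proof -
    obtain a a' where "a \<in> U" "a' \<in> U'" "G *v b = a + a'" using b by (auto simp: rad_def ssum_def)
    then show ?thesis using vec.subspace_neg[OF U'] by (intro bexI[of _ a]) auto
  qed
  then have "\<forall>b\<in>?Y. \<exists>a. a \<in> U \<and> a - G *v b \<in> U'" by blast
  from bchoice[OF this] obtain s where s: "\<forall>b\<in>?Y. s b \<in> U \<and> s b - G *v b \<in> U'" by blast
  \<comment> \<open>\<open>s b\<close> is one chosen e-part above b; c runs through U \<inter>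
    U'.\<close>
  let ?f = "\<lambda>(c, b). join (s b + c) b"
  have "?f ` ((U \<inter> U') \<times> ?Y) = Lset U 0 \<inter> Lset U' G"
  proof (intro set_eqI iffI)
    fix v assume "v \<in> ?f ` ((U \<inter> U') \<times> ?Y)"
    then obtain c b where v: "v = join (s b + c) b" "c \<in> U" "c \<in> U'" "b \<in> ?Y" by auto
    have b: "b \<in> perp U" "b \<in> perp U'" using v(4) perp_ssum[OF U U'] by (auto simp: rad_def)
    have "(s b - G *v b) + c \<in> U'" using s v vec.subspace_add[OF U'] by blast
    moreover have "s b + c \<in> U" using s v vec.subspace_add[OF U] by blast
    ultimately show "v \<in> Lset U 0 \<inter> Lset U' G" using v b by (simp add: mem_Lset algebra_simps)
  next
    fix v assume "v \<in> Lset U 0 \<inter> Lset U' G"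
    then have v: "pR v \<in> perp U" "pL v \<in> U" "pR v \<in> perp U'" "pL v - G *v pR v \<in> U'" by (simp_all add: mem_Lset)
    have "- (pL v - G *v pR v) \<in> U'" using v(4) vec.subspace_neg[OF U'] by blast
    then have "pL v + - (pL v - G *v pR v) \<in> ssum U U'" using v(2) unfolding ssum_def by blast
    then have b: "pR v \<in> ?Y" using v(1,3) by (simp add: rad_def perp_ssum[OF U U'])
    then have "pL v - s (pR v) \<in> U" using s v(2) vec.subspace_diff[OF U] by blast
    moreover have "(pL v - G *v pR v) - (s (pR v) - G *v pR v) \<in> U'" using s b v(4) vec.subspace_diff[OF U'] by blast
    ultimately have "(pL v - s (pR v), pR v) \<in> (U \<inter> U') \<times> ?Y" using b by simp
    moreover have "v = ?f (pL v - s (pR v), pR v)" by simp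
    ultimately show "v \<in> ?f ` ((U \<inter> U') \<times> ?Y)" by blast
  qed
  moreover have "inj_on ?f ((U \<inter> U') \<times> ?Y)" by (auto simp: inj_on_def)
  ultimately have "card (Lset U 0 \<inter> Lset U' G) = card (U \<inter> U') * card ?Y"
    using card_image[of ?f "(U \<inter> U') \<times> ?Y"] by (simp only: card_cartesian_product)
  then have "CARD('a) ^ vec.dim (Lset U 0 \<inter> Lset U' G) = CARD('a) ^ (vec.dim (U \<inter> U') + vec.dim ?Y)"
    by (simp add: card_subspace sY vec.subspace_inter subspace_Lset U U' power_add)
  then show ?thesis using q_gt_2 by simp
qed

text \<open>Only one dimension may be lost. Either it separates U from U', and then the form of G on
  \<open>perp (U + U')\<close> is zero, or U = U' and that form has rank one.\<close>

lemma adj_iff: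
  fixes G :: "('a, 'd::finite) sqmat"
  assumes U: "vec.subspace U" and U': "vec.subspace U'" and G: "G \<in> Sym"
  shows "adj (Lg U 0) (Lg U' G) \<longleftrightarrow>
    (cov U U' \<and> (\<forall>b\<in>perp U'. G *v b \<in> U')) \<or> (cov U' U \<and> (\<forall>b\<in>perp U. G *v b \<in> U)) \<or>
    (U = U' \<and> vec.dim (rad U G) + 1 = vec.dim (perp U))"
proof -
  let ?T = "ssum U U'" and ?D = "CARD('d)"
  let ?Y = "rad ?T G"
  have sT: "vec.subspace ?T" by (rule subspace_ssum[OF U U'])
  have D: "?D > 0" by simp
  have a: "adj (Lg U 0) (Lg U' G) \<longleftrightarrow> vec.dim (U \<inter> U') + vec.dim ?Y = ?D - 1"
    unfolding adj_def Rep_Lg[OF U Sym_closed(3)] Rep_Lg[OF U' G] dim_Lset_Int[OF U U'] ..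
  have Yp: "?Y \<subseteq> perp ?T" by (auto simp: rad_def)
  have Yd: "vec.dim ?Y \<le> vec.dim (perp ?T)" by (rule vec.dim_subset[OF Yp])
  have dT: "vec.dim ?T + vec.dim (perp ?T) = ?D" by (rule dim_perp[OF sT])
  have ds: "vec.dim ?T + vec.dim (U \<inter> U') = vec.dim U + vec.dim U'" by (rule dim_ssum[OF U U'])
  have le: "vec.dim U \<le> vec.dim ?T" "vec.dim U' \<le> vec.dim ?T" "vec.dim (U \<inter> U') \<le> vec.dim U" "vec.dim (U \<inter> U') \<le> vec.dim U'"
    using ssum_upper[OF U U'] by (auto intro: vec.dim_subset)
  have sub1: "?T = U' \<and> U \<inter> U' = U" if "U \<subseteq> U'"
    using that ssum_upper[OF U U'] ssum_least[OF U' that order_refl] by auto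
  have sub2: "?T = U \<and> U \<inter> U' = U'" if "U' \<subseteq> U"
    using that ssum_upper[OF U U'] ssum_least[OF U order_refl that] by auto
  have full: "(\<forall>b\<in>perp ?T. G *v b \<in> ?T) \<longleftrightarrow> vec.dim ?Y = vec.dim (perp ?T)"
  proof
    assume "\<forall>b\<in>perp ?T. G *v b \<in> ?T"
    then have "?Y = perp ?T" by (auto simp: rad_def)
    then show "vec.dim ?Y = vec.dim (perp ?T)" by simp
  next
    assume "vec.dim ?Y = vec.dim (perp ?T)"
    then have "?Y = perp ?T" using vec.subspace_dim_equal[OF subspace_rad[OF sT] subspace_perp Yp] by simp
    then show "\<forall>b\<in>perp ?T. G *v b \<in> ?T" by (auto simp: rad_def)
  qed
  show ?thesis
  proof
    assume "adj (Lg U 0) (Lg U' G)"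
    then have e: "vec.dim (U \<inter> U') + vec.dim ?Y = ?D - 1" using a by simp
    have *: "U' \<subseteq> U" if "vec.dim (U \<inter> U') = vec.dim U'"
      using vec.subspace_dim_equal[OF vec.subspace_inter[OF U U'] U'] that by auto
    have **: "U \<subseteq> U'" if "vec.dim (U \<inter> U') = vec.dim U"
      using vec.subspace_dim_equal[OF vec.subspace_inter[OF U U'] U] that by auto
    \<comment> \<open>The radical has dimension at most D - dim T, so dim T exceeds dim (U \<inter>
      U') by at most 1.\<close>
    have "vec.dim ?T = vec.dim (U \<inter> U') \<or> vec.dim ?T = vec.dim (U \<inter> U') + 1"
      using e Yd dT D le by linarith
    then show "(cov U U' \<and> (\<forall>b\<in>perp U'. G *v b \<in> U')) \<or> (cov U' U \<and> (\<forall>b\<in>perp U. G *v b \<in> U)) \<or>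
      (U = U' \<and> vec.dim (rad U G) + 1 = vec.dim (perp U))"
    proof
      assume t: "vec.dim ?T = vec.dim (U \<inter> U')"
      then have "vec.dim (U \<inter> U') = vec.dim U" "vec.dim (U \<inter> U') = vec.dim U'" using le by linarith+
      then have "U = U'" using * ** by blast
      moreover have "vec.dim ?Y + 1 = vec.dim (perp ?T)" using t e dT D by linarith
      ultimately show ?thesis using sub1 by simp
    next
      assume t: "vec.dim ?T = vec.dim (U \<inter> U') + 1"
      then have "vec.dim ?Y = vec.dim (perp ?T)" using e dT D by linarith
      then have f: "\<forall>b\<in>perp ?T. G *v b \<in> ?T" using full by simp
      have "vec.dim (U \<inter> U') = vec.dim U \<or> vec.dim (U \<inter> U') = vec.dim U'" using t ds le by linarith
      then show ?thesis
      proof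
        assume u: "vec.dim (U \<inter> U') = vec.dim U"
        have "?T = U'" using sub1[OF **[OF u]] by simp
        then show ?thesis using **[OF u] t u f by (simp add: cov_def)
      next
        assume u: "vec.dim (U \<inter> U') = vec.dim U'"
        have "?T = U" using sub2[OF *[OF u]] by simp
        then show ?thesis using *[OF u] t u f by (simp add: cov_def)
      qed
    qed
  next
    assume "(cov U U' \<and> (\<forall>b\<in>perp U'. G *v b \<in> U')) \<or> (cov U' U \<and> (\<forall>b\<in>perp U. G *v b \<in> U)) \<or>
      (U = U' \<and> vec.dim (rad U G) + 1 = vec.dim (perp U))"
    then consider "cov U U'" "\<forall>b\<in>perp U'. G *v b \<in> U'" | "cov U' U" "\<forall>b\<in>perp U. G *v b \<in> U"
      | "U = U'" "vec.dim (rad U G) + 1 = vec.dim (perp U)" by blast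
    then show "adj (Lg U 0) (Lg U' G)"
    proof cases
      case 1
      then have s: "?T = U'" "U \<inter> U' = U" using sub1 by (auto simp: cov_def)
      have "vec.dim ?Y = vec.dim (perp ?T)" using full 1(2) s(1) by simp
      then show ?thesis unfolding a using s dT 1(1) D by (simp add: cov_def)
    next
      case 2
      then have s: "?T = U" "U \<inter> U' = U'" using sub2 by (auto simp: cov_def)
      have "vec.dim ?Y = vec.dim (perp ?T)" using full 2(2) s(1) by simp
      then show ?thesis unfolding a using s dT 2(1) D by (simp add: cov_def)
    next
      case 3
      then have s: "?T = U" "U \<inter> U' = U" using sub1 by auto
      then show ?thesis unfolding a using dT 3(2) D by simp
    qed
  qed
qed

end

subsection \<open>Adjacency on functions with a fixed character\<close>

definition rank1 :: "'a \<Rightarrow> ('a::field)^'n::finite \<Rightarrow> ('a, 'n) sqmat" where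
  "rank1 c a = (\<chi> i j. c * a $ i * a $ j)"

definition symprod :: "('a::field)^'n::finite \<Rightarrow> 'a^'n \<Rightarrow> ('a, 'n) sqmat" where
  "symprod a u = (\<chi> i j. a $ i * u $ j + u $ i * a $ j)"

lemma rank1_mult: "rank1 c a *v v = (c * dot a v) *s a"
  by (simp add: vec_eq_iff rank1_def matrix_vector_mult_def dot_def sum_distrib_left sum_distrib_right mult_ac)

lemma symprod_mult: "symprod a u *v v = dot u v *s a + dot a v *s u"
  by (simp add: vec_eq_iff symprod_def matrix_vector_mult_def dot_def sum_distrib_left sum_distrib_right sum.distrib distrib_left distrib_right mult_ac)

lemma rank1_Sym: "rank1 c a \<in> Sym" and symprod_Sym: "symprod a u \<in> Sym"
  by (auto simp: Sym_iff rank1_def symprod_def mult_ac add.commute)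

lemma trace_mult: "trace (S ** F) = (\<Sum>i\<in>UNIV. \<Sum>j\<in>UNIV. S $ i $ j * F $ j $ i)"
  by (simp add: trace_def matrix_matrix_mult_def)

lemma trace_rank1: "trace (S ** rank1 c a) = c * qform S a"
  by (simp add: trace_mult rank1_def qform_def dot_def matrix_vector_mult_def sum_distrib_left mult_ac)

lemma trace_symprod: "S \<in> Sym \<Longrightarrow> trace (S ** symprod a u) = 2 * dot a (S *v u)"
proof -
  assume S: "S \<in> Sym"
  have "trace (S ** symprod a u) = dot a (S *v u) + dot u (S *v a)"
    by (simp add: trace_mult symprod_def dot_def matrix_vector_mult_def sum_distrib_left sum.distrib distrib_left mult_ac)
      
  then show ?thesis using dot_sym[OF S, of u a] by simp
qed

lemma card_fibres:
  fixes f :: "'b \<Rightarrow> 'c" and h :: "'c \<Rightarrow> complex"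
  assumes P: "finite P" and k: "\<And>p. p \<in> P \<Longrightarrow> card {p' \<in> P. f p' = f p} = k"
  shows "(\<Sum>p\<in>P. h (f p)) = of_nat k * (\<Sum>x\<in>f ` P. h x)" and "card P = k * card (f ` P)"
proof -
  have "(\<Sum>p\<in>P. h (f p)) = (\<Sum>x\<in>f ` P. \<Sum>p\<in>{p \<in> P. f p = x}. h (f p))"
    by (rule sum.image_gen[OF P])
  also have "\<dots> = (\<Sum>x\<in>f ` P. of_nat k * h x)"
    using k by (intro sum.cong refl) auto
  finally show "(\<Sum>p\<in>P. h (f p)) = of_nat k * (\<Sum>x\<in>f ` P. h x)" by (simp add: sum_distrib_left)
  have "card P = (\<Sum>p\<in>P. 1)" by simp
  also have "\<dots> = (\<Sum>x\<in>f ` P. \<Sum>p\<in>{p \<in> P. f p = x}. 1)"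
    by (rule sum.image_gen[OF P])
  also have "\<dots> = (\<Sum>x\<in>f ` P. k)" using k by (intro sum.cong refl) auto
  finally show "card P = k * card (f ` P)" by simp
qed

context odd_prime_field
begin

lemma exists_projection:
  fixes U :: "('a^'n::finite) set"
  assumes U: "vec.subspace U"
  shows "\<exists>P :: ('a, 'n) sqmat. (\<forall>v. P *v v \<in> U) \<and> (\<forall>u\<in>U. P *v u = u)"
proof -
  obtain p where p: "range p \<subseteq> U" "Vector_Spaces.linear (*s) (*s) p" "\<forall>b\<in>U. p b = b"
    using vec.linear_exists_right_inverse_on[OF vec.linear_id U] by auto
  have "matrix p *v v = p v" for v using matrix_works[OF p(2)] by simp
  then show ?thesis using p by (intro exI[of _ "matrix p"]) auto
qed

text \<open>G S maps into U, hence is fixed by a projection P to U, while S P = 0; cycling the trace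
  gives 0. Thus the phase of S is well defined on maximal isotropic subspaces over U.\<close>

lemma trace_annihilator:
  fixes S G :: "('a, 'd::finite) sqmat"
  assumes S: "S \<in> Sym" and U: "vec.subspace U" "U \<subseteq> nullspace S" and G: "\<forall>b\<in>perp U. G *v b \<in> U"
  shows "trace (S ** G) = 0"
proof -
  obtain P :: "('a, 'd) sqmat" where P: "\<And>v. P *v v \<in> U" "\<And>u. u \<in> U \<Longrightarrow> P *v u = u"
    using exists_projection[OF U(1)] by blast
  have "S *v v \<in> perp U" for v
    using U(2) dot_sym[OF S, of _ v] by (auto simp: perp_def nullspace_def)
  then have "P *v (G *v (S *v v)) = G *v (S *v v)" for v using P(2) G by blast
  then have e: "P ** (G ** S) = G ** S" by (simp add: matrix_eq matrix_vector_mul_assoc matrix_mul_assoc)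
  have "S *v (P *v v) = 0" for v using P(1)[of v] U(2) by (auto simp: nullspace_def)
  then have z: "S ** P = 0" by (simp add: matrix_eq matrix_vector_mul_assoc)
  have "trace (S ** G) = trace (P ** (G ** S))" unfolding e by (rule trace_mul_sym)
  also have "\<dots> = trace ((G ** S) ** P)" by (rule trace_mul_sym)
  also have "(G ** S) ** P = 0" by (simp add: z flip: matrix_mul_assoc)
  finally show ?thesis by (simp add: trace_def)
qed

text \<open>For u in U outside the kernel, \<open>symprod a u\<close> maps \<open>perp U\<close>
  into U and has trace 2 a.(S u) against S; a suitable a makes it non-zero.\<close>

lemma exists_nonzero_trace:
  fixes S :: "('a, 'd::finite) sqmat"
  assumes S: "S \<in> Sym" and U: "vec.subspace U" "\<not> U \<subseteq> nullspace S"
  shows "\<exists>G\<in>Sym. (\<forall>b\<in>perp U. G *v b \<in> U) \<and> trace (S ** G) \<noteq> 0"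
proof -
  obtain u where u: "u \<in> U" "S *v u \<noteq> 0" using U(2) by (auto simp: nullspace_def)
  obtain a where a: "dot (S *v u) a \<noteq> 0" using dot_eq_0_imp[of "S *v u"] u(2) by blast
  have "symprod a u *v b \<in> U" if "b \<in> perp U" for b
    using that u(1) vec.subspace_scale[OF U(1)] by (auto simp: symprod_mult perp_def)
  moreover have "trace (S ** symprod a u) \<noteq> 0"
    using a two_neq_0 by (simp add: trace_symprod[OF S] dot_commute)
  ultimately show ?thesis using symprod_Sym by blast
qed

lemma mem_by_perp: "vec.subspace U \<Longrightarrow> (\<And>b. b \<in> perp U \<Longrightarrow> dot b v = 0) \<Longrightarrow> v \<in> (U :: ('a^'n::finite) set)"
proof -
  assume U: "vec.subspace U" and "\<And>b. b \<in> perp U \<Longrightarrow> dot b v = 0"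
  then have "v \<in> perp (perp U)" by (simp add: perp_def)
  then show ?thesis using perp_perp[OF U] by simp
qed

text \<open>When U covers U', these are the neighbours of \<open>Lg U 0\<close> over U'.\<close>

definition below_nbrs :: "('a^'d::finite) set \<Rightarrow> ('a^'d) set \<Rightarrow> ('a, 'd) lagr set" where
  "below_nbrs U U' = {Lg U' G | G. G \<in> Sym \<and> (\<forall>b\<in>perp U. G *v b \<in> U)}"

lemma perp_cov:
  fixes U U' :: "('a^'d::finite) set"
  assumes "vec.subspace U" "vec.subspace U'" "cov U' U"
  shows "cov (perp U) (perp U')"
  using assms perp_antimono[of U' U] dim_perp[OF assms(1)] dim_perp[OF assms(2)] by (auto simp: cov_def)

text \<open>Let w span \<open>perp U'\<close> over \<open>perp U\<close>. The neighbour is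
  determined by G w modulo U', and every value occurs.\<close>

lemma card_below_nbrs:
  fixes U U' :: "('a^'d::finite) set"
  assumes U: "vec.subspace U" and U': "vec.subspace U'" and cv: "cov U' U"
  shows "card (below_nbrs U U') = CARD('a) ^ (CARD('d) - vec.dim U')"
proof -
  have sub: "U' \<subseteq> U" using cv by (simp add: cov_def)
  have pc: "cov (perp U) (perp U')" by (rule perp_cov[OF U U' cv])
  obtain w where w: "w \<in> perp U'" "w \<notin> perp U"
  proof -
    have "perp U \<noteq> perp U'" using pc by (auto simp: cov_def)
    then show ?thesis using that pc by (auto simp: cov_def)
  qed
  then obtain u1 where u1: "u1 \<in> U" "dot u1 w \<noteq> 0" by (auto simp: perp_def)
  define u where "u = inverse (dot u1 w) *s u1"
  have u: "u \<in> U" "dot u w = 1" using u1 vec.subspace_scale[OF U] by (auto simp: u_def)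
  have pU': "perp U' = vec.span (insert w (perp U))"
    by (rule cov_eq_span_insert[OF subspace_perp subspace_perp pc w])
  \<comment> \<open>A symmetric matrix with \<open>Ga a *v w = a\<close> that maps
    \<open>perp U\<close> into U; the rank-one term removes the surplus multiple of u.\<close>
  define Ga where "Ga a = symprod a u + rank1 (- dot a w) u" for a
  have Ga: "Ga a *v b = dot u b *s a + (dot a b - dot a w * dot u b) *s u" for a b
    by (simp add: Ga_def matrix_vector_mult_add_rdistrib symprod_mult rank1_mult vec.scale_left_diff_distrib algebra_simps)
  have GS: "Ga a \<in> Sym" for a unfolding Ga_def by (intro Sym_closed symprod_Sym rank1_Sym)
  have Gw: "Ga a *v w = a" for a by (simp add: Ga u(2))
  have GU: "\<forall>b\<in>perp U. Ga a *v b \<in> U" for a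
    using u(1) vec.subspace_scale[OF U] by (auto simp: Ga perp_def)
  have eq: "Lg U' (Ga a) = Lg U' (Ga a') \<longleftrightarrow> a - a' \<in> U'" for a a'
  proof -
    have d: "(Ga a - Ga a') *v b = dot u b *s (a - a') + (dot (a - a') b - dot (a - a') w * dot u b) *s u" for b
      by (simp add: matrix_vector_mult_diff_rdistrib Ga algebra_simps vec.scale_left_diff_distrib vec.scale_left_distrib)
    have "(\<forall>b\<in>perp U'. (Ga a - Ga a') *v b \<in> U') \<longleftrightarrow> a - a' \<in> U'"
    proof
      assume "\<forall>b\<in>perp U'. (Ga a - Ga a') *v b \<in> U'"
      then have "(Ga a - Ga a') *v w \<in> U'" using w by blast
      then show "a - a' \<in> U'" by (simp add: matrix_vector_mult_diff_rdistrib Gw)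
    next
      assume e: "a - a' \<in> U'"
      have "(Ga a - Ga a') *v b \<in> U'" if "b \<in> perp U'" for b
      proof -
        have "dot (a - a') b = 0" "dot (a - a') w = 0" using e that w unfolding perp_def by blast+
        then have "(Ga a - Ga a') *v b = dot u b *s (a - a')" unfolding d by (simp only:) simp
        then show ?thesis using vec.subspace_scale[OF U' e, of "dot u b"] by (simp only:)
      qed
      then show "\<forall>b\<in>perp U'. (Ga a - Ga a') *v b \<in> U'" by blast
    qed
    then show ?thesis using Lg_eq_iff[OF U' GS U' GS] by simp
  qed
  have img: "range (\<lambda>a. Lg U' (Ga a)) = below_nbrs U U'"
  proof
    show "range (\<lambda>a. Lg U' (Ga a)) \<subseteq> below_nbrs U U'" unfolding below_nbrs_def using GS GU by blast
    show "below_nbrs U U' \<subseteq> range (\<lambda>a. Lg U' (Ga a))"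
    proof
      fix x assume "x \<in> below_nbrs U U'"
      then obtain G where G: "x = Lg U' G" "G \<in> Sym" "\<forall>b\<in>perp U. G *v b \<in> U" by (auto simp: below_nbrs_def)
      \<comment> \<open>H kills w and maps \<open>perp U\<close> into U; by symmetry it then maps
        \<open>perp U'\<close> into U', so G and \<open>Ga (G *v w)\<close> give the same
        subspace.\<close>
      let ?H = "G - Ga (G *v w)"
      have H: "?H \<in> Sym" using G(2) GS by (intro Sym_closed)
      have Hw: "?H *v w = 0" by (simp add: matrix_vector_mult_diff_rdistrib Gw)
      have HU: "?H *v b \<in> U" if "b \<in> perp U" for b
        using G(3) GU that vec.subspace_diff[OF U] by (simp add: matrix_vector_mult_diff_rdistrib)
      have "?H *v b \<in> U'" if b: "b \<in> perp U'" for b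
      proof (rule mem_by_perp[OF U'])
        obtain k where k: "b - k *s w \<in> perp U"
          using b unfolding pU' by (auto simp: vec.span_breakdown_eq vec.span_eq_iff[THEN iffD2, OF subspace_perp])
        have Hb: "?H *v b = ?H *v (b - k *s w)" using Hw by (simp add: matrix_vector_mult_diff_distrib vec.scale)
        fix b' assume "b' \<in> perp U'"
        then obtain k' where k': "b' - k' *s w \<in> perp U"
          unfolding pU' by (auto simp: vec.span_breakdown_eq vec.span_eq_iff[THEN iffD2, OF subspace_perp])
        have "dot (b' - k' *s w) (?H *v b) = 0" unfolding Hb using HU[OF k] k' by (auto simp: perp_def dot_commute)
        moreover have "dot w (?H *v b) = 0" using dot_sym[OF H, of w b] Hw by simp
        ultimately show "dot b' (?H *v b) = 0" by simp
      qed
      then have "Lg U' G = Lg U' (Ga (G *v w))" using Lg_eq_iff[OF U' G(2) U' GS] by simp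
      then show "x \<in> range (\<lambda>a. Lg U' (Ga a))" using G(1) by blast
    qed
  qed
  have "card {a' \<in> UNIV. Lg U' (Ga a') = Lg U' (Ga a)} = card U'" for a
  proof -
    have "{a' \<in> UNIV. Lg U' (Ga a') = Lg U' (Ga a)} = (\<lambda>v. v + a) ` U'"
    proof (intro set_eqI iffI)
      fix x assume "x \<in> {a' \<in> UNIV. Lg U' (Ga a') = Lg U' (Ga a)}"
      then have "x - a \<in> U'" using eq by simp
      then show "x \<in> (\<lambda>v. v + a) ` U'" by (intro image_eqI[of _ _ "x - a"]) auto
    qed (auto simp: eq)
    then show ?thesis by (simp add: card_image)
  qed
  from card_fibres(2)[OF finite this] have "CARD('a) ^ CARD('d) = CARD('a) ^ vec.dim U' * card (below_nbrs U U')"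
    unfolding img by (simp add: card_subspace U')
  moreover have "CARD('a) ^ CARD('d) = CARD('a) ^ vec.dim U' * CARD('a) ^ (CARD('d) - vec.dim U')"
    using dim_perp[OF U'] by (simp flip: power_add)
  ultimately show ?thesis using q_gt_2 by simp
qed

text \<open>The neighbours of \<open>Lg U 0\<close> over the same U: the form of G on
  \<open>perp U\<close> has rank one.\<close>

definition flat_nbrs :: "('a^'d::finite) set \<Rightarrow> ('a, 'd) lagr set" where
  "flat_nbrs U = {Lg U G | G. G \<in> Sym \<and> vec.dim (rad U G) + 1 = vec.dim (perp U)}"

lemma flat_nbrs_eq:
  fixes U :: "('a^'d::finite) set"
  assumes U: "vec.subspace U"
  shows "flat_nbrs U = (\<lambda>(a, c). Lg U (rank1 c a)) ` ((- U) \<times> (UNIV - {0}))"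
proof
  show "(\<lambda>(a, c). Lg U (rank1 c a)) ` ((- U) \<times> (UNIV - {0})) \<subseteq> flat_nbrs U"
  proof
    fix x assume "x \<in> (\<lambda>(a, c). Lg U (rank1 c a)) ` ((- U) \<times> (UNIV - {0}))"
    then obtain a c where a: "a \<notin> U" and c: "c \<noteq> 0" and x: "x = Lg U (rank1 c a)" by auto
    let ?V = "vec.span (insert a U)"
    have "rad U (rank1 c a) = perp ?V"
    proof (intro set_eqI iffI)
      fix b assume b: "b \<in> rad U (rank1 c a)"
      have "dot a b = 0"
      proof (rule ccontr)
        assume nz: "dot a b \<noteq> 0"
        have "inverse (c * dot a b) *s ((c * dot a b) *s a) \<in> U"
          by (rule vec.subspace_scale[OF U]) (use b in \<open>simp add: rad_def rank1_mult\<close>)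
        moreover have "inverse k *s (k *s a) = a" if "k \<noteq> 0" for k using that by simp
        ultimately show False using nz c a by (metis mult_eq_0_iff)
      qed
      moreover have "b \<in> perp U" using b by (simp add: rad_def)
      ultimately have "?V \<subseteq> {v. dot v b = 0}"
        by (intro vec.span_minimal) (auto simp: perp_def vec.subspace_def)
      then show "b \<in> perp ?V" by (auto simp: perp_def)
    next
      fix b assume b: "b \<in> perp ?V"
      then have "dot a b = 0" "b \<in> perp U" by (auto simp: perp_def intro: vec.span_base)
      then show "b \<in> rad U (rank1 c a)" using vec.subspace_0[OF U] by (simp add: rad_def rank1_mult)
    qed
    then have "vec.dim (rad U (rank1 c a)) + 1 = vec.dim (perp U)"
      using perp_cov[OF vec.subspace_span U cov_span_insert[OF U a]] by (simp add: cov_def)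
    then show "x \<in> flat_nbrs U" unfolding flat_nbrs_def x using rank1_Sym by blast
  qed
  show "flat_nbrs U \<subseteq> (\<lambda>(a, c). Lg U (rank1 c a)) ` ((- U) \<times> (UNIV - {0}))"
  proof
    fix x assume "x \<in> flat_nbrs U"
    then obtain G where G: "x = Lg U G" "G \<in> Sym" "vec.dim (rad U G) + 1 = vec.dim (perp U)" by (auto simp: flat_nbrs_def)
    let ?R = "rad U G"
    have sR: "vec.subspace ?R" by (rule subspace_rad[OF U])
    have Rp: "?R \<subseteq> perp U" by (auto simp: rad_def)
    have cR: "cov ?R (perp U)" using G(3) Rp by (simp add: cov_def)
    obtain w where w: "w \<in> perp U" "w \<notin> ?R"
    proof -
      have "?R \<noteq> perp U" using G(3) by auto
      then show ?thesis using that Rp by auto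
    qed
    have pU: "perp U = vec.span (insert w ?R)" by (rule cov_eq_span_insert[OF sR subspace_perp cR w])
    have dec: "\<exists>k. b - k *s w \<in> ?R" if "b \<in> perp U" for b
      using that unfolding pU by (auto simp: vec.span_breakdown_eq vec.span_eq_iff[THEN iffD2, OF sR])
    let ?a = "G *v w"
    have aR: "dot ?a b = 0" if "b \<in> ?R" for b
    proof -
      have "dot ?a b = dot w (G *v b)" using dot_sym[OF G(2), of b w] by (simp add: dot_commute)
      also have "\<dots> = 0" using that w(1) by (auto simp: rad_def perp_def dot_commute)
      finally show ?thesis .
    qed
    have aw: "dot w ?a \<noteq> 0"
    proof
      assume z: "dot w ?a = 0"
      have "?a \<in> U"
      proof (rule mem_by_perp[OF U])
        fix b assume "b \<in> perp U"
        then obtain k where "b - k *s w \<in> ?R" using dec by blast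
        from aR[OF this] show "dot b ?a = 0" using z by (simp add: dot_commute)
      qed
      then show False using w by (simp add: rad_def)
    qed
    \<comment> \<open>With this c the difference of G and \<open>rank1 c\<close> of G w kills w,
      leaving only the radical.\<close>
    define c where "c = inverse (dot w ?a)"
    have aU: "?a \<notin> U" using w by (simp add: rad_def)
    have "(G - rank1 c ?a) *v b \<in> U" if "b \<in> perp U" for b
    proof -
      from dec[OF that] obtain k where k: "b - k *s w \<in> ?R" by blast
      have "(G - rank1 c ?a) *v w = 0"
        using aw by (simp add: matrix_vector_mult_diff_rdistrib rank1_mult c_def dot_commute)
      then have "(G - rank1 c ?a) *v b = (G - rank1 c ?a) *v (b - k *s w)"
        by (simp add: matrix_vector_mult_diff_distrib vec.scale)
      also have "\<dots> = G *v (b - k *s w)"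
        using aR[OF k] by (simp only: matrix_vector_mult_diff_rdistrib rank1_mult) simp
      finally show ?thesis using k by (simp add: rad_def)
    qed
    then have "x = Lg U (rank1 c ?a)" unfolding G(1) using Lg_eq_iff[OF U G(2) U rank1_Sym] by blast
    moreover have "c \<noteq> 0" using aw by (simp add: c_def)
    ultimately show "x \<in> (\<lambda>(a, c). Lg U (rank1 c a)) ` ((- U) \<times> (UNIV - {0}))" using aU by auto
  qed
qed

text \<open>A rank-one form on \<open>perp U\<close> fixes a modulo U up to a scalar t, and then
  scales c by 1/t^2.\<close>

lemma rank1_fibre:
  fixes U :: "('a^'d::finite) set"
  assumes U: "vec.subspace U" and a: "a \<notin> U" and c: "c \<noteq> 0"
  shows "card {p \<in> (- U) \<times> (UNIV - {0}). (\<lambda>(a, c). Lg U (rank1 c a)) p = Lg U (rank1 c a)} = (CARD('a) - 1) * card U"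
proof -
  let ?f = "\<lambda>(t, u). (t *s a + u, c / t ^ 2)"
  have e: "Lg U (rank1 c' a') = Lg U (rank1 c a) \<longleftrightarrow> (\<forall>b\<in>perp U. (c' * dot a' b) *s a' - (c * dot a b) *s a \<in> U)" for a' c'
    using Lg_eq_iff[OF U rank1_Sym U rank1_Sym] by (simp add: matrix_vector_mult_diff_rdistrib rank1_mult)
  have sc: "k = 0" if "k *s a \<in> U" for k
  proof (rule ccontr)
    assume "k \<noteq> 0"
    then show False using vec.subspace_scale[OF U that, of "inverse k"] a by simp
  qed
  obtain b0 where b0: "b0 \<in> perp U" "dot a b0 \<noteq> 0" using mem_by_perp[OF U, of a] a by (auto simp: dot_commute)
  have "{p \<in> (- U) \<times> (UNIV - {0}). (\<lambda>(a, c). Lg U (rank1 c a)) p = Lg U (rank1 c a)} = ?f ` ((UNIV - {0}) \<times> U)"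
  proof (intro set_eqI iffI)
    fix p assume p: "p \<in> {p \<in> (- U) \<times> (UNIV - {0}). (\<lambda>(a, c). Lg U (rank1 c a)) p = Lg U (rank1 c a)}"
    then obtain a' c' where p': "p = (a', c')" "a' \<notin> U" "c' \<noteq> 0" "Lg U (rank1 c' a') = Lg U (rank1 c a)" by auto
    have m: "(c' * dot a' b) *s a' - (c * dot a b) *s a \<in> U" if "b \<in> perp U" for b using p'(4) e that by blast
    have nz: "dot a' b0 \<noteq> 0"
    proof
      assume "dot a' b0 = 0"
      then have "- ((c * dot a b0) *s a) \<in> U" using m[OF b0(1)] by simp
      then have "(c * dot a b0) *s a \<in> U" using vec.subspace_neg[OF U] by fastforce
      from sc[OF this] show False using c b0 by simp
    qed
    \<comment> \<open>Comparing both forms at b0, which pairs non-trivially with a, exhibits a' as t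
      a modulo U.\<close>
    define t where "t = (c * dot a b0) / (c' * dot a' b0)"
    have t: "t \<noteq> 0" using c b0 nz p' by (simp add: t_def)
    have "inverse (c' * dot a' b0) *s ((c' * dot a' b0) *s a' - (c * dot a b0) *s a) \<in> U"
      by (rule vec.subspace_scale[OF U m[OF b0(1)]])
    moreover have "inverse (c' * dot a' b0) *s ((c' * dot a' b0) *s a' - (c * dot a b0) *s a) = a' - t *s a"
      using nz p'(3) by (simp add: t_def vec.scale_right_diff_distrib divide_inverse mult_ac)
    ultimately have u: "a' - t *s a \<in> U" by simp
    let ?u = "a' - t *s a"
    have d: "dot a' b0 = t * dot a b0"
    proof -
      have "dot ?u b0 = 0" using u b0(1) unfolding perp_def by blast
      then show ?thesis by simp
    qed
    have "((c' * dot a' b0) *s a' - (c * dot a b0) *s a) - (c' * dot a' b0) *s ?u \<in> U"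
      using m[OF b0(1)] vec.subspace_scale[OF U u] vec.subspace_diff[OF U] by blast
    moreover have "((c' * dot a' b0) *s a' - (c * dot a b0) *s a) - (c' * dot a' b0) *s ?u = ((c' * t ^ 2 - c) * dot a b0) *s a"
      by (simp add: d vec.scale_right_diff_distrib vec.scale_left_diff_distrib power2_eq_square algebra_simps)
    ultimately have "((c' * t ^ 2 - c) * dot a b0) *s a \<in> U" by (simp only:)
    from sc[OF this] have "(c' * t ^ 2 - c) * dot a b0 = 0" .
    then have "c' = c / t ^ 2" using b0 t by (simp add: field_simps)
    then have "p = ?f (t, ?u)" using p'(1) by simp
    then show "p \<in> ?f ` ((UNIV - {0}) \<times> U)" using t u by blast
  next
    fix p assume "p \<in> ?f ` ((UNIV - {0}) \<times> U)"
    then obtain t u where p: "p = (t *s a + u, c / t ^ 2)" and t: "t \<noteq> 0" and u: "u \<in> U" by auto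
    have "t *s a + u \<notin> U"
    proof
      assume "t *s a + u \<in> U"
      then have "(t *s a + u) - u \<in> U" using u vec.subspace_diff[OF U] by blast
      then have "t *s a \<in> U" by simp
      from sc[OF this] show False using t by simp
    qed
    moreover have "Lg U (rank1 (c / t ^ 2) (t *s a + u)) = Lg U (rank1 c a)"
      unfolding e
    proof
      fix b assume "b \<in> perp U"
      then have "dot u b = 0" using u unfolding perp_def by blast
      then have "(c / t ^ 2 * dot (t *s a + u) b) *s (t *s a + u) - (c * dot a b) *s a = (c / t * dot a b) *s u"
        using t by (simp add: vec.scale_right_distrib power2_eq_square)
      then show "(c / t ^ 2 * dot (t *s a + u) b) *s (t *s a + u) - (c * dot a b) *s a \<in> U"
        using vec.subspace_scale[OF U u] by simp
    qed
    ultimately show "p \<in> {p \<in> (- U) \<times> (UNIV - {0}). (\<lambda>(a, c). Lg U (rank1 c a)) p = Lg U (rank1 c a)}"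
      using p c t by simp
  qed
  moreover have "inj_on ?f ((UNIV - {0}) \<times> U)"
  proof (rule inj_onI)
    fix p p' assume "p \<in> (UNIV - {0}) \<times> U" "p' \<in> (UNIV - {0}) \<times> U" "?f p = ?f p'"
    then obtain t u t' u' where p: "p = (t, u)" "p' = (t', u')" and h: "u \<in> U" "u' \<in> U" "t *s a + u = t' *s a + u'" by auto
    have "(t - t') *s a = u' - u" using h(3) by (simp add: vec.scale_left_diff_distrib algebra_simps)
    then have "(t - t') *s a \<in> U" using h vec.subspace_diff[OF U] by simp
    then have "t = t'" using sc by fastforce
    then show "p = p'" using h(3) p by simp
  qed
  ultimately show ?thesis by (simp add: card_image card_cartesian_product card_Diff_singleton)
qed

text \<open>Each neighbour is counted (q - 1)|U| times by the pairs (a, c) with a outside U. The sum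
  over all a is \<open>gauss_total\<close>; the excluded a in U contribute phase 1 each, which is
  the -1.\<close>

lemma sum_flat_nbrs:
  fixes S :: "('a, 'd::{finite,linorder}) sqmat" and h :: "('a, 'd) lagr \<Rightarrow> complex"
  assumes S: "S \<in> Sym" and U: "vec.subspace U" "U \<subseteq> nullspace S"
    and h: "\<And>G. G \<in> Sym \<Longrightarrow> h (Lg U G) = psi (trace (S ** G))"
  shows "(\<Sum>x\<in>flat_nbrs U. h x) = of_int (mtype S) * of_nat CARD('a) ^ (CARD('d) - vec.dim U - rank S div 2) - 1"
proof -
  let ?q = "of_nat CARD('a) :: complex" and ?P = "(- U) \<times> (UNIV - {0::'a})"
  let ?k = "(CARD('a) - 1) * card U" and ?f = "\<lambda>(a, c). Lg U (rank1 c a)"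
  have r: "vec.dim U + rank S \<le> CARD('d)"
    using vec.dim_subset[OF U(2)] dim_nullspace[of S] by simp
  have "(\<Sum>p\<in>?P. h (?f p)) = of_nat ?k * (\<Sum>x\<in>?f ` ?P. h x)"
    by (rule card_fibres(1)) (use rank1_fibre[OF U(1)] in auto)
  then have 1: "(\<Sum>p\<in>?P. h (?f p)) = of_nat ?k * (\<Sum>x\<in>flat_nbrs U. h x)" unfolding flat_nbrs_eq[OF U(1)] .
  have "(\<Sum>p\<in>?P. h (?f p)) = (\<Sum>(a, c)\<in>?P. psi (c * qform S a))"
    by (intro sum.cong refl) (auto simp: h rank1_Sym trace_rank1)
  also have "\<dots> = (\<Sum>a\<in>- U. \<Sum>c\<in>UNIV - {0}. psi (c * qform S a))"
    by (rule sum.cartesian_product[symmetric])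
  also have "\<dots> = (\<Sum>a\<in>UNIV. \<Sum>c\<in>UNIV - {0}. psi (c * qform S a)) - (\<Sum>a\<in>U. \<Sum>c\<in>UNIV - {0}. psi (c * qform S a))"
    by (simp add: Compl_eq_Diff_UNIV sum_diff)
  also have "(\<Sum>a\<in>UNIV. \<Sum>c\<in>UNIV - {0}. psi (c * qform S a)) = of_int (mtype S) * of_nat (CARD('a) - 1) * ?q ^ (CARD('d) - rank S div 2)"
    by (subst sum.swap) (rule gauss_total[OF S])
  also have "(\<Sum>a\<in>U. \<Sum>c\<in>UNIV - {0}. psi (c * qform S a)) = (\<Sum>a\<in>U. \<Sum>c\<in>UNIV - {0::'a}. 1)"
    using U(2) by (intro sum.cong refl) (auto simp: qform_def nullspace_def)
  also have "\<dots> = of_nat ?k" by (simp add: card_Diff_singleton)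
  also have "?q ^ (CARD('d) - rank S div 2) = ?q ^ (CARD('d) - vec.dim U - rank S div 2) * ?q ^ vec.dim U"
    using r by (simp flip: power_add)
  also have "?q ^ vec.dim U = of_nat (card U)" by (simp add: card_subspace[OF U(1)])
  finally have "of_nat ?k * (\<Sum>x\<in>flat_nbrs U. h x) = of_nat ?k * (of_int (mtype S) * ?q ^ (CARD('d) - vec.dim U - rank S div 2) - 1)"
    unfolding 1 by (simp add: algebra_simps)
  moreover have "of_nat ?k \<noteq> (0::complex)" using q_gt_2 by (simp add: card_subspace[OF U(1)])
  ultimately show ?thesis by (rule mult_left_cancel[THEN iffD1, rotated])
qed

end

section \<open>Character spaces of the translation group\<close>

definition emb :: "(('a::field)^'d::finite) set \<Rightarrow> ('a^('d + 'd)) set" where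
  "emb U = (\<lambda>a. join a 0) ` U"

definition unemb :: "(('a::field)^('d::finite + 'd)) set \<Rightarrow> ('a^'d) set" where
  "unemb X = {a. join a 0 \<in> X}"

text \<open>The factor q^(-i(i+1)/4) of \<open>state_I\<close>, with i = D - dim U.\<close>

definition nrm :: "(('a::{field,finite})^'d::finite) set \<Rightarrow> complex" where
  "nrm U = of_real (real CARD('a) powr (- (real (CARD('d) - vec.dim U) * (real (CARD('d) - vec.dim U) + 1) / 4)))"

definition form :: "('a::{field,finite}, 'd::finite) lagr \<Rightarrow> ('a, 'd) sqmat" where
  "form x = (SOME F. F \<in> Sym \<and> x = Lg (base x) F)"

text \<open>The inverse of \<open>phi S\<close> in closed form: the ket of \<open>emb U\<close> goes to the normalized character sum over the subspaces meeting \<open>x_0\<close> in \<open>U\<close>.\<close>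

definition Psi :: "('a::{field,finite}, 'd::finite) sqmat \<Rightarrow> complex^(('a^('d + 'd)) set) \<Rightarrow> complex^('a, 'd) lagr" where
  "Psi S u = (\<chi> x. if base x \<subseteq> nullspace S then nrm (base x) * psi (trace (S ** form x)) * u $ emb (base x) else 0)"

text \<open>The isotypic component of the translations for the character of S, later identified with
  \<open>W_space S\<close>.\<close>

definition Iso :: "('a::{field,finite}, 'd::finite) sqmat \<Rightarrow> (complex^('a, 'd) lagr) set" where
  "Iso S = {v. \<forall>U F G. vec.subspace U \<longrightarrow> F \<in> Sym \<longrightarrow> G \<in> Sym \<longrightarrow>
     v $ Lg U (F + G) = psi (trace (S ** G)) * v $ Lg U F}"

lemma unemb_emb [simp]: "unemb (emb U) = U"
  by (auto simp: unemb_def emb_def)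

lemma inj_emb: "inj emb"
  by (rule inj_on_inverseI[of _ unemb]) simp

lemma mem_emb: "v \<in> emb U \<longleftrightarrow> pL v \<in> U \<and> pR v = 0"
proof
  assume v: "pL v \<in> U \<and> pR v = 0"
  then have "v = join (pL v) 0" using join_pL_pR[of v] by simp
  then show "v \<in> emb U" using v unfolding emb_def by blast
qed (auto simp: emb_def)

lemma emb_mono [simp]: "emb U \<subseteq> emb U' \<longleftrightarrow> U \<subseteq> U'"
proof
  assume e: "emb U \<subseteq> emb U'"
  show "U \<subseteq> U'"
  proof
    fix a assume "a \<in> U"
    then have "join a 0 \<in> emb U" by (simp add: mem_emb)
    then have "join a 0 \<in> emb U'" using e by blast
    then show "a \<in> U'" by (simp add: mem_emb)
  qed
qed (auto simp: mem_emb)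

lemma pL_pR_0 [simp]: "pL 0 = 0" "pR 0 = 0"
  by (simp_all add: pL_def pR_def vec_eq_iff)

lemma trace_zero [simp]: "trace 0 = 0"
  by (simp add: trace_def)

lemma subspace_emb [simp]: "vec.subspace (emb U) \<longleftrightarrow> vec.subspace U"
proof
  assume e: "vec.subspace (emb U)"
  have m: "join a 0 \<in> emb U \<longleftrightarrow> a \<in> U" for a by (simp add: mem_emb)
  show "vec.subspace U"
    unfolding vec.subspace_def
  proof (intro conjI ballI allI)
    show "0 \<in> U" using vec.subspace_0[OF e] by (simp add: mem_emb)
    fix a assume a: "a \<in> U"
    show "c *s a \<in> U" for c using vec.subspace_scale[OF e, of "join a 0" c] a by (simp add: m join_arith)
    fix b assume b: "b \<in> U"
    show "a + b \<in> U" using vec.subspace_add[OF e, of "join a 0" "join b 0"] a b by (simp add: m join_arith)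
  qed
next
  assume "vec.subspace U"
  then show "vec.subspace (emb U)"
    by (simp add: vec.subspace_def mem_emb pL_pR_arith)
qed

lemma V0_eq_emb: "V0 S = emb (nullspace S)"
  by (auto simp: V0_def mem_emb nullspace_def pL_def pR_def vec_eq_iff)

lemma subs_V0: "subs (V0 S) = emb ` {U. vec.subspace U \<and> U \<subseteq> nullspace S}"
proof (intro set_eqI iffI)
  fix X assume X: "X \<in> subs (V0 S)"
  then have "X \<subseteq> emb (nullspace S)" by (simp add: subs_def V0_eq_emb)
  then have "X = emb (unemb X)"
  proof -
    have "v \<in> X \<longleftrightarrow> v \<in> emb (unemb X)" for v
    proof (cases "pR v = 0")
      case True
      then have "v = join (pL v) 0" using join_pL_pR[of v] by simp
      then show ?thesis using True by (simp add: mem_emb unemb_def)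
    next
      case False
      then show ?thesis using \<open>X \<subseteq> emb (nullspace S)\<close> by (auto simp: mem_emb)
    qed
    then show ?thesis by blast
  qed
  moreover have "unemb X \<subseteq> nullspace S" using \<open>X \<subseteq> emb (nullspace S)\<close> by (auto simp: unemb_def mem_emb)
  moreover have "vec.subspace (unemb X)" using X \<open>X = emb (unemb X)\<close> subspace_emb[of "unemb X"] by (simp add: subs_def)
  ultimately show "X \<in> emb ` {U. vec.subspace U \<and> U \<subseteq> nullspace S}" by blast
next
  fix X assume "X \<in> emb ` {U. vec.subspace U \<and> U \<subseteq> nullspace S}"
  then obtain U where "X = emb U" "vec.subspace U" "U \<subseteq> nullspace S" by blast
  then show "X \<in> subs (V0 S)" by (simp add: subs_def V0_eq_emb)
qed

lemma emb_in_subs: "emb U \<in> subs (V0 S) \<longleftrightarrow> vec.subspace U \<and> U \<subseteq> nullspace S"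
  by (simp add: subs_def V0_eq_emb)

lemma A_mat_mult: "(A_mat *v v) $ x = (\<Sum>y\<in>{y. adj x y}. v $ y)"
proof -
  have "(A_mat *v v) $ x = (\<Sum>y\<in>UNIV. if adj x y then v $ y else 0)"
    unfolding A_mat_def matrix_vector_mult_def vec_lambda_beta by (intro sum.cong) auto
  then show ?thesis by (simp add: sum.If_cases)
qed

context odd_prime_field
begin

lemma dim_emb [simp]:
  fixes U :: "('a^'d::finite) set"
  assumes "vec.subspace U"
  shows "vec.dim (emb U) = vec.dim U"
proof -
  have "card (emb U) = card U" unfolding emb_def by (rule card_image) (simp add: inj_on_def)
  then show ?thesis using q_gt_2 assms by (simp add: card_subspace)
qed

lemma cov_emb:
  fixes U U' :: "('a^'d::finite) set"
  assumes "vec.subspace U" "vec.subspace U'"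
  shows "cov (emb U) (emb U') \<longleftrightarrow> cov U U'"
  using assms by (simp add: cov_def)

lemma nrm_nonzero [simp]: "nrm (U :: ('a^'d::finite) set) \<noteq> 0"
  using q_gt_2 by (simp add: nrm_def)

lemma Lg_form: "form x \<in> Sym" "Lg (base x) (form x) = (x :: ('a, 'd::finite) lagr)"
proof -
  obtain U F where x: "vec.subspace U" "F \<in> Sym" "x = Lg U F" using lagr_cases by blast
  have "base x = U" using base_Lg[OF x(1,2)] x(3) by simp
  then have "F \<in> Sym \<and> x = Lg (base x) F" using x(2,3) by simp
  then have "\<exists>F. F \<in> Sym \<and> x = Lg (base x) F" by blast
  then have "form x \<in> Sym \<and> x = Lg (base x) (form x)" unfolding form_def by (rule someI_ex)
  then show "form x \<in> Sym" "Lg (base x) (form x) = x" by auto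
qed

lemma trace_diff_right: "trace (S ** (F - G)) = trace (S ** F) - trace (S ** G)" for S F G :: "('a, 'd::finite) sqmat"
  by (simp add: trace_mult sum_subtractf algebra_simps)

lemma trace_add_right: "trace (S ** (F + G)) = trace (S ** F) + trace (S ** G)" for S F G :: "('a, 'd::finite) sqmat"
  by (simp add: trace_mult sum.distrib algebra_simps)

lemma Psi_Lg:
  fixes S F :: "('a, 'd::finite) sqmat"
  assumes S: "S \<in> Sym" and U: "vec.subspace U" and F: "F \<in> Sym"
  shows "Psi S u $ Lg U F = (if U \<subseteq> nullspace S then nrm U * psi (trace (S ** F)) * u $ emb U else 0)"
proof -
  let ?x = "Lg U F"
  have b: "base ?x = U" by (rule base_Lg[OF U F])
  have "Lg U F = Lg U (form ?x)" using Lg_form(2)[of ?x] b by simp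
  then have d: "\<forall>b\<in>perp U. (F - form ?x) *v b \<in> U" using Lg_eq_iff[OF U F U Lg_form(1)] by blast
  show ?thesis
  proof (cases "U \<subseteq> nullspace S")
    case True
    have "trace (S ** (F - form ?x)) = 0" by (rule trace_annihilator[OF S U True d])
    then have "trace (S ** form ?x) = trace (S ** F)" by (simp add: trace_diff_right)
    then show ?thesis by (simp add: Psi_def b)
  qed (simp add: Psi_def b)
qed

lemma Psi_in_Iso: "S \<in> Sym \<Longrightarrow> Psi S u \<in> Iso (S :: ('a, 'd::finite) sqmat)"
  by (auto simp: Iso_def Psi_Lg Sym_closed trace_add_right psi_add)

text \<open>If U is not inside the kernel, some translation fixes \<open>Lg U F\<close> but acts on
  the function by a phase other than 1.\<close>

lemma Iso_vanish:
  fixes S :: "('a, 'd::finite) sqmat"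
  assumes S: "S \<in> Sym" and v: "v \<in> Iso S" and U: "vec.subspace U" "\<not> U \<subseteq> nullspace S" and F: "F \<in> Sym"
  shows "v $ Lg U F = 0"
proof -
  obtain G where G: "G \<in> Sym" "\<forall>b\<in>perp U. G *v b \<in> U" "trace (S ** G) \<noteq> 0"
    using exists_nonzero_trace[OF S U] by blast
  have "Lg U (F + G) = Lg U F" using Lg_eq_iff[OF U(1) Sym_closed(1)[OF F G(1)] U(1) F] G(2) by simp
  moreover have "v $ Lg U (F + G) = psi (trace (S ** G)) * v $ Lg U F"
    using v U(1) F G(1) unfolding Iso_def by blast
  ultimately have "(psi (trace (S ** G)) - 1) * v $ Lg U F = 0" by (simp add: algebra_simps)
  moreover have "psi (trace (S ** G)) - 1 \<noteq> 0" using G(3) psi_eq_1_iff by simp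
  ultimately show ?thesis by simp
qed

lemma Iso_eqI:
  fixes S :: "('a, 'd::finite) sqmat"
  assumes S: "S \<in> Sym" and v: "v \<in> Iso S" "w \<in> Iso S"
    and e: "\<And>U. vec.subspace U \<Longrightarrow> U \<subseteq> nullspace S \<Longrightarrow> v $ Lg U 0 = w $ Lg U 0"
  shows "v = w"
proof (rule vec_eq_iff[THEN iffD2], rule allI)
  fix x :: "('a, 'd) lagr"
  obtain U F where x: "vec.subspace U" "F \<in> Sym" "x = Lg U F" using lagr_cases by blast
  have i: "v' $ Lg U (0 + F) = psi (trace (S ** F)) * v' $ Lg U 0" if "v' \<in> Iso S" for v'
    using that x Sym_closed(3) unfolding Iso_def by blast
  show "v $ x = w $ x"
  proof (cases "U \<subseteq> nullspace S")
    case True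
    then show ?thesis using i[OF v(1)] i[OF v(2)] e[OF x(1)] x(3) by simp
  next
    case False
    then show ?thesis using Iso_vanish[OF S v(1) x(1) False x(2)] Iso_vanish[OF S v(2) x(1) False x(2)] x(3) by simp
  qed
qed

text \<open>The inverse of \<open>Psi S\<close> on \<open>Iso S\<close>: values at F = 0, with the
  normalisation divided out.\<close>

definition coord :: "('a, 'd::finite) sqmat \<Rightarrow> complex^('a, 'd) lagr \<Rightarrow> complex^(('a^('d + 'd)) set)" where
  "coord S v = (\<chi> X. if X \<in> subs (V0 S) then v $ Lg (unemb X) 0 / nrm (unemb X) else 0)"

lemma coord_in_V_L: "coord S v \<in> V_L (V0 S)"
  by (simp add: mem_V_L coord_def)

lemma Psi_coord: "S \<in> Sym \<Longrightarrow> v \<in> Iso S \<Longrightarrow> Psi S (coord S v) = v" for S :: "('a, 'd::finite) sqmat"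
  by (rule Iso_eqI) (auto simp: Psi_in_Iso Psi_Lg Sym_closed coord_def emb_in_subs trace_mult)

lemma coord_Psi: "S \<in> Sym \<Longrightarrow> u \<in> V_L (V0 S) \<Longrightarrow> coord S (Psi S u) = u" for S :: "('a, 'd::finite) sqmat"
  by (auto simp: vec_eq_iff coord_def Psi_Lg Sym_closed mem_V_L subs_V0 trace_mult)

lemma Psi_lin: "Psi S (u + v) = Psi S u + Psi S v" "Psi S (c *s u) = c *s Psi S u" "Psi S 0 = 0"
  for S :: "('a, 'd::finite) sqmat"
  by (auto simp: Psi_def vec_eq_iff algebra_simps)

lemma Psi_sum: "Psi S (\<Sum>i\<in>A. f i) = (\<Sum>i\<in>A. Psi S (f i))" for S :: "('a, 'd::finite) sqmat"
  by (induction A rule: infinite_finite_induct) (auto simp: Psi_lin)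

lemma coord_lin: "coord S (u + v) = coord S u + coord S v" "coord S (c *s u) = c *s coord S u" "coord S 0 = 0"
  for S :: "('a, 'd::finite) sqmat"
  by (auto simp: coord_def vec_eq_iff add_divide_distrib)

lemma Psi_inj: "S \<in> Sym \<Longrightarrow> u \<in> V_L (V0 S) \<Longrightarrow> v \<in> V_L (V0 S) \<Longrightarrow> Psi S u = Psi S v \<Longrightarrow> u = v"
  for S :: "('a, 'd::finite) sqmat"
  using coord_Psi by metis

lemma Iso_eq_Psi: "S \<in> Sym \<Longrightarrow> Iso S = Psi S ` V_L (V0 S)" for S :: "('a, 'd::finite) sqmat"
proof (intro set_eqI iffI)
  fix v assume "S \<in> Sym" "v \<in> Iso S"
  then show "v \<in> Psi S ` V_L (V0 S)" using coord_in_V_L Psi_coord[of S v] by (intro image_eqI[of _ _ "coord S v"]) auto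
qed (use Psi_in_Iso in auto)

lemma bij_translate:
  assumes G: "G \<in> Sym"
  shows "bij (act (spm (mat 1) G) :: ('a, 'd::finite) lagr \<Rightarrow> _)"
proof -
  have inv: "act (spm (mat 1) H) (act (spm (mat 1) G) x) = x"
    if "G \<in> Sym" "H = - G" for G H :: "('a, 'd) sqmat" and x :: "('a, 'd) lagr"
  proof -
    obtain U F where x: "vec.subspace U" "F \<in> Sym" "x = Lg U F" using lagr_cases by blast
    then show ?thesis using that by (simp add: translate Sym_closed)
  qed
  have "inj (act (spm (mat 1) G) :: ('a, 'd) lagr \<Rightarrow> _)"
    by (rule inj_on_inverseI[of _ "act (spm (mat 1) (- G))"]) (rule inv[OF G refl])
  then show ?thesis by (simp add: bij_def finite_UNIV_inj_surj)
qed

lemma A_mat_Iso: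
  fixes S :: "('a, 'd::finite) sqmat"
  assumes v: "v \<in> Iso S"
  shows "A_mat *v v \<in> Iso S"
  unfolding Iso_def
proof (intro CollectI allI impI)
  fix U :: "('a, 'd) vec set" and F G :: "('a, 'd) sqmat" assume U: "vec.subspace U" "F \<in> Sym" "G \<in> Sym"
  let ?t = "act (spm (mat 1) G) :: ('a, 'd) lagr \<Rightarrow> _"
  have a: "adj (Lg U (F + G)) (?t y) \<longleftrightarrow> adj (Lg U F) y" and vt: "v $ ?t y = psi (trace (S ** G)) * v $ y" for y :: "('a, 'd) lagr"
  proof -
    obtain U' F' where y: "vec.subspace U'" "F' \<in> Sym" "y = Lg U' F'" using lagr_cases by blast
    show "adj (Lg U (F + G)) (?t y) \<longleftrightarrow> adj (Lg U F) y"
      unfolding y(3) translate[OF y(2,1)] by (rule adj_translate[OF U(2) y(2) U(3,1) y(1)])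
    show "v $ ?t y = psi (trace (S ** G)) * v $ y"
      unfolding y(3) translate[OF y(2,1)] using v y U(3) unfolding Iso_def by blast
  qed
  have "(A_mat *v v) $ Lg U (F + G) = (\<Sum>y\<in>UNIV. if adj (Lg U (F + G)) y then v $ y else 0)"
    by (simp add: A_mat_mult sum.If_cases)
  also have "\<dots> = (\<Sum>y\<in>UNIV. if adj (Lg U (F + G)) (?t y) then v $ ?t y else 0)"
    by (rule sum.reindex_bij_betw[OF bij_translate[OF U(3)], symmetric])
  also have "\<dots> = psi (trace (S ** G)) * (\<Sum>y\<in>UNIV. if adj (Lg U F) y then v $ y else 0)"
    unfolding a vt sum_distrib_left by (intro sum.cong) auto
  also have "(\<Sum>y\<in>UNIV. if adj (Lg U F) y then v $ y else 0) = (A_mat *v v) $ Lg U F"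
    by (simp add: A_mat_mult sum.If_cases)
  finally show "(A_mat *v v) $ Lg U (F + G) = psi (trace (S ** G)) * (A_mat *v v) $ Lg U F" .
qed

text \<open>Over each cover U' of U there is a single neighbour, since the form of G on
  \<open>perp U'\<close> vanishes; below U the form is free modulo the condition on
  \<open>perp U\<close>.\<close>

lemma nbrs_Lg0:
  fixes U :: "('a^'d::finite) set"
  assumes U: "vec.subspace U"
  shows "{y. adj (Lg U 0) y} = (\<lambda>U'. Lg U' 0) ` {U'. vec.subspace U' \<and> cov U U'} \<union> flat_nbrs U
    \<union> (\<Union>U'\<in>{U'. vec.subspace U' \<and> cov U' U}. below_nbrs U U')"
proof (intro set_eqI iffI)
  fix y :: "('a, 'd) lagr" assume y: "y \<in> {y. adj (Lg U 0) y}"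
  obtain U' G where G: "vec.subspace U'" "G \<in> Sym" "y = Lg U' G" using lagr_cases by blast
  consider "cov U U'" "\<forall>b\<in>perp U'. G *v b \<in> U'" | "cov U' U" "\<forall>b\<in>perp U. G *v b \<in> U"
    | "U = U'" "vec.dim (rad U G) + 1 = vec.dim (perp U)"
    using adj_iff[OF U G(1,2)] y G(3) by auto
  then show "y \<in> (\<lambda>U'. Lg U' 0) ` {U'. vec.subspace U' \<and> cov U U'} \<union> flat_nbrs U
    \<union> (\<Union>U'\<in>{U'. vec.subspace U' \<and> cov U' U}. below_nbrs U U')"
  proof cases
    case 1
    then have "y = Lg U' 0" unfolding G(3) using Lg_eq_iff[OF G(1,2) G(1) Sym_closed(3)] by simp
    then show ?thesis using 1 G(1) by blast
  next
    case 2
    then have "y \<in> below_nbrs U U'" using G by (auto simp: below_nbrs_def)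
    then show ?thesis using 2 G(1) by blast
  next
    case 3
    then have "y \<in> flat_nbrs U" using G by (auto simp: flat_nbrs_def)
    then show ?thesis by blast
  qed
next
  fix y assume "y \<in> (\<lambda>U'. Lg U' 0) ` {U'. vec.subspace U' \<and> cov U U'} \<union> flat_nbrs U
    \<union> (\<Union>U'\<in>{U'. vec.subspace U' \<and> cov U' U}. below_nbrs U U')"
  then consider U' where "vec.subspace U'" "cov U U'" "y = Lg U' 0"
    | G where "G \<in> Sym" "vec.dim (rad U G) + 1 = vec.dim (perp U)" "y = Lg U G"
    | U' G where "vec.subspace U'" "cov U' U" "G \<in> Sym" "\<forall>b\<in>perp U. G *v b \<in> U" "y = Lg U' G"
    by (auto simp: flat_nbrs_def below_nbrs_def)
  then show "y \<in> {y. adj (Lg U 0) y}"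
  proof cases
    case 1
    then show ?thesis using adj_iff[OF U 1(1) Sym_closed(3)] vec.subspace_0 by auto
  next
    case 2
    then show ?thesis using adj_iff[OF U U 2(1)] by simp
  next
    case 3
    then show ?thesis using adj_iff[OF U 3(1,3)] by simp
  qed
qed

text \<open>The phase is 1 on neighbours with smaller or larger base, by
  \<open>trace_annihilator\<close>, so there only counts remain. The flat neighbours contribute the
  Gauss sum.\<close>

lemma A_mat_Psi_value:
  fixes S :: "('a, 'd::{finite,linorder}) sqmat"
  assumes S: "S \<in> Sym" and U: "vec.subspace U" "U \<subseteq> nullspace S"
  shows "(A_mat *v Psi S u) $ Lg U 0 =
    (\<Sum>U'\<in>{U'. vec.subspace U' \<and> U' \<subseteq> nullspace S \<and> cov U U'}. nrm U' * u $ emb U')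
    + (of_int (mtype S) * of_nat CARD('a) ^ (CARD('d) - vec.dim U - rank S div 2) - 1) * (nrm U * u $ emb U)
    + (\<Sum>U'\<in>{U'. vec.subspace U' \<and> cov U' U}. of_nat CARD('a) ^ (CARD('d) - vec.dim U') * (nrm U' * u $ emb U'))"
proof -
  let ?g = "\<lambda>x. Psi S u $ x"
  let ?N1 = "(\<lambda>U'. Lg U' 0) ` {U'. vec.subspace U' \<and> cov U U'}" and ?D = "{U'. vec.subspace U' \<and> cov U' U}"
  let ?N3 = "\<Union>U'\<in>?D. below_nbrs U U'"
  have b1: "base y \<in> {U'. cov U U'}" if "y \<in> ?N1" for y using that by (auto simp: base_Lg Sym_closed)
  have b2: "base y = U" if "y \<in> flat_nbrs U" for y using that U(1) by (auto simp: flat_nbrs_def base_Lg)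
  have b3: "base y = U'" if "y \<in> below_nbrs U U'" "vec.subspace U'" for y U'
    using that by (auto simp: below_nbrs_def base_Lg)
  have d12: "?N1 \<inter> flat_nbrs U = {}" using b1 b2 by (fastforce simp: cov_def)
  have d3: "(?N1 \<union> flat_nbrs U) \<inter> ?N3 = {}"
  proof -
    have "\<not> (y \<in> ?N3)" if "y \<in> ?N1 \<union> flat_nbrs U" for y
    proof
      assume "y \<in> ?N3"
      then obtain U' where U': "vec.subspace U'" "cov U' U" "y \<in> below_nbrs U U'" by blast
      then have "cov (base y) U" using b3 by simp
      moreover have "cov U (base y) \<or> base y = U" using that b1 b2 by blast
      ultimately show False by (auto simp: cov_def)
    qed
    then show ?thesis by blast
  qed
  have "(A_mat *v Psi S u) $ Lg U 0 = (\<Sum>y\<in>?N1 \<union> flat_nbrs U \<union> ?N3. ?g y)"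
    unfolding A_mat_mult nbrs_Lg0[OF U(1)] ..
  also have "\<dots> = (\<Sum>y\<in>?N1. ?g y) + (\<Sum>y\<in>flat_nbrs U. ?g y) + (\<Sum>y\<in>?N3. ?g y)"
    using d12 d3 by (simp add: sum.union_disjoint)
  also have "(\<Sum>y\<in>?N1. ?g y) = (\<Sum>U'\<in>{U'. vec.subspace U' \<and> cov U U'}. ?g (Lg U' 0))"
    by (rule sum.reindex_cong[of "\<lambda>U'. Lg U' 0"]) (auto intro!: inj_on_inverseI[of _ base] simp: base_Lg Sym_closed)
  also have "\<dots> = (\<Sum>U'\<in>{U'. vec.subspace U' \<and> cov U U'}. if U' \<subseteq> nullspace S then nrm U' * u $ emb U' else 0)"
    by (intro sum.cong refl) (simp add: Psi_Lg[OF S _ Sym_closed(3)] trace_mult)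
  also have "\<dots> = (\<Sum>U'\<in>{U'. vec.subspace U' \<and> U' \<subseteq> nullspace S \<and> cov U U'}. nrm U' * u $ emb U')"
    by (intro sum.mono_neutral_cong_right) auto
  also have "(\<Sum>y\<in>flat_nbrs U. ?g y) = (\<Sum>y\<in>flat_nbrs U. (nrm U * u $ emb U) * psi (trace (S ** form y)))"
    using b2 U(2) by (intro sum.cong refl) (simp add: Psi_def)
  also have "\<dots> = (nrm U * u $ emb U) * (\<Sum>y\<in>flat_nbrs U. psi (trace (S ** form y)))"
    by (simp add: sum_distrib_left)
  also have "(\<Sum>y\<in>flat_nbrs U. psi (trace (S ** form y))) = of_int (mtype S) * of_nat CARD('a) ^ (CARD('d) - vec.dim U - rank S div 2) - 1"
  proof (rule sum_flat_nbrs[OF S U])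
    fix G :: "('a, 'd) sqmat" assume G: "G \<in> Sym"
    \<comment> \<open>Evaluating \<open>Psi\<close> on the constant function 1 transfers its
      independence of the choice made in \<open>form\<close>.\<close>
    have "Psi S (\<chi> X. 1) $ Lg U G = nrm U * psi (trace (S ** form (Lg U G)))"
      using U(2) base_Lg[OF U(1) G] by (simp add: Psi_def)
    then show "psi (trace (S ** form (Lg U G))) = psi (trace (S ** G))"
      using Psi_Lg[OF S U(1) G, of "\<chi> X. 1"] U(2) by simp
  qed
  also have "(\<Sum>y\<in>?N3. ?g y) = (\<Sum>U'\<in>?D. \<Sum>y\<in>below_nbrs U U'. ?g y)"
  proof (rule sum.UNION_disjoint)
    show "\<forall>i\<in>?D. \<forall>j\<in>?D. i \<noteq> j \<longrightarrow> below_nbrs U i \<inter> below_nbrs U j = {}" using b3 by blast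
  qed auto
  also have "\<dots> = (\<Sum>U'\<in>?D. of_nat CARD('a) ^ (CARD('d) - vec.dim U') * (nrm U' * u $ emb U'))"
  proof (rule sum.cong[OF refl])
    fix U' assume U': "U' \<in> ?D"
    then have k: "U' \<subseteq> nullspace S" using U(2) by (auto simp: cov_def)
    have "?g y = nrm U' * u $ emb U'" if "y \<in> below_nbrs U U'" for y
    proof -
      obtain G where G: "G \<in> Sym" "\<forall>b\<in>perp U. G *v b \<in> U" "y = Lg U' G" using \<open>y \<in> below_nbrs U U'\<close> by (auto simp: below_nbrs_def)
      then show ?thesis using Psi_Lg[OF S _ G(1), of U' u] trace_annihilator[OF S U G(2)] k U' by simp
    qed
    then show "(\<Sum>y\<in>below_nbrs U U'. ?g y) = of_nat CARD('a) ^ (CARD('d) - vec.dim U') * (nrm U' * u $ emb U')"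
      using card_below_nbrs[OF U(1), of U'] U' by simp
  qed
  finally show ?thesis by (simp only: mult.commute)
qed

end

subsection \<open>The idempotent \<open>E_1\<close> and the distance layers\<close>

lemma hinner_simps:
  "hinner (u + u') v = hinner u v + hinner u' v" "hinner u (v + v') = hinner u v + hinner u v'"
  "hinner (u - u') v = hinner u v - hinner u' v" "hinner u (v - v') = hinner u v - hinner u v'"
  "hinner (c *s u) v = cnj c * hinner u v" "hinner u (c *s v) = c * hinner u v"
  by (simp_all add: hinner_def sum.distrib sum_subtractf algebra_simps sum_distrib_left)

lemma hinner_cnj: "hinner u v = cnj (hinner v u)"
  by (simp add: hinner_def mult.commute)

lemma hinner_ket: "hinner (ket x) v = v $ x" "hinner v (ket x) = cnj (v $ x)"
proof -
  have "hinner (ket x) v = (\<Sum>y\<in>UNIV. if y = x then v $ x else 0)"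
    unfolding hinner_def by (intro sum.cong) (auto simp: axis_def)
  then show "hinner (ket x) v = v $ x" by simp
  then show "hinner v (ket x) = cnj (v $ x)" by (subst hinner_cnj) simp
qed

lemma hinner_self_eq_0: "hinner v v = 0 \<longleftrightarrow> v = 0"
proof
  assume "hinner v v = 0"
  moreover have "hinner v v = (\<Sum>x\<in>UNIV. of_real ((cmod (v $ x)) ^ 2))"
    unfolding hinner_def complex_norm_square by (simp only: mult.commute)
  ultimately have "complex_of_real (\<Sum>x\<in>UNIV. (cmod (v $ x)) ^ 2) = 0" by simp
  then have "(\<Sum>x\<in>UNIV. (cmod (v $ x)) ^ 2) = 0" by (simp only: of_real_eq_0_iff)
  then show "v = 0" by (simp add: sum_nonneg_eq_0_iff vec_eq_iff)
qed (simp add: hinner_def)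

lemma inner_eq_Re_hinner: "inner u v = Re (hinner u v)" for u v :: "complex^'n"
  by (simp add: hinner_def inner_vec_def inner_complex_def)

lemma orth_decomp_unique:
  assumes "vec.subspace W" "y \<in> W" "y' \<in> W" "\<forall>w\<in>W. hinner w (v - y) = 0" "\<forall>w\<in>W. hinner w (v - y') = 0"
  shows "y = y'"
proof -
  have d: "y - y' \<in> W" using assms vec.subspace_diff by blast
  have "hinner (y - y') (y - y') = hinner (y - y') (v - y') - hinner (y - y') (v - y)" by (simp add: hinner_simps)
  also have "\<dots> = 0" using assms(4,5) d by simp
  finally show ?thesis by (simp add: hinner_self_eq_0)
qed

text \<open>The real orthogonal decomposition serves: W is closed under multiplication by i, so real
  orthogonality to w and to i w is Hermitian orthogonality.\<close>

lemma orth_decomp_exists: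
  fixes W :: "(complex^'n) set"
  assumes W: "vec.subspace W"
  shows "\<exists>y\<in>W. \<forall>w\<in>W. hinner w (v - y) = 0"
proof -
  have sc: "r *\<^sub>R w = of_real r *s w" for r and w :: "complex^'n"
    by (simp add: vec_eq_iff scaleR_conv_of_real[symmetric])
  have rW: "subspace W"
    unfolding subspace_def sc using W by (auto simp: vec.subspace_def)
  obtain y z where yz: "y \<in> span W" "\<And>w. w \<in> span W \<Longrightarrow> orthogonal z w" "v = y + z"
    using orthogonal_subspace_decomp_exists[of W v] by blast
  have sp: "span W = W" using rW by (simp add: span_eq_iff)
  have "hinner w (v - y) = 0" if w: "w \<in> W" for w
  proof -
    have iw: "\<i> *s w \<in> W" using vec.subspace_scale[OF W w] .
    have "inner w z = 0" "inner (\<i> *s w) z = 0"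
      using yz(2)[of w] yz(2)[of "\<i> *s w"] w iw unfolding sp orthogonal_def inner_commute[of z] by blast+
    then have "Re (hinner w z) = 0" "Re (hinner (\<i> *s w) z) = 0" unfolding inner_eq_Re_hinner .
    then have "hinner w z = 0" by (simp add: hinner_simps complex_eq_iff)
    then show ?thesis using yz(3) by simp
  qed
  then show ?thesis using yz(1) sp by blast
qed

lemma orth_proj_works:
  fixes W :: "(complex^'n) set"
  assumes W: "vec.subspace W"
  shows "orth_proj W *v v \<in> W" "\<forall>w\<in>W. hinner w (v - orth_proj W *v v) = 0"
proof -
  have "\<forall>v. \<exists>y. y \<in> W \<and> (\<forall>w\<in>W. hinner w (v - y) = 0)" using orth_decomp_exists[OF W] by blast
  from choice[OF this] obtain p where p: "\<forall>v. p v \<in> W \<and> (\<forall>w\<in>W. hinner w (v - p v) = 0)" by blast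
  have pI: "p v = y" if "y \<in> W" "\<forall>w\<in>W. hinner w (v - y) = 0" for v y
    using orth_decomp_unique[OF W _ that(1) _ that(2)] p by blast
  have "Vector_Spaces.linear (*s) (*s) p"
  proof (rule Vector_Spaces.linear_iff[THEN iffD2], intro conjI allI)
    fix u v and c :: complex
    show "p (u + v) = p u + p v"
    proof (rule pI)
      show "p u + p v \<in> W" using p vec.subspace_add[OF W] by blast
      have "u + v - (p u + p v) = (u - p u) + (v - p v)" by simp
      then show "\<forall>w\<in>W. hinner w (u + v - (p u + p v)) = 0" using p by (simp only: hinner_simps(2)) simp
    qed
    show "p (c *s v) = c *s p v"
    proof (rule pI)
      show "c *s p v \<in> W" using p vec.subspace_scale[OF W] by blast
      have "c *s v - c *s p v = c *s (v - p v)" by (simp add: vec.scale_right_diff_distrib)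
      then show "\<forall>w\<in>W. hinner w (c *s v - c *s p v) = 0" using p by (simp only: hinner_simps(6)) simp
    qed
  qed (unfold_locales)
  then have M: "matrix p *v v = p v" for v by (rule matrix_works)
  let ?Q = "\<lambda>P. \<forall>v. P *v v \<in> W \<and> (\<forall>w\<in>W. hinner w (v - P *v v) = 0)"
  have "?Q (orth_proj W)"
    unfolding orth_proj_def
  proof (rule theI[of ?Q])
    show "?Q (matrix p)" unfolding M using p by blast
    fix P assume P: "?Q P"
    have "P *v v = matrix p *v v" for v unfolding M using pI[of "P *v v" v] P by simp
    then show "P = matrix p" by (simp add: matrix_eq)
  qed
  then show "orth_proj W *v v \<in> W" "\<forall>w\<in>W. hinner w (v - orth_proj W *v v) = 0" by auto
qed

lemma orth_proj_eqI:
  assumes "vec.subspace W" "y \<in> W" "\<forall>w\<in>W. hinner w (v - y) = 0"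
  shows "orth_proj W *v v = y"
  using orth_decomp_unique[OF assms(1) orth_proj_works(1)[OF assms(1)] assms(2) orth_proj_works(2)[OF assms(1)] assms(3)] .

lemma orth_proj_hermitian:
  assumes W: "vec.subspace W"
  shows "orth_proj W $ x $ y = cnj (orth_proj W $ y $ x)"
proof -
  let ?P = "orth_proj W"
  have h: "hinner (?P *v a) b = hinner (?P *v a) (?P *v b)" for a b
    using orth_proj_works(2)[OF W, of b] orth_proj_works(1)[OF W, of a] by (simp add: hinner_simps)
  have "hinner (?P *v a) b = hinner a (?P *v b)" for a b
    using h[of a b] h[of b a] hinner_cnj[of "?P *v a" "?P *v b"] hinner_cnj[of a "?P *v b"] by simp
  from this[of "ket x" "ket y"] show ?thesis by (simp add: hinner_ket)
qed

lemma subspace_eigenspace: "vec.subspace (eigenspace M c)"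
  by (auto simp: vec.subspace_def eigenspace_def matrix_vector_right_distrib vec.scale vec.scale_right_distrib mult.commute)

section \<open>Radial vectors and the row of the idempotent at x_0\<close>

definition lay :: "('a::{field,finite}, 'd::finite) lagr \<Rightarrow> nat" where
  "lay x = CARD('d) - vec.dim (base x)"

definition radial :: "(nat \<Rightarrow> complex) \<Rightarrow> complex^('a::{field,finite}, 'd::finite) lagr" where
  "radial f = (\<chi> x. f (lay x))"

definition lsum :: "complex^('a::{field,finite}, 'd::finite) lagr \<Rightarrow> nat \<Rightarrow> complex" where
  "lsum w i = (\<Sum>x | lay x = i. w $ x)"

lemma lay_le: "lay (x :: ('a::{field,finite}, 'd::finite) lagr) \<le> CARD('d)"
  by (simp add: lay_def)

lemma hinner_radial: "hinner (radial f) (w :: complex^('a::{field,finite}, 'd::finite) lagr) = (\<Sum>i\<le>CARD('d). cnj (f i) * lsum w i)"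
proof -
  have "hinner (radial f) w = (\<Sum>i\<in>{..CARD('d)}. \<Sum>x\<in>{x. x \<in> UNIV \<and> lay x = i}. cnj (f (lay x)) * w $ x)"
    unfolding hinner_def radial_def using lay_le[where 'a = 'a and 'd = 'd] by (subst sum.group) auto
  then show ?thesis by (simp add: lsum_def sum_distrib_left)
qed

lemma adj_sym: "adj x y = adj y x"
  by (simp add: adj_def Int_commute)

lemma A_mat_hermitian: "hinner (A_mat *v v) w = hinner v (A_mat *v w)"
proof -
  have "hinner (A_mat *v v) w = (\<Sum>x\<in>UNIV. \<Sum>y\<in>UNIV. if adj x y then cnj (v $ y) * w $ x else 0)"
    by (simp add: hinner_def A_mat_mult sum_distrib_right sum.If_cases)
  also have "\<dots> = (\<Sum>y\<in>UNIV. \<Sum>x\<in>UNIV. if adj x y then cnj (v $ y) * w $ x else 0)"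
    by (rule sum.swap)
  also have "\<dots> = hinner v (A_mat *v w)"
    by (simp add: hinner_def A_mat_mult sum_distrib_left sum.If_cases adj_sym)
  finally show ?thesis .
qed

lemma evec_join: "evec m = join (axis m 1) 0" and fvec_join: "fvec m = join 0 (axis m 1)"
  by (auto simp: evec_def fvec_def join_def axis_def vec_eq_iff split: sum.split)

lemma join_expand: "join a b = (\<Sum>m\<in>UNIV. a $ m *s evec m) + (\<Sum>m\<in>UNIV. b $ m *s fvec m)"
proof (rule vec_eq_iff[THEN iffD2], rule allI)
  fix i
  show "join a b $ i = ((\<Sum>m\<in>UNIV. a $ m *s evec m) + (\<Sum>m\<in>UNIV. b $ m *s fvec m)) $ i"
    by (cases i) (simp_all add: join_def evec_def fvec_def axis_def sum_component if_distrib[of "\<lambda>x. y * x" for y] cong: if_cong)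
qed

context odd_prime_field
begin

lemma perp_coord_space: "perp (coord_space k) = {b :: ('a, 'd::{finite,linorder}) vec. \<forall>m. pos m \<le> k \<longrightarrow> b $ m = 0}"
proof (intro set_eqI iffI CollectI allI impI)
  fix b :: "('a, 'd) vec" and m :: 'd assume b: "b \<in> perp (coord_space k)" "pos m \<le> k"
  have "axis m 1 \<in> (coord_space k :: ('a, 'd) vec set)" using b(2) by (auto simp: coord_space_def axis_def)
  then have "dot (axis m 1) b = 0" using b(1) unfolding perp_def by blast
  then show "b $ m = 0" by simp
next
  fix b :: "('a, 'd) vec" assume b: "b \<in> {b. \<forall>m. pos m \<le> k \<longrightarrow> b $ m = 0}"
  have "u $ m * b $ m = 0" if "u \<in> coord_space k" for u :: "('a, 'd) vec" and m
    using that b by (cases "pos m \<le> k") (auto simp: coord_space_def)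
  then show "b \<in> perp (coord_space k)" by (auto simp: perp_def dot_def intro!: sum.neutral)
qed

lemma xl_eq: "xl i = Lg (coord_space (CARD('d) - i)) (0 :: ('a, 'd::{finite,linorder}) sqmat)"
proof -
  let ?k = "CARD('d) - i" and ?E = "evec ` {m :: 'd. pos m \<le> CARD('d) - i} \<union> fvec ` {m. pos m > CARD('d) - i} :: ('a, 'd + 'd) vec set"
  have "vec.span ?E = Lset (coord_space ?k) 0"
  proof
    show "vec.span ?E \<subseteq> Lset (coord_space ?k) 0"
      by (rule vec.span_minimal[OF _ subspace_Lset[OF subspace_coord_space]])
        (auto simp: evec_join fvec_join mem_Lset perp_coord_space; auto simp: coord_space_def axis_def)
    show "Lset (coord_space ?k) 0 \<subseteq> vec.span ?E"
    proof
      fix v :: "('a, 'd + 'd) vec" assume v: "v \<in> Lset (coord_space ?k) 0"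
      then have a: "pL v $ m = 0" if "pos m > ?k" for m using that by (simp add: mem_Lset coord_space_def)
      have b: "pR v $ m = 0" if "pos m \<le> ?k" for m using that v by (simp add: mem_Lset perp_coord_space)
      have "pL v $ m *s evec m \<in> vec.span ?E" for m
      proof (cases "pos m \<le> ?k")
        case True
        then show ?thesis by (intro vec.span_scale vec.span_base) auto
      qed (use a[of m] in \<open>simp add: vec.span_zero\<close>)
      moreover have "pR v $ m *s fvec m \<in> vec.span ?E" for m
      proof (cases "pos m \<le> ?k")
        case False
        then show ?thesis by (intro vec.span_scale vec.span_base) auto
      qed (use b[of m] in \<open>simp add: vec.span_zero\<close>)
      ultimately have "join (pL v) (pR v) \<in> vec.span ?E"
        unfolding join_expand by (intro vec.span_add vec.span_sum)
      then show "v \<in> vec.span ?E" by simp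
    qed
  qed
  then show ?thesis unfolding xl_def Lg_def by simp
qed

lemma lay_Lg: "vec.subspace U \<Longrightarrow> F \<in> Sym \<Longrightarrow> lay (Lg U F) = CARD('d) - vec.dim U" for F :: "('a, 'd::finite) sqmat"
  by (simp add: lay_def base_Lg)

lemma coord_space_UNIV: "coord_space CARD('d) = (UNIV :: ('a, 'd::{finite,linorder}) vec set)"
  using pos_pos(2) by (auto simp: coord_space_def not_less[symmetric])

lemma lay_eq_0: "lay x = 0 \<longleftrightarrow> x = (xl 0 :: ('a, 'd::{finite,linorder}) lagr)"
proof
  assume l: "lay x = 0"
  obtain U F where x: "vec.subspace U" "F \<in> Sym" "x = Lg U F" using lagr_cases by blast
  have "vec.dim U \<ge> CARD('d)" using l x by (simp add: lay_Lg)
  then have "U = UNIV" using vec.subspace_dim_equal[OF x(1) vec.subspace_UNIV] by (simp add: card_cart_basis)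
  then have "x = Lg UNIV 0" unfolding x(3) using Lg_eq_iff[OF x(1,2) x(1) Sym_closed(3)] by simp
  then show "x = xl 0" by (simp add: xl_eq coord_space_UNIV)
next
  assume "x = xl 0"
  then show "lay x = 0" by (simp add: xl_eq coord_space_UNIV lay_Lg Sym_closed card_cart_basis)
qed

lemma mtype_0: "mtype (0 :: ('a, 'd::{finite,linorder}) sqmat) = 1"
  by (simp add: mtype_def)

lemma Sym_0: "(0 :: ('a, 'd::finite) sqmat) \<in> Sym"
  by (rule Sym_closed)

text \<open>A radial vector is the image of a dimension function under \<open>Psi\<close> for S = 0,
  so the general formula applies with all phases equal to 1.\<close>

lemma A_mat_radial:
  "(A_mat *v radial f) $ (x :: ('a, 'd::{finite,linorder}) lagr) = of_real (qnum CARD('a) (lay x)) * f (lay x - 1)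
    + (of_nat CARD('a) ^ lay x - 1) * f (lay x)
    + of_nat CARD('a) ^ (lay x + 1) * of_real (qnum CARD('a) (CARD('d) - lay x)) * f (lay x + 1)"
proof -
  let ?u = "(\<chi> X. f (CARD('d) - vec.dim (unemb X)) / nrm (unemb X)) :: complex^(('a, 'd + 'd) vec set)"
  let ?S = "0 :: ('a, 'd) sqmat" and ?D = "CARD('d)"
  have k0: "nullspace ?S = UNIV" by (simp add: nullspace_def)
  have R: "radial f = Psi ?S ?u"
  proof (rule vec_eq_iff[THEN iffD2], rule allI)
    fix x :: "('a, 'd) lagr"
    obtain U F where x: "vec.subspace U" "F \<in> Sym" "x = Lg U F" using lagr_cases by blast
    then show "radial f $ x = Psi ?S ?u $ x" by (simp add: radial_def lay_Lg Psi_Lg[OF Sym_0] k0)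
  qed
  obtain U F where x: "vec.subspace U" "F \<in> Sym" "x = Lg U F" using lagr_cases by blast
  have i: "lay x = ?D - vec.dim U" using x by (simp add: lay_Lg)
  have dU: "vec.dim U \<le> ?D" using dim_subset_UNIV_cart_gen by blast
  have dU': "vec.dim U' \<le> ?D" for U' :: "('a, 'd) vec set" using dim_subset_UNIV_cart_gen by blast
  have "A_mat *v Psi ?S ?u \<in> Iso ?S" by (intro A_mat_Iso Psi_in_Iso Sym_0)
  then have "(A_mat *v Psi ?S ?u) $ Lg U (0 + F) = psi (trace (?S ** F)) * (A_mat *v Psi ?S ?u) $ Lg U 0"
    using x Sym_0 unfolding Iso_def by blast
  then have "(A_mat *v radial f) $ x = (A_mat *v Psi ?S ?u) $ Lg U 0" by (simp add: R x(3))
  also have "\<dots> = (\<Sum>U'\<in>{U'. vec.subspace U' \<and> U' \<subseteq> UNIV \<and> cov U U'}. nrm U' * ?u $ emb U')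
    + (of_nat CARD('a) ^ (?D - vec.dim U) - 1) * (nrm U * ?u $ emb U)
    + (\<Sum>U'\<in>{U'. vec.subspace U' \<and> cov U' U}. of_nat CARD('a) ^ (?D - vec.dim U') * (nrm U' * ?u $ emb U'))"
    using A_mat_Psi_value[OF Sym_0 x(1), of ?u] by (simp add: k0 mtype_0 rank_zero)
  also have "(\<Sum>U'\<in>{U'. vec.subspace U' \<and> U' \<subseteq> UNIV \<and> cov U U'}. nrm U' * ?u $ emb U')
    = (\<Sum>U'\<in>{U'. vec.subspace U' \<and> U' \<subseteq> UNIV \<and> cov U U'}. f (lay x - 1))"
    using i by (intro sum.cong refl) (auto simp: cov_def)
  also have "\<dots> = of_real (qnum CARD('a) (lay x)) * f (lay x - 1)"
  proof -
    have "complex_of_nat (card {U'. vec.subspace U' \<and> U' \<subseteq> UNIV \<and> cov U U'}) = of_real (qnum CARD('a) (lay x))"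
      using arg_cong[OF card_up[OF x(1) vec.subspace_UNIV], of complex_of_real] i by (simp add: card_cart_basis)
    then show ?thesis by (simp only: sum_constant)
  qed
  also have "(\<Sum>U'\<in>{U'. vec.subspace U' \<and> cov U' U}. of_nat CARD('a) ^ (?D - vec.dim U') * (nrm U' * ?u $ emb U'))
    = (\<Sum>U'\<in>{U'. vec.subspace U' \<and> cov U' U}. of_nat CARD('a) ^ (lay x + 1) * f (lay x + 1))"
  proof (intro sum.cong refl)
    fix U' assume "U' \<in> {U'. vec.subspace U' \<and> cov U' U}"
    then have "?D - vec.dim U' = lay x + 1" using i dU by (auto simp: cov_def)
    then show "of_nat CARD('a) ^ (?D - vec.dim U') * (nrm U' * ?u $ emb U') = of_nat CARD('a) ^ (lay x + 1) * f (lay x + 1)" by simp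
  qed
  also have "\<dots> = of_nat CARD('a) ^ (lay x + 1) * of_real (qnum CARD('a) (?D - lay x)) * f (lay x + 1)"
  proof -
    have "complex_of_nat (card {U'. vec.subspace U' \<and> cov U' U}) = of_real (qnum CARD('a) (?D - lay x))"
      using arg_cong[OF card_down[OF x(1)], of complex_of_real] i dU by simp
    then show ?thesis by (simp only: sum_constant mult_ac)
  qed
  also have "nrm U * ?u $ emb U = f (lay x)" using i by simp
  finally show ?thesis using i by simp
qed

lemma x0_lay: "{x. lay x = 0} = {xl 0 :: ('a, 'd::{finite,linorder}) lagr}"
  using lay_eq_0 by auto

lemma lsum_0: "lsum w 0 = w $ (xl 0 :: ('a, 'd::{finite,linorder}) lagr)"
  by (simp add: lsum_def x0_lay)

lemma lsum_above: "i > CARD('d) \<Longrightarrow> lsum (w :: complex^('a, 'd::finite) lagr) i = 0"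
proof -
  assume i: "i > CARD('d)"
  have "lay x \<noteq> i" for x :: "('a, 'd) lagr" using lay_le[of x] i by linarith
  then show ?thesis by (simp add: lsum_def)
qed

text \<open>Pair the eigenvector with the indicator of a layer and move the Hermitian
  \<open>A\<close> to the indicator, whose image is supported on three layers.\<close>

lemma lsum_recurrence:
  fixes w :: "complex^('a, 'd::{finite,linorder}) lagr"
  assumes w: "A_mat *v w = c *s w" and i: "i \<le> CARD('d)"
  shows "c * lsum w i = of_real (qnum CARD('a) (i + 1)) * lsum w (i + 1) + (of_nat CARD('a) ^ i - 1) * lsum w i
    + (if i = 0 then 0 else of_nat CARD('a) ^ i * of_real (qnum CARD('a) (CARD('d) - (i - 1))) * lsum w (i - 1))"
proof -
  let ?\<delta> = "\<lambda>j. if j = i then 1 else 0 :: complex"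
  let ?g = "\<lambda>j. (if j = i + 1 then of_real (qnum CARD('a) (i + 1)) else 0) + (if j = i then of_nat CARD('a) ^ i - 1 else 0)
    + (if i \<noteq> 0 \<and> j = i - 1 then of_nat CARD('a) ^ i * of_real (qnum CARD('a) (CARD('d) - (i - 1))) else 0) :: complex"
  have g: "A_mat *v radial ?\<delta> = (radial ?g :: complex^('a, 'd) lagr)"
  proof (rule vec_eq_iff[THEN iffD2], rule allI)
    fix x :: "('a, 'd) lagr"
    show "(A_mat *v radial ?\<delta>) $ x = radial ?g $ x"
      unfolding A_mat_radial by (cases "lay x"; cases i) (auto simp: radial_def)
  qed
  have S: "(\<Sum>j\<le>CARD('d). (if j = a then b else 0) * lsum w j) = b * lsum w a" for a b
    using lsum_above[of a w] by (cases "a \<le> CARD('d)") (auto simp: if_distrib[of "\<lambda>x. x * y" for y] not_le cong: if_cong)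
  have "c * lsum w i = hinner (radial ?\<delta>) (A_mat *v w)"
    unfolding w hinner_simps(6) hinner_radial using i by (simp add: if_distrib[of cnj] S cong: if_cong)
  also have "\<dots> = hinner (radial ?g) w" unfolding A_mat_hermitian[symmetric] g ..
  \<comment> \<open>For i = 0 the lower index is redirected to D + 1, where layer sums vanish;
    truncated i - 1 would wrongly hit layer 0.\<close>
  also have "\<dots> = (\<Sum>j\<le>CARD('d). ((if j = i + 1 then of_real (qnum CARD('a) (i + 1)) else 0) + (if j = i then of_nat CARD('a) ^ i - 1 else 0)
    + (if j = (if i = 0 then CARD('d) + 1 else i - 1) then of_nat CARD('a) ^ i * of_real (qnum CARD('a) (CARD('d) - (i - 1))) else 0)) * lsum w j)"
    unfolding hinner_radial by (intro sum.cong refl) auto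
  also have "\<dots> = of_real (qnum CARD('a) (i + 1)) * lsum w (i + 1) + (of_nat CARD('a) ^ i - 1) * lsum w i
    + of_nat CARD('a) ^ i * of_real (qnum CARD('a) (CARD('d) - (i - 1))) * lsum w (if i = 0 then CARD('d) + 1 else i - 1)"
    unfolding distrib_right sum.distrib S ..
  finally show ?thesis using lsum_above[of "CARD('d) + 1" w] by auto
qed

lemma qnum_nonzero: "n > 0 \<Longrightarrow> qnum CARD('a) n \<noteq> 0"
proof -
  assume "n > 0"
  then have "real CARD('a) ^ n > 1" using q_gt_2 by (intro one_less_power) auto
  then show ?thesis using q_gt_2 by (simp add: qnum_def)
qed

text \<open>The layer sums of an eigenvector satisfy a three-term recurrence, so they are determined by the value at \<open>x_0\<close>. Hence the projection of \<open>|x_0\<rangle>\<close> to an eigenspace containing a radial vector is radial.\<close>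

lemma lsum_proportional:
  fixes w w' :: "complex^('a, 'd::{finite,linorder}) lagr"
  assumes w: "A_mat *v w = c *s w" "A_mat *v w' = c *s w'"
  shows "lsum w i * lsum w' 0 = lsum w' i * lsum w 0"
proof (induction i rule: less_induct)
  case (less i)
  show ?case
  proof (cases i)
    case (Suc k)
    show ?thesis
    proof (cases "k \<le> CARD('d)")
      case True
      let ?Q = "of_real (qnum CARD('a) (k + 1)) :: complex"
      have Q: "?Q \<noteq> 0" using qnum_nonzero[of "k + 1"] by simp
      note r = lsum_recurrence[OF w(1) True] lsum_recurrence[OF w(2) True]
      have k: "lsum w k * lsum w' 0 = lsum w' k * lsum w 0" using less[of k] Suc by simp
      have k1: "lsum w (k - 1) * lsum w' 0 = lsum w' (k - 1) * lsum w 0" using less[of "k - 1"] Suc by simp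
      let ?B = "if k = 0 then 0 else of_nat CARD('a) ^ k * of_real (qnum CARD('a) (CARD('d) - (k - 1))) :: complex"
      have e: "?Q * lsum v (k + 1) = (c - (of_nat CARD('a) ^ k - 1)) * lsum v k - ?B * lsum v (k - 1)"
        if "A_mat *v v = c *s v" for v :: "complex^('a, 'd) lagr"
        using lsum_recurrence[OF that True] by (auto simp: algebra_simps)
      have "?Q * (lsum w (k + 1) * lsum w' 0) = (c - (of_nat CARD('a) ^ k - 1)) * (lsum w k * lsum w' 0) - ?B * (lsum w (k - 1) * lsum w' 0)"
        using e[OF w(1)] by (simp add: left_diff_distrib mult.assoc[symmetric])
      also have "\<dots> = ?Q * (lsum w' (k + 1) * lsum w 0)"
        unfolding k k1 using e[OF w(2)] by (simp add: left_diff_distrib mult.assoc[symmetric])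
      finally show ?thesis using Q Suc by simp
    next
      case False
      then show ?thesis using lsum_above[of i w] lsum_above[of i w'] Suc by simp
    qed
  qed simp
qed

text \<open>Up to a non-zero factor the diagonal of \<open>A_star\<close> on layer i. It has the
  form q^(-i) plus a constant, and the constant is the one that makes the radial vector a
  theta_1-eigenvector.\<close>

definition dual_fun :: "nat \<Rightarrow> nat \<Rightarrow> real" where
  "dual_fun D i = 1 / real CARD('a) ^ i - 2 / (real CARD('a) ^ D + 1)"

lemma dual_fun_inj: "dual_fun D i = dual_fun D j \<longleftrightarrow> i = j"
  using q_gt_2 by (auto simp: dual_fun_def power_inject_exp)

lemma dual_fun_0: "D > 0 \<Longrightarrow> dual_fun D 0 \<noteq> 0"
proof -
  assume "D > 0"
  then have "real CARD('a) ^ D > 1" using q_gt_2 by (intro one_less_power) auto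
  then show ?thesis by (simp add: dual_fun_def field_simps)
qed

lemma theta_1_eigenvector:
  "A_mat *v radial (\<lambda>i. of_real (dual_fun CARD('d) i)) =
    theta CARD('a) CARD('d) 1 *s (radial (\<lambda>i. of_real (dual_fun CARD('d) i)) :: complex^('a, 'd::{finite,linorder}) lagr)"
proof (rule vec_eq_iff[THEN iffD2], rule allI)
  fix x :: "('a, 'd) lagr"
  let ?q = "real CARD('a)" and ?D = "CARD('d)" and ?i = "lay x"
  let ?\<theta> = "(1 - 2 * ?q + ?q ^ ?D) / (?q - 1)" and ?u = "dual_fun CARD('d)"
  have q: "?q > 1" using q_gt_2 by simp
  have th: "theta CARD('a) ?D 1 = of_real ?\<theta>" by (simp add: theta_def)
  have "qnum CARD('a) ?i * ?u (?i - 1) + (?q ^ ?i - 1) * ?u ?i + ?q ^ (?i + 1) * qnum CARD('a) (?D - ?i) * ?u (?i + 1) = ?\<theta> * ?u ?i"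
  proof -
    \<comment> \<open>On layer 0 the factor qnum 0 = 0 hides the truncated index i - 1.\<close>
    have a: "qnum CARD('a) ?i * ?u (?i - 1) = qnum CARD('a) ?i * (?q / ?q ^ ?i - 2 / (?q ^ ?D + 1))"
      using q by (cases ?i) (simp_all add: dual_fun_def)
    have b: "?q ^ (?D - ?i) = ?q ^ ?D / ?q ^ ?i" using lay_le[of x] q by (simp add: power_diff)
    let ?X = "?q ^ ?i" and ?A = "?q ^ ?D"
    have pos: "?X > 0" "?A > 0" using q by auto
    then have A1: "?A + 1 \<noteq> 0" by linarith
    have "((?X - 1) / (?q - 1)) * (?q / ?X - 2 / (?A + 1)) + (?X - 1) * (1 / ?X - 2 / (?A + 1))
      + ?q * ?X * ((?A / ?X - 1) / (?q - 1)) * (1 / (?q * ?X) - 2 / (?A + 1)) = (1 - 2 * ?q + ?A) / (?q - 1) * (1 / ?X - 2 / (?A + 1))"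
      using pos q A1 by (simp add: divide_simps) (simp add: algebra_simps)
    then show ?thesis unfolding a unfolding qnum_def b dual_fun_def by simp
  qed
  from arg_cong[OF this, of complex_of_real]
  show "(A_mat *v radial (\<lambda>i. of_real (?u i))) $ x = (theta CARD('a) ?D 1 *s radial (\<lambda>i. of_real (?u i))) $ x"
    unfolding A_mat_radial th by (simp add: radial_def)
qed

text \<open>For every eigenvector w, \<open>lsum_proportional\<close> makes the product with the
  radial eigenvector u a fixed multiple of w(x_0). Hence the projection of the ket of x_0 is a
  multiple of u.\<close>

lemma E_1_entry:
  obtains c :: real where "c \<noteq> 0"
    "\<And>x :: ('a, 'd::{finite,linorder}) lagr. E_mat 1 $ xl 0 $ x = of_real (c * dual_fun CARD('d) (lay x))"
proof -
  let ?W = "eigenspace A_mat (theta CARD('a) CARD('d) 1) :: (complex^('a, 'd) lagr) set"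
  let ?u = "radial (\<lambda>i. of_real (dual_fun CARD('d) i)) :: complex^('a, 'd) lagr"
  let ?z = "dual_fun CARD('d) 0"
  have uW: "?u \<in> ?W" using theta_1_eigenvector by (simp add: eigenspace_def)
  have u0: "?z \<noteq> 0" by (rule dual_fun_0) simp
  have l0: "lsum ?u 0 = of_real ?z" by (simp add: lsum_0 radial_def lay_eq_0[THEN iffD2])
  define n where "n = (\<Sum>x\<in>(UNIV :: ('a, 'd) lagr set). (dual_fun CARD('d) (lay x)) ^ 2)"
  have n: "hinner ?u ?u = of_real n" by (simp add: hinner_def radial_def n_def power2_eq_square)
  have "?u \<noteq> 0"
  proof
    assume "?u = 0"
    then have "?u $ xl 0 = 0" by simp
    then show False using u0 by (simp add: radial_def lay_eq_0[THEN iffD2])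
  qed
  then have n0: "n \<noteq> 0" using n hinner_self_eq_0[of ?u] by auto
  \<comment> \<open>The Fourier coefficient u(x_0)/|u|^2 of the ket of x_0 along u.\<close>
  define c where "c = ?z / n"
  have "orth_proj ?W *v ket (xl 0) = of_real c *s ?u"
  proof (rule orth_proj_eqI[OF subspace_eigenspace])
    show "of_real c *s ?u \<in> ?W" by (rule vec.subspace_scale[OF subspace_eigenspace uW])
    show "\<forall>w\<in>?W. hinner w (ket (xl 0) - of_real c *s ?u) = 0"
    proof
      fix w assume w: "w \<in> ?W"
      have p: "lsum w i * of_real ?z = lsum ?u i * lsum w 0" for i
        using lsum_proportional[of w "theta CARD('a) CARD('d) 1" ?u i] w uW unfolding eigenspace_def mem_Collect_eq l0 by blast
      have "of_real ?z * hinner ?u w = (\<Sum>i\<le>CARD('d). of_real (dual_fun CARD('d) i) * (lsum w i * of_real ?z))"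
        unfolding hinner_radial by (simp add: sum_distrib_left mult_ac)
      also have "\<dots> = hinner ?u ?u * lsum w 0"
        unfolding p hinner_radial[of _ ?u] sum_distrib_right by (simp add: mult_ac)
      finally have "of_real ?z * hinner ?u w = of_real n * lsum w 0" unfolding n .
      then have e: "w $ xl 0 = of_real c * hinner ?u w" using n0 by (simp add: c_def lsum_0 field_simps)
      have "hinner w (ket (xl 0) - of_real c *s ?u) = cnj (w $ xl 0) - of_real c * cnj (hinner ?u w)"
        using hinner_cnj[of w ?u] by (simp add: hinner_simps hinner_ket)
      then show "hinner w (ket (xl 0) - of_real c *s ?u) = 0" unfolding e by simp
    qed
  qed
  then have E: "E_mat 1 *v ket (xl 0) = of_real c *s ?u" by (simp add: E_mat_def)
  have "E_mat 1 $ xl 0 $ x = of_real (c * dual_fun CARD('d) (lay x))" for x :: "('a, 'd) lagr"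
  proof -
    have "E_mat 1 $ xl 0 $ x = cnj (E_mat 1 $ x $ xl 0)"
      unfolding E_mat_def by (rule orth_proj_hermitian[OF subspace_eigenspace])
    also have "E_mat 1 $ x $ xl 0 = (E_mat 1 *v ket (xl 0)) $ x" by simp
    finally show ?thesis unfolding E by (simp add: radial_def)
  qed
  moreover have "c \<noteq> 0" using u0 n0 by (simp add: c_def)
  ultimately show ?thesis using that by blast
qed

lemma A_star_diag:
  obtains g :: "nat \<Rightarrow> complex" where "inj g"
    "A_star = (\<chi> x y. if x = (y :: ('a, 'd::{finite,linorder}) lagr) then g (lay x) else 0)"
proof -
  obtain c :: real where c: "c \<noteq> 0" "\<And>x :: ('a, 'd) lagr. E_mat 1 $ xl 0 $ x = of_real (c * dual_fun CARD('d) (lay x))"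
    using E_1_entry by blast
  define g where "g i = of_nat CARD(('a, 'd) lagr) * complex_of_real (c * dual_fun CARD('d) i)" for i
  have "inj g" using c(1) by (auto simp: inj_def g_def dual_fun_inj)
  moreover have "A_star = (\<chi> x y. if x = (y :: ('a, 'd) lagr) then g (lay x) else 0)"
    unfolding A_star_def c(2) g_def ..
  ultimately show ?thesis using that by blast
qed

definition lproj :: "nat \<Rightarrow> (complex, ('a, 'd::{finite,linorder}) lagr) sqmat" where
  "lproj i = (\<chi> x y. if x = y then (if lay x = i then 1 else 0) else 0)"

text \<open>\<open>A_star\<close> is diagonal with values separating the layers, so interpolation
  yields the indicator of a layer inside the algebra.\<close>

lemma lproj_in_T_alg: "lproj i \<in> (T_alg :: (complex, ('a, 'd::{finite,linorder}) lagr) sqmat set)"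
proof -
  let ?m = "\<lambda>f. (\<chi> x y. if x = y then f x else 0) :: (complex, ('a, 'd) lagr) sqmat"
  obtain g :: "nat \<Rightarrow> complex" where g: "inj g" "A_star = ?m (\<lambda>x. g (lay x))" using A_star_diag by blast
  have "?m (\<lambda>x. if g (lay x) = g i then 1 else 0) \<in> T_alg"
  proof (rule level_indicator_closed[where Q = "\<lambda>f. ?m f \<in> T_alg"], goal_cases)
    case 1
    have "?m (\<lambda>_. 1) = mat 1" by (simp add: mat_def)
    then show ?case using one_in by simp
  next
    case (2 f h)
    have "?m (\<lambda>x. f x + h x) = ?m f + ?m h" by (auto simp: vec_eq_iff)
    then show ?case using add_in[OF 2] by simp
  next
    case (3 c f)
    have "?m (\<lambda>x. c * f x) = (\<chi> x y. c * ?m f $ x $ y)" by (auto simp: vec_eq_iff)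
    then show ?case using scale_in[OF 3, of c] by simp
  next
    case (4 f h)
    have "?m (\<lambda>x. f x * h x) *v v = (?m f ** ?m h) *v v" for v
      by (simp add: diag_mult mult.assoc flip: matrix_vector_mul_assoc)
    then have "?m (\<lambda>x. f x * h x) = ?m f ** ?m h" by (simp add: matrix_eq)
    then show ?case using mult_in[OF 4] by simp
  next
    case 5
    show ?case using A_star_in g(2) by simp
  qed
  moreover have "g (lay x) = g i \<longleftrightarrow> lay x = i" for x :: "('a, 'd) lagr" using g(1) by (auto simp: inj_def)
  ultimately show ?thesis by (simp add: lproj_def cong: if_cong)
qed

lemma lproj_mult: "lproj i *v v = (\<chi> x. if lay x = i then v $ x else 0)"
  unfolding lproj_def diag_mult by (simp add: vec_eq_iff)

end

subsection \<open>Irreducibility\<close>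

definition flat_eigenvalue :: "('a::{field,finite}, 'd::{finite,linorder}) sqmat \<Rightarrow> nat \<Rightarrow> complex" where
  "flat_eigenvalue S k = of_int (mtype S) * of_nat CARD('a) ^ (CARD('d) - k - rank S div 2) - 1"

text \<open>\<open>A\<close> transported to the lattice by \<open>Psi S\<close>.\<close>

definition Bop :: "('a::{field,finite}, 'd::{finite,linorder}) sqmat \<Rightarrow> complex^(('a^('d + 'd)) set) \<Rightarrow> complex^(('a^('d + 'd)) set)" where
  "Bop S u = (\<chi> X. if X \<in> subs (V0 S) then
     of_real (real CARD('a) powr (real (CARD('d) - vec.dim X) / 2)) * (Lm (V0 S) *v u) $ X
     + flat_eigenvalue S (vec.dim X) * u $ X
     + of_real (real CARD('a) powr ((real (CARD('d) - vec.dim X) + 1) / 2)) * (Rm (V0 S) *v u) $ X else 0)"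

lemma Lm_component: "(Lm Y *v u) $ X = (if X \<in> subs Y then \<Sum>X' | X' \<in> subs Y \<and> cov X X'. u $ X' else 0)"
proof -
  have "(Lm Y *v u) $ X = (\<Sum>X'\<in>UNIV. if X \<in> subs Y \<and> X' \<in> subs Y \<and> cov X X' then u $ X' else 0)"
    unfolding Lm_def matrix_vector_mult_def vec_lambda_beta by (intro sum.cong) auto
  then show ?thesis by (auto simp: sum.If_cases)
qed

lemma Rm_component: "(Rm Y *v u) $ X = (if X \<in> subs Y then \<Sum>X' | X' \<in> subs Y \<and> cov X' X. u $ X' else 0)"
proof -
  have "(Rm Y *v u) $ X = (\<Sum>X'\<in>UNIV. if X \<in> subs Y \<and> X' \<in> subs Y \<and> cov X' X then u $ X' else 0)"
    unfolding Rm_def matrix_vector_mult_def vec_lambda_beta by (intro sum.cong) auto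
  then show ?thesis by (auto simp: sum.If_cases)
qed

lemma Bop_lin: "Bop S (u + v) = Bop S u + Bop S v" "Bop S (c *s u) = c *s Bop S u" "Bop S 0 = 0"
  by (auto simp: Bop_def vec_eq_iff matrix_vector_right_distrib vec.scale algebra_simps)

lemma Bop_sum: "Bop S (\<Sum>i\<in>A. f i) = (\<Sum>i\<in>A. Bop S (f i))"
  by (induction A rule: infinite_finite_induct) (auto simp: Bop_lin)

lemma Bop_in_V_L: "Bop S u \<in> V_L (V0 S)"
  by (simp add: mem_V_L Bop_def)

context odd_prime_field
begin

text \<open>The source of the half-integral powers of q in \<open>Bop\<close>.\<close>

lemma nrm_cov:
  fixes U U' :: "('a, 'd::finite) vec set"
  assumes "cov U U'"
  shows "nrm U' = nrm U * of_real (real CARD('a) powr (real (CARD('d) - vec.dim U) / 2))"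
proof -
  have "vec.dim U' \<le> CARD('d)" using dim_subset_UNIV_cart_gen by blast
  then obtain i where i: "CARD('d) - vec.dim U = Suc i" "CARD('d) - vec.dim U' = i"
    using assms by (cases "CARD('d) - vec.dim U") (auto simp: cov_def)
  have "- (real i * (real i + 1) / 4) = - (real (Suc i) * (real (Suc i) + 1) / 4) + real (Suc i) / 2"
    by (simp add: field_simps)
  then show ?thesis using q_gt_2 unfolding nrm_def i by (simp only: powr_add of_real_mult)
qed

lemma A_Psi:
  fixes S :: "('a, 'd::{finite,linorder}) sqmat"
  assumes S: "S \<in> Sym"
  shows "A_mat *v Psi S u = Psi S (Bop S u)"
proof (rule Iso_eqI[OF S])
  show "A_mat *v Psi S u \<in> Iso S" by (intro A_mat_Iso Psi_in_Iso S)
  show "Psi S (Bop S u) \<in> Iso S" by (rule Psi_in_Iso[OF S])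
  fix U :: "('a, 'd) vec set" assume U: "vec.subspace U" "U \<subseteq> nullspace S"
  let ?q = "real CARD('a)" and ?i = "CARD('d) - vec.dim U"
  have X: "emb U \<in> subs (V0 S)" using U by (simp add: emb_in_subs)
  have up: "{X'. X' \<in> subs (V0 S) \<and> cov (emb U) X'} = emb ` {U'. vec.subspace U' \<and> U' \<subseteq> nullspace S \<and> cov U U'}"
    unfolding subs_V0 using cov_emb[OF U(1)] by auto
  have dn: "{X'. X' \<in> subs (V0 S) \<and> cov X' (emb U)} = emb ` {U'. vec.subspace U' \<and> cov U' U}"
  proof (intro set_eqI iffI)
    fix X assume "X \<in> {X'. X' \<in> subs (V0 S) \<and> cov X' (emb U)}"
    then obtain U' where "vec.subspace U'" "X = emb U'" "cov X (emb U)" unfolding subs_V0 by blast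
    then show "X \<in> emb ` {U'. vec.subspace U' \<and> cov U' U}" using cov_emb[OF _ U(1)] by blast
  next
    fix X assume "X \<in> emb ` {U'. vec.subspace U' \<and> cov U' U}"
    then obtain U' where u: "vec.subspace U'" "X = emb U'" "cov U' U" by blast
    then have "U' \<subseteq> nullspace S" using U(2) by (auto simp: cov_def)
    then show "X \<in> {X'. X' \<in> subs (V0 S) \<and> cov X' (emb U)}" using u cov_emb[OF u(1) U(1)] by (simp add: emb_in_subs)
  qed
  have 1: "(\<Sum>U'\<in>{U'. vec.subspace U' \<and> U' \<subseteq> nullspace S \<and> cov U U'}. nrm U' * u $ emb U')
      = nrm U * (of_real (?q powr (real ?i / 2)) * (Lm (V0 S) *v u) $ emb U)"
    unfolding Lm_component up sum.reindex[OF inj_on_subset[OF inj_emb subset_UNIV]] using X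
    by (simp add: sum_distrib_left mult.assoc) (intro sum.cong refl, simp add: nrm_cov)
  have 2: "(\<Sum>U'\<in>{U'. vec.subspace U' \<and> cov U' U}. of_nat CARD('a) ^ (CARD('d) - vec.dim U') * (nrm U' * u $ emb U'))
      = nrm U * (of_real (?q powr ((real ?i + 1) / 2)) * (Rm (V0 S) *v u) $ emb U)"
  proof -
    \<comment> \<open>Of the q^(i+1) neighbours over U', half of the exponent is absorbed by the
      ratio of the normalisations.\<close>
    have "of_nat CARD('a) ^ (CARD('d) - vec.dim U') * nrm U' = nrm U * of_real (?q powr ((real ?i + 1) / 2))"
      if c: "cov U' U" for U' :: "('a, 'd) vec set"
    proof -
      have "vec.dim U \<le> CARD('d)" using dim_subset_UNIV_cart_gen by blast
      then have d: "CARD('d) - vec.dim U' = Suc ?i" using c by (auto simp: cov_def)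
      have "complex_of_nat CARD('a) ^ Suc ?i = of_real (?q powr real (Suc ?i))"
        using q_gt_2 by (simp only: powr_realpow of_nat_0_less_iff zero_less_card_finite) simp
      also have "real (Suc ?i) = (real ?i + 1) / 2 + real (Suc ?i) / 2" by (simp add: field_simps)
      finally show ?thesis unfolding nrm_cov[OF c] d powr_add by simp
    qed
    then have "(\<Sum>U'\<in>{U'. vec.subspace U' \<and> cov U' U}. of_nat CARD('a) ^ (CARD('d) - vec.dim U') * (nrm U' * u $ emb U'))
        = (\<Sum>U'\<in>{U'. vec.subspace U' \<and> cov U' U}. nrm U * of_real (?q powr ((real ?i + 1) / 2)) * u $ emb U')"
      by (intro sum.cong refl) (simp only: mult.assoc[symmetric] mem_Collect_eq)
    then show ?thesis
      unfolding Rm_component dn sum.reindex[OF inj_on_subset[OF inj_emb subset_UNIV]] using X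
      by (simp add: sum_distrib_left mult.assoc)
  qed
  have "(A_mat *v Psi S u) $ Lg U 0 = nrm U * Bop S u $ emb U"
    unfolding A_mat_Psi_value[OF S U] 1 2 Bop_def flat_eigenvalue_def vec_lambda_beta
    using X U(1) by (simp add: algebra_simps)
  also have "\<dots> = Psi S (Bop S u) $ Lg U 0"
    using U by (simp add: Psi_Lg[OF S U(1) Sym_closed(3)])
  finally show "(A_mat *v Psi S u) $ Lg U 0 = Psi S (Bop S u) $ Lg U 0" .
qed

text \<open>On a vector of fixed dimension k the three terms live in dimensions k - 1, k and k + 1,
  so the position-dependent factors become scalars.\<close>

lemma Bop_weight:
  fixes S :: "('a, 'd::{finite,linorder}) sqmat"
  assumes v: "gproj (V0 S) k v = v"
  shows "Bop S v = of_real (real CARD('a) powr (real (CARD('d) - (k - 1)) / 2)) *s (Lm (V0 S) *v v) + flat_eigenvalue S k *s v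
    + of_real (real CARD('a) powr ((real (CARD('d) - (k + 1)) + 1) / 2)) *s (Rm (V0 S) *v v)"
proof (rule vec_eq_iff[THEN iffD2], rule allI)
  fix X
  have vX: "v $ X \<noteq> 0 \<Longrightarrow> X \<in> subs (V0 S) \<and> vec.dim X = k"
    using arg_cong[OF v, of "\<lambda>v. v $ X"] by (auto simp: gproj_def split: if_splits)
  \<comment> \<open>For k = 0 the image under L is 0, so the truncated k - 1 does no harm.\<close>
  have L: "(Lm (V0 S) *v v) $ X \<noteq> 0 \<Longrightarrow> vec.dim X = k - 1"
  proof (cases k)
    case 0
    then show "(Lm (V0 S) *v v) $ X \<noteq> 0 \<Longrightarrow> vec.dim X = k - 1" using Lm_gproj_0[of "V0 S" v] v by simp
  next
    case (Suc m)
    have "gproj (V0 S) m (Lm (V0 S) *v v) = Lm (V0 S) *v v" using gproj_Lm[of "V0 S" m v] v Suc by simp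
    from arg_cong[OF this, of "\<lambda>v. v $ X"]
    show "(Lm (V0 S) *v v) $ X \<noteq> 0 \<Longrightarrow> vec.dim X = k - 1" using Suc by (auto simp: gproj_def split: if_splits)
  qed
  have "gproj (V0 S) (k + 1) (Rm (V0 S) *v v) = Rm (V0 S) *v v" using gproj_Rm[of "V0 S" k v] v by simp
  from arg_cong[OF this, of "\<lambda>v. v $ X"]
  have R: "(Rm (V0 S) *v v) $ X \<noteq> 0 \<Longrightarrow> vec.dim X = k + 1" by (auto simp: gproj_def split: if_splits)
  have z: "X \<notin> subs (V0 S) \<Longrightarrow> (Lm (V0 S) *v v) $ X = 0 \<and> (Rm (V0 S) *v v) $ X = 0"
    by (simp add: Lm_component Rm_component)
  have 1: "of_real (real CARD('a) powr (real (CARD('d) - vec.dim X) / 2)) * (Lm (V0 S) *v v) $ X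
      = of_real (real CARD('a) powr (real (CARD('d) - (k - 1)) / 2)) * (Lm (V0 S) *v v) $ X"
    using L by (cases "(Lm (V0 S) *v v) $ X = 0") auto
  have 2: "of_real (real CARD('a) powr ((real (CARD('d) - vec.dim X) + 1) / 2)) * (Rm (V0 S) *v v) $ X
      = of_real (real CARD('a) powr ((real (CARD('d) - (k + 1)) + 1) / 2)) * (Rm (V0 S) *v v) $ X"
    using R by (cases "(Rm (V0 S) *v v) $ X = 0") auto
  have 3: "flat_eigenvalue S (vec.dim X) * v $ X = flat_eigenvalue S k * v $ X"
    using vX by (cases "v $ X = 0") auto
  show "Bop S v $ X = (of_real (real CARD('a) powr (real (CARD('d) - (k - 1)) / 2)) *s (Lm (V0 S) *v v) + flat_eigenvalue S k *s v
    + of_real (real CARD('a) powr ((real (CARD('d) - (k + 1)) + 1) / 2)) *s (Rm (V0 S) *v v)) $ X"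
  proof (cases "X \<in> subs (V0 S)")
    case True
    then show ?thesis unfolding Bop_def vec_lambda_beta 1 2 3 by simp
  next
    case False
    then show ?thesis using z vX by (auto simp: Bop_def)
  qed
qed

lemma lproj_Psi:
  fixes S :: "('a, 'd::{finite,linorder}) sqmat"
  assumes S: "S \<in> Sym" and i: "i \<le> CARD('d)"
  shows "lproj i *v Psi S u = Psi S (gproj (V0 S) (CARD('d) - i) u)"
proof (rule vec_eq_iff[THEN iffD2], rule allI)
  fix x :: "('a, 'd) lagr"
  obtain U F where x: "vec.subspace U" "F \<in> Sym" "x = Lg U F" using lagr_cases by blast
  have "vec.dim U \<le> CARD('d)" using dim_subset_UNIV_cart_gen by blast
  then have "lay x = i \<longleftrightarrow> vec.dim U = CARD('d) - i" using i x by (auto simp: lay_Lg)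
  then show "(lproj i *v Psi S u) $ x = Psi S (gproj (V0 S) (CARD('d) - i) u) $ x"
    using x by (simp add: lproj_mult Psi_Lg[OF S x(1,2)] gproj_def emb_in_subs)
qed

lemma A_star_mult:
  obtains g :: "nat \<Rightarrow> complex" where
    "\<And>w :: complex^('a, 'd::{finite,linorder}) lagr. A_star *v w = (\<Sum>i\<le>CARD('d). g i *s (lproj i *v w))"
proof -
  obtain g :: "nat \<Rightarrow> complex" where g: "A_star = (\<chi> x y. if x = (y :: ('a, 'd) lagr) then g (lay x) else 0)"
    using A_star_diag by blast
  have "A_star *v w = (\<Sum>i\<le>CARD('d). g i *s (lproj i *v w))" for w :: "complex^('a, 'd) lagr"
  proof (rule vec_eq_iff[THEN iffD2], rule allI)
    fix x :: "('a, 'd) lagr"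
    show "(A_star *v w) $ x = (\<Sum>i\<le>CARD('d). g i *s (lproj i *v w)) $ x"
      using lay_le[of x] unfolding g diag_mult by (simp add: lproj_mult if_distrib[of "\<lambda>x. y * x" for y] cong: if_cong)
  qed
  then show ?thesis using that by blast
qed

lemma dim_V0: "S \<in> Sym \<Longrightarrow> vec.dim (V0 (S :: ('a, 'd::finite) sqmat)) + rank S = CARD('d)"
  using dim_nullspace[of S] by (simp add: V0_eq_emb subspace_nullspace)

lemma subspace_V0: "vec.subspace (V0 (S :: ('a, 'd::finite) sqmat))"
  by (simp add: V0_eq_emb subspace_nullspace)

lemma subspace_Psi_image:
  fixes S :: "('a, 'd::finite) sqmat"
  assumes "vec.subspace I"
  shows "vec.subspace (Psi S ` I)"
  unfolding vec.subspace_def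
proof (intro conjI ballI allI)
  show "0 \<in> Psi S ` I" using vec.subspace_0[OF assms] by (intro image_eqI[of _ _ 0]) (auto simp: Psi_lin)
  fix x assume "x \<in> Psi S ` I"
  then obtain u where u: "u \<in> I" "x = Psi S u" by blast
  show "c *s x \<in> Psi S ` I" for c
    using u vec.subspace_scale[OF assms] by (intro image_eqI[of _ _ "c *s u"]) (auto simp: Psi_lin)
  fix y assume "y \<in> Psi S ` I"
  then obtain v where v: "v \<in> I" "y = Psi S v" by blast
  show "x + y \<in> Psi S ` I"
    using u v vec.subspace_add[OF assms] by (intro image_eqI[of _ _ "u + v"]) (auto simp: Psi_lin)
qed

lemma graded_Bop:
  fixes S :: "('a, 'd::{finite,linorder}) sqmat"
  assumes I: "graded_submodule (V0 S) I" and u: "u \<in> I"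
  shows "Bop S u \<in> I"
proof -
  have s: "vec.subspace I" "I \<subseteq> V_L (V0 S)" and cl: "\<And>v. v \<in> I \<Longrightarrow> Lm (V0 S) *v v \<in> I" "\<And>v. v \<in> I \<Longrightarrow> Rm (V0 S) *v v \<in> I"
    "\<And>v k. v \<in> I \<Longrightarrow> gproj (V0 S) k v \<in> I"
    using I unfolding graded_submodule_def by blast+
  have "Bop S (gproj (V0 S) k u) \<in> I" for k
    unfolding Bop_weight[of S k "gproj (V0 S) k u", simplified gproj_gproj, simplified]
    by (intro vec.subspace_add[OF s(1)] vec.subspace_scale[OF s(1)] cl u) 
  then have "(\<Sum>k\<le>vec.dim (V0 S). Bop S (gproj (V0 S) k u)) \<in> I" by (intro vec.subspace_sum[OF s(1)])
  then show ?thesis using sum_gproj[OF subsetD[OF s(2) u]] by (simp flip: Bop_sum)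
qed

text \<open>Invariance needs checking on generators only: \<open>A\<close> acts as
  \<open>Bop\<close>, and \<open>A_star\<close> is a combination of layer projections, which act as
  \<open>gproj\<close>.\<close>

lemma T_submodule_Psi:
  fixes S :: "('a, 'd::{finite,linorder}) sqmat"
  assumes S: "S \<in> Sym" and I: "graded_submodule (V0 S) I"
  shows "T_submodule (Psi S ` I)"
  unfolding T_submodule_def
proof (intro conjI ballI)
  have sI: "vec.subspace I" using I by (simp add: graded_submodule_def)
  show sW: "vec.subspace (Psi S ` I)" by (rule subspace_Psi_image[OF sI])
  obtain g :: "nat \<Rightarrow> complex" where g: "\<And>w :: complex^('a, 'd) lagr. A_star *v w = (\<Sum>i\<le>CARD('d). g i *s (lproj i *v w))"
    using A_star_mult by blast
  fix M :: "(complex, ('a, 'd) lagr) sqmat" and v assume "M \<in> T_alg" "v \<in> Psi S ` I"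
  then show "M *v v \<in> Psi S ` I"
  proof (induction M arbitrary: v)
    case A_in
    then obtain u where u: "u \<in> I" "v = Psi S u" by blast
    then show ?case using graded_Bop[OF I] by (simp add: A_Psi[OF S])
  next
    case A_star_in
    then obtain u where u: "u \<in> I" "v = Psi S u" by blast
    have "lproj i *v v \<in> Psi S ` I" if "i \<le> CARD('d)" for i
      unfolding u(2) lproj_Psi[OF S that] using I u(1) by (auto simp: graded_submodule_def)
    then show ?case unfolding g by (intro vec.subspace_sum[OF sW] vec.subspace_scale[OF sW]) auto
  next
    case one_in
    then show ?case by simp
  next
    case (add_in M M')
    then show ?case using vec.subspace_add[OF sW] by (simp add: matrix_vector_mult_add_rdistrib)
  next
    case (scale_in M c)
    have "(\<chi> x y. c * M $ x $ y) *v v = c *s (M *v v)"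
      by (simp add: vec_eq_iff matrix_vector_mult_def sum_distrib_left mult.assoc)
    then show ?case using scale_in vec.subspace_scale[OF sW] by simp
  next
    case (mult_in M M')
    then show ?case by (simp flip: matrix_vector_mul_assoc)
  qed
qed

text \<open>Projecting to the neighbouring dimensions recovers L and R from \<open>A\<close>, up to
  non-zero scalars.\<close>

lemma gproj_Bop:
  fixes S :: "('a, 'd::{finite,linorder}) sqmat"
  assumes v: "gproj (V0 S) k v = v"
  shows "gproj (V0 S) k (Bop S v) = flat_eigenvalue S k *s v"
    and "k = Suc m \<Longrightarrow> gproj (V0 S) m (Bop S v) = of_real (real CARD('a) powr (real (CARD('d) - m) / 2)) *s (Lm (V0 S) *v v)"
    and "gproj (V0 S) (Suc k) (Bop S v) = of_real (real CARD('a) powr ((real (CARD('d) - (k + 1)) + 1) / 2)) *s (Rm (V0 S) *v v)"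
proof -
  let ?Y = "V0 S"
  have L: "gproj ?Y j (Lm ?Y *v v) = (if Suc j = k then Lm ?Y *v v else 0)" for j
    using gproj_Lm[of ?Y j v] gproj_in_span_shift[OF v, of "Suc j"] by auto
  have L0: "k = 0 \<Longrightarrow> Lm ?Y *v v = 0" using Lm_gproj_0[of ?Y v] v by auto
  have R: "gproj ?Y j (Rm ?Y *v v) = (if j = Suc k then Rm ?Y *v v else 0)" for j
    using gproj_in_span_shift[of ?Y "Suc k" "Rm ?Y *v v" j] gproj_Rm[of ?Y k v] v by simp
  note w = Bop_weight[OF v] gproj_in_span_shift[OF v]
  show "gproj ?Y k (Bop S v) = flat_eigenvalue S k *s v" unfolding w(1) gproj_lin L R w(2) by simp
  show "k = Suc m \<Longrightarrow> gproj ?Y m (Bop S v) = of_real (real CARD('a) powr (real (CARD('d) - m) / 2)) *s (Lm ?Y *v v)"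
    unfolding w(1) gproj_lin L R w(2) by simp
  show "gproj ?Y (Suc k) (Bop S v) = of_real (real CARD('a) powr ((real (CARD('d) - (k + 1)) + 1) / 2)) *s (Rm ?Y *v v)"
    unfolding w(1) gproj_lin L R w(2) by simp
qed

text \<open>The converse of \<open>T_submodule_Psi\<close>: layer projections give the grading, and
  \<open>gproj_Bop\<close> then gives closure under L and R. Together they match irreducibility on
  both sides.\<close>

lemma T_submodule_imp_graded:
  fixes S :: "('a, 'd::{finite,linorder}) sqmat"
  assumes S: "S \<in> Sym" and W: "T_submodule W"
  defines "I \<equiv> {u \<in> V_L (V0 S). Psi S u \<in> W}"
  shows "graded_submodule (V0 S) I"
proof -
  let ?Y = "V0 S"
  have sW: "vec.subspace W" and cl: "\<And>M v. M \<in> T_alg \<Longrightarrow> v \<in> W \<Longrightarrow> M *v v \<in> W" using W by (auto simp: T_submodule_def)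
  have sI: "vec.subspace I"
    using vec.subspace_0[OF sW] vec.subspace_add[OF sW] vec.subspace_scale[OF sW]
      vec.subspace_0[OF subspace_V_L] vec.subspace_add[OF subspace_V_L] vec.subspace_scale[OF subspace_V_L]
    by (auto simp: vec.subspace_def I_def Psi_lin)
  have N: "vec.dim ?Y \<le> CARD('d)" using dim_V0[OF S] by simp
  have g: "gproj ?Y k u \<in> I" if u: "u \<in> I" for k u
  proof (cases "k \<le> CARD('d)")
    case True
    have "Psi S (gproj ?Y k u) = lproj (CARD('d) - k) *v Psi S u" using lproj_Psi[OF S, of "CARD('d) - k" u] True by simp
    also have "\<dots> \<in> W" using u by (intro cl lproj_in_T_alg) (simp add: I_def)
    finally show ?thesis by (simp add: I_def gproj_in_V_L)
  next
    case False
    then have "gproj ?Y k u = 0" using N by (intro gproj_above) simp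
    then show ?thesis using vec.subspace_0[OF sI] by simp
  qed
  have B: "Bop S u \<in> I" if "u \<in> I" for u
    using that cl[OF A_in] by (simp add: I_def Bop_in_V_L flip: A_Psi[OF S])
  have sc: "x \<in> I" if "of_real (real CARD('a) powr r) *s x \<in> I" for r x
    using vec.subspace_scale[OF sI that, of "inverse (of_real (real CARD('a) powr r))"] q_gt_2 by simp
  have "Lm ?Y *v gproj ?Y k u \<in> I \<and> Rm ?Y *v gproj ?Y k u \<in> I" if u: "u \<in> I" for k u
  proof
    let ?v = "gproj ?Y k u"
    have v: "gproj ?Y k ?v = ?v" "Bop S ?v \<in> I" using B[OF g[OF u]] by (simp_all add: gproj_gproj)
    show "Lm ?Y *v ?v \<in> I"
    proof (cases k)
      case 0
      then show ?thesis using Lm_gproj_0 vec.subspace_0[OF sI] by metis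
    next
      case (Suc m)
      from g[OF v(2), of m] show ?thesis unfolding gproj_Bop(2)[OF v(1) Suc] by (rule sc)
    qed
    from g[OF v(2), of "Suc k"] show "Rm ?Y *v ?v \<in> I" unfolding gproj_Bop(3)[OF v(1)] by (rule sc)
  qed
  then have "(\<Sum>k\<le>vec.dim ?Y. Lm ?Y *v gproj ?Y k u) \<in> I" "(\<Sum>k\<le>vec.dim ?Y. Rm ?Y *v gproj ?Y k u) \<in> I" if "u \<in> I" for u
    using that by (auto intro!: vec.subspace_sum[OF sI])
  then have LR: "Lm ?Y *v (\<Sum>k\<le>vec.dim ?Y. gproj ?Y k u) \<in> I" "Rm ?Y *v (\<Sum>k\<le>vec.dim ?Y. gproj ?Y k u) \<in> I" if "u \<in> I" for u
    using that by (simp_all add: matrix_vector_mult_sum)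
  have sub: "I \<subseteq> V_L ?Y" by (auto simp: I_def)
  show ?thesis unfolding graded_submodule_def
  proof (intro conjI ballI allI sI sub g)
    fix u assume u: "u \<in> I"
    show "Lm ?Y *v u \<in> I" "Rm ?Y *v u \<in> I" using LR[OF u] unfolding sum_gproj[OF subsetD[OF sub u]] by auto
  qed
qed

theorem T_irreducible_Psi:
  fixes S :: "('a, 'd::{finite,linorder}) sqmat"
  assumes S: "S \<in> Sym" and I: "sl2_irreducible (V0 S) I"
  shows "T_irreducible (Psi S ` I)"
proof -
  have gI: "graded_submodule (V0 S) I" "I \<noteq> {0}" "I \<subseteq> V_L (V0 S)"
    and min: "\<And>I'. graded_submodule (V0 S) I' \<Longrightarrow> I' \<subseteq> I \<Longrightarrow> I' = {0} \<or> I' = I"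
    using I by (auto simp: sl2_irreducible_def sl2_submodule_iff graded_submodule_def)
  have sI: "vec.subspace I" using gI(1) by (simp add: graded_submodule_def)
  have nz: "Psi S ` I \<noteq> {0}"
  proof
    assume z: "Psi S ` I = {0}"
    have "u = 0" if "u \<in> I" for u
      using Psi_inj[OF S, of u 0] that gI(3) z vec.subspace_0[OF subspace_V_L] by (auto simp: Psi_lin)
    then show False using gI(2) vec.subspace_0[OF sI] by blast
  qed
  have "W' = {0} \<or> W' = Psi S ` I" if W': "T_submodule W'" "W' \<subseteq> Psi S ` I" for W'
  proof -
    let ?I = "{u \<in> V_L (V0 S). Psi S u \<in> W'}"
    have g: "graded_submodule (V0 S) ?I" by (rule T_submodule_imp_graded[OF S W'(1)])
    have sub: "?I \<subseteq> I"
    proof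
      fix u assume u: "u \<in> ?I"
      then obtain u' where "u' \<in> I" "Psi S u = Psi S u'" using W'(2) by blast
      then show "u \<in> I" using Psi_inj[OF S, of u u'] u gI(3) by blast
    qed
    have img: "Psi S ` ?I = W'" using W'(2) gI(3) by blast
    from min[OF g sub] show ?thesis
    proof
      assume "?I = {0}"
      then show ?thesis using img by (simp add: Psi_lin)
    next
      assume "?I = I"
      then show ?thesis using img by simp
    qed
  qed
  then show ?thesis using T_submodule_Psi[OF S gI(1)] nz by (auto simp: T_irreducible_def)
qed

end

subsection \<open>Isomorphism\<close>

text \<open>A family with one vector per layer, k being the dimension of the intersection with x_0;
  different members have disjoint supports.\<close>

definition layered :: "nat set \<Rightarrow> (nat \<Rightarrow> complex^('a::{field,finite}, 'd::{finite,linorder}) lagr) \<Rightarrow> bool" where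
  "layered K W \<longleftrightarrow> finite K \<and> (\<forall>k\<in>K. W k \<noteq> 0 \<and> (\<forall>x. W k $ x \<noteq> 0 \<longrightarrow> lay x + k = CARD('d)))"

definition acts_by :: "(complex, 'n::finite) sqmat \<Rightarrow> nat set \<Rightarrow> (nat \<Rightarrow> nat \<Rightarrow> complex) \<Rightarrow> (nat \<Rightarrow> complex^'n) \<Rightarrow> bool" where
  "acts_by M K d W \<longleftrightarrow> (\<forall>k\<in>K. M *v W k = (\<Sum>j\<in>K. d k j *s W j))"

lemma layered_witness:
  assumes "layered K W"
  obtains x where "\<And>k. k \<in> K \<Longrightarrow> W k $ x k \<noteq> 0" "\<And>j k. j \<in> K \<Longrightarrow> k \<in> K \<Longrightarrow> j \<noteq> k \<Longrightarrow> W j $ x k = 0"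
proof -
  have "\<forall>k\<in>K. \<exists>x. W k $ x \<noteq> 0" using assms by (auto simp: layered_def vec_eq_iff)
  from bchoice[OF this] obtain x where x: "\<forall>k\<in>K. W k $ x k \<noteq> 0" by blast
  have "W j $ x k = 0" if "j \<in> K" "k \<in> K" "j \<noteq> k" for j k
  proof (rule ccontr)
    assume nz: "W j $ x k \<noteq> 0"
    have "lay (x k) + j = CARD('b)" using assms that(1) nz unfolding layered_def by blast
    moreover have "lay (x k) + k = CARD('b)" using assms that(2) x unfolding layered_def by blast
    ultimately show False using that(3) by simp
  qed
  then show ?thesis using that x by blast
qed

lemma acts_by_mat_1: "finite K \<Longrightarrow> acts_by (mat 1) K (\<lambda>k j. if j = k then 1 else 0) W"
  unfolding acts_by_def by (auto simp: if_distrib[of "\<lambda>c. c *s v" for v] cong: if_cong)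

lemma acts_by_add: "acts_by M K d W \<Longrightarrow> acts_by M' K d' W \<Longrightarrow> acts_by (M + M') K (\<lambda>k j. d k j + d' k j) W"
  unfolding acts_by_def by (simp add: matrix_vector_mult_add_rdistrib vec.scale_left_distrib sum.distrib)

lemma acts_by_scale: "acts_by M K d W \<Longrightarrow> acts_by (\<chi> x y. c * M $ x $ y) K (\<lambda>k j. c * d k j) W"
proof -
  have "(\<chi> x y. c * M $ x $ y) *v v = c *s (M *v v)" for v
    by (simp add: vec_eq_iff matrix_vector_mult_def sum_distrib_left mult.assoc)
  then show "acts_by M K d W \<Longrightarrow> acts_by (\<chi> x y. c * M $ x $ y) K (\<lambda>k j. c * d k j) W"
    unfolding acts_by_def by (simp add: vec.scale_sum_right)
qed

lemma acts_by_sum: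
  assumes M: "acts_by M K d W"
  shows "M *v (\<Sum>k\<in>K. a k *s W k) = (\<Sum>j\<in>K. (\<Sum>k\<in>K. a k * d k j) *s W j)"
proof -
  have "M *v (\<Sum>k\<in>K. a k *s W k) = (\<Sum>k\<in>K. a k *s (\<Sum>j\<in>K. d k j *s W j))"
    using M by (simp add: matrix_vector_mult_sum vec.scale acts_by_def)
  also have "\<dots> = (\<Sum>k\<in>K. \<Sum>j\<in>K. (a k * d k j) *s W j)" by (simp add: vec.scale_sum_right)
  also have "\<dots> = (\<Sum>j\<in>K. (\<Sum>k\<in>K. a k * d k j) *s W j)" by (subst sum.swap) (simp add: vec.scale_sum_left)
  finally show ?thesis .
qed

lemma acts_by_mult:
  assumes M: "acts_by M K d W" and M': "acts_by M' K d' W"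
  shows "acts_by (M ** M') K (\<lambda>k j. \<Sum>i\<in>K. d' k i * d i j) W"
  unfolding acts_by_def
proof
  fix k assume "k \<in> K"
  then have "M ** M' *v W k = M *v (\<Sum>i\<in>K. d' k i *s W i)" using M' by (simp add: acts_by_def flip: matrix_vector_mul_assoc)
  then show "M ** M' *v W k = (\<Sum>j\<in>K. (\<Sum>i\<in>K. d' k i * d i j) *s W j)" using acts_by_sum[OF M] by simp
qed

context odd_prime_field
begin

lemma lproj_layered:
  fixes W :: "nat \<Rightarrow> complex^('a, 'd::{finite,linorder}) lagr"
  assumes W: "layered K W" and k: "k \<in> K"
  shows "lproj i *v W k = (if i + k = CARD('d) then W k else 0)"
proof (rule vec_eq_iff[THEN iffD2], rule allI)
  fix x
  have "W k $ x \<noteq> 0 \<Longrightarrow> lay x + k = CARD('d)" using W k unfolding layered_def by blast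
  then show "(lproj i *v W k) $ x = (if i + k = CARD('d) then W k else 0) $ x"
    by (cases "W k $ x = 0") (auto simp: lproj_mult)
qed

lemma lproj_layered_sum:
  fixes W :: "nat \<Rightarrow> complex^('a, 'd::{finite,linorder}) lagr"
  assumes W: "layered K W" and i: "i + k = CARD('d)"
  shows "lproj i *v (\<Sum>j\<in>K. a j *s W j) = (if k \<in> K then a k *s W k else 0)"
proof -
  have "lproj i *v (\<Sum>j\<in>K. a j *s W j) = (\<Sum>j\<in>K. if j = k then a k *s W k else 0)"
    unfolding matrix_vector_mult_sum vec.scale using i by (intro sum.cong refl) (auto simp: lproj_layered[OF W])
  then show ?thesis using W by (simp add: layered_def)
qed

lemma layered_le: "layered K (W :: nat \<Rightarrow> complex^('a, 'd::{finite,linorder}) lagr) \<Longrightarrow> k \<in> K \<Longrightarrow> k \<le> CARD('d)"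
proof -
  assume W: "layered K W" "k \<in> K"
  then obtain x where "W k $ x \<noteq> 0" by (auto simp: layered_def vec_eq_iff)
  then have "lay x + k = CARD('d)" using W unfolding layered_def by blast
  then show ?thesis by simp
qed

text \<open>If \<open>A\<close> has the same matrix on both families, so has every element of the
  algebra, because \<open>A_star\<close> depends only on the layer. Sending \<open>W k\<close> to
  \<open>W' k\<close> then commutes with all of them.\<close>

lemma layered_T_isomorphic:
  fixes W W' :: "nat \<Rightarrow> complex^('a, 'd::{finite,linorder}) lagr"
  assumes W: "layered K W" and W': "layered K W'"
    and A: "acts_by A_mat K c W" "acts_by A_mat K c W'"
  shows "T_isomorphic (vec.span (W ` K)) (vec.span (W' ` K))"
proof -
  have K: "finite K" using W by (simp add: layered_def)
  have T: "\<exists>d. acts_by M K d W \<and> acts_by M K d W'" if "M \<in> T_alg" for M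
    using that
  proof induction
    case A_in
    then show ?case using A by blast
  next
    case A_star_in
    obtain g :: "nat \<Rightarrow> complex" where g: "\<And>w :: complex^('a, 'd) lagr. A_star *v w = (\<Sum>i\<le>CARD('d). g i *s (lproj i *v w))"
      using A_star_mult by blast
    have "acts_by A_star K (\<lambda>k j. if j = k then g (CARD('d) - k) else 0) W0" if W0: "layered K W0"
      for W0 :: "nat \<Rightarrow> complex^('a, 'd) lagr"
      unfolding acts_by_def
    proof
      fix k assume k: "k \<in> K"
      have kD: "k \<le> CARD('d)" by (rule layered_le[OF W0 k])
      have "A_star *v W0 k = (\<Sum>i\<le>CARD('d). if i = CARD('d) - k then g (CARD('d) - k) *s W0 k else 0)"
        unfolding g lproj_layered[OF W0 k] using kD by (intro sum.cong) auto
      also have "\<dots> = g (CARD('d) - k) *s W0 k" by simp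
      also have "\<dots> = (\<Sum>j\<in>K. if j = k then g (CARD('d) - k) *s W0 k else 0)" using K k by simp
      also have "\<dots> = (\<Sum>j\<in>K. (if j = k then g (CARD('d) - k) else 0) *s W0 j)" by (intro sum.cong) auto
      finally show "A_star *v W0 k = \<dots>" .
    qed
    then show ?case using W W' by blast
  next
    case one_in
    then show ?case using acts_by_mat_1[OF K] by blast
  next
    case (add_in M M')
    then show ?case using acts_by_add by blast
  next
    case (scale_in M c)
    then show ?case using acts_by_scale by blast
  next
    case (mult_in M M')
    then show ?case using acts_by_mult by blast
  qed
  obtain x where x: "\<And>k. k \<in> K \<Longrightarrow> W k $ x k \<noteq> 0" "\<And>j k. j \<in> K \<Longrightarrow> k \<in> K \<Longrightarrow> j \<noteq> k \<Longrightarrow> W j $ x k = 0"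
    using layered_witness[OF W] by blast
  obtain y where y: "\<And>k. k \<in> K \<Longrightarrow> W' k $ y k \<noteq> 0" "\<And>j k. j \<in> K \<Longrightarrow> k \<in> K \<Longrightarrow> j \<noteq> k \<Longrightarrow> W' j $ y k = 0"
    using layered_witness[OF W'] by blast
  \<comment> \<open>Coefficients read at the witness coordinates make f and its inverse g linear on
    the whole space.\<close>
  define f where "f v = (\<Sum>k\<in>K. (v $ x k / W k $ x k) *s W' k)" for v
  define g where "g v = (\<Sum>k\<in>K. (v $ y k / W' k $ y k) *s W k)" for v
  have single: "(\<Sum>j\<in>K. a j *s V j) $ z k = a k * V k $ z k"
    if "k \<in> K" "\<And>j k. j \<in> K \<Longrightarrow> k \<in> K \<Longrightarrow> j \<noteq> k \<Longrightarrow> V j $ z k = 0"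
    for a k z and V :: "nat \<Rightarrow> complex^('a, 'd) lagr"
  proof -
    have "(\<Sum>j\<in>K. a j *s V j) $ z k = (\<Sum>j\<in>K. if j = k then a k * V k $ z k else 0)"
      unfolding sum_component using that by (intro sum.cong) auto
    then show ?thesis using that(1) K by simp
  qed
  have sx: "(\<Sum>j\<in>K. a j *s W j) $ x k = a k * W k $ x k" if "k \<in> K" for a k by (rule single[OF that x(2)])
  have sy: "(\<Sum>j\<in>K. a j *s W' j) $ y k = a k * W' k $ y k" if "k \<in> K" for a k by (rule single[OF that y(2)])
  have f: "f (\<Sum>k\<in>K. a k *s W k) = (\<Sum>k\<in>K. a k *s W' k)" for a
    unfolding f_def using x by (intro sum.cong refl) (simp only: sx, simp)
  have g: "g (\<Sum>k\<in>K. a k *s W' k) = (\<Sum>k\<in>K. a k *s W k)" for a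
    unfolding g_def using y by (intro sum.cong refl) (simp only: sy, simp)
  have eW: "v = (\<Sum>k\<in>K. (v $ x k / W k $ x k) *s W k)" if "v \<in> vec.span (W ` K)" for v
    by (rule disjoint_support(3)[OF K x that])
  have eW': "v = (\<Sum>k\<in>K. (v $ y k / W' k $ y k) *s W' k)" if "v \<in> vec.span (W' ` K)" for v
    by (rule disjoint_support(3)[OF K y that])
  have gf: "g (f v) = v" if "v \<in> vec.span (W ` K)" for v
    using eW[OF that] g[of "\<lambda>k. v $ x k / W k $ x k"] unfolding f_def by simp
  have fg: "f (g v) = v" if "v \<in> vec.span (W' ` K)" for v
    using eW'[OF that] f[of "\<lambda>k. v $ y k / W' k $ y k"] unfolding g_def by simp
  have b: "bij_betw f (vec.span (W ` K)) (vec.span (W' ` K))"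
  proof (rule bij_betwI[where g = g])
    show "f \<in> vec.span (W ` K) \<rightarrow> vec.span (W' ` K)"
      unfolding f_def by (intro Pi_I vec.span_sum vec.span_scale vec.span_base) auto
    show "g \<in> vec.span (W' ` K) \<rightarrow> vec.span (W ` K)"
      unfolding g_def by (intro Pi_I vec.span_sum vec.span_scale vec.span_base) auto
  qed (rule gf fg; assumption)+
  have l: "lin_on (vec.span (W ` K)) f"
    unfolding lin_on_def f_def
    by (simp add: add_divide_distrib vec.scale_left_distrib sum.distrib vec.scale_sum_right)
  have "f (M *v v) = M *v f v" if M: "M \<in> T_alg" and v: "v \<in> vec.span (W ` K)" for M v
  proof -
    obtain d where d: "acts_by M K d W" "acts_by M K d W'" using T[OF M] by blast
    obtain a where a: "v = (\<Sum>k\<in>K. a k *s W k)" using span_image_finite[OF K v] by blast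
    show ?thesis unfolding a f acts_by_sum[OF d(1)] acts_by_sum[OF d(2)] ..
  qed
  then show ?thesis unfolding T_isomorphic_def using l b by blast
qed

text \<open>An isomorphism commutes with the layer projections, so it maps \<open>W k\<close> to a
  non-zero multiple of \<open>W' k\<close>; hence the occurring layers agree.\<close>

lemma T_isomorphic_layered:
  fixes W W' :: "nat \<Rightarrow> complex^('a, 'd::{finite,linorder}) lagr"
  assumes W: "layered K W" and W': "layered K' W'"
    and iso: "T_isomorphic (vec.span (W ` K)) (vec.span (W' ` K'))"
  shows "K = K'"
    and "acts_by A_mat K c W \<Longrightarrow> acts_by A_mat K' c' W' \<Longrightarrow> k \<in> K \<Longrightarrow> c k k = c' k k"
proof -
  have K: "finite K" "finite K'" using W W' by (simp_all add: layered_def)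
  obtain f where l: "lin_on (vec.span (W ` K)) f" and b: "bij_betw f (vec.span (W ` K)) (vec.span (W' ` K'))"
    and c: "\<And>M v. M \<in> T_alg \<Longrightarrow> v \<in> vec.span (W ` K) \<Longrightarrow> f (M *v v) = M *v f v"
    using iso unfolding T_isomorphic_def by blast
  have sc: "f (a *s v) = a *s f v" if "v \<in> vec.span (W ` K)" for a v using l that unfolding lin_on_def by blast
  have f0: "f 0 = 0" using sc[OF vec.span_zero, of 0] by simp
  have WK: "W k \<in> vec.span (W ` K)" if "k \<in> K" for k using that by (intro vec.span_base) blast
  have WK': "W' k \<in> vec.span (W' ` K')" if "k \<in> K'" for k using that by (intro vec.span_base) blast
  have nz: "f v \<noteq> 0" if "v \<in> vec.span (W ` K)" "v \<noteq> 0" for v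
    using b that f0 vec.span_zero[of "W ` K"] unfolding bij_betw_def inj_on_def by metis
  have fW: "\<exists>a. k \<in> K' \<and> a \<noteq> 0 \<and> f (W k) = a *s W' k" if k: "k \<in> K" for k
  proof -
    have kD: "CARD('d) - k + k = CARD('d)" using layered_le[OF W k] by simp
    have "f (W k) \<in> vec.span (W' ` K')" by (rule bij_betwE[OF b, rule_format, OF WK[OF k]])
    then obtain a where a: "f (W k) = (\<Sum>j\<in>K'. a j *s W' j)" using span_image_finite[OF K(2)] by blast
    have "f (W k) = lproj (CARD('d) - k) *v f (W k)"
      using c[OF lproj_in_T_alg WK[OF k], of "CARD('d) - k"] kD by (simp add: lproj_layered[OF W k])
    also have "\<dots> = (if k \<in> K' then a k *s W' k else 0)" unfolding a by (rule lproj_layered_sum[OF W' kD])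
    finally have e: "f (W k) = (if k \<in> K' then a k *s W' k else 0)" .
    have "W k \<noteq> 0" using W k unfolding layered_def by blast
    then have "f (W k) \<noteq> 0" by (rule nz[OF WK[OF k]])
    then have "k \<in> K' \<and> a k \<noteq> 0 \<and> f (W k) = a k *s W' k" using e by (cases "k \<in> K'") auto
    then show ?thesis by blast
  qed
  have "k \<in> K" if k: "k \<in> K'" for k
  proof (rule ccontr)
    assume nK: "k \<notin> K"
    have kD: "CARD('d) - k + k = CARD('d)" using layered_le[OF W' k] by simp
    have "W' k \<in> f ` vec.span (W ` K)" using WK'[OF k] unfolding bij_betw_imp_surj_on[OF b] .
    then obtain v where v: "v \<in> vec.span (W ` K)" "f v = W' k" by (elim imageE) simp
    obtain a where a: "v = (\<Sum>j\<in>K. a j *s W j)" using span_image_finite[OF K(1) v(1)] by blast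
    have "lproj (CARD('d) - k) *v v = 0" unfolding a lproj_layered_sum[OF W kD] using nK by simp
    then have "lproj (CARD('d) - k) *v W' k = 0" using c[OF lproj_in_T_alg v(1), of "CARD('d) - k"] v(2) f0 by simp
    then have "W' k = 0" using kD by (simp add: lproj_layered[OF W' k])
    then show False using W' k unfolding layered_def by blast
  qed
  then show KK: "K = K'" using fW by blast
  assume A: "acts_by A_mat K c W" "acts_by A_mat K' c' W'" and k: "k \<in> K"
  obtain a where a: "k \<in> K'" "a \<noteq> 0" "f (W k) = a *s W' k" using fW[OF k] by blast
  have kD: "CARD('d) - k + k = CARD('d)" using layered_le[OF W k] by simp
  \<comment> \<open>The compression of \<open>A\<close> to one layer lies in the algebra and has the
    diagonal coefficient as eigenvalue, which the isomorphism preserves.\<close>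
  let ?M = "lproj (CARD('d) - k) ** A_mat :: (complex, ('a, 'd) lagr) sqmat"
  have M: "?M \<in> T_alg" by (intro mult_in lproj_in_T_alg A_in)
  have MW: "?M *v W k = c k k *s W k"
    using A(1) k lproj_layered_sum[OF W kD] by (simp add: acts_by_def flip: matrix_vector_mul_assoc)
  have MW': "?M *v W' k = c' k k *s W' k"
    using A(2) a(1) lproj_layered_sum[OF W' kD] by (simp add: acts_by_def flip: matrix_vector_mul_assoc)
  have "c k k *s (a *s W' k) = f (?M *v W k)" unfolding MW sc[OF WK[OF k]] a(3) ..
  also have "\<dots> = ?M *v f (W k)" by (rule c[OF M WK[OF k]])
  also have "\<dots> = a *s (c' k k *s W' k)" unfolding a(3) vec.scale MW' ..
  finally have "(c k k - c' k k) *s (a *s W' k) = 0" by (simp add: vec.scale_left_diff_distrib mult.commute)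
  moreover have "W' k \<noteq> 0" using W' a(1) unfolding layered_def by blast
  ultimately show "c k k = c' k k" using a(2) by simp
qed

text \<open>The matrix of \<open>A\<close> on the image of a string basis; S enters only through N,
  the rank and the type.\<close>

definition string_coeff :: "('a, 'd::{finite,linorder}) sqmat \<Rightarrow> nat \<Rightarrow> nat \<Rightarrow> nat \<Rightarrow> complex" where
  "string_coeff S \<nu> k j =
     (if k > \<nu> \<and> j = k - 1 then of_real (real CARD('a) powr (real (CARD('d) - (k - 1)) / 2)) * of_real (lower_coeff CARD('a) (vec.dim (V0 S)) \<nu> (k - \<nu> - 1)) else 0)
     + (if j = k then flat_eigenvalue S k else 0)
     + (if j = k + 1 then of_real (real CARD('a) powr ((real (CARD('d) - (k + 1)) + 1) / 2)) else 0)"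

lemma Psi_string:
  fixes S :: "('a, 'd::{finite,linorder}) sqmat"
  assumes S: "S \<in> Sym" and sb: "string_basis (V0 S) I \<nu> w"
  defines "K \<equiv> {\<nu>..vec.dim (V0 S) - \<nu>}" and "W \<equiv> \<lambda>k. Psi S (w k)"
  shows "layered K W" and "acts_by A_mat K (string_coeff S \<nu>) W" and "Psi S ` I = vec.span (W ` K)"
    and "vec.dim (Psi S ` I) = vec.dim (V0 S) - 2 * \<nu> + 1"
proof -
  let ?Y = "V0 S"
  have N: "vec.dim ?Y \<le> CARD('d)" using dim_V0[OF S] by simp
  have nu: "2 * \<nu> \<le> vec.dim ?Y" and I: "I = vec.span (w ` K)"
    and w: "\<And>k. k \<in> K \<Longrightarrow> w k \<noteq> 0" "\<And>k. k \<in> K \<Longrightarrow> gproj ?Y k (w k) = w k"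
    and R: "\<And>k. k \<in> K \<Longrightarrow> Rm ?Y *v w k = (if k < vec.dim ?Y - \<nu> then w (Suc k) else 0)"
    and L: "\<And>k. k \<in> K \<Longrightarrow> Lm ?Y *v w k = (if k > \<nu> then of_real (lower_coeff CARD('a) (vec.dim ?Y) \<nu> (k - \<nu> - 1)) *s w (k - 1) else 0)"
    using sb unfolding string_basis_def K_def by blast+
  show lW: "layered K W"
    unfolding layered_def
  proof (intro conjI ballI allI impI)
    show "finite K" by (simp add: K_def)
    fix k assume k: "k \<in> K"
    have "w k \<in> V_L ?Y" using gproj_in_V_L[of ?Y k "w k"] w(2)[OF k] by simp
    then show "W k \<noteq> 0" using Psi_inj[OF S _ vec.subspace_0[OF subspace_V_L], of "w k"] w(1)[OF k] by (auto simp: W_def Psi_lin)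
    fix x :: "('a, 'd) lagr" assume nz: "W k $ x \<noteq> 0"
    have kD: "k \<le> CARD('d)" using k N unfolding K_def atLeastAtMost_iff by linarith
    have "lproj (CARD('d) - k) *v W k = W k" using lproj_Psi[OF S, of "CARD('d) - k" "w k"] kD w(2)[OF k] by (simp add: W_def)
    from arg_cong[OF this, of "\<lambda>v. v $ x"] nz show "lay x + k = CARD('d)"
      using kD by (auto simp: lproj_mult split: if_splits)
  qed
  show "acts_by A_mat K (string_coeff S \<nu>) W"
    unfolding acts_by_def
  proof
    fix k assume k: "k \<in> K"
    let ?a = "of_real (real CARD('a) powr (real (CARD('d) - (k - 1)) / 2)) * of_real (lower_coeff CARD('a) (vec.dim ?Y) \<nu> (k - \<nu> - 1)) :: complex"
    let ?b = "of_real (real CARD('a) powr ((real (CARD('d) - (k + 1)) + 1) / 2)) :: complex"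
    have fK: "finite K" by (simp add: K_def)
    have "(\<Sum>j\<in>K. string_coeff S \<nu> k j *s w j) = (\<Sum>j\<in>K. (if j = k - 1 then (if k > \<nu> then ?a *s w (k - 1) else 0) else 0)
        + (if j = k then flat_eigenvalue S k *s w k else 0) + (if j = k + 1 then ?b *s w (k + 1) else 0))"
      unfolding string_coeff_def by (intro sum.cong refl) (auto simp: vec.scale_left_distrib)
    also have "\<dots> = (if k - 1 \<in> K then (if k > \<nu> then ?a *s w (k - 1) else 0) else 0)
        + (if k \<in> K then flat_eigenvalue S k *s w k else 0) + (if k + 1 \<in> K then ?b *s w (k + 1) else 0)"
      unfolding sum.distrib sum.delta[OF fK] ..
    also have "\<dots> = Bop S (w k)"
      unfolding Bop_weight[OF w(2)[OF k]] L[OF k] R[OF k] using k by (auto simp: K_def)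
    finally have "Bop S (w k) = (\<Sum>j\<in>K. string_coeff S \<nu> k j *s w j)" by simp
    then show "A_mat *v W k = (\<Sum>j\<in>K. string_coeff S \<nu> k j *s W j)"
      unfolding W_def A_Psi[OF S] by (simp add: Psi_sum Psi_lin)
  qed
  have fK: "finite K" by (simp add: K_def)
  show img: "Psi S ` I = vec.span (W ` K)"
  proof (intro equalityI subsetI)
    fix v assume "v \<in> Psi S ` I"
    then obtain u where u: "u \<in> vec.span (w ` K)" "v = Psi S u" using I by blast
    obtain a where a: "u = (\<Sum>k\<in>K. a k *s w k)" using span_image_finite[OF fK u(1)] by blast
    show "v \<in> vec.span (W ` K)"
      unfolding u(2) a Psi_sum Psi_lin by (intro vec.span_sum vec.span_scale vec.span_base) (auto simp: W_def)
  next
    fix v assume "v \<in> vec.span (W ` K)"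
    then obtain a where a: "v = (\<Sum>k\<in>K. a k *s W k)" using span_image_finite[OF fK] by blast
    have "v = Psi S (\<Sum>k\<in>K. a k *s w k)" unfolding a W_def Psi_sum Psi_lin ..
    moreover have "(\<Sum>k\<in>K. a k *s w k) \<in> I"
      unfolding I by (intro vec.span_sum vec.span_scale vec.span_base) auto
    ultimately show "v \<in> Psi S ` I" by blast
  qed
  obtain x where x: "\<And>k. k \<in> K \<Longrightarrow> W k $ x k \<noteq> 0" "\<And>j k. j \<in> K \<Longrightarrow> k \<in> K \<Longrightarrow> j \<noteq> k \<Longrightarrow> W j $ x k = 0"
    using layered_witness[OF lW] by blast
  have "vec.dim (Psi S ` I) = card (W ` K)"
    unfolding img vec.dim_span by (rule vec.dim_eq_card_independent[OF disjoint_support(2)[OF fK x]])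
  also have "\<dots> = card K" by (rule card_image[OF disjoint_support(1)[OF fK x]])
  also have "\<dots> = vec.dim ?Y - 2 * \<nu> + 1" using nu by (simp add: K_def)
  finally show "vec.dim (Psi S ` I) = vec.dim ?Y - 2 * \<nu> + 1" .
qed

text \<open>The interval {\<nu>..N - \<nu>} of layers determines N and so the rank; the diagonal
  coefficient at \<nu> then determines the type. Conversely, rank and dimension fix N and \<nu>, and
  with the type all of \<open>string_coeff\<close>.\<close>

theorem T_isomorphic_Psi:
  fixes S S' :: "('a, 'd::{finite,linorder}) sqmat"
  assumes S: "S \<in> Sym" "sl2_irreducible (V0 S) I" and S': "S' \<in> Sym" "sl2_irreducible (V0 S') I'"
  shows "T_isomorphic (Psi S ` I) (Psi S' ` I') \<longleftrightarrow>
    vec.dim (Psi S ` I) = vec.dim (Psi S' ` I') \<and> rank S = rank S' \<and> mtype S = mtype S'"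
proof -
  let ?N = "vec.dim (V0 S)" and ?N' = "vec.dim (V0 S')"
  obtain \<nu> w where sb: "string_basis (V0 S) I \<nu> w" using irreducible_string_basis[OF subspace_V0 S(2)] by blast
  obtain \<nu>' w' where sb': "string_basis (V0 S') I' \<nu>' w'" using irreducible_string_basis[OF subspace_V0 S'(2)] by blast
  note P = Psi_string[OF S(1) sb] and P' = Psi_string[OF S'(1) sb']
  have nu: "2 * \<nu> \<le> ?N" "2 * \<nu>' \<le> ?N'" using sb sb' by (simp_all add: string_basis_def)
  have N: "?N + rank S = CARD('d)" "?N' + rank S' = CARD('d)" using dim_V0[OF S(1)] dim_V0[OF S'(1)] .
  show ?thesis
  proof
    assume iso: "T_isomorphic (Psi S ` I) (Psi S' ` I')"
    note Q = T_isomorphic_layered[OF P(1) P'(1) iso[unfolded P(3) P'(3)]]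
    have K: "{\<nu>..?N - \<nu>} = {\<nu>'..?N' - \<nu>'}" by (rule Q(1))
    \<comment> \<open>The intervals are non-empty because 2\<nu> \<le> N, so equal intervals have
      equal endpoints.\<close>
    then have 1: "\<nu> = \<nu>'" "?N - \<nu> = ?N' - \<nu>'" using nu Icc_eq_Icc[of \<nu> "?N - \<nu>" \<nu>' "?N' - \<nu>'"] by auto
    then have NN: "?N = ?N'" using nu by simp
    then have r: "rank S = rank S'" using N by simp
    have "string_coeff S \<nu> \<nu> \<nu> = string_coeff S' \<nu>' \<nu> \<nu>" using nu by (intro Q(2)[OF P(2) P'(2)]) auto
    then have "flat_eigenvalue S \<nu> = flat_eigenvalue S' \<nu>" using 1(1) by (simp add: string_coeff_def)
    then have "mtype S = mtype S'" using q_gt_2 r by (simp add: flat_eigenvalue_def)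
    then show "vec.dim (Psi S ` I) = vec.dim (Psi S' ` I') \<and> rank S = rank S' \<and> mtype S = mtype S'"
      using P(4) P'(4) NN 1(1) r by simp
  next
    assume e: "vec.dim (Psi S ` I) = vec.dim (Psi S' ` I') \<and> rank S = rank S' \<and> mtype S = mtype S'"
    then have NN: "?N' = ?N" using N by simp
    have "?N - 2 * \<nu> + 1 = ?N - 2 * \<nu>' + 1" using e P(4) P'(4) NN by simp
    then have nn: "\<nu>' = \<nu>" using nu NN by linarith
    have c: "string_coeff S' \<nu> = string_coeff S \<nu>" using e NN by (simp add: fun_eq_iff string_coeff_def flat_eigenvalue_def)
    show "T_isomorphic (Psi S ` I) (Psi S' ` I')"
      unfolding P(3) P'(3) NN nn
      by (rule layered_T_isomorphic[OF P(1) P'(1)[unfolded NN nn] P(2) P'(2)[unfolded c NN nn]])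
  qed
qed

end

subsection \<open>The states and the map \<open>phi\<close>\<close>

lemma Sym_sub_nullspace:
  fixes S :: "('a::{field,finite}, 'd::{finite,linorder}) sqmat"
  assumes S: "S \<in> Sym"
  shows "S \<in> Sym_sub i \<longleftrightarrow> coord_space (CARD('d) - i) \<subseteq> nullspace S"
proof
  assume S': "S \<in> Sym_sub i"
  show "coord_space (CARD('d) - i) \<subseteq> nullspace S"
  proof
    fix v :: "('a, 'd) vec" assume v: "v \<in> coord_space (CARD('d) - i)"
    have "S $ m $ n * v $ n = 0" for m n
      using S' v by (cases "pos n \<le> CARD('d) - i") (auto simp: Sym_sub_def coord_space_def)
    then have "(\<Sum>n\<in>UNIV. S $ m $ n * v $ n) = 0" for m by (rule sum.neutral[OF ballI])
    then show "v \<in> nullspace S" unfolding nullspace_def matrix_vector_mult_def by (simp add: vec_eq_iff)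
  qed
next
  assume U: "coord_space (CARD('d) - i) \<subseteq> nullspace S"
  have z: "S $ m $ n = 0" if "pos n \<le> CARD('d) - i" for m n
  proof -
    have "axis n 1 \<in> (coord_space (CARD('d) - i) :: ('a, 'd) vec set)" using that by (auto simp: coord_space_def axis_def)
    then have "S *v axis n 1 = 0" using U by (auto simp: nullspace_def)
    from arg_cong[OF this, of "\<lambda>v. v $ m"] show ?thesis by simp
  qed
  have "S $ m $ n = 0" if "pos m \<le> CARD('d) - i" for m n using z[OF that, of n] Sym_entry[OF S, of m n] by simp
  then show "S \<in> Sym_sub i" using S z unfolding Sym_sub_def by blast
qed

context odd_prime_field
begin

lemma dim_image_invertible:
  fixes C :: "('a, 'd::finite) sqmat"
  assumes "invertible C" "vec.subspace U"
  shows "vec.dim ((*v) C ` U) = vec.dim U"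
proof -
  have "card ((*v) C ` U) = card U" by (rule card_image[OF inj_on_subset[OF invertible_imp_inj[OF assms(1)] subset_UNIV]])
  then show ?thesis using q_gt_2 assms(2) by (simp add: card_subspace subspace_image_mv)
qed

lemma nullspace_image_congruent:
  fixes C S :: "('a, 'd::finite) sqmat"
  assumes C: "invertible C"
  shows "U \<subseteq> nullspace (transpose C ** S ** C) \<longleftrightarrow> (*v) C ` U \<subseteq> nullspace S"
proof -
  have "inj ((*v) (transpose C))" using C by (auto intro!: invertible_imp_inj simp: invertible_det_nz)
  then have "transpose C *v v = 0 \<longleftrightarrow> v = 0" for v using inj_eq[of "(*v) (transpose C)" v 0] by simp
  then have "(transpose C ** S ** C) *v u = 0 \<longleftrightarrow> S *v (C *v u) = 0" for u by (simp flip: matrix_vector_mul_assoc)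
  then show ?thesis by (auto simp: nullspace_def)
qed

lemma admissible_iff:
  fixes S :: "('a, 'd::{finite,linorder}) sqmat"
  assumes S: "S \<in> Sym"
  shows "admissible i C S \<longleftrightarrow> i \<le> CARD('d) \<and> invertible C \<and> (*v) C ` coord_space (CARD('d) - i) \<subseteq> nullspace S"
  unfolding admissible_def Sym_sub_nullspace[OF Sym_congruent[OF S]] using nullspace_image_congruent by blast

text \<open>Modulo matrices mapping \<open>perp U\<close> into U, every symmetric matrix has exactly
  one representative in \<open>Sym_sub i\<close>. The sum in \<open>state_I\<close> therefore runs
  once through the subspaces over U.\<close>

lemma state_I_eq:
  fixes S :: "('a, 'd::{finite,linorder}) sqmat"
  assumes S: "S \<in> Sym" "S \<in> Sym_sub i" and i: "i \<le> CARD('d)"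
  shows "state_I i S = Psi S (ket (emb (coord_space (CARD('d) - i))))"
proof (rule vec_eq_iff[THEN iffD2], rule allI)
  fix x :: "('a, 'd) lagr"
  let ?k = "CARD('d) - i" and ?U = "coord_space (CARD('d) - i) :: ('a, 'd) vec set"
  let ?c = "of_real (real CARD('a) powr (- (real i * (real i + 1) / 4))) :: complex"
  obtain U F where x: "vec.subspace U" "F \<in> Sym" "x = Lg U F" using lagr_cases by blast
  have sU: "vec.subspace ?U" by (rule subspace_coord_space)
  have UK: "?U \<subseteq> nullspace S" using S Sym_sub_nullspace by blast
  have c: "nrm ?U = ?c" using i by (simp add: nrm_def dim_coord_space)
  have sym: "G \<in> Sym" if "G \<in> Sym_sub i" for G :: "('a, 'd) sqmat" using that by (simp add: Sym_sub_def)
  have "state_I i S $ x = ?c * (\<Sum>G\<in>Sym_sub i. psi (trace (S ** G)) * ket (Lg ?U G) $ x)"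
    unfolding state_I_def psi_def[symmetric] xl_eq translate[OF Sym_closed(3) sU] by simp
  also have "\<dots> = Psi S (ket (emb ?U)) $ x"
  proof (cases "U = ?U")
    case False
    then have "ket (Lg ?U G) $ x = 0" if "G \<in> Sym_sub i" for G
      using Lg_eq_iff[OF sU sym[OF that] x(1,2)] x(3) by (auto simp: axis_def)
    moreover have "emb U \<noteq> emb ?U" using False by (simp add: inj_eq[OF inj_emb])
    ultimately show ?thesis by (simp add: x(3) Psi_Lg[OF S(1) x(1,2)] axis_def)
  next
    case True
    \<comment> \<open>Cutting F down to its lower right block gives the representative in
      \<open>Sym_sub i\<close>.\<close>
    define F1 :: "('a, 'd) sqmat" where "F1 = (\<chi> m n. if pos m > ?k \<and> pos n > ?k then F $ m $ n else 0)"
    have F1: "F1 \<in> Sym_sub i" using Sym_entry[OF x(2)] by (auto simp: Sym_sub_def Sym_iff F1_def)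
    have "(F1 - F) *v b \<in> ?U" if b: "b \<in> perp ?U" for b
      unfolding coord_space_def
    proof (intro CollectI allI impI)
      fix m :: 'd assume m: "pos m > ?k"
      have "(F1 - F) $ m $ n * b $ n = 0" for n
        using b m by (cases "pos n > ?k") (auto simp: perp_coord_space F1_def)
      then have "(\<Sum>n\<in>UNIV. (F1 - F) $ m $ n * b $ n) = 0" by (rule sum.neutral[OF ballI])
      then show "((F1 - F) *v b) $ m = 0" by (simp add: matrix_vector_mult_def)
    qed
    then have xF1: "x = Lg ?U F1" unfolding x(3) True using Lg_eq_iff[OF sU sym[OF F1] sU x(2)] by simp
    have un: "G = F1" if G: "G \<in> Sym_sub i" and e: "Lg ?U G = x" for G
    proof (rule vec_eq_iff[THEN iffD2], intro allI, rule vec_eq_iff[THEN iffD2], intro allI)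
      fix m n
      have d: "\<forall>b\<in>perp ?U. (G - F1) *v b \<in> ?U" using Lg_eq_iff[OF sU sym[OF G] sU sym[OF F1]] e xF1 by simp
      show "G $ m $ n = F1 $ m $ n"
      proof (cases "pos m > ?k \<and> pos n > ?k")
        case True
        then have "axis n 1 \<in> perp ?U" by (auto simp: perp_coord_space axis_def)
        then have "((G - F1) *v axis n 1) $ m = 0" using d True unfolding coord_space_def by blast
        then show ?thesis by simp
      next
        case False
        then show ?thesis using G F1 by (auto simp: Sym_sub_def not_less)
      qed
    qed
    have "(\<Sum>G\<in>Sym_sub i. psi (trace (S ** G)) * ket (Lg ?U G) $ x) = (\<Sum>G\<in>Sym_sub i. if G = F1 then psi (trace (S ** F1)) else 0)"
    proof (intro sum.cong refl)
      fix G :: "('a, 'd) sqmat" assume G: "G \<in> Sym_sub i"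
      show "psi (trace (S ** G)) * ket (Lg ?U G) $ x = (if G = F1 then psi (trace (S ** F1)) else 0)"
        using un[OF G] xF1 by (cases "G = F1") (auto simp: axis_def)
    qed
    also have "\<dots> = psi (trace (S ** F1))" using F1 by simp
    finally show ?thesis using UK c by (simp add: xF1 Psi_Lg[OF S(1) sU sym[OF F1]])
  qed
  finally show "state_I i S $ x = Psi S (ket (emb ?U)) $ x" .
qed

lemma rho_mult:
  fixes C B :: "('a, 'd::{finite,linorder}) sqmat"
  assumes CB: "C ** B = mat 1" "B ** C = mat 1"
  shows "(rho (spm C 0) *v v) $ y = v $ act (spm B 0) y"
proof -
  have inv: "invertible C" "invertible B" using CB by (auto simp: invertible_def)
  have key: "act (spm C 0) (act (spm B 0) x) = x" if "C ** B = mat 1" "invertible C" "invertible B" for C B and x :: "('a, 'd) lagr"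
  proof -
    obtain U F where x: "vec.subspace U" "F \<in> Sym" "x = Lg U F" using lagr_cases by blast
    have F': "B ** F ** transpose B \<in> Sym" using Sym_congruent[OF x(2), of "transpose B"] by simp
    have "C ** (B ** F ** transpose B) ** transpose C = (C ** B) ** F ** transpose (C ** B)"
      by (simp only: matrix_transpose_mul matrix_mul_assoc)
    then have 1: "C ** (B ** F ** transpose B) ** transpose C = F" using that(1) by simp
    have "(*v) C ` (*v) B ` U = (\<lambda>u. (C ** B) *v u) ` U" by (simp add: image_image matrix_vector_mul_assoc)
    then have 2: "(*v) C ` (*v) B ` U = U" using that(1) by simp
    show ?thesis
      unfolding x(3) act_spm[OF that(3) x(2,1)] add_0_right
        act_spm[OF that(2) F' subspace_image_mv[OF x(1)]] 1 2 ..
  qed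
  have "y = act (spm C 0) x \<longleftrightarrow> x = act (spm B 0) y" for x
    using key[OF CB(1) inv, of y] key[OF CB(2) inv(2,1), of x] by metis
  then have "(rho (spm C 0) *v v) $ y = (\<Sum>x\<in>UNIV. if x = act (spm B 0) y then v $ x else 0)"
    unfolding rho_def matrix_vector_mult_def vec_lambda_beta by (intro sum.cong) auto
  then show ?thesis by simp
qed

lemma state_eq:
  fixes S C :: "('a, 'd::{finite,linorder}) sqmat"
  assumes S: "S \<in> Sym" and a: "admissible i C S"
  shows "state i C S = Psi S (ket (emb ((*v) C ` coord_space (CARD('d) - i))))"
proof (rule vec_eq_iff[THEN iffD2], rule allI)
  fix y :: "('a, 'd) lagr"
  let ?U = "coord_space (CARD('d) - i) :: ('a, 'd) vec set" and ?S = "transpose C ** S ** C"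
  define B where "B = matrix_inv C"
  have i: "i \<le> CARD('d)" and C: "invertible C" and K: "(*v) C ` ?U \<subseteq> nullspace S" and sub: "?S \<in> Sym_sub i"
    using a a[unfolded admissible_iff[OF S]] by (simp_all add: admissible_def)
  have CB: "C ** B = mat 1" "B ** C = mat 1" using matrix_inv_works[OF C] by (simp_all add: B_def)
  have B: "invertible B" using CB by (auto simp: invertible_def)
  obtain U F where y: "vec.subspace U" "F \<in> Sym" "y = Lg U F" using lagr_cases by blast
  have F': "B ** F ** transpose B \<in> Sym" using Sym_congruent[OF y(2), of "transpose B"] by simp
  have sB: "vec.subspace ((*v) B ` U)" by (rule subspace_image_mv[OF y(1)])
  \<comment> \<open>Cyclic invariance of the trace brings C and its inverse together, so
    transporting S and F leaves the phase unchanged.\<close>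
  have tr: "trace (?S ** (B ** F ** transpose B)) = trace (S ** F)"
  proof -
    have e: "?S ** (B ** F ** transpose B) = (transpose C ** (S ** (C ** B) ** F)) ** transpose B"
      by (simp only: matrix_mul_assoc)
    have "trace (?S ** (B ** F ** transpose B)) = trace (transpose B ** (transpose C ** (S ** (C ** B) ** F)))"
      unfolding e by (rule trace_mul_sym)
    also have "transpose B ** (transpose C ** (S ** (C ** B) ** F)) = transpose (C ** B) ** (S ** (C ** B) ** F)"
      by (simp only: matrix_transpose_mul matrix_mul_assoc)
    finally show ?thesis by (simp add: CB)
  qed
  have CBU: "(*v) C ` (*v) B ` V = V" "(*v) B ` (*v) C ` V = V" for V
    unfolding image_image matrix_vector_mul_assoc CB by simp_all
  have "state i C S $ y = Psi ?S (ket (emb ?U)) $ Lg ((*v) B ` U) (B ** F ** transpose B)"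
    unfolding state_def rho_mult[OF CB] state_I_eq[OF Sym_congruent[OF S] sub i] y(3) act_spm[OF B y(2,1)] by simp
  also have "\<dots> = Psi S (ket (emb ((*v) C ` ?U))) $ y"
  proof (cases "U = (*v) C ` ?U")
    case True
    then have BU: "(*v) B ` U = ?U" using CBU by simp
    have "?U \<subseteq> nullspace ?S" using K nullspace_image_congruent[OF C] by blast
    moreover have "nrm ?U = nrm U" using dim_image_invertible[OF C subspace_coord_space] True by (simp add: nrm_def)
    ultimately show ?thesis
      unfolding BU Psi_Lg[OF Sym_congruent[OF S] subspace_coord_space F'] tr y(3) Psi_Lg[OF S y(1,2)] using K True by simp
  next
    case False
    then have "(*v) B ` U \<noteq> ?U" using CBU(1)[of U] by auto
    then have "emb ((*v) B ` U) \<noteq> emb ?U" "emb U \<noteq> emb ((*v) C ` ?U)" using False by (simp_all add: inj_eq[OF inj_emb])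
    then show ?thesis
      unfolding Psi_Lg[OF Sym_congruent[OF S] sB F'] y(3) Psi_Lg[OF S y(1,2)] by (simp add: axis_def)
  qed
  finally show "state i C S $ y = Psi S (ket (emb ((*v) C ` ?U))) $ y" .
qed

text \<open>By \<open>adapted_basis\<close> every subspace of the kernel is of the form C times a
  member of the standard flag, so the states are exactly the images of the kets.\<close>

lemma states_eq:
  fixes S :: "('a, 'd::{finite,linorder}) sqmat"
  assumes S: "S \<in> Sym"
  shows "{state i C S | i C. admissible i C S} = (\<lambda>X. Psi S (ket X)) ` subs (V0 S)"
proof (intro equalityI subsetI)
  fix v assume "v \<in> {state i C S | i C. admissible i C S}"
  then obtain i C where a: "admissible i C S" "v = state i C S" by blast
  then have "emb ((*v) C ` coord_space (CARD('d) - i)) \<in> subs (V0 S)"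
    by (simp add: emb_in_subs admissible_iff[OF S] subspace_image_mv[OF subspace_coord_space])
  then show "v \<in> (\<lambda>X. Psi S (ket X)) ` subs (V0 S)" using a state_eq[OF S a(1)] by blast
next
  fix v assume "v \<in> (\<lambda>X. Psi S (ket X)) ` subs (V0 S)"
  then obtain U where U: "vec.subspace U" "U \<subseteq> nullspace S" "v = Psi S (ket (emb U))" unfolding subs_V0 by blast
  obtain C :: "('a, 'd) sqmat" where C: "invertible C" "U = (*v) C ` coord_space (vec.dim U)"
    by (rule adapted_basis[OF U(1)])
  have "vec.dim U \<le> CARD('d)" using dim_subset_UNIV_cart_gen by blast
  then have k: "CARD('d) - (CARD('d) - vec.dim U) = vec.dim U" by simp
  have a: "admissible (CARD('d) - vec.dim U) C S" unfolding admissible_iff[OF S] k using C U(2) by auto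
  have "v = state (CARD('d) - vec.dim U) C S" unfolding state_eq[OF S a] k unfolding C(2)[symmetric] by (rule U(3))
  then show "v \<in> {state i C S | i C. admissible i C S}" using a by blast
qed

lemma W_space_eq:
  fixes S :: "('a, 'd::{finite,linorder}) sqmat"
  assumes S: "S \<in> Sym"
  shows "W_space S = Psi S ` V_L (V0 S)"
proof
  show "W_space S \<subseteq> Psi S ` V_L (V0 S)"
    unfolding W_space_def states_eq[OF S]
    by (rule vec.span_minimal[OF _ subspace_Psi_image[OF subspace_V_L]]) (auto simp: V_L_def intro!: imageI vec.span_base)
  show "Psi S ` V_L (V0 S) \<subseteq> W_space S"
  proof
    fix v assume "v \<in> Psi S ` V_L (V0 S)"
    then obtain u where u: "u \<in> vec.span (ket ` subs (V0 S))" "v = Psi S u" by (auto simp: V_L_def)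
    obtain a where a: "u = (\<Sum>X\<in>subs (V0 S). a X *s ket X)" using span_image_finite[OF finite u(1)] by blast
    show "v \<in> W_space S"
      unfolding W_space_def states_eq[OF S] u(2) a Psi_sum Psi_lin
      by (intro vec.span_sum vec.span_scale vec.span_base) auto
  qed
qed

lemma Rep_act_xl:
  fixes C :: "('a, 'd::{finite,linorder}) sqmat"
  assumes C: "invertible C"
  shows "Rep_lagr (act (spm C 0) (xl i)) \<inter> Rep_lagr (xl 0) = emb ((*v) C ` coord_space (CARD('d) - i))"
proof -
  let ?U = "coord_space (CARD('d) - i) :: ('a, 'd) vec set"
  have 1: "Rep_lagr (act (spm C 0) (xl i)) = Lset ((*v) C ` ?U) 0"
    unfolding xl_eq act_spm[OF C Sym_closed(3) subspace_coord_space]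
    using Rep_Lg[OF subspace_image_mv[OF subspace_coord_space] Sym_closed(3)] by simp
  have 2: "Rep_lagr (xl 0 :: ('a, 'd) lagr) = Lset (coord_space CARD('d)) 0"
    unfolding xl_eq using Rep_Lg[OF subspace_coord_space Sym_closed(3)] by simp
  have "perp (coord_space CARD('d)) = {0 :: ('a, 'd) vec}" using pos_pos(2)[where 'd = 'd] by (auto simp: perp_coord_space vec_eq_iff)
  then show ?thesis
    unfolding 1 2 using vec.subspace_0[OF subspace_perp] by (auto simp: mem_Lset mem_emb coord_space_UNIV)
qed

text \<open>\<open>coord S\<close> satisfies the condition in the choice defining
  \<open>phi\<close>, so \<open>phi S\<close> satisfies it too; the values on the spanning states
  leave no freedom on \<open>W_space S\<close>.\<close>

lemma phi_eq:
  fixes S :: "('a, 'd::{finite,linorder}) sqmat"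
  assumes S: "S \<in> Sym" and w: "w \<in> W_space S"
  shows "phi S w = coord S w"
proof -
  let ?P = "\<lambda>f. lin_on (W_space S) f \<and> (\<forall>i C. admissible i C S \<longrightarrow>
        f (state i C S) = ket (Rep_lagr (act (spm C 0) (xl i)) \<inter> Rep_lagr (xl 0 :: ('a, 'd) lagr)))"
  have cs: "coord S (state i C S) = ket (Rep_lagr (act (spm C 0) (xl i)) \<inter> Rep_lagr (xl 0 :: ('a, 'd) lagr))"
    if a: "admissible i C S" for i C
  proof -
    have C: "invertible C" using a by (simp add: admissible_def)
    have "emb ((*v) C ` coord_space (CARD('d) - i)) \<in> subs (V0 S)"
      using a by (simp add: emb_in_subs admissible_iff[OF S] subspace_image_mv[OF subspace_coord_space])
    then have "ket (emb ((*v) C ` coord_space (CARD('d) - i))) \<in> V_L (V0 S)" by (auto simp: V_L_def intro: vec.span_base)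
    then show ?thesis unfolding Rep_act_xl[OF C] state_eq[OF S a] by (rule coord_Psi[OF S])
  qed
  have "?P (coord S)" using cs by (auto simp: lin_on_def coord_lin)
  then have P: "?P (phi S)" unfolding phi_def by (rule someI[where P = ?P])
  let ?G = "{state i C S | i C. admissible i C S}"
  have "w \<in> vec.span ?G \<and> phi S w = coord S w"
    using w unfolding W_space_def
  proof (induction rule: vec.span_induct_alt)
    case base
    have "phi S (0 *s 0) = 0 *s phi S 0" using P vec.span_zero unfolding lin_on_def W_space_def by blast
    then show ?case by (simp add: coord_lin vec.span_zero)
  next
    case (step c x y)
    obtain i C where x: "admissible i C S" "x = state i C S" using step(1) by blast
    have xs: "x \<in> vec.span ?G" by (rule vec.span_base[OF step(1)])
    have "phi S (c *s x + y) = phi S (c *s x) + phi S y"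
      using P step(2) vec.span_scale[OF xs, of c] unfolding lin_on_def W_space_def by blast
    also have "phi S (c *s x) = c *s phi S x" using P xs unfolding lin_on_def W_space_def by blast
    also have "phi S x = coord S x" using P x cs[OF x(1)] by simp
    finally show ?case using step(2) vec.span_add[OF vec.span_scale[OF xs, of c]] by (simp add: coord_lin)
  qed
  then show ?thesis by simp
qed

lemma summand_eq:
  fixes S :: "('a, 'd::{finite,linorder}) sqmat"
  assumes S: "S \<in> Sym" and I: "I \<subseteq> V_L (V0 S)"
  shows "summand S I = Psi S ` I"
proof (intro equalityI subsetI)
  fix w assume "w \<in> summand S I"
  then have w: "w \<in> W_space S" "coord S w \<in> I" using phi_eq[OF S] by (auto simp: summand_def)
  then have "w \<in> Iso S" using W_space_eq[OF S] Iso_eq_Psi[OF S] by simp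
  then have "w = Psi S (coord S w)" using Psi_coord[OF S] by simp
  then show "w \<in> Psi S ` I" using w(2) by blast
next
  fix w assume "w \<in> Psi S ` I"
  then obtain u where u: "u \<in> I" "w = Psi S u" by blast
  then have w: "w \<in> W_space S" using I unfolding W_space_eq[OF S] by blast
  then show "w \<in> summand S I" using u I coord_Psi[OF S, of u] by (auto simp: summand_def phi_eq[OF S])
qed

subsection \<open>Decomposition and multiplicities\<close>

text \<open>The averaging projection to the isotypic component of S.\<close>

definition iso_proj :: "('a, 'd::finite) sqmat \<Rightarrow> complex^('a, 'd) lagr \<Rightarrow> complex^('a, 'd) lagr" where
  "iso_proj S v = (\<chi> x. (\<Sum>G\<in>Sym. psi (- trace (S ** G)) * v $ act (spm (mat 1) G) x) / of_nat (card (Sym :: ('a, 'd) sqmat set)))"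

text \<open>The trace form on symmetric matrices is non-degenerate, by
  \<open>exists_nonzero_trace\<close> with U the whole space.\<close>

lemma sum_Sym_psi:
  fixes G :: "('a, 'd::finite) sqmat"
  assumes G: "G \<in> Sym"
  shows "(\<Sum>S\<in>Sym. psi (trace (S ** G))) = (if G = 0 then of_nat (card (Sym :: ('a, 'd) sqmat set)) else 0)"
proof -
  have 1: "(\<Sum>S\<in>Sym. psi (trace (S ** G))) = (if \<forall>S\<in>Sym. trace (S ** G) = 0 then of_nat (card (Sym :: ('a, 'd) sqmat set)) else 0)"
    by (rule sum_psi_hom) (simp_all add: Sym_closed trace_mul_sym[of _ G] trace_add_right)
  have "G = 0" if z: "\<forall>S\<in>Sym. trace (S ** G) = 0"
  proof -
    have "(UNIV :: ('a, 'd) vec set) \<subseteq> nullspace G"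
    proof (rule ccontr)
      assume "\<not> (UNIV :: ('a, 'd) vec set) \<subseteq> nullspace G"
      then obtain H where "H \<in> Sym" "trace (G ** H) \<noteq> 0"
        using exists_nonzero_trace[OF G vec.subspace_UNIV] by blast
      then show False using z trace_mul_sym[of G H] by simp
    qed
    then have "G *v v = 0" for v by (auto simp: nullspace_def)
    then show "G = 0" by (simp add: matrix_eq)
  qed
  moreover have "G = 0 \<Longrightarrow> \<forall>S\<in>Sym. trace (S ** G) = 0" by (simp add: trace_mult)
  ultimately show ?thesis unfolding 1 by (cases "G = 0") auto
qed

lemma Sym_nonempty: "(Sym :: ('a, 'd::finite) sqmat set) \<noteq> {}"
  using Sym_closed(3) by auto

lemma iso_proj_in_Iso: "iso_proj S v \<in> Iso (S :: ('a, 'd::finite) sqmat)"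
  unfolding Iso_def
proof (intro CollectI allI impI)
  fix U :: "('a, 'd) vec set" and F G :: "('a, 'd) sqmat"
  assume U: "vec.subspace U" and F: "F \<in> Sym" and G: "G \<in> Sym"
  have b: "bij_betw (\<lambda>H. H + G) Sym Sym"
    by (rule bij_betwI[where g = "\<lambda>H. H - G"]) (auto simp: Sym_closed G)
  have "(\<Sum>H\<in>Sym. psi (- trace (S ** H)) * v $ act (spm (mat 1) H) (Lg U F))
      = (\<Sum>H\<in>Sym. psi (- trace (S ** (H + G))) * v $ act (spm (mat 1) (H + G)) (Lg U F))"
    by (rule sum.reindex_bij_betw[OF b, symmetric])
  also have "\<dots> = (\<Sum>H\<in>Sym. psi (- trace (S ** G)) * (psi (- trace (S ** H)) * v $ act (spm (mat 1) H) (Lg U (F + G))))"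
  proof (intro sum.cong refl)
    fix H :: "('a, 'd) sqmat"
    have "act (spm (mat 1) (H + G)) (Lg U F) = act (spm (mat 1) H) (Lg U (F + G))"
      unfolding translate[OF F U] translate[OF Sym_closed(1)[OF F G] U] by (simp add: algebra_simps)
    moreover have "psi (- trace (S ** (H + G))) = psi (- trace (S ** G)) * psi (- trace (S ** H))"
      by (simp add: trace_add_right add.commute flip: psi_add)
    ultimately show "psi (- trace (S ** (H + G))) * v $ act (spm (mat 1) (H + G)) (Lg U F)
      = psi (- trace (S ** G)) * (psi (- trace (S ** H)) * v $ act (spm (mat 1) H) (Lg U (F + G)))" by simp
  qed
  finally have "(\<Sum>H\<in>Sym. psi (- trace (S ** H)) * v $ act (spm (mat 1) H) (Lg U F))
      = psi (- trace (S ** G)) * (\<Sum>H\<in>Sym. psi (- trace (S ** H)) * v $ act (spm (mat 1) H) (Lg U (F + G)))"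
    by (simp only: sum_distrib_left)
  then show "iso_proj S v $ Lg U (F + G) = psi (trace (S ** G)) * iso_proj S v $ Lg U F"
    by (simp add: iso_proj_def psi_minus)
qed

text \<open>Fourier inversion on the group of translations: summing over S leaves only the trivial
  translation.\<close>

lemma sum_iso_proj: "(\<Sum>S\<in>Sym. iso_proj S v) = (v :: complex^('a, 'd::finite) lagr)"
proof (rule vec_eq_iff[THEN iffD2], rule allI)
  fix x :: "('a, 'd) lagr"
  let ?c = "of_nat (card (Sym :: ('a, 'd) sqmat set)) :: complex"
  obtain U F where x: "vec.subspace U" "F \<in> Sym" "x = Lg U F" using lagr_cases by blast
  have "(\<Sum>S\<in>Sym. iso_proj S v) $ x = (\<Sum>S\<in>Sym. \<Sum>G\<in>Sym. psi (- trace (S ** G)) * v $ act (spm (mat 1) G) x) / ?c"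
    by (simp add: iso_proj_def sum_divide_distrib)
  also have "(\<Sum>S\<in>Sym. \<Sum>G\<in>Sym. psi (- trace (S ** G)) * v $ act (spm (mat 1) G) x)
      = (\<Sum>G\<in>Sym. (\<Sum>S\<in>Sym. psi (trace (S ** (- G)))) * v $ act (spm (mat 1) G) x)"
    unfolding sum_distrib_right
    by (subst sum.swap) (intro sum.cong refl, simp add: trace_mult sum_negf)
  also have "\<dots> = (\<Sum>G\<in>Sym. if G = (0 :: ('a, 'd) sqmat) then ?c * v $ x else 0)"
  proof (intro sum.cong refl)
    fix G :: "('a, 'd) sqmat" assume "G \<in> Sym"
    then have "- G \<in> Sym" using Sym_closed(2)[OF Sym_closed(3), of G] by simp
    then show "(\<Sum>S\<in>Sym. psi (trace (S ** (- G)))) * v $ act (spm (mat 1) G) x = (if G = 0 then ?c * v $ x else 0)"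
      using translate[OF x(2,1), of 0] by (auto simp: sum_Sym_psi x(3))
  qed
  finally show "(\<Sum>S\<in>Sym. iso_proj S v) $ x = v $ x"
    using Sym_nonempty[where 'd = 'd] by (simp add: Sym_closed)
qed

lemma iso_proj_Iso:
  fixes S T :: "('a, 'd::finite) sqmat"
  assumes S: "S \<in> Sym" and T: "T \<in> Sym" and v: "v \<in> Iso S"
  shows "iso_proj T v = (if S = T then v else 0)"
proof (rule vec_eq_iff[THEN iffD2], rule allI)
  fix x :: "('a, 'd) lagr"
  obtain U F where x: "vec.subspace U" "F \<in> Sym" "x = Lg U F" using lagr_cases by blast
  have "(\<Sum>G\<in>Sym. psi (- trace (T ** G)) * v $ act (spm (mat 1) G) x) = (\<Sum>G\<in>Sym. psi (trace (G ** (S - T))) * v $ x)"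
  proof (intro sum.cong refl)
    fix G :: "('a, 'd) sqmat" assume G: "G \<in> Sym"
    have "v $ act (spm (mat 1) G) x = psi (trace (S ** G)) * v $ x"
      unfolding x(3) translate[OF x(2,1)] using v x(1,2) G unfolding Iso_def by blast
    moreover have "trace (G ** (S - T)) = - trace (T ** G) + trace (S ** G)"
      by (simp add: trace_diff_right trace_mul_sym[of G])
    ultimately show "psi (- trace (T ** G)) * v $ act (spm (mat 1) G) x = psi (trace (G ** (S - T))) * v $ x"
      by (simp only: psi_add mult.assoc)
  qed
  also have "\<dots> = (if S = T then of_nat (card (Sym :: ('a, 'd) sqmat set)) else 0) * v $ x"
    unfolding sum_distrib_right[symmetric] sum_Sym_psi[OF Sym_closed(2)[OF S T]] by simp
  finally show "iso_proj T v $ x = (if S = T then v else 0) $ x"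
    using Sym_nonempty[where 'd = 'd] by (simp add: iso_proj_def)
qed

lemma iso_proj_sum: "iso_proj T (\<Sum>i\<in>A. f i) = (\<Sum>i\<in>A. iso_proj T (f i))" for T :: "('a, 'd::finite) sqmat"
proof -
  have "iso_proj T (u + v) = iso_proj T u + iso_proj T v" for u v
    by (simp add: iso_proj_def vec_eq_iff distrib_left sum.distrib add_divide_distrib)
  moreover have "iso_proj T 0 = 0" by (simp add: iso_proj_def vec_eq_iff)
  ultimately show ?thesis by (induction A rule: infinite_finite_induct) auto
qed

lemma coord_sum: "coord S (\<Sum>i\<in>A. f i) = (\<Sum>i\<in>A. coord S (f i))" for S :: "('a, 'd::finite) sqmat"
  by (induction A rule: infinite_finite_induct) (auto simp: coord_lin)

lemma decomposition_props:
  assumes "sl2_decomposition Y Is"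
  shows "finite Is" "I \<in> Is \<Longrightarrow> sl2_irreducible Y I" "I \<in> Is \<Longrightarrow> I \<subseteq> V_L Y" "I \<in> Is \<Longrightarrow> vec.subspace I"
    and "u \<in> V_L Y \<Longrightarrow> \<exists>c. (\<forall>I\<in>Is. c I \<in> I) \<and> u = (\<Sum>I\<in>Is. c I)"
    and "\<forall>I\<in>Is. c I \<in> I \<Longrightarrow> (\<Sum>I\<in>Is. c I) = 0 \<Longrightarrow> I \<in> Is \<Longrightarrow> c I = 0"
proof -
  have irr: "sl2_irreducible Y I" if "I \<in> Is" for I using assms that by (simp add: sl2_decomposition_def)
  have "direct_sum (V_L Y) Is (\<lambda>I. I)" using assms by (simp add: sl2_decomposition_def)
  note d = this[unfolded direct_sum_def]
  have U: "V_L Y = {\<Sum>I\<in>Is. w I | w. \<forall>I\<in>Is. w I \<in> I}" by (rule d[THEN conjunct2, THEN conjunct2, THEN conjunct1])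
  show "finite Is" by (rule d[THEN conjunct1])
  show "I \<in> Is \<Longrightarrow> sl2_irreducible Y I" by (rule irr)
  show "I \<in> Is \<Longrightarrow> I \<subseteq> V_L Y" "I \<in> Is \<Longrightarrow> vec.subspace I"
    using irr by (simp_all add: sl2_irreducible_def sl2_submodule_def)
  show "\<exists>c. (\<forall>I\<in>Is. c I \<in> I) \<and> u = (\<Sum>I\<in>Is. c I)" if "u \<in> V_L Y"
    using that unfolding U by (elim CollectE exE conjE) (intro exI conjI)
  show "c I = 0" if "\<forall>I\<in>Is. c I \<in> I" "(\<Sum>I\<in>Is. c I) = 0" "I \<in> Is"
    using d[THEN conjunct2, THEN conjunct2, THEN conjunct2, THEN spec, THEN mp, OF that(1), THEN mp, OF that(2)] that(3)
    by (rule bspec)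
qed

text \<open>A two-stage decomposition: first into isotypic components by \<open>iso_proj\<close>,
  then each component by transporting the given decomposition along \<open>Psi S\<close>.\<close>

theorem direct_sum_summands:
  fixes Dec :: "('a, 'd::{finite,linorder}) sqmat \<Rightarrow> (complex^(('a^('d + 'd)) set)) set set"
  assumes Dec: "\<And>S. S \<in> Sym \<Longrightarrow> sl2_decomposition (V0 S) (Dec S)"
  shows "direct_sum (UNIV :: (complex^('a, 'd) lagr) set) (Sigma Sym Dec) (\<lambda>(S, I). summand S I)"
proof -
  note P = decomposition_props[OF Dec]
  have sm: "summand S I = Psi S ` I" if "S \<in> Sym" "I \<in> Dec S" for S I
    using summand_eq[OF that(1) P(3)[OF that]] .
  have fin: "finite (Sigma Sym Dec)" using P(1) by (intro finite_SigmaI) auto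
  have ex: "\<exists>w. (\<forall>j\<in>Sigma Sym Dec. w j \<in> (case j of (S, I) \<Rightarrow> summand S I)) \<and> v = (\<Sum>j\<in>Sigma Sym Dec. w j)"
    for v :: "complex^('a, 'd) lagr"
  proof -
    have "\<forall>S\<in>Sym. \<exists>c. (\<forall>I\<in>Dec S. c I \<in> I) \<and> coord S (iso_proj S v) = (\<Sum>I\<in>Dec S. c I)"
      using P(5)[OF _ coord_in_V_L] by blast
    from bchoice[OF this] obtain c where c: "\<forall>S\<in>Sym. (\<forall>I\<in>Dec S. c S I \<in> I) \<and> coord S (iso_proj S v) = (\<Sum>I\<in>Dec S. c S I)"
      by blast
    have "v = (\<Sum>S\<in>Sym. iso_proj S v)" by (simp add: sum_iso_proj)
    also have "\<dots> = (\<Sum>S\<in>Sym. \<Sum>I\<in>Dec S. Psi S (c S I))"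
    proof (intro sum.cong refl)
      fix S :: "('a, 'd) sqmat" assume S: "S \<in> Sym"
      have "iso_proj S v = Psi S (coord S (iso_proj S v))" using Psi_coord[OF S iso_proj_in_Iso] by simp
      then show "iso_proj S v = (\<Sum>I\<in>Dec S. Psi S (c S I))" using c S by (simp add: Psi_sum)
    qed
    also have "\<dots> = (\<Sum>j\<in>Sigma Sym Dec. case j of (S, I) \<Rightarrow> Psi S (c S I))"
      using P(1) by (intro sum.Sigma) auto
    finally have e: "v = (\<Sum>j\<in>Sigma Sym Dec. case j of (S, I) \<Rightarrow> Psi S (c S I))" .
    have "(case j of (S, I) \<Rightarrow> Psi S (c S I)) \<in> (case j of (S, I) \<Rightarrow> summand S I)" if j: "j \<in> Sigma Sym Dec" for j
    proof -
      obtain S I where "j = (S, I)" "S \<in> Sym" "I \<in> Dec S" using j by blast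
      then show ?thesis using c sm by simp
    qed
    then show ?thesis using e by (intro exI[of _ "\<lambda>j. case j of (S, I) \<Rightarrow> Psi S (c S I)"]) simp
  qed
  have ind: "w j = 0" if w: "\<forall>j\<in>Sigma Sym Dec. w j \<in> (case j of (S, I) \<Rightarrow> summand S I)"
    and z: "(\<Sum>j\<in>Sigma Sym Dec. w j) = 0" and j: "j \<in> Sigma Sym Dec" for w j
  proof -
    have wI: "w (S, I) \<in> Psi S ` I" if "S \<in> Sym" "I \<in> Dec S" for S I
      using bspec[OF w, of "(S, I)"] that sm by simp
    have wIso: "w (S, I) \<in> Iso S" if "S \<in> Sym" "I \<in> Dec S" for S I
      using wI[OF that] P(3)[OF that] unfolding Iso_eq_Psi[OF that(1)] by blast
    obtain S I where SI: "S \<in> Sym" "I \<in> Dec S" "j = (S, I)" using j by blast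
    \<comment> \<open>Applying the projection for S discards all summands that belong to other
      matrices.\<close>
    have "0 = iso_proj S (\<Sum>j\<in>Sigma Sym Dec. w j)" by (simp add: z iso_proj_def vec_eq_iff)
    also have "(\<Sum>j\<in>Sigma Sym Dec. w j) = (\<Sum>T\<in>Sym. \<Sum>J\<in>Dec T. w (T, J))"
      using P(1) by (subst sum.Sigma) auto
    also have "iso_proj S \<dots> = (\<Sum>T\<in>Sym. if T = S then (\<Sum>J\<in>Dec S. w (S, J)) else 0)"
      unfolding iso_proj_sum
    proof (intro sum.cong refl)
      fix T :: "('a, 'd) sqmat" assume T: "T \<in> Sym"
      have "(\<Sum>J\<in>Dec T. iso_proj S (w (T, J))) = (\<Sum>J\<in>Dec T. if T = S then w (T, J) else 0)"
        by (intro sum.cong refl iso_proj_Iso[OF T SI(1)] wIso[OF T])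
      then show "(\<Sum>J\<in>Dec T. iso_proj S (w (T, J))) = (if T = S then (\<Sum>J\<in>Dec S. w (S, J)) else 0)" by auto
    qed
    also have "\<dots> = (\<Sum>J\<in>Dec S. w (S, J))" using SI(1) by simp
    finally have "(\<Sum>J\<in>Dec S. coord S (w (S, J))) = 0" by (simp add: coord_lin flip: coord_sum)
    moreover have cw: "coord S (w (S, J)) \<in> J" if J: "J \<in> Dec S" for J
    proof -
      obtain u where u: "u \<in> J" "w (S, J) = Psi S u" using wI[OF SI(1) J] by blast
      then show ?thesis using coord_Psi[OF SI(1) subsetD[OF P(3)[OF SI(1) J] u(1)]] by simp
    qed
    ultimately have "coord S (w (S, I)) = 0"
      using P(6)[OF SI(1), of "\<lambda>J. coord S (w (S, J))" I] SI(2) by blast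
    then have "w (S, I) = Psi S 0" using Psi_coord[OF SI(1) wIso[OF SI(1,2)]] by simp
    then show "w j = 0" by (simp add: SI(3) Psi_lin)
  qed
  have sub: "vec.subspace (case j of (S, I) \<Rightarrow> summand S I)" if j: "j \<in> Sigma Sym Dec" for j
  proof -
    obtain S I where SI: "S \<in> Sym" "I \<in> Dec S" "j = (S, I)" using j by blast
    then show ?thesis using sm[OF SI(1,2)] subspace_Psi_image[OF P(4)[OF SI(1,2)]] by simp
  qed
  show ?thesis
    unfolding direct_sum_def
  proof (intro conjI fin ballI allI impI)
    show "UNIV = {\<Sum>j\<in>Sigma Sym Dec. w j | w. \<forall>j\<in>Sigma Sym Dec. w j \<in> (case j of (S, I) \<Rightarrow> summand S I)}"
      using ex by blast
  qed (rule sub ind; assumption)+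
qed

lemma dim_Psi_image:
  fixes S :: "('a, 'd::{finite,linorder}) sqmat"
  assumes S: "S \<in> Sym" "sl2_irreducible (V0 S) I"
  shows "vec.dim (Psi S ` I) = vec.dim I"
proof -
  obtain \<nu> w where sb: "string_basis (V0 S) I \<nu> w" using irreducible_string_basis[OF subspace_V0 S(2)] by blast
  show ?thesis using Psi_string(4)[OF S(1) sb] dim_string[OF sb] by simp
qed

text \<open>All S of rank r have the same N = D - r, so each contributes the same multiplicity and
  the count factors.\<close>

theorem M_count_eq:
  fixes Dec :: "('a, 'd::{finite,linorder}) sqmat \<Rightarrow> (complex^(('a^('d + 'd)) set)) set set"
  assumes Dec: "\<And>S. S \<in> Sym \<Longrightarrow> sl2_decomposition (V0 S) (Dec S)"
  shows "real (M_count Dec l r \<epsilon>) = qmult CARD('a) ((real (CARD('d) - r) - real l) / 2) (CARD('d) - r)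
    * real (card {S :: ('a, 'd) sqmat. S \<in> Sym \<and> rank S = r \<and> mtype S = \<epsilon>})"
proof -
  note P = decomposition_props[OF Dec]
  let ?Q = "{S :: ('a, 'd) sqmat. S \<in> Sym \<and> rank S = r \<and> mtype S = \<epsilon>}"
  let ?I = "\<lambda>S. {I \<in> Dec S. vec.dim I = l + 1}"
  have d: "vec.dim (summand S I) = vec.dim I" if "S \<in> Sym" "I \<in> Dec S" for S I
    unfolding summand_eq[OF that(1) P(3)[OF that]] by (rule dim_Psi_image[OF that(1) P(2)[OF that]])
  have "{(S, I). S \<in> Sym \<and> I \<in> Dec S \<and> vec.dim (summand S I) = l + 1 \<and> rank S = r \<and> mtype S = \<epsilon>} = Sigma ?Q ?I"
    using d by auto
  then have "M_count Dec l r \<epsilon> = card (Sigma ?Q ?I)" by (simp only: M_count_def)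
  also have "\<dots> = (\<Sum>S\<in>?Q. card (?I S))" using P(1) by (intro card_SigmaI) auto
  finally have "real (M_count Dec l r \<epsilon>) = (\<Sum>S\<in>?Q. real (card (?I S)))" by simp
  also have "\<dots> = (\<Sum>S\<in>?Q. qmult CARD('a) ((real (CARD('d) - r) - real l) / 2) (CARD('d) - r))"
  proof (intro sum.cong refl)
    fix S :: "('a, 'd) sqmat" assume S: "S \<in> ?Q"
    then have "vec.dim (V0 S) = CARD('d) - r" using dim_V0[of S] by auto
    then show "real (card (?I S)) = qmult CARD('a) ((real (CARD('d) - r) - real l) / 2) (CARD('d) - r)"
      using multiplicity_count[OF subspace_V0 Dec, of S l] S by simp
  qed
  finally show ?thesis by simp
qed

end

theorem theorem3:
  fixes Dec :: "('a::{field,finite}, 'd::{finite,linorder}) sqmat \<Rightarrow> (complex^(('a^('d + 'd)) set)) set set"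
    and q D :: nat
  assumes q: "q = CARD('a)" "prime q" "odd q"
    and D: "D = CARD('d)"
    and Dec: "\<And>S. S \<in> Sym \<Longrightarrow> sl2_decomposition (V0 S) (Dec S)"
  shows "direct_sum (UNIV :: (complex^('a, 'd) lagr) set) (Sigma Sym Dec) (\<lambda>(S, I). summand S I)
    \<and> (\<forall>S\<in>Sym. \<forall>I\<in>Dec S. T_irreducible (summand S I))
    \<and> (\<forall>S\<in>Sym. \<forall>I\<in>Dec S. \<forall>S'\<in>Sym. \<forall>I'\<in>Dec S'.
         T_isomorphic (summand S I) (summand S' I') \<longleftrightarrow>
         vec.dim (summand S I) = vec.dim (summand S' I') \<and> rank S = rank S' \<and> mtype S = mtype S')
    \<and> (\<forall>l. real (M_count Dec l 0 1) = qmult q ((real D - real l) / 2) D)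
    \<and> (\<forall>l n. 2 * n + 1 \<le> D \<longrightarrow>
         real (M_count Dec l (2 * n + 1) 0) =
           qmult q ((real D - 2 * real n - 1 - real l) / 2) (D - 2 * n - 1)
           * (\<Prod>k = 1..n. real q ^ (2 * k) / (real q ^ (2 * k) - 1))
           * (\<Prod>k = 0..2 * n. real q ^ (D - k) - 1))
    \<and> (\<forall>l n. \<forall>\<epsilon>\<in>{1, -1}. 2 * n \<le> D \<longrightarrow>
         real (M_count Dec l (2 * n) \<epsilon>) =
           qmult q ((real D - 2 * real n - real l) / 2) (D - 2 * n)
           * ((real q ^ n + of_int \<epsilon>) / (2 * real q ^ n))
           * (\<Prod>k = 1..n. real q ^ (2 * k) / (real q ^ (2 * k) - 1))
           * (\<Prod>k<2 * n. real q ^ (D - k) - 1))"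
proof -
  interpret odd_prime_field "TYPE('a)" using q by unfold_locales auto
  note P = decomposition_props[OF Dec]
  have sm: "summand S I = Psi S ` I" if "S \<in> Sym" "I \<in> Dec S" for S I
    using summand_eq[OF that(1) P(3)[OF that]] .
  have M: "real (M_count Dec l r \<epsilon>) = qmult q ((real (D - r) - real l) / 2) (D - r)
      * real (card {S :: ('a, 'd) sqmat. S \<in> Sym \<and> rank S = r \<and> mtype S = \<epsilon>})" for l r \<epsilon>
    unfolding q(1) D by (rule M_count_eq) (rule Dec)
  show ?thesis
  proof (intro conjI ballI allI impI)
    show "direct_sum (UNIV :: (complex^('a, 'd) lagr) set) (Sigma Sym Dec) (\<lambda>(S, I). summand S I)"
      by (rule direct_sum_summands[OF Dec])
  next
    fix S I assume S: "S \<in> Sym" "I \<in> Dec S"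
    show "T_irreducible (summand S I)" unfolding sm[OF S] by (rule T_irreducible_Psi[OF S(1) P(2)[OF S]])
  next
    fix S I S' I' assume S: "S \<in> Sym" "I \<in> Dec S" "S' \<in> Sym" "I' \<in> Dec S'"
    show "T_isomorphic (summand S I) (summand S' I') \<longleftrightarrow>
         vec.dim (summand S I) = vec.dim (summand S' I') \<and> rank S = rank S' \<and> mtype S = mtype S'"
      unfolding sm[OF S(1,2)] sm[OF S(3,4)] by (rule T_isomorphic_Psi[OF S(1) P(2)[OF S(1,2)] S(3) P(2)[OF S(3,4)]])
  next
    fix l
    \<comment> \<open>The even count with n = 0 and \<epsilon> = 1, where the factor (q^0 + 1)/(2
      q^0) is 1.\<close>
    show "real (M_count Dec l 0 1) = qmult q ((real D - real l) / 2) D"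
      unfolding M using card_Sym_rank_type(1)[of 1 0, where 'd = 'd] by (simp add: q(1) D pfac_def)
  next
    fix l n assume n: "2 * n + 1 \<le> D"
    \<comment> \<open>The bound on n makes the natural subtraction agree with the real one.\<close>
    have r: "real (D - (2 * n + 1)) = real D - 2 * real n - 1" using n by simp
    have "real (M_count Dec l (2 * n + 1) 0) =
        qmult q ((real D - 2 * real n - 1 - real l) / 2) (D - (2 * n + 1)) * (pfac q n * qfac q D (2 * n + 1))"
      unfolding M r unfolding card_Sym_rank_type(2) q(1) D ..
    also have "qfac q D (2 * n + 1) = (\<Prod>k = 0..2 * n. real q ^ (D - k) - 1)"
      unfolding qfac_def by (intro prod.cong) auto
    finally show "real (M_count Dec l (2 * n + 1) 0) =
           qmult q ((real D - 2 * real n - 1 - real l) / 2) (D - 2 * n - 1)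
           * (\<Prod>k = 1..n. real q ^ (2 * k) / (real q ^ (2 * k) - 1))
           * (\<Prod>k = 0..2 * n. real q ^ (D - k) - 1)"
      unfolding pfac_def by (simp only: diff_diff_left mult.assoc)
  next
    fix l n and \<epsilon> :: int assume e: "\<epsilon> \<in> {1, - 1}" and n: "2 * n \<le> D"
    have r: "real (D - 2 * n) = real D - 2 * real n" using n by simp
    have e': "\<epsilon> = 1 \<or> \<epsilon> = - 1" using e by auto
    have "real (M_count Dec l (2 * n) \<epsilon>) = qmult q ((real D - 2 * real n - real l) / 2) (D - 2 * n)
        * (pfac q n * qfac q D (2 * n) * ((real q ^ n + of_int \<epsilon>) / (2 * real q ^ n)))"
      unfolding M r unfolding card_Sym_rank_type(1)[OF e'] q(1) D ..
    then show "real (M_count Dec l (2 * n) \<epsilon>) =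
           qmult q ((real D - 2 * real n - real l) / 2) (D - 2 * n)
           * ((real q ^ n + of_int \<epsilon>) / (2 * real q ^ n))
           * (\<Prod>k = 1..n. real q ^ (2 * k) / (real q ^ (2 * k) - 1))
           * (\<Prod>k<2 * n. real q ^ (D - k) - 1)"
      unfolding pfac_def qfac_def by (simp only: mult_ac)
  qed
qed

end
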